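(* Let $d \in \mathbb{N}$ and suppose $L$ is an operator with Fourier multiplier $\omega$ satisfying Assumption 1 (stated in the context) with some $s \ge 0$. Assume that $p > 2$ is an even integer or $p=\infty$, and let $1 \le p' \le 2$ be its conjugate exponent, i.e. $1/p+1/p'=1$. Then, for any $f \in H^s(\mathbb{R}^d) \cap \mathcal{F}(L^{p'}(\mathbb{R}^d))$, we have $f^\sharp \in H^s(\mathbb{R}^d) \cap \mathcal{F}(L^{p'}(\mathbb{R}^d))$ and $$\langle f^\sharp, L f^\sharp \rangle \le \langle f, L f \rangle \quad \text{and} \quad \| f \|_{L^p} \le \| f^\sharp \|_{L^p}.$$ In addition, assume that $\widehat{f}(\xi)$ is continuous. Then equality occurs in both of these inequalities if and only if $f$ equals its Fourier rearrangement $f^\sharp$ up to a constant phase and translation, i.e. $$f(x) = e^{i \alpha} f^\sharp(x-x_0) \quad \text{for a.e. } x \in \mathbb{R}^d,$$ with some constants $\alpha \in \mathbb{R}$ and $x_0 \in \mathbb{R}^d$. In particular (in this equality case), $f$ is radially symmetric and real-valued up to translation and constant phase.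
   Context: Functions are complex-valued. The Fourier transform is $\widehat{f}(\xi) = (\mathcal{F} f)(\xi) = \int_{\mathbb{R}^d} e^{-2\pi i x\cdot \xi} f(x)\,dx$ for Schwartz functions, extended to tempered distributions by duality. For $q \in [1,\infty]$, $\mathcal{F}(L^q(\mathbb{R}^d))$ is the space of tempered distributions $f$ with $f = \widehat{g}$ for some $g \in L^q(\mathbb{R}^d)$ (equivalently, $\widehat f \in L^q(\mathbb{R}^d)$). $H^s(\mathbb{R}^d)$ is the usual $L^2$-based Sobolev space. For a measurable $g : \mathbb{R}^d \to \mathbb{C}$ vanishing at infinity (i.e. $\{|g|>t\}$ has finite Lebesgue measure for every $t>0$), its symmetric-decreasing rearrangement is $g^*(x) = \int_0^\infty \mathbf{1}_{\{|g|>t\}^*}(x)\,dt$, where for a measurable set $A$ of finite measure $A^*=B_R(0)$ is the open ball centered at the origin with $|B_R(0)| = |A|$ ($A^*=\emptyset$ if $|A|=0$). The Fourier rearrangement of $f \in L^2(\mathbb{R}^d)$ is $f^\sharp = \mathcal{F}^{-1}\{(\mathcal{F} f)^*\}$. Assumption 1 (on $L$, with parameter $s\ge 0$): $\omega : \mathbb{R}^d \to \mathbb{R}$ is real-valued and locally integrable, $L$ is defined by $\widehat{(Lf)}(\xi) = \omega(\xi)\widehat{f}(\xi)$ for Schwartz functions $f$, and: (i) there is a constant $C\ge 0$ such that $0 \le \omega(\xi) \le C(1+|\xi|^{2s})$ for a.e. $\xi \in \mathbb{R}^d$; (ii) $\omega(\xi)=\omega(\eta)$ if $|\xi|=|\eta|$,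 and $\omega(\xi)<\omega(\eta)$ if $|\xi|<|\eta|$. For $f \in H^s(\mathbb{R}^d)$, $\langle f, Lf\rangle := \int_{\mathbb{R}^d} \omega(\xi)|\widehat{f}(\xi)|^2\,d\xi$. *)

theory Defs
  imports "HOL-Analysis.Analysis" "HOL-Probability.Essential_Supremum"
begin

text \<open>
  The space \<open>\<real>\<^sup>d\<close> is rendered as a type of class \<open>euclidean_space\<close>. Functions are
  complex-valued and Lebesgue measurable; elements of Lebesgue spaces are functions, not
  equivalence classes, and are compared almost everywhere.
\<close>

subsection \<open>Lebesgue spaces, for exponents in \<open>[1, \<infinity>]\<close>\<close>

definition Lp_norm :: "ennreal \<Rightarrow> ('a::euclidean_space \<Rightarrow> complex) \<Rightarrow> ennreal" where
  "Lp_norm q f =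
    (if q = \<infinity> then esssup lebesgue (\<lambda>x. ennreal (norm (f x)))
     else let I = (\<integral>\<^sup>+ x. ennreal (norm (f x) powr enn2real q) \<partial>lebesgue)
          in if I = \<infinity> then \<infinity> else ennreal (enn2real I powr (1 / enn2real q)))"

definition Lp :: "ennreal \<Rightarrow> ('a::euclidean_space \<Rightarrow> complex) set" where
  "Lp q = {f \<in> borel_measurable lebesgue. Lp_norm q f < \<infinity>}"

subsection \<open>Schwartz functions and tempered distributions\<close>

text \<open>Iterated partial derivative; the list of basis vectors plays the role of a multi-index.\<close>

definition iter_partial :: "'a::euclidean_space list \<Rightarrow> ('a \<Rightarrow> complex) \<Rightarrow> 'a \<Rightarrow> complex" where
  "iter_partial bs f = fold (\<lambda>b g x. frechet_derivative g (at x) b) bs f"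

text \<open>Requiring every iterated partial derivative to be differentiable everywhere amounts to
  smoothness, and ensures that \<open>frechet_derivative\<close> is never applied where it is unspecified.\<close>

definition schwartz :: "('a::euclidean_space \<Rightarrow> complex) set" where
  "schwartz = {f. \<forall>bs. set bs \<subseteq> Basis \<longrightarrow>
      (\<forall>x. iter_partial bs f differentiable (at x)) \<and>
      (\<forall>k::nat. bounded (range (\<lambda>x. (norm x) ^ k *\<^sub>R iter_partial bs f x)))}"

definition schwartz_seminorm :: "nat \<Rightarrow> ('a::euclidean_space \<Rightarrow> complex) \<Rightarrow> real" where
  "schwartz_seminorm N f =
    (SUP (bs, x) \<in> {bs. set bs \<subseteq> Basis \<and> length bs \<le> N} \<times> UNIV.
       (1 + norm x) ^ N * norm (iter_partial bs f x))"

text \<open>A distribution is a functional on functions; only its values on \<open>schwartz\<close> are meaningful,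
  so equality of distributions is equality on \<open>schwartz\<close>.\<close>

type_synonym 'a distribution = "('a \<Rightarrow> complex) \<Rightarrow> complex"

definition tempered_distribution :: "'a::euclidean_space distribution \<Rightarrow> bool" where
  "tempered_distribution u \<longleftrightarrow>
    (\<forall>\<phi>\<in>schwartz. \<forall>\<psi>\<in>schwartz. u (\<lambda>x. \<phi> x + \<psi> x) = u \<phi> + u \<psi>) \<and>
    (\<forall>c. \<forall>\<phi>\<in>schwartz. u (\<lambda>x. c * \<phi> x) = c * u \<phi>) \<and>
    (\<exists>N C. \<forall>\<phi>\<in>schwartz. norm (u \<phi>) \<le> C * schwartz_seminorm N \<phi>)"

definition distr_eq :: "'a::euclidean_space distribution \<Rightarrow> 'a distribution \<Rightarrow> bool" where
  "distr_eq u v \<longleftrightarrow> (\<forall>\<phi>\<in>schwartz. u \<phi> = v \<phi>)"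

definition distr_of :: "('a::euclidean_space \<Rightarrow> complex) \<Rightarrow> 'a distribution" where
  "distr_of f = (\<lambda>\<phi>. LINT x|lebesgue. f x * \<phi> x)"

subsection \<open>The Fourier transform\<close>

definition fourier :: "('a::euclidean_space \<Rightarrow> complex) \<Rightarrow> 'a \<Rightarrow> complex" where
  "fourier f \<xi> = (LINT x|lebesgue. exp (- 2 * complex_of_real pi * \<i> * complex_of_real (x \<bullet> \<xi>)) * f x)"

definition fourier_distr :: "'a::euclidean_space distribution \<Rightarrow> 'a distribution" where
  "fourier_distr u = (\<lambda>\<phi>. u (fourier \<phi>))"

definition fourier_Lp :: "ennreal \<Rightarrow> 'a::euclidean_space distribution set" where
  "fourier_Lp q =
    {u. tempered_distribution u \<and> (\<exists>g\<in>Lp q. distr_eq u (fourier_distr (distr_of g)))}"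

text \<open>On \<open>Lp 2\<close> the distributional transform and its inverse are functions, determined up to null
  sets; \<open>SOME\<close> picks a representative.\<close>

definition fourier_L2 :: "('a::euclidean_space \<Rightarrow> complex) \<Rightarrow> 'a \<Rightarrow> complex" where
  "fourier_L2 f = (SOME g. g \<in> Lp 2 \<and> distr_eq (fourier_distr (distr_of f)) (distr_of g))"

definition inv_fourier_L2 :: "('a::euclidean_space \<Rightarrow> complex) \<Rightarrow> 'a \<Rightarrow> complex" where
  "inv_fourier_L2 g = (SOME f. f \<in> Lp 2 \<and> distr_eq (fourier_distr (distr_of f)) (distr_of g))"

text \<open>For \<open>s \<ge> 0\<close> only, so that every element is an \<open>Lp 2\<close> function.\<close>

definition sobolev :: "real \<Rightarrow> ('a::euclidean_space \<Rightarrow> complex) set" where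
  "sobolev s = {f \<in> Lp 2.
     (\<integral>\<^sup>+ \<xi>. ennreal ((1 + (norm \<xi>)\<^sup>2) powr s * (norm (fourier_L2 f \<xi>))\<^sup>2) \<partial>lebesgue) < \<infinity>}"

subsection \<open>Rearrangements\<close>

text \<open>Intended for measurable sets of finite measure. A null set yields radius \<open>0\<close>, hence \<open>{}\<close>.\<close>

definition set_rearrangement :: "'a::euclidean_space set \<Rightarrow> 'a set" where
  "set_rearrangement A =
    ball 0 (THE R. 0 \<le> R \<and> emeasure lebesgue (ball (0::'a) R) = emeasure lebesgue A)"

text \<open>For an essentially unbounded \<open>g\<close> vanishing at infinity the layer-cake integral diverges at
  the origin, and only there; the Bochner integral then takes the value \<open>0\<close> at that single point.\<close>

definition symm_decr_rearrangement :: "('a::euclidean_space \<Rightarrow> complex) \<Rightarrow> 'a \<Rightarrow> real" where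
  "symm_decr_rearrangement g x =
    (LINT t:{0<..}|lborel. indicat_real (set_rearrangement {y. norm (g y) > t}) x)"

definition fourier_rearrangement :: "('a::euclidean_space \<Rightarrow> complex) \<Rightarrow> 'a \<Rightarrow> complex" where
  "fourier_rearrangement f =
    inv_fourier_L2 (\<lambda>\<xi>. complex_of_real (symm_decr_rearrangement (fourier_L2 f) \<xi>))"

subsection \<open>The multiplier operator and its quadratic form\<close>

text \<open>\<open>L\<close> maps Schwartz functions to tempered distributions.\<close>

definition fourier_multiplier_op ::
    "(('a::euclidean_space \<Rightarrow> complex) \<Rightarrow> 'a distribution) \<Rightarrow> ('a \<Rightarrow> real) \<Rightarrow> bool" where
  "fourier_multiplier_op L \<omega> \<longleftrightarrow>
    (\<forall>f\<in>schwartz. tempered_distribution (L f) \<and>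
       distr_eq (fourier_distr (L f)) (distr_of (\<lambda>\<xi>. complex_of_real (\<omega> \<xi>) * fourier f \<xi>)))"

text \<open>In the upper bound, \<open>0 powr 0 = 0\<close> matters only at the origin, a null set.\<close>

definition multiplier_assumption ::
    "real \<Rightarrow> (('a::euclidean_space \<Rightarrow> complex) \<Rightarrow> 'a distribution) \<Rightarrow> ('a \<Rightarrow> real) \<Rightarrow> bool" where
  "multiplier_assumption s L \<omega> \<longleftrightarrow>
    (\<forall>K. compact K \<longrightarrow> \<omega> absolutely_integrable_on K) \<and>
    fourier_multiplier_op L \<omega> \<and>
    (\<exists>C\<ge>0. AE \<xi> in lebesgue. 0 \<le> \<omega> \<xi> \<and> \<omega> \<xi> \<le> C * (1 + norm \<xi> powr (2 * s))) \<and>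
    (\<forall>\<xi> \<eta>. (norm \<xi> = norm \<eta> \<longrightarrow> \<omega> \<xi> = \<omega> \<eta>) \<and> (norm \<xi> < norm \<eta> \<longrightarrow> \<omega> \<xi> < \<omega> \<eta>))"

text \<open>The value \<open>\<langle>f, L f\<rangle>\<close>, which for \<open>f\<close> in the Sobolev space is by definition this integral.\<close>

definition quad_form :: "('a::euclidean_space \<Rightarrow> real) \<Rightarrow> ('a \<Rightarrow> complex) \<Rightarrow> real" where
  "quad_form \<omega> f = (LINT \<xi>|lebesgue. \<omega> \<xi> * (norm (fourier_L2 f \<xi>))\<^sup>2)"

definition radially_symmetric :: "('a::euclidean_space \<Rightarrow> 'b) \<Rightarrow> bool" where
  "radially_symmetric h \<longleftrightarrow> (\<forall>x y. norm x = norm y \<longrightarrow> h x = h y)"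

end

(*
  Write G for the Fourier transform of f, r = |G|* for its symmetric decreasing rearrangement and u for
  the function with Fourier transform r.  Since the weight is radially increasing, moving |G| to r
  lowers the quadratic form, strictly unless |G| = r.  For p = 2m the Plancherel identity turns the p-th
  power of the L^p norm of f into the squared L^2 norm of the m-fold convolution power of G.  This is at most the
  value for |G|, which by the Riesz rearrangement inequality (Riesz on the line, then Steiner
  symmetrization) is at most the value for r, that is, for u.  Young's inequality makes all of them
  finite under the hypothesis on p'.  In the case of equality the convolution G * G has no cancellation:
  for all z the phase of G x * G (z - x) does not depend on x.  As |G| = r, the open set where G does not
  vanish is a ball around 0 or the whole space, so G has a continuous logarithm there, whose imaginary
  part minus its value at 0 is locally additive and hence linear.  A linear phase of G is a translation of f.
  For p = infinity, the supremum norm of u is u 0 = integral of r, and equality means that a translate of f attains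
  at 0 the bound given by the integral of |G|.
*)
theory Submission
  imports Defs "HOL-Probability.Characteristic_Functions"
begin

text \<open>\<open>G\<close> need not be integrable, so the Plancherel identity for powers holds at
  first only after damping \<open>G\<close> by a Gaussian. Removing the damping is a one-sided
  limit: Fatou gives the upper bound needed for \<open>f\<close>. The opposite bound, needed for
  \<open>u\<close>, uses that \<open>r\<close> is nonnegative: the damped convolution powers
  increase to their limit, while on the other side damping is convolution of \<open>u\<close> with a
  probability density, which does not raise its norm. The convolution has m factors, while the Riesz
  inequality has two and a test set. The link is the relation \<open>maj\<close>, which compares
  masses on a set and on the ball of equal measure and survives one more convolution. Steiner
  symmetrization is made quantitative: averaging over directions finds one that lowers the total
  distance D of three sets from their balls by a fixed multiple of D squared, so the infimum of D is
  0. The Fourier transform on L2 is a relation \<open>ft2\<close> defined by duality. It is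
  recognised by testing on modulated and translated Gaussians, two families that the transform
  exchanges. These are Schwartz functions, which ties \<open>ft2\<close> to the distributional
  definitions.\<close>

abbreviation nonneg_integral :: "('a::euclidean_space \<Rightarrow> ennreal) \<Rightarrow> ennreal" (binder "\<J>" 10)
  where "nonneg_integral F \<equiv> nn_integral lborel F"
abbreviation vol :: "'a::euclidean_space set \<Rightarrow> ennreal" where "vol A \<equiv> emeasure lborel A"
abbreviation Borel :: "('a::topological_space \<Rightarrow> 'b::topological_space) set" where "Borel \<equiv> borel_measurable borel"

subsection \<open>Fourier transforms of Gaussians and changes of variables\<close>

definition ech :: "real \<Rightarrow> complex" where "ech t = cis (2 * pi * t)"

lemma norm_ech [simp]: "norm (ech t) = 1" by (simp add: ech_def)
lemma ech_0 [simp]: "ech 0 = 1" by (simp add: ech_def)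
lemma ech_add: "ech (s + t) = ech s * ech t" by (simp add: ech_def cis_mult ring_distribs)
lemma cnj_ech: "cnj (ech t) = ech (- t)" by (simp add: ech_def cis_cnj)
lemma continuous_ech [continuous_intros]: "continuous_on S f \<Longrightarrow> continuous_on S (\<lambda>x. ech (f x))"
  unfolding ech_def cis_conv_exp by (intro continuous_intros)
lemma measurable_ech [measurable]: "ech \<in> Borel"
  by (intro borel_measurable_continuous_onI continuous_intros)
lemma ech_sum: "finite S \<Longrightarrow> ech (\<Sum>i\<in>S. f i) = (\<Prod>i\<in>S. ech (f i))"
  by (induction S rule: finite_induct) (auto simp: ech_add)

text \<open>The factor \<open>pi\<close> in the exponent makes \<open>gauss 1\<close> its own
  Fourier transform, with integral 1.\<close>

definition gauss :: "real \<Rightarrow> 'a::euclidean_space \<Rightarrow> real" where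
  "gauss a x = exp (- pi * a * (norm x)\<^sup>2)"

lemma gauss_pos [simp]: "gauss a x > 0" "gauss a x \<ge> 0" by (auto simp: gauss_def)
lemma gauss_minus [simp]: "gauss a (- x) = gauss a x" by (simp add: gauss_def)
lemma measurable_gauss [measurable]: "gauss a \<in> Borel"
  unfolding gauss_def by measurable

text \<open>This is the characteristic function of the standard normal distribution, rescaled by
  \<open>c = sqrt (2 * pi * a)\<close>: at \<open>c * t\<close> the normal density equals the
  Gaussian divided by \<open>sqrt (2 * pi)\<close>.\<close>

lemma fourier_gauss_real:
  assumes "a > 0"
  shows "integrable lborel (\<lambda>t::real. complex_of_real (exp (- pi * a * t\<^sup>2)))"
    and "(LINT t|lborel. ech (s * t) * complex_of_real (exp (- pi * a * t\<^sup>2))) =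
          complex_of_real (exp (- pi * s\<^sup>2 / a) / sqrt a)"
proof -
  define c where "c = sqrt (2 * pi * a)"
  have c: "c > 0" "c\<^sup>2 = 2 * pi * a" using assms by (auto simp: c_def)
  have *: "std_normal_density (c * t) = exp (- pi * a * t\<^sup>2) / sqrt (2 * pi)" for t
    by (simp add: normal_density_def power_mult_distrib c)
  have "integrable lborel std_normal_density" by (rule integrable_normal_density) simp
  then have "integrable lborel (\<lambda>t. std_normal_density (0 + c * t))"
    by (intro lborel_integrable_real_affine) (use c in auto)
  then have "integrable lborel (\<lambda>t. sqrt (2 * pi) * std_normal_density (0 + c * t))" by simp
  then show "integrable lborel (\<lambda>t::real. complex_of_real (exp (- pi * a * t\<^sup>2)))"
    by (intro integrable_of_real) (simp add: *)
  define r where "r = 2 * pi * s / c"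
  have "complex_of_real (exp (- (r^2) / 2)) = char std_normal_distribution r"
    by (simp add: char_std_normal_distribution)
  also have "\<dots> = (LINT x|lborel. std_normal_density x *\<^sub>R iexp (r * x))"
    unfolding char_def by (subst integral_density) (auto)
  also have "\<dots> = \<bar>c\<bar> *\<^sub>R (LINT x|lborel. std_normal_density (0 + c * x) *\<^sub>R iexp (r * (0 + c * x)))"
    by (rule lborel_integral_real_affine) (use c in auto)
  also have "\<dots> = \<bar>c\<bar> *\<^sub>R (LINT t|lborel. (1 / sqrt (2*pi)) *\<^sub>R (ech (s * t) * complex_of_real (exp (- pi * a * t\<^sup>2))))"
    using c by (intro arg_cong[where f="scaleR _"] Bochner_Integration.integral_cong)
      (auto simp: *[simplified mult.commute[of c]] ech_def cis_conv_exp r_def scaleR_conv_of_real mult_ac)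
  also have "\<dots> = (\<bar>c\<bar> / sqrt (2*pi)) *\<^sub>R (LINT t|lborel. (ech (s * t) * complex_of_real (exp (- pi * a * t\<^sup>2))))"
    by simp
  also have "\<bar>c\<bar> / sqrt (2*pi) = sqrt a" unfolding c_def using assms by (simp add: real_sqrt_mult)
  finally have "complex_of_real (exp (- (r^2) / 2)) = sqrt a * (LINT t|lborel. (ech (s * t) * complex_of_real (exp (- pi * a * t\<^sup>2))))"
    by (simp add: scaleR_conv_of_real)
  moreover have "- (r^2) / 2 = - pi * s\<^sup>2 / a"
  proof -
    have "- (r^2) / 2 = - ((2 * pi * s)\<^sup>2 / (2 * pi * a)) / 2" by (simp add: r_def power_divide c(2))
    also have "\<dots> = - pi * s\<^sup>2 / a" using assms by (simp add: power2_eq_square field_simps)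
    finally show ?thesis .
  qed
  ultimately show "(LINT t|lborel. ech (s * t) * complex_of_real (exp (- pi * a * t\<^sup>2))) =
          complex_of_real (exp (- pi * s\<^sup>2 / a) / sqrt a)"
    using assms by (simp only: of_real_divide) (simp add: nonzero_eq_divide_eq mult.commute)
qed

text \<open>\<open>lborel\<close> is the image of a product of copies of the line under summation of
  coordinates, so tensor products integrate factor by factor; this reduces the Gaussian in any
  dimension to the line.\<close>

lemma lborel_integral_prod:
  fixes f :: "'a::euclidean_space \<Rightarrow> real \<Rightarrow> complex"
  assumes "\<And>b. b \<in> Basis \<Longrightarrow> integrable lborel (f b)"
  shows "integrable lborel (\<lambda>x::'a. \<Prod>b\<in>Basis. f b (x \<bullet> b))"
    and "(LINT x|lborel. (\<Prod>b\<in>Basis. f b (x \<bullet> b))) = (\<Prod>b\<in>Basis. LINT t|lborel. f b t)"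
proof -
  interpret product_sigma_finite "\<lambda>_::'a. lborel :: real measure" ..
  have [measurable]: "f b \<in> Borel" if "b \<in> Basis" for b
    using assms[OF that] by auto
  have *: "(\<lambda>f. \<Sum>b\<in>Basis. f b *\<^sub>R b) \<in> (\<Pi>\<^sub>M b\<in>(Basis::'a set). (lborel::real measure)) \<rightarrow>\<^sub>M borel"
    by measurable
  have eq: "(\<Prod>b\<in>Basis. f b ((\<Sum>b'\<in>Basis. g b' *\<^sub>R b') \<bullet> b)) = (\<Prod>b\<in>Basis. f b (g b))" for g
    by (intro prod.cong) auto
  have [measurable]: "(\<lambda>x::'a. \<Prod>b\<in>Basis. f b (x \<bullet> b)) \<in> Borel"
    by measurable
  show "integrable lborel (\<lambda>x::'a. \<Prod>b\<in>Basis. f b (x \<bullet> b))"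
    using *
    by (subst lborel_eq, subst integrable_distr_eq) (auto simp: eq intro!: product_integrable_prod assms)
  show "(LINT x|lborel. (\<Prod>b\<in>Basis. f b (x \<bullet> b))) = (\<Prod>b\<in>Basis. LINT t|lborel. f b t)"
    using * by (subst lborel_eq, subst integral_distr) (auto simp: eq intro!: product_integral_prod assms)
qed

lemma gauss_prod: "gauss a x = (\<Prod>b\<in>Basis. exp (- pi * a * (x \<bullet> b)\<^sup>2))"
proof -
  have "(norm x)\<^sup>2 = (\<Sum>b\<in>Basis. (x \<bullet> b)\<^sup>2)"
    unfolding power2_norm_eq_inner by (subst euclidean_inner) (simp add: power2_eq_square)
  then show ?thesis by (simp add: gauss_def exp_sum sum_distrib_left)
qed

lemma fourier_gauss:
  assumes "a > 0"
  shows "integrable lborel (\<lambda>x::'a::euclidean_space. complex_of_real (gauss a x))"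
    and "(LINT x|lborel. ech (x \<bullet> (w::'a)) * complex_of_real (gauss a x)) =
          complex_of_real ((1 / sqrt a) ^ DIM('a) * gauss (1 / a) w)"
proof -
  have 1: "integrable lborel (\<lambda>t::real. ech (s * t) * complex_of_real (exp (- pi * a * t\<^sup>2)))" for s
    by (rule Bochner_Integration.integrable_bound[OF fourier_gauss_real(1)[OF assms]]) (auto simp: norm_mult)
  define h :: "'a \<Rightarrow> 'a \<Rightarrow> real \<Rightarrow> complex" where
    "h w b t = ech ((w \<bullet> b) * t) * complex_of_real (exp (- pi * a * t\<^sup>2))" for w b t
  have h: "integrable lborel (h w b)" for w b using 1 unfolding h_def .
  have hI: "integral\<^sup>L lborel (h w b) = complex_of_real (exp (- pi * (w \<bullet> b)\<^sup>2 / a) / sqrt a)" for w b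
    unfolding h_def by (rule fourier_gauss_real(2)[OF assms])
  have eq: "ech (x \<bullet> w) * complex_of_real (gauss a x) = (\<Prod>b\<in>Basis. h w b (x \<bullet> b))" for x w :: 'a
  proof -
    have "ech (x \<bullet> w) = (\<Prod>b\<in>Basis. ech ((w \<bullet> b) * (x \<bullet> b)))"
      unfolding ech_sum[OF finite_Basis, symmetric] euclidean_inner[of x w] by (simp only: mult.commute)
    then show ?thesis unfolding h_def prod.distrib gauss_prod of_real_prod by simp
  qed
  have "integrable lborel (\<lambda>x::'a. \<Prod>b\<in>Basis. h 0 b (x \<bullet> b))"
    by (rule lborel_integral_prod) (rule h)
  then show "integrable lborel (\<lambda>x::'a::euclidean_space. complex_of_real (gauss a x))"
    unfolding eq[symmetric] by simp
  have "(\<Prod>b\<in>Basis. exp (- pi * (w \<bullet> b)\<^sup>2 / a) / sqrt a) = (1 / sqrt a) ^ DIM('a) * gauss (1 / a) w"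
    by (simp add: gauss_prod prod_dividef power_one_over divide_simps)
  moreover have "(LINT x|lborel. ech (x \<bullet> (w::'a)) * complex_of_real (gauss a x)) =
      (\<Prod>b\<in>Basis. complex_of_real (exp (- pi * (w \<bullet> b)\<^sup>2 / a) / sqrt a))"
    unfolding eq lborel_integral_prod(2)[OF h] hI ..
  ultimately show "(LINT x|lborel. ech (x \<bullet> (w::'a)) * complex_of_real (gauss a x)) =
          complex_of_real ((1 / sqrt a) ^ DIM('a) * gauss (1 / a) w)"
    by (simp only: of_real_prod[symmetric])
qed

lemma lborel_integral_affine:
  fixes f :: "'a::euclidean_space \<Rightarrow> 'b::{banach, second_countable_topology}"
  assumes [measurable]: "f \<in> Borel" and "c \<noteq> 0"
  shows "(LINT x|lborel. f x) = (\<bar>c\<bar> ^ DIM('a)) *\<^sub>R (LINT x|lborel. f (t + c *\<^sub>R x))"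
  by (subst lborel_affine[OF assms(2), of t])
     (simp add: integral_density integral_distr)

lemma lborel_nn_integral_affine:
  fixes f :: "'a::euclidean_space \<Rightarrow> ennreal"
  assumes [measurable]: "f \<in> Borel" and "c \<noteq> 0"
  shows "(\<J> x. f x) = ennreal (\<bar>c\<bar> ^ DIM('a)) * (\<J> x. f (t + c *\<^sub>R x))"
  by (subst lborel_affine[OF assms(2), of t])
     (simp add: nn_integral_density nn_integral_distr nn_integral_cmult)

lemma lborel_integral_shift:
  fixes f :: "'a::euclidean_space \<Rightarrow> 'b::{banach, second_countable_topology}"
  assumes [measurable]: "f \<in> Borel"
  shows "(LINT x|lborel. f (x + t)) = (LINT x|lborel. f x)"
    and "(LINT x|lborel. f (x - t)) = (LINT x|lborel. f x)"
    and "(LINT x|lborel. f (t - x)) = (LINT x|lborel. f x)"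
    and "(LINT x|lborel. f (- x)) = (LINT x|lborel. f x)"
  using lborel_integral_affine[of f 1 t] lborel_integral_affine[of f 1 "-t"]
    lborel_integral_affine[of f "-1" t] lborel_integral_affine[of f "-1" 0] assms by (simp_all add: add.commute)

lemma lborel_nn_integral_shift:
  fixes f :: "'a::euclidean_space \<Rightarrow> ennreal"
  assumes [measurable]: "f \<in> Borel"
  shows "(\<J> x. f (x + t)) = (\<J> x. f x)"
    and "(\<J> x. f (x - t)) = (\<J> x. f x)"
    and "(\<J> x. f (t - x)) = (\<J> x. f x)"
    and "(\<J> x. f (- x)) = (\<J> x. f x)"
  using lborel_nn_integral_affine[of f 1 t] lborel_nn_integral_affine[of f 1 "-t"]
    lborel_nn_integral_affine[of f "-1" t] lborel_nn_integral_affine[of f "-1" 0] assms by (simp_all add: add.commute)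

lemma lborel_integrable_shift:
  fixes f :: "'a::euclidean_space \<Rightarrow> 'b::{banach, second_countable_topology}"
  assumes "integrable lborel f"
  shows "integrable lborel (\<lambda>x. f (x + t))" and "integrable lborel (\<lambda>x. f (x - t))"
    and "integrable lborel (\<lambda>x. f (t - x))" and "integrable lborel (\<lambda>x. f (- x))"
proof -
  have [measurable]: "f \<in> Borel" using assms by auto
  have "(\<J> x. ennreal (norm (f x))) < \<infinity>" using assms by (simp add: integrable_iff_bounded)
  then show "integrable lborel (\<lambda>x. f (x + t))" "integrable lborel (\<lambda>x. f (x - t))"
    "integrable lborel (\<lambda>x. f (t - x))" "integrable lborel (\<lambda>x. f (- x))"
    unfolding integrable_iff_bounded
    by (auto simp: lborel_nn_integral_shift[where f = "\<lambda>x. ennreal (norm (f x))"])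
qed

lemma AE_lborel_shift:
  assumes "AE x in lborel. P (x::'a::euclidean_space)" and "c \<noteq> 0"
  shows "AE x in lborel. P (t + c *\<^sub>R x)"
proof -
  obtain N where N: "{x. \<not> P x} \<subseteq> N" "vol N = 0" "N \<in> sets borel"
    using assms(1) by (auto elim!: AE_E)
  have [measurable]: "N \<in> sets borel" by (rule N)
  have "0 = (\<J> x. indicator N x)" using N by simp
  also have "\<dots> = ennreal (\<bar>c\<bar> ^ DIM('a)) * (\<J> x. indicator N (t + c *\<^sub>R x))"
    by (rule lborel_nn_integral_affine) (use assms in auto)
  finally have "(\<J> x. indicator N (t + c *\<^sub>R x)) = 0" using assms(2) by simp
  then have "AE x in lborel. indicator N (t + c *\<^sub>R x) = (0::ennreal)"
    by (subst (asm) nn_integral_0_iff_AE) auto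
  then show ?thesis using N(1) by (auto simp: indicator_def split: if_splits elim!: eventually_mono)
qed

lemma AE_lborel_shifts:
  assumes "AE x in lborel. P (x::'a::euclidean_space)"
  shows "AE x in lborel. P (x + t)" "AE x in lborel. P (x - t)" "AE x in lborel. P (t - x)" "AE x in lborel. P (- x)"
  using AE_lborel_shift[OF assms, of 1 t] AE_lborel_shift[OF assms, of 1 "-t"]
   AE_lborel_shift[OF assms, of "-1" t] AE_lborel_shift[OF assms, of "-1" 0] by (simp_all add: add.commute)

lemma fubini_dominated:
  fixes F :: "'a::euclidean_space \<Rightarrow> 'b::euclidean_space \<Rightarrow> complex"
  assumes [measurable]: "(\<lambda>(x, y). F x y) \<in> borel_measurable (lborel \<Otimes>\<^sub>M lborel)"
    and u: "integrable lborel (u::'a \<Rightarrow> complex)" and w: "integrable lborel (w::'b \<Rightarrow> complex)"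
    and le: "\<And>x y. norm (F x y) \<le> norm (u x) * norm (w y)"
  shows "(LINT x|lborel. LINT y|lborel. F x y) = (LINT y|lborel. LINT x|lborel. F x y)"
    and "integrable lborel (\<lambda>x. LINT y|lborel. F x y)"
    and "integrable lborel (\<lambda>y. LINT x|lborel. F x y)"
proof -
  have [measurable]: "u \<in> Borel" "w \<in> Borel" using u w by auto
  have "integrable (lborel \<Otimes>\<^sub>M lborel) (\<lambda>(x, y). F x y)"
  proof (rule integrableI_bounded)
    have "(\<integral>\<^sup>+p. ennreal (norm (case p of (x, y) \<Rightarrow> F x y)) \<partial>(lborel \<Otimes>\<^sub>M lborel))
       \<le> (\<integral>\<^sup>+p. ennreal (norm (u (fst p))) * ennreal (norm (w (snd p))) \<partial>(lborel \<Otimes>\<^sub>M lborel))"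
      by (intro nn_integral_mono) (auto simp: ennreal_mult[symmetric] le)
    also have "\<dots> = (\<J> x. \<J> y. ennreal (norm (u x)) * ennreal (norm (w y)))"
      by (subst lborel.nn_integral_fst[symmetric]) auto
    also have "\<dots> = (\<J> x. ennreal (norm (u x))) * (\<J> y. ennreal (norm (w y)))"
      by (simp add: nn_integral_cmult nn_integral_multc)
    also have "\<dots> < \<infinity>" using u w by (auto simp: integrable_iff_bounded ennreal_mult_less_top)
    finally show "(\<integral>\<^sup>+p. ennreal (norm (case p of (x, y) \<Rightarrow> F x y)) \<partial>(lborel \<Otimes>\<^sub>M lborel)) < \<infinity>" .
  qed auto
  note i = this
  show "(LINT x|lborel. LINT y|lborel. F x y) = (LINT y|lborel. LINT x|lborel. F x y)"
    using lborel_pair.Fubini_integral[OF i] by simp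
  show "integrable lborel (\<lambda>x. LINT y|lborel. F x y)"
    using lborel_pair.integrable_fst[OF i] by simp
  show "integrable lborel (\<lambda>y. LINT x|lborel. F x y)"
    using lborel_pair.integrable_snd[OF i] by simp
qed

subsection \<open>The Fourier transform on integrable functions\<close>

text \<open>The positive and the negative part of \<open>v\<close>, taken as densities, give equal
  mass to all boxes. Boxes form an intersection-stable generator, so the two measures and hence the
  two densities agree almost everywhere; as one of the parts is always 0, both are.\<close>

lemma box_integrals_zero_imp_AE_zero_real:
  fixes v :: "'a::euclidean_space \<Rightarrow> real"
  assumes v: "integrable lborel v" and 0: "\<And>l u. (LINT x|lborel. indicator (box l u) x * v x) = 0"
  shows "AE x in lborel. v x = 0"
proof -
  have [measurable]: "v \<in> Borel" using v by auto
  let ?p = "\<lambda>x. ennreal (v x)" and ?n = "\<lambda>x. ennreal (- v x)"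
  have fin: "(\<J> x. ?p x) \<noteq> \<infinity>" "(\<J> x. ?n x) \<noteq> \<infinity>"
    using v by (auto simp: real_integrable_def)
  have eq: "emeasure (density lborel ?p) (box l u) = emeasure (density lborel ?n) (box l u)" for l u
  proof -
    let ?w = "\<lambda>x. indicator (box l u) x * v x"
    have w: "integrable lborel ?w"
      by (rule Bochner_Integration.integrable_bound[OF v]) (auto simp: indicator_def)
    have eq0: "enn2real (\<J> x. ennreal (?w x)) = enn2real (\<J> x. ennreal (- ?w x))"
      using 0[of l u] real_lebesgue_integral_def[OF w] by simp
    have "(\<J> x. ennreal (?w x)) = (\<J> x. ennreal (- ?w x))"
    proof -
      have "(\<J> x. ennreal (?w x)) < top" "(\<J> x. ennreal (- ?w x)) < top"
        using w by (auto simp: real_integrable_def less_top)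
      with eq0 show ?thesis using ennreal_enn2real by metis
    qed
    moreover have "(\<J> x. ennreal (?w x)) = emeasure (density lborel ?p) (box l u)"
      by (simp add: emeasure_density) (intro nn_integral_cong, auto simp: indicator_def)
    moreover have "(\<J> x. ennreal (- ?w x)) = emeasure (density lborel ?n) (box l u)"
      by (simp add: emeasure_density) (intro nn_integral_cong, auto simp: indicator_def)
    ultimately show ?thesis by simp
  qed
  have "density lborel ?p = density lborel ?n"
  proof (rule measure_eqI_generator_eq)
    let ?E = "range (\<lambda>(a, b). box a b::'a set)"
    show "Int_stable ?E"
      by (auto simp: Int_stable_def box_Int_box)
    show "?E \<subseteq> Pow UNIV" "sets (density lborel ?p) = sigma_sets UNIV ?E" "sets (density lborel ?n) = sigma_sets UNIV ?E"
      by (simp_all add: borel_eq_box)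
    let ?A = "\<lambda>n::nat. box (- (real n *\<^sub>R One)) (real n *\<^sub>R One) :: 'a set"
    show "range ?A \<subseteq> ?E" "(\<Union>i. ?A i) = UNIV"
      unfolding UN_box_eq_UNIV by auto
    show "emeasure (density lborel ?p) (?A i) \<noteq> \<infinity>" for i
    proof -
      have "emeasure (density lborel ?p) (?A i) \<le> (\<J> x. ?p x)"
        by (simp add: emeasure_density) (intro nn_integral_mono, auto simp: indicator_def)
      with fin show ?thesis by (auto simp: top_unique)
    qed
    show "emeasure (density lborel ?p) X = emeasure (density lborel ?n) X" if "X \<in> ?E" for X
      using that eq by auto
  qed
  then have "AE x in lborel. ?p x = ?n x"
    by (subst (asm) finite_density_unique) (use fin in auto)
  then show ?thesis
  proof eventually_elim
    case (elim x)
    then show ?case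
    proof (cases "v x \<ge> 0")
      case True
      with elim have "ennreal (v x) = 0" by (simp add: ennreal_neg)
      with True show ?thesis by (simp add: ennreal_eq_0_iff)
    next
      case False
      with elim have "ennreal (- v x) = 0" by (simp add: ennreal_neg)
      with False show ?thesis by (simp add: ennreal_eq_0_iff)
    qed
  qed
qed

lemma box_integrals_zero_imp_AE_zero:
  fixes v :: "'a::euclidean_space \<Rightarrow> complex"
  assumes v: "integrable lborel v" and 0: "\<And>l u. (LINT x|lborel. indicator (box l u) x *\<^sub>R v x) = 0"
  shows "AE x in lborel. v x = 0"
proof -
  have w: "integrable lborel (\<lambda>x. indicator (box l u) x *\<^sub>R v x)" for l u
    by (rule Bochner_Integration.integrable_bound[OF v]) (use v in \<open>auto simp: indicator_def\<close>)
  have "AE x in lborel. Re (v x) = 0"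
    by (rule box_integrals_zero_imp_AE_zero_real)
       (use v 0 integral_Re[OF w] in auto)
  moreover have "AE x in lborel. Im (v x) = 0"
    by (rule box_integrals_zero_imp_AE_zero_real)
       (use v 0 integral_Im[OF w] in auto)
  ultimately show ?thesis by eventually_elim (simp add: complex_eq_iff)
qed

text \<open>The Fourier transform of \<open>gauss (\<epsilon>\<^sup>2)\<close>: a probability
  density that concentrates at 0 as \<epsilon> tends to 0. Multiplying a transform by that Gaussian
  is convolution with this kernel on the other side.\<close>

definition heat :: "real \<Rightarrow> 'a::euclidean_space \<Rightarrow> real" where
  "heat \<epsilon> x = (1 / \<epsilon>) ^ DIM('a) * gauss (1 / \<epsilon>\<^sup>2) x"

lemma measurable_heat [measurable]: "heat \<epsilon> \<in> Borel"
  unfolding heat_def by measurable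

lemma heat_nonneg: "\<epsilon> > 0 \<Longrightarrow> heat \<epsilon> x \<ge> 0" by (simp add: heat_def)
lemma heat_minus [simp]: "heat \<epsilon> (- x) = heat \<epsilon> x" by (simp add: heat_def)

lemma heat_Fourier:
  assumes "\<epsilon> > 0"
  shows "(LINT \<xi>|lborel. ech (\<xi> \<bullet> (x::'a::euclidean_space)) * complex_of_real (gauss (\<epsilon>\<^sup>2) \<xi>)) = heat \<epsilon> x"
  using assms fourier_gauss(2)[of "\<epsilon>\<^sup>2" x] by (simp add: heat_def)

lemma integrable_gauss: "a > 0 \<Longrightarrow> integrable lborel (gauss a :: 'a::euclidean_space \<Rightarrow> real)"
  using integrable_Re[OF fourier_gauss(1)[of a]] by simp

lemma integral_gauss: "a > 0 \<Longrightarrow> (LINT x|lborel. gauss a (x::'a::euclidean_space)) = (1 / sqrt a) ^ DIM('a)"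
proof -
  assume a: "a > 0"
  have "complex_of_real (LINT x|lborel. gauss a (x::'a)) = complex_of_real ((1 / sqrt a) ^ DIM('a))"
    using fourier_gauss(2)[OF a, of 0] by (simp add: gauss_def)
  then show ?thesis using of_real_eq_iff by blast
qed

lemma nn_integral_gauss: "a > 0 \<Longrightarrow> (\<J> x. ennreal (gauss a (x::'a::euclidean_space))) = ennreal ((1 / sqrt a) ^ DIM('a))"
  using integrable_gauss integral_gauss by (subst nn_integral_eq_integral) auto

lemma nn_integral_heat: "\<epsilon> > 0 \<Longrightarrow> (\<J> x. ennreal (heat \<epsilon> (x::'a::euclidean_space))) = 1"
proof -
  assume e: "\<epsilon> > 0"
  have "(\<J> x. ennreal (heat \<epsilon> (x::'a))) = (\<J> x. ennreal ((1 / \<epsilon>) ^ DIM('a)) * ennreal (gauss (1 / \<epsilon>\<^sup>2) (x::'a)))"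
    unfolding heat_def using e by (intro nn_integral_cong ennreal_mult) auto
  also have "\<dots> = ennreal ((1 / \<epsilon>) ^ DIM('a)) * ennreal ((1 / sqrt (1 / \<epsilon>\<^sup>2)) ^ DIM('a))"
    using e by (simp add: nn_integral_cmult nn_integral_gauss)
  also have "\<dots> = ennreal (((1 / \<epsilon>) * (1 / sqrt (1 / \<epsilon>\<^sup>2))) ^ DIM('a))"
    unfolding power_mult_distrib using e by (intro ennreal_mult[symmetric]) auto
  also have "\<dots> = 1" using e by (simp add: real_sqrt_divide)
  finally show ?thesis .
qed

lemma gauss_shift_integrable: "a > 0 \<Longrightarrow> integrable lborel (\<lambda>x::'a::euclidean_space. complex_of_real (gauss a (x - t)))"
  by (rule lborel_integrable_shift(2)[OF fourier_gauss(1)])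

text \<open>The integral is that of \<open>fourier\<close>, taken over \<open>lborel\<close> so that
  Borel measurability is preserved along the way; the two agree on Borel functions by
  \<open>fourier_eq_ft\<close>.\<close>

definition ft :: "('a::euclidean_space \<Rightarrow> complex) \<Rightarrow> 'a \<Rightarrow> complex" where
  "ft u \<xi> = (LINT x|lborel. ech (- (x \<bullet> \<xi>)) * u x)"

lemma measurable_ft [measurable]:
  assumes [measurable]: "u \<in> Borel"
  shows "ft u \<in> Borel"
  unfolding ft_def by measurable

lemma integrable_ech_mult: 
  assumes "integrable lborel (u :: 'a::euclidean_space \<Rightarrow> complex)" and [measurable]: "g \<in> Borel"
  shows "integrable lborel (\<lambda>x. ech (g x) * u x)"
  by (rule Bochner_Integration.integrable_bound[OF assms(1)]) (use assms in \<open>auto simp: norm_mult\<close>)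

lemma ft_norm_le: "norm (ft u \<xi>) \<le> (LINT x|lborel. norm (u x))"
  unfolding ft_def by (rule order_trans[OF integral_norm_bound]) (simp add: norm_mult)

text \<open>The double integral of \<open>u x * w \<xi>\<close> against the symmetric kernel
  \<open>ech (- (x \<bullet> \<xi>))\<close> can be computed in either order. This symmetry later
  extends the transform to L2 by duality.\<close>

lemma ft_multiplication:
  assumes u: "integrable lborel u" and w: "integrable lborel w"
  shows "(LINT \<xi>|lborel. ft u \<xi> * w \<xi>) = (LINT x|lborel. u x * ft w x)"
    and "integrable lborel (\<lambda>\<xi>. ft u \<xi> * w \<xi>)"
proof -
  have [measurable]: "u \<in> Borel" "w \<in> Borel" using u w by auto
  have *: "(\<lambda>(x, \<xi>). ech (- (x \<bullet> \<xi>)) * u x * w \<xi>) \<in> borel_measurable (lborel \<Otimes>\<^sub>M lborel)" by measurable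
  note F = fubini_dominated[OF * u w, unfolded norm_mult norm_ech, simplified]
  have 2: "(LINT \<xi>|lborel. ech (- (x \<bullet> \<xi>)) * u x * w \<xi>) = u x * ft w x" for x
    unfolding ft_def by (subst integral_mult_right_zero[symmetric]) (simp add: inner_commute mult_ac)
  show "(LINT \<xi>|lborel. ft u \<xi> * w \<xi>) = (LINT x|lborel. u x * ft w x)" "integrable lborel (\<lambda>\<xi>. ft u \<xi> * w \<xi>)"
    using F unfolding 2 by (simp_all add: ft_def[of u])
qed

text \<open>A substitution has moved the scale \<epsilon> into the argument of \<open>h\<close>, so
  the Gaussian stays fixed and dominated convergence asks for continuity at the single point
  \<open>x\<close>.\<close>

lemma heat_approx_identity:
  fixes h :: "'a::euclidean_space \<Rightarrow> real"
  assumes [measurable]: "h \<in> Borel" and B: "\<And>x. \<bar>h x\<bar> \<le> B" and c: "isCont h x"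
    and \<epsilon>: "\<epsilon> \<longlonglongrightarrow> 0"
  shows "(\<lambda>n. LINT z|lborel. h (x + \<epsilon> n *\<^sub>R z) * gauss 1 z) \<longlonglongrightarrow> h x"
proof -
  have "(\<lambda>n. LINT z|lborel. h (x + \<epsilon> n *\<^sub>R z) * gauss 1 z) \<longlonglongrightarrow> (LINT z|lborel. h x * gauss 1 (z::'a))"
  proof (rule integral_dominated_convergence[where w = "\<lambda>z. B * gauss 1 z"])
    show "AE z in lborel. (\<lambda>n. h (x + \<epsilon> n *\<^sub>R z) * gauss 1 z) \<longlonglongrightarrow> h x * gauss 1 z"
    proof (intro always_eventually allI tendsto_mult tendsto_const)
      fix z :: 'a
      have "(\<lambda>n. x + \<epsilon> n *\<^sub>R z) \<longlonglongrightarrow> x + 0 *\<^sub>R z" by (intro tendsto_intros \<epsilon>)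
      then show "(\<lambda>n. h (x + \<epsilon> n *\<^sub>R z)) \<longlonglongrightarrow> h x" using isCont_tendsto_compose[OF c] by simp
    qed
    show "AE z in lborel. norm (h (x + \<epsilon> n *\<^sub>R z) * gauss 1 z) \<le> B * gauss 1 z" for n
      using B by (auto simp: abs_mult intro!: mult_right_mono)
  qed (auto intro: integrable_gauss)
  then show ?thesis by (simp add: integral_gauss)
qed

text \<open>By the multiplication formula with a modulated Gaussian, the convolution of
  \<open>v\<close> with every \<open>heat\<close> kernel vanishes. Integrating this over a box moves
  the smoothing to the indicator of the box, and the smoothed indicators converge back to it off the
  boundary, which is null.\<close>

lemma L1_fourier_injective:
  fixes v :: "'a::euclidean_space \<Rightarrow> complex"
  assumes v: "integrable lborel v" and 0: "\<And>\<xi>. ft v \<xi> = 0"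
  shows "AE x in lborel. v x = 0"
proof (rule box_integrals_zero_imp_AE_zero[OF v])
  fix l u :: 'a
  have [measurable]: "v \<in> Borel" using v by auto
  have conv: "(LINT x|lborel. v x * complex_of_real (heat \<epsilon> (b - x))) = 0" if "\<epsilon> > 0" for \<epsilon> b
  proof -
    have e2: "\<epsilon>\<^sup>2 > 0" using that by simp
    have w: "integrable lborel (\<lambda>\<xi>::'a. ech (\<xi> \<bullet> b) * complex_of_real (gauss (\<epsilon>\<^sup>2) \<xi>))"
      by (intro integrable_ech_mult fourier_gauss e2) auto
    have "ft (\<lambda>\<xi>. ech (\<xi> \<bullet> b) * complex_of_real (gauss (\<epsilon>\<^sup>2) \<xi>)) x = heat \<epsilon> (b - x)" for x
      unfolding ft_def heat_Fourier[OF that, symmetric]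
      by (simp add: mult.assoc[symmetric] ech_add[symmetric] inner_diff_right)
    then show ?thesis using ft_multiplication(1)[OF v w] 0 by simp
  qed
  \<comment> \<open>The box indicator smoothed at scale \<epsilon>, after the substitution
    \<open>b = x + \<epsilon> *\<^sub>R z\<close>, in the form to which
    \<open>heat_approx_identity\<close> applies.\<close>
  define P where "P \<epsilon> x = (LINT z|lborel. indicat_real (box l u) (x + \<epsilon> *\<^sub>R z) * gauss 1 z)" for \<epsilon> x
  have P0: "(LINT x|lborel. v x * complex_of_real (P \<epsilon> x)) = 0" if e: "\<epsilon> > 0" for \<epsilon>
  proof -
    let ?F = "\<lambda>x b. complex_of_real (indicator (box l u) b) * (v x * complex_of_real (heat \<epsilon> (b - x)))"
    have le1: "gauss a (x::'a) \<le> 1" if "a > 0" for a x using that by (simp add: gauss_def)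
    have hle: "heat \<epsilon> x \<le> (1/\<epsilon>)^DIM('a)" for x :: 'a
      unfolding heat_def using mult_left_mono[OF le1[of "1/\<epsilon>\<^sup>2" x], of "(1/\<epsilon>)^DIM('a)"] e by simp
    have i: "integrable lborel (\<lambda>b::'a. complex_of_real ((1/\<epsilon>)^DIM('a) * indicator (box l u) b))"
      by (intro integrable_of_real integrable_mult_right integrable_real_indicator) (auto simp: emeasure_lborel_box_eq)
    have "(LINT x|lborel. LINT b|lborel. ?F x b) = (LINT b|lborel. LINT x|lborel. ?F x b)"
    proof (rule fubini_dominated(1)[OF _ v i])
      show "norm (?F x y) \<le> norm (v x) * norm (complex_of_real ((1/\<epsilon>)^DIM('a) * indicator (box l u) y))" for x y
        using hle[of "y - x"] heat_nonneg[OF e, of "y - x"] e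
        by (auto simp: norm_mult indicator_def abs_mult norm_power norm_divide mult_left_mono)
    qed measurable
    also have "\<dots> = 0" by (simp add: conv[OF e])
    also have "(\<lambda>x. LINT b|lborel. ?F x b) = (\<lambda>x. v x * complex_of_real (P \<epsilon> x))"
    proof
      fix x
      have "(LINT b|lborel. ?F x b) = v x * complex_of_real (LINT b|lborel. indicator (box l u) b * heat \<epsilon> (b - x))"
      proof -
        have "(LINT b|lborel. ?F x b) = (LINT b|lborel. v x * complex_of_real (indicator (box l u) b * heat \<epsilon> (b - x)))"
          by (intro Bochner_Integration.integral_cong) auto
        then show ?thesis by (simp only: integral_mult_right_zero integral_complex_of_real)
      qed
      also have "(LINT b|lborel. indicator (box l u) b * heat \<epsilon> (b - x)) = 
          \<epsilon> ^ DIM('a) * (LINT z|lborel. indicat_real (box l u) (x + \<epsilon> *\<^sub>R z) * heat \<epsilon> (\<epsilon> *\<^sub>R z))"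
        using e by (subst lborel_integral_affine[where t = x and c = \<epsilon>]) auto
      also have "\<dots> = P \<epsilon> x"
        unfolding P_def integral_mult_right_zero[symmetric] heat_def using e
        by (intro Bochner_Integration.integral_cong) (auto simp: gauss_def power_mult_distrib power_divide)
      finally show "(LINT b|lborel. ?F x b) = v x * complex_of_real (P \<epsilon> x)" .
    qed
    finally show ?thesis .
  qed
  have [measurable]: "P \<epsilon> \<in> Borel" for \<epsilon> unfolding P_def by measurable
  have P1: "\<bar>P \<epsilon> x\<bar> \<le> 1" for \<epsilon> x
  proof -
    have "\<bar>P \<epsilon> x\<bar> \<le> (LINT z|lborel. \<bar>indicat_real (box l u) (x + \<epsilon> *\<^sub>R z) * gauss 1 z\<bar>)"
      unfolding P_def using integral_norm_bound[of lborel "\<lambda>z. indicat_real (box l u) (x + \<epsilon> *\<^sub>R z) * gauss 1 z"] by simp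
    also have "\<dots> \<le> (LINT z|lborel. gauss 1 (z::'a))"
      by (intro integral_mono_AE Bochner_Integration.integrable_bound[OF integrable_gauss[of 1]])
         (auto simp: indicator_def integrable_gauss)
    finally show ?thesis by (simp add: integral_gauss)
  qed
  have "(\<lambda>n. LINT x|lborel. v x * complex_of_real (P (1 / real (Suc n)) x)) \<longlonglongrightarrow> 
        (LINT x|lborel. v x * complex_of_real (indicator (box l u) x))"
  proof (rule integral_dominated_convergence[where w = "\<lambda>x. norm (v x)"])
    have "AE x in lborel. x \<notin> cbox l u - box l u"
      by (rule AE_not_in) (rule null_sets_cbox_Diff_box)
    then show "AE x in lborel. (\<lambda>n. v x * complex_of_real (P (1 / real (Suc n)) x))
         \<longlonglongrightarrow> v x * complex_of_real (indicator (box l u) x)"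
    proof eventually_elim
      case (elim x)
      have c: "isCont (indicat_real (box l u)) x"
      proof (cases "x \<in> box l u")
        case True
        have "eventually (\<lambda>y. y \<in> box l u) (nhds x)" using True open_box by (metis eventually_nhds)
        then have "eventually (\<lambda>y. indicat_real (box l u) y = 1) (nhds x)" by eventually_elim simp
        then show ?thesis by (subst isCont_cong[where g = "\<lambda>_. 1"]) auto
      next
        case False
        then have "x \<in> - cbox l u" using elim by auto
        then have "eventually (\<lambda>y. y \<in> - cbox l u) (nhds x)" using open_Compl closed_cbox by (metis eventually_nhds)
        then have "eventually (\<lambda>y. indicat_real (box l u) y = 0) (nhds x)" 
          by eventually_elim (use box_subset_cbox in \<open>auto simp: indicator_def\<close>)
        then show ?thesis by (subst isCont_cong[where g = "\<lambda>_. 0"]) auto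
      qed
      show ?case unfolding P_def
        by (intro tendsto_intros heat_approx_identity[OF _ _ c LIMSEQ_Suc[OF lim_1_over_n], of 1])
           (auto simp: indicator_def)
    qed
    show "AE x in lborel. norm (v x * complex_of_real (P (1 / real (Suc n)) x)) \<le> norm (v x)" for n
      using P1 by (auto simp: norm_mult intro!: mult_left_le)
  qed (use v in auto)
  then have "(\<lambda>n::nat. 0) \<longlonglongrightarrow> (LINT x|lborel. v x * complex_of_real (indicator (box l u) x))"
    by (subst (asm) P0) auto
  then have "(LINT x|lborel. v x * complex_of_real (indicator (box l u) x)) = 0"
    using LIMSEQ_unique tendsto_const by blast
  then show "(LINT x|lborel. indicator (box l u) x *\<^sub>R v x) = 0"
    by (simp add: scaleR_conv_of_real mult.commute)
qed

subsection \<open>Square-integrable functions\<close>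

definition n2 :: "('a::euclidean_space \<Rightarrow> complex) \<Rightarrow> ennreal" where
  "n2 u = (\<J> x. ennreal ((norm (u x))\<^sup>2))"

definition sq :: "('a::euclidean_space \<Rightarrow> complex) \<Rightarrow> bool" where
  "sq u \<longleftrightarrow> u \<in> Borel \<and> n2 u < \<infinity>"

lemma sq_measurable [measurable_dest]: "sq u \<Longrightarrow> u \<in> Borel" by (simp add: sq_def)

lemma measurable_cnj [measurable]: "cnj \<in> Borel"
  by (intro borel_measurable_continuous_onI continuous_intros)

lemma n2_mono: "(\<And>x. norm (u x) \<le> norm (v x)) \<Longrightarrow> n2 u \<le> n2 v"
  unfolding n2_def by (intro nn_integral_mono ennreal_leI power_mono) auto

lemma n2_cong_AE: "AE x in lborel. norm (u x) = norm (v x) \<Longrightarrow> n2 u = n2 v"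
  unfolding n2_def by (intro nn_integral_cong_AE) (elim eventually_mono, simp)

lemma n2_add:
  assumes [measurable]: "u \<in> Borel" "v \<in> Borel"
  shows "n2 (\<lambda>x. u x + v x) \<le> 2 * (n2 u + n2 v)"
proof -
  have "(norm (u x + v x))\<^sup>2 \<le> 2 * ((norm (u x))\<^sup>2 + (norm (v x))\<^sup>2)" for x
  proof -
    have "(norm (u x + v x))\<^sup>2 \<le> (norm (u x) + norm (v x))\<^sup>2" by (intro power_mono norm_triangle_ineq) auto
    also have "\<dots> \<le> 2 * ((norm (u x))\<^sup>2 + (norm (v x))\<^sup>2)"
      using sum_squares_bound[of "norm (u x)" "norm (v x)"] by (simp add: power2_sum)
    finally show ?thesis .
  qed
  then have "n2 (\<lambda>x. u x + v x) \<le> (\<J> x. ennreal (2 * ((norm (u x))\<^sup>2 + (norm (v x))\<^sup>2)))"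
    unfolding n2_def by (intro nn_integral_mono ennreal_leI)
  also have "\<dots> = 2 * (n2 u + n2 v)"
    unfolding n2_def by (simp add: ennreal_mult nn_integral_cmult nn_integral_add)
  finally show ?thesis .
qed

lemma n2_diff:
  assumes "u \<in> Borel" "v \<in> Borel"
  shows "n2 (\<lambda>x. u x - v x) \<le> 2 * (n2 u + n2 v)"
  using n2_add[of u "\<lambda>x. - v x"] assms by (simp add: n2_def)

lemma n2_diff_commute: "n2 (\<lambda>x. u x - v x) = n2 (\<lambda>x. v x - u x)"
  by (simp add: n2_def norm_minus_commute)

lemma n2_cmult: "u \<in> Borel \<Longrightarrow> n2 (\<lambda>x. c * u x) = ennreal ((norm c)\<^sup>2) * n2 u"
  unfolding n2_def by (simp add: norm_mult power_mult_distrib ennreal_mult nn_integral_cmult)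

lemma ennreal_two_mult_add_less_top: "a < \<infinity> \<Longrightarrow> b < \<infinity> \<Longrightarrow> 2 * (a + b) < (\<infinity>::ennreal)"
  by (simp add: ennreal_mult_less_top)

lemma sq_add: "sq u \<Longrightarrow> sq v \<Longrightarrow> sq (\<lambda>x. u x + v x)"
  unfolding sq_def using n2_add[of u v] ennreal_two_mult_add_less_top[of "n2 u" "n2 v"] by (auto intro: order_le_less_trans)
lemma sq_diff: "sq u \<Longrightarrow> sq v \<Longrightarrow> sq (\<lambda>x. u x - v x)"
  unfolding sq_def using n2_diff[of u v] ennreal_two_mult_add_less_top[of "n2 u" "n2 v"] by (auto intro: order_le_less_trans)
lemma sq_cmult: "sq u \<Longrightarrow> sq (\<lambda>x. c * u x)"
  unfolding sq_def by (auto simp: n2_cmult ennreal_mult_less_top)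
lemma sq_bound: "sq v \<Longrightarrow> u \<in> Borel \<Longrightarrow> (\<And>x. norm (u x) \<le> norm (v x)) \<Longrightarrow> sq u"
  unfolding sq_def using n2_mono[of u v] by (auto intro: order_le_less_trans)

lemma n2_shift:
  assumes [measurable]: "u \<in> Borel"
  shows "n2 (\<lambda>x. u (x + t)) = n2 u" "n2 (\<lambda>x. u (x - t)) = n2 u" "n2 (\<lambda>x. u (- x)) = n2 u"
  unfolding n2_def using lborel_nn_integral_shift[of "\<lambda>x. ennreal ((norm (u x))\<^sup>2)"] by simp_all

lemma sq_shift: "sq u \<Longrightarrow> sq (\<lambda>x. u (x + t))" "sq u \<Longrightarrow> sq (\<lambda>x. u (x - t))" "sq u \<Longrightarrow> sq (\<lambda>x. u (- x))"
  unfolding sq_def by (auto simp: n2_shift)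

lemma sq_mult_bound:
  assumes u: "sq u" and v: "sq v"
  shows "(\<J> x. ennreal (norm (u x * v x)))\<^sup>2 \<le> n2 u * n2 v"
proof -
  have [measurable]: "u \<in> Borel" "v \<in> Borel" using u v by (auto simp: sq_def)
  show ?thesis
    using Cauchy_Schwarz_nn_integral[of "\<lambda>x. ennreal (norm (u x))" lborel "\<lambda>x. ennreal (norm (v x))"]
    by (simp add: n2_def norm_mult ennreal_mult ennreal_power)
qed

lemma sq_mult_integrable:
  assumes u: "sq u" and v: "sq v" shows "integrable lborel (\<lambda>x. u x * v x)"
proof (rule integrableI_bounded)
  have [measurable]: "u \<in> Borel" "v \<in> Borel" using u v by (auto simp: sq_def)
  show "(\<lambda>x. u x * v x) \<in> borel_measurable lborel" by measurable
  have "(\<J> x. ennreal (norm (u x * v x)))\<^sup>2 < \<infinity>"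
    using sq_mult_bound[OF u v] u v by (auto simp: sq_def ennreal_mult_less_top elim: order_le_less_trans)
  then show "(\<J> x. ennreal (norm (u x * v x))) < \<infinity>"
    by (simp add: power_less_top_ennreal)
qed

lemma sq_mult_norm_le:
  assumes u: "sq u" and v: "sq v" shows "ennreal ((norm (LINT x|lborel. u x * v x))\<^sup>2) \<le> n2 u * n2 v"
proof -
  have "ennreal (norm (LINT x|lborel. u x * v x)) \<le> (\<J> x. ennreal (norm (u x * v x)))"
    by (rule integral_norm_bound_ennreal[OF sq_mult_integrable[OF u v]])
  then have "(ennreal (norm (LINT x|lborel. u x * v x)))\<^sup>2 \<le> (\<J> x. ennreal (norm (u x * v x)))\<^sup>2"
    by (intro power_mono) auto
  also note sq_mult_bound[OF u v]
  finally show ?thesis by (simp add: ennreal_power)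
qed

lemma sq_inner_tendsto:
  assumes w: "\<And>n. sq (w n)" and u: "sq u" and v: "sq v" and lim: "(\<lambda>n. n2 (\<lambda>x. w n x - u x)) \<longlonglongrightarrow> 0"
  shows "(\<lambda>n. LINT x|lborel. w n x * v x) \<longlonglongrightarrow> (LINT x|lborel. u x * v x)"
proof -
  have eq: "(LINT x|lborel. w n x * v x) - (LINT x|lborel. u x * v x) = (LINT x|lborel. (w n x - u x) * v x)" for n
    using sq_mult_integrable[OF w v] sq_mult_integrable[OF u v] by (simp add: left_diff_distrib)
  have "(\<lambda>n. n2 v * n2 (\<lambda>x. w n x - u x)) \<longlonglongrightarrow> n2 v * 0"
    by (intro ennreal_tendsto_cmult lim) (use v in \<open>auto simp: sq_def\<close>)
  then have "(\<lambda>n. n2 (\<lambda>x. w n x - u x) * n2 v) \<longlonglongrightarrow> 0 * n2 v" by (simp add: mult.commute)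
  then have lim0: "(\<lambda>n. n2 (\<lambda>x. w n x - u x) * n2 v) \<longlonglongrightarrow> 0" by simp
  have le: "ennreal ((norm (LINT x|lborel. (w n x - u x) * v x))\<^sup>2) \<le> n2 (\<lambda>x. w n x - u x) * n2 v" for n
    by (rule sq_mult_norm_le[OF sq_diff[OF w u] v])
  have "(\<lambda>n. ennreal ((norm (LINT x|lborel. (w n x - u x) * v x))\<^sup>2)) \<longlonglongrightarrow> 0"
    by (rule tendsto_sandwich[OF _ _ tendsto_const lim0]) (simp_all add: le)
  then have "(\<lambda>n. ennreal ((norm (LINT x|lborel. (w n x - u x) * v x))\<^sup>2)) \<longlonglongrightarrow> ennreal 0" by simp
  then have "(\<lambda>n. (norm (LINT x|lborel. (w n x - u x) * v x))\<^sup>2) \<longlonglongrightarrow> 0"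
    by (subst (asm) tendsto_ennreal_iff) auto
  then have "(\<lambda>n. norm (LINT x|lborel. (w n x - u x) * v x)) \<longlonglongrightarrow> 0"
    using tendsto_real_sqrt[of "\<lambda>n. (norm (LINT x|lborel. (w n x - u x) * v x))\<^sup>2" 0] by simp
  then show ?thesis unfolding eq[symmetric] by (subst LIM_zero_iff[symmetric], subst tendsto_norm_zero_iff[symmetric])
qed

text \<open>Riesz-Fischer with a rate. Increments whose squares have integral at most
  \<open>(1/4) ^ n\<close> still have summable integrals after weighting by \<open>2 ^ n\<close>,
  and the weighted squares dominate the increments up to a geometric series.\<close>

lemma fast_cauchy_convergent:
  fixes u :: "nat \<Rightarrow> 'a::euclidean_space \<Rightarrow> complex"
  assumes [measurable]: "\<And>n. u n \<in> Borel"
    and fast: "\<And>n. n2 (\<lambda>x. u (Suc n) x - u n x) \<le> ennreal ((1/4) ^ n)"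
  shows "\<exists>g. g \<in> Borel \<and> (AE x in lborel. (\<lambda>n. u n x) \<longlonglongrightarrow> g x)"
proof -
  define D where "D n x = 2 ^ n * (norm (u (Suc n) x - u n x))\<^sup>2" for n x
  have [measurable]: "D n \<in> Borel" for n unfolding D_def by measurable
  have "(\<J> x. (\<Sum>n. ennreal (D n x))) = (\<Sum>n. \<J> x. ennreal (D n x))"
    by (rule nn_integral_suminf) auto
  also have "\<dots> \<le> (\<Sum>n. ennreal ((1/2) ^ n))"
  proof (intro suminf_le summableI)
    fix n
    have "(\<J> x. ennreal (D n x)) = ennreal (2 ^ n) * n2 (\<lambda>x. u (Suc n) x - u n x)"
      unfolding D_def n2_def by (simp add: ennreal_mult nn_integral_cmult)
    also have "\<dots> \<le> ennreal (2 ^ n) * ennreal ((1/4) ^ n)" by (intro mult_left_mono fast) auto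
    also have "\<dots> = ennreal ((1/2) ^ n)" by (simp add: ennreal_mult[symmetric] power_mult_distrib[symmetric])
    finally show "(\<J> x. ennreal (D n x)) \<le> ennreal ((1/2) ^ n)" .
  qed
  also have "\<dots> = ennreal (\<Sum>n. (1/2) ^ n)" by (rule suminf_ennreal2) auto
  also have "\<dots> < \<infinity>" by simp
  finally have "(\<J> x. (\<Sum>n. ennreal (D n x))) \<noteq> \<infinity>" by simp
  then have "AE x in lborel. (\<Sum>n. ennreal (D n x)) \<noteq> \<infinity>"
    by (intro nn_integral_PInf_AE) auto
  then have "AE x in lborel. convergent (\<lambda>n. u n x)"
  proof eventually_elim
    case (elim x)
    have "summable (\<lambda>n. D n x)" by (rule summable_suminf_not_top) (use elim in \<open>auto simp: D_def\<close>)
    then have "summable (\<lambda>n. (1/2) ^ n + D n x)" by (intro summable_add) auto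
    then have "summable (\<lambda>n. norm (u (Suc n) x - u n x))"
    proof (rule summable_comparison_test'[where N = 0])
      fix n
      define y where "y = norm (u (Suc n) x - u n x)"
      \<comment> \<open>Yields \<open>y \<le> (1/2) ^ n + 2 ^ n * y\<^sup>2\<close>, which trades
        the first power of the increment for its square.\<close>
      have "0 \<le> (1 - 2 ^ n * y)\<^sup>2" by simp
      then have "2 * (2 ^ n * y) \<le> 1 + (2 ^ n * y)\<^sup>2" by (simp add: power2_diff)
      moreover have "0 \<le> 2 ^ n * y" by (simp add: y_def)
      ultimately have "2 ^ n * y \<le> 1 + (2 ^ n * y)\<^sup>2" by linarith
      then have "2 ^ n * y \<le> 2 ^ n * ((1/2) ^ n + 2 ^ n * y\<^sup>2)"
        by (simp add: distrib_left power2_eq_square power_one_over mult_ac)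
      then have "y \<le> (1/2) ^ n + 2 ^ n * y\<^sup>2" by (rule mult_left_le_imp_le) simp
      then show "norm (norm (u (Suc n) x - u n x)) \<le> (1/2) ^ n + D n x" by (simp add: D_def y_def)
    qed
    then have "summable (\<lambda>n. u (Suc n) x - u n x)" by (rule summable_norm_cancel)
    then have "convergent (\<lambda>k. \<Sum>n<k. u (Suc n) x - u n x)" by (simp add: summable_iff_convergent)
    then have "convergent (\<lambda>k. u k x - u 0 x)" by (simp only: sum_lessThan_telescope[of "\<lambda>k. u k x"])
    then have "convergent (\<lambda>k. (u k x - u 0 x) + u 0 x)" by (intro convergent_add convergent_const)
    then show ?case by simp
  qed
  then show ?thesis
    by (intro exI[of _ "\<lambda>x. lim (\<lambda>n. u n x)"] conjI borel_measurable_lim_metric)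
       (auto simp: convergent_LIMSEQ_iff elim!: eventually_mono)
qed

lemma n2_fatou:
  assumes [measurable]: "\<And>n. u n \<in> Borel" "g \<in> Borel"
    and "AE x in lborel. (\<lambda>n. u n x) \<longlonglongrightarrow> g x" and "\<And>n. n \<ge> N \<Longrightarrow> n2 (u n) \<le> C"
  shows "n2 g \<le> C"
proof -
  have "n2 g = (\<J> x. liminf (\<lambda>n. ennreal ((norm (u n x))\<^sup>2)))"
    unfolding n2_def
  proof (intro nn_integral_cong_AE, use assms(3) in eventually_elim)
    case (elim x)
    have "(\<lambda>n. ennreal ((norm (u n x))\<^sup>2)) \<longlonglongrightarrow> ennreal ((norm (g x))\<^sup>2)" by (intro tendsto_intros elim)
    from lim_imp_Liminf[OF sequentially_bot this] show ?case by (rule sym)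
  qed
  also have "\<dots> \<le> liminf (\<lambda>n. n2 (u n))" unfolding n2_def by (rule nn_integral_liminf) auto
  also have "\<dots> \<le> C"
    by (rule Liminf_le) (auto simp: eventually_sequentially intro!: assms(4))
  finally show ?thesis .
qed

text \<open>The function is cut off outside large balls. Each truncation is integrable as a product
  of two L2 functions, and the exponent \<open>n + 2\<close> leaves room for the factor 4 that
  comparing two truncations costs in \<open>ft2_exists_le\<close>.\<close>

lemma n2_fast_approx:
  assumes u: "sq u"
  shows "\<exists>v. (\<forall>n. integrable lborel (v n) \<and> sq (v n) \<and> (\<forall>x. norm (v n x) \<le> norm (u x)) \<and> 
     n2 (\<lambda>x. u x - v n x) \<le> ennreal ((1/4) ^ (n + 2)))"
proof -
  have [measurable]: "u \<in> Borel" using u by (simp add: sq_def)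
  define w where "w R x = (if norm x \<le> real R then u x else 0)" for R x
  have [measurable]: "w R \<in> Borel" for R unfolding w_def by measurable
  have le: "norm (w R x) \<le> norm (u x)" for R x by (simp add: w_def)
  have lim: "(\<lambda>R. n2 (\<lambda>x. u x - w R x)) \<longlonglongrightarrow> n2 (\<lambda>x::'a. 0)"
    unfolding n2_def
  proof (rule nn_integral_dominated_convergence[where w = "\<lambda>x. ennreal ((norm (u x))\<^sup>2)"])
    show "AE x in lborel. (\<lambda>R. ennreal ((norm (u x - w R x))\<^sup>2)) \<longlonglongrightarrow> ennreal ((norm (0::complex))\<^sup>2)"
    proof (rule AE_I2, rule tendsto_eventually)
      fix x :: 'a
      obtain N where "norm x \<le> real N" using real_arch_simple by blast
      then have "norm x \<le> real n" if "n \<ge> N" for n using that by simp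
      then show "\<forall>\<^sub>F R in sequentially. ennreal ((norm (u x - w R x))\<^sup>2) = ennreal ((norm (0::complex))\<^sup>2)"
        unfolding eventually_sequentially w_def by auto
    qed
    show "AE x in lborel. ennreal ((norm (u x - w j x))\<^sup>2) \<le> ennreal ((norm (u x))\<^sup>2)" for j
      by (rule AE_I2) (simp add: w_def)
    show "(\<J> x. ennreal ((norm (u x))\<^sup>2)) < \<infinity>" using u by (simp add: sq_def n2_def)
  qed measurable
  have "\<exists>R. n2 (\<lambda>x. u x - w R x) \<le> ennreal ((1/4) ^ (n + 2))" for n
  proof -
    have "eventually (\<lambda>R. n2 (\<lambda>x. u x - w R x) < ennreal ((1/4) ^ (n + 2))) sequentially"
      by (rule order_tendstoD[OF lim]) (simp add: n2_def)
    then show ?thesis by (auto simp: eventually_sequentially intro: less_imp_le)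
  qed
  then have "\<exists>R. \<forall>n. n2 (\<lambda>x. u x - w (R n) x) \<le> ennreal ((1/4) ^ (n + 2))" by (intro choice allI)
  then obtain R where R: "\<And>n. n2 (\<lambda>x. u x - w (R n) x) \<le> ennreal ((1/4) ^ (n + 2))" by blast
  have sqw: "sq (w R)" for R by (rule sq_bound[OF u]) (auto simp: le)
  have "integrable lborel (w R)" for R
  proof -
    have eq: "(\<lambda>x. ennreal ((norm (indicator (cball (0::'a) R) x :: complex))\<^sup>2)) = indicator (cball 0 R)"
      by (auto simp: fun_eq_iff indicator_def)
    have b: "sq (\<lambda>x. indicator (cball (0::'a) R) x)"
      unfolding sq_def n2_def eq using emeasure_lborel_cball_finite[of "0::'a" "real R"]
      by (auto intro!: borel_measurable_indicator)
    have "(\<lambda>x. w R x * indicator (cball (0::'a) R) x) = w R" by (auto simp: w_def indicator_def)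
    then show ?thesis using sq_mult_integrable[OF sqw[of R] b] by simp
  qed
  then show ?thesis using R sqw le by (intro exI[of _ "\<lambda>n. w (R n)"]) auto
qed

text \<open>One half of Plancherel. With Gaussian damping, the multiplication formula rewrites the
  square integral of \<open>ft u\<close> as the double integral of \<open>u x * cnj (u y)\<close>
  against \<open>heat \<epsilon> (y - x)\<close>. Replacing \<open>norm (u x) * norm (u y)\<close>
  by half the sum of squares, and using mass 1 of the kernel in either variable, bounds it by
  \<open>n2 u\<close>; Fatou removes the damping.\<close>

lemma ft_contraction:
  assumes u: "integrable lborel u" and u2: "sq u"
  shows "n2 (ft u) \<le> n2 u"
proof -
  have [measurable]: "u \<in> Borel" using u by auto
  have main: "(\<J> \<xi>. ennreal (gauss (\<epsilon>\<^sup>2) \<xi> * (norm (ft u \<xi>))\<^sup>2)) \<le> n2 u" if e: "\<epsilon> > 0" for \<epsilon>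
  proof -
    have e2: "\<epsilon>\<^sup>2 > 0" using e by simp
    define M where "M = (LINT x|lborel. norm (u x))"
    define w where "w \<xi> = complex_of_real (gauss (\<epsilon>\<^sup>2) \<xi>) * cnj (ft u \<xi>)" for \<xi>
    have [measurable]: "w \<in> Borel" unfolding w_def by measurable
    have w: "integrable lborel w"
    proof (rule Bochner_Integration.integrable_bound)
      show "integrable lborel (\<lambda>x::'a. M * gauss (\<epsilon>\<^sup>2) x)" by (intro integrable_mult_right integrable_gauss e2)
      have "gauss (\<epsilon>\<^sup>2) x * norm (ft u x) \<le> \<bar>M * gauss (\<epsilon>\<^sup>2) x\<bar>" for x
        using mult_left_mono[OF ft_norm_le[of u x], of "gauss (\<epsilon>\<^sup>2) x"] by (simp add: M_def abs_mult mult.commute)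
      then show "AE x in lborel. norm (w x) \<le> norm (M * gauss (\<epsilon>\<^sup>2) x)"
        by (auto simp: w_def norm_mult)
    qed auto
    define hf :: real where "hf = 1/2"
    have hf: "hf \<ge> 0" "hf + hf = 1" by (auto simp: hf_def)
    \<comment> \<open>The conjugate reflection of \<open>u\<close> has transform
      \<open>cnj (ft u \<xi>)\<close>, so the multiplication formula also computes
      \<open>ft w\<close>.\<close>
    define u' where "u' y = cnj (u (- y))" for y
    have u': "integrable lborel u'" unfolding u'_def by (intro integrable_cnj lborel_integrable_shift u)
    have [measurable]: "u' \<in> Borel" unfolding u'_def by measurable
    have ftu': "ft u' \<xi> = cnj (ft u \<xi>)" for \<xi>
    proof -
      have "ft u' \<xi> = (LINT y|lborel. (\<lambda>y. cnj (ech (- (y \<bullet> \<xi>)) * u y)) (- y))"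
        unfolding ft_def u'_def by (simp add: cnj_ech)
      also have "\<dots> = (LINT y|lborel. cnj (ech (- (y \<bullet> \<xi>)) * u y))"
        by (rule lborel_integral_shift(4)[of "\<lambda>y. cnj (ech (- (y \<bullet> \<xi>)) * u y)"]) measurable
      also have "\<dots> = cnj (ft u \<xi>)" unfolding ft_def by (rule Bochner_Integration.integral_cnj)
      finally show ?thesis .
    qed
    have g: "integrable lborel (\<lambda>\<xi>. ech (- (\<xi> \<bullet> x)) * complex_of_real (gauss (\<epsilon>\<^sup>2) \<xi>))" for x :: 'a
      by (intro integrable_ech_mult fourier_gauss e2) auto
    have ftg: "ft (\<lambda>\<xi>. ech (- (\<xi> \<bullet> x)) * complex_of_real (gauss (\<epsilon>\<^sup>2) \<xi>)) y = heat \<epsilon> (- y - x)" for x y :: 'a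
      unfolding ft_def heat_Fourier[OF e, symmetric]
      by (simp add: mult.assoc[symmetric] ech_add[symmetric] inner_diff_right)
    have ftw: "ft w x = (LINT y|lborel. cnj (u y) * heat \<epsilon> (y - x))" for x
    proof -
      have "ft w x = (LINT \<xi>|lborel. ft u' \<xi> * (ech (- (\<xi> \<bullet> x)) * complex_of_real (gauss (\<epsilon>\<^sup>2) \<xi>)))"
        unfolding ft_def[of w] w_def ftu' by (simp add: mult_ac)
      also have "\<dots> = (LINT y|lborel. u' y * heat \<epsilon> (- y - x))"
        unfolding ft_multiplication(1)[OF u' g] ftg ..
      also have "\<dots> = (LINT y|lborel. (\<lambda>y. cnj (u y) * heat \<epsilon> (y - x)) (- y))" unfolding u'_def by simp
      also have "\<dots> = (LINT y|lborel. cnj (u y) * heat \<epsilon> (y - x))"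
        by (rule lborel_integral_shift(4)[of "\<lambda>y. cnj (u y) * complex_of_real (heat \<epsilon> (y - x))"]) measurable
      finally show ?thesis .
    qed
    have L: "ft u \<xi> * w \<xi> = complex_of_real (gauss (\<epsilon>\<^sup>2) \<xi> * (norm (ft u \<xi>))\<^sup>2)" for \<xi>
      unfolding w_def of_real_mult complex_norm_square by (rule mult.left_commute)
    have iu: "integrable lborel (\<lambda>x. u x * ft w x)"
      using ft_multiplication(2)[OF w u] by (simp add: mult.commute)
    have "(\<J> \<xi>. ennreal (gauss (\<epsilon>\<^sup>2) \<xi> * (norm (ft u \<xi>))\<^sup>2)) = 
        ennreal (LINT \<xi>|lborel. gauss (\<epsilon>\<^sup>2) \<xi> * (norm (ft u \<xi>))\<^sup>2)"
    proof (rule nn_integral_eq_integral)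
      show "integrable lborel (\<lambda>\<xi>. gauss (\<epsilon>\<^sup>2) \<xi> * (norm (ft u \<xi>))\<^sup>2)"
        using integrable_Re[OF ft_multiplication(2)[OF u w]] unfolding L by simp
    qed auto
    also have "(LINT \<xi>|lborel. gauss (\<epsilon>\<^sup>2) \<xi> * (norm (ft u \<xi>))\<^sup>2) = norm (LINT \<xi>|lborel. ft u \<xi> * w \<xi>)"
      unfolding L integral_complex_of_real norm_of_real by (simp add: integral_nonneg_AE)
    also have "(LINT \<xi>|lborel. ft u \<xi> * w \<xi>) = (LINT x|lborel. u x * ft w x)"
      by (rule ft_multiplication(1)[OF u w])
    also have "ennreal (norm (LINT x|lborel. u x * ft w x)) \<le> (\<J> x. ennreal (norm (u x * ft w x)))"
      by (rule integral_norm_bound_ennreal[OF iu])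
    also have "\<dots> \<le> (\<J> x. \<J> y. ennreal (norm (u x) * norm (u y) * heat \<epsilon> (y - x)))"
    proof (intro nn_integral_mono)
      fix x
      have hi: "integrable lborel (\<lambda>y. cnj (u y) * heat \<epsilon> (y - x))"
      proof (rule Bochner_Integration.integrable_bound)
        show "integrable lborel (\<lambda>y. u y * (1 / \<epsilon>) ^ DIM('a))" using u by simp
        have "gauss a (x::'a) \<le> 1" if "a > 0" for a x using that by (simp add: gauss_def)
        then have "heat \<epsilon> y \<le> (1 / \<epsilon>) ^ DIM('a)" for y :: 'a using e by (simp add: heat_def divide_simps)
        then show "AE y in lborel. norm (cnj (u y) * complex_of_real (heat \<epsilon> (y - x))) \<le> norm (u y * (1 / \<epsilon>) ^ DIM('a))"
          using e by (intro AE_I2) (auto simp: norm_mult norm_power norm_divide heat_nonneg abs_of_nonneg intro!: mult_left_mono)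
      qed auto
      have "ennreal (norm (u x * ft w x)) = ennreal (norm (u x)) * ennreal (norm (ft w x))"
        by (simp add: norm_mult ennreal_mult)
      also have "\<dots> \<le> ennreal (norm (u x)) * (\<J> y. ennreal (norm (cnj (u y) * heat \<epsilon> (y - x))))"
        unfolding ftw by (intro mult_left_mono integral_norm_bound_ennreal hi) auto
      also have "\<dots> = (\<J> y. ennreal (norm (u x) * norm (u y) * heat \<epsilon> (y - x)))"
        by (subst nn_integral_cmult[symmetric])
          (auto simp: norm_mult ennreal_mult'[symmetric] mult.assoc abs_of_nonneg[OF heat_nonneg[OF e]])
      finally show "ennreal (norm (u x * ft w x)) \<le> (\<J> y. ennreal (norm (u x) * norm (u y) * heat \<epsilon> (y - x)))" .
    qed
    also have "\<dots> \<le> (\<J> x. \<J> y. ennreal hf * (ennreal ((norm (u x))\<^sup>2) * ennreal (heat \<epsilon> (y - x)))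
         + ennreal hf * (ennreal ((norm (u y))\<^sup>2) * ennreal (heat \<epsilon> (y - x))))"
    proof (intro nn_integral_mono)
      fix x y
      have "norm (u x) * norm (u y) * heat \<epsilon> (y - x) \<le> ((norm (u x))\<^sup>2 / 2 + (norm (u y))\<^sup>2 / 2) * heat \<epsilon> (y - x)"
        using sum_squares_bound[of "norm (u x)" "norm (u y)"] by (intro mult_right_mono heat_nonneg e) simp
      also have "\<dots> = hf * ((norm (u x))\<^sup>2 * heat \<epsilon> (y - x)) + hf * ((norm (u y))\<^sup>2 * heat \<epsilon> (y - x))"
        by (simp add: hf_def algebra_simps)
      finally have "ennreal (norm (u x) * norm (u y) * heat \<epsilon> (y - x)) \<le> ennreal \<dots>" by (rule ennreal_leI)
      also have "\<dots> = ennreal hf * (ennreal ((norm (u x))\<^sup>2) * ennreal (heat \<epsilon> (y - x)))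
         + ennreal hf * (ennreal ((norm (u y))\<^sup>2) * ennreal (heat \<epsilon> (y - x)))"
        using heat_nonneg[OF e, of "y - x"] hf by (simp add: ennreal_mult)
      finally show "ennreal (norm (u x) * norm (u y) * heat \<epsilon> (y - x)) \<le> \<dots>" .
    qed
    also have "\<dots> = ennreal hf * (\<J> x. \<J> y. (ennreal ((norm (u x))\<^sup>2) * ennreal (heat \<epsilon> (y - x))))
         + ennreal hf * (\<J> x. \<J> y. (ennreal ((norm (u y))\<^sup>2) * ennreal (heat \<epsilon> (y - x))))"
      by (simp add: nn_integral_add nn_integral_cmult)
    also have "(\<J> x. \<J> y. (ennreal ((norm (u y))\<^sup>2) * ennreal (heat \<epsilon> (y - x))))
       = (\<J> y. \<J> x. (ennreal ((norm (u y))\<^sup>2) * ennreal (heat \<epsilon> (y - x))))"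
      by (rule lborel_pair.Fubini') measurable
    also have "(\<lambda>y. \<J> x. (ennreal ((norm (u y))\<^sup>2) * ennreal (heat \<epsilon> (y - x)))) = (\<lambda>y. ennreal ((norm (u y))\<^sup>2))"
      using lborel_nn_integral_shift(3)[of "\<lambda>x::'a. ennreal (heat \<epsilon> x)"]
      by (simp add: nn_integral_cmult nn_integral_heat[OF e])
    also have "(\<lambda>x. \<J> y. (ennreal ((norm (u x))\<^sup>2) * ennreal (heat \<epsilon> (y - x)))) = (\<lambda>y. ennreal ((norm (u y))\<^sup>2))"
      using lborel_nn_integral_shift(2)[of "\<lambda>x::'a. ennreal (heat \<epsilon> x)"]
      by (simp add: nn_integral_cmult nn_integral_heat[OF e])
    also have "ennreal hf * (\<J> y. ennreal ((norm (u y))\<^sup>2)) + ennreal hf * (\<J> y. ennreal ((norm (u y))\<^sup>2)) = n2 u"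
      unfolding n2_def[symmetric] distrib_right[symmetric] using hf by (simp add: ennreal_plus[symmetric] del: ennreal_plus)
    finally show ?thesis .
  qed
  let ?G = "\<lambda>n \<xi>. complex_of_real (sqrt (gauss ((1 / real (Suc n))\<^sup>2) \<xi>)) * ft u \<xi>"
  show ?thesis
  proof (rule n2_fatou[where u = ?G and N = 0])
    show "AE \<xi> in lborel. (\<lambda>n. ?G n \<xi>) \<longlonglongrightarrow> ft u \<xi>"
    proof (intro always_eventually allI)
      fix \<xi> :: 'a
      have "(\<lambda>n. complex_of_real (sqrt (exp (- pi * (1 / real (Suc n))\<^sup>2 * (norm \<xi>)\<^sup>2))) * ft u \<xi>) \<longlonglongrightarrow>
          complex_of_real (sqrt (exp (- pi * 0\<^sup>2 * (norm \<xi>)\<^sup>2))) * ft u \<xi>"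
        by (intro tendsto_intros LIMSEQ_Suc[OF lim_1_over_n])
      then show "(\<lambda>n. ?G n \<xi>) \<longlonglongrightarrow> ft u \<xi>" by (simp add: gauss_def)
    qed
    show "n2 (?G n) \<le> n2 u" for n
      using main[of "1 / real (Suc n)"] unfolding n2_def[of "?G n"] by (simp add: norm_mult power_mult_distrib)
  qed auto
qed

subsection \<open>The Fourier transform on square-integrable functions\<close>

lemma ft_integrable_uminus: "ft (\<lambda>x. u (- x)) \<xi> = ft u (- \<xi>)" if [measurable]: "u \<in> Borel"
proof -
  have "ft (\<lambda>x. u (- x)) \<xi> = (LINT x|lborel. (\<lambda>x. ech (x \<bullet> \<xi>) * u x) (- x))"
    unfolding ft_def by simp
  also have "\<dots> = (LINT x|lborel. ech (x \<bullet> \<xi>) * u x)"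
    by (rule lborel_integral_shift(4)[of "\<lambda>x. ech (x \<bullet> \<xi>) * u x"]) measurable
  finally show ?thesis by (simp add: ft_def)
qed

lemma ft_shift: "ft (\<lambda>x. u (x - t)) \<xi> = ech (- (t \<bullet> \<xi>)) * ft u \<xi>" if [measurable]: "u \<in> Borel"
proof -
  have "ft (\<lambda>x. u (x - t)) \<xi> = (LINT x|lborel. (\<lambda>x. ech (- ((x + t) \<bullet> \<xi>)) * u x) (x - t))"
    unfolding ft_def by simp
  also have "\<dots> = (LINT x|lborel. ech (- ((x + t) \<bullet> \<xi>)) * u x)"
    by (rule lborel_integral_shift(2)[of "\<lambda>x. ech (- ((x + t) \<bullet> \<xi>)) * u x"]) measurable
  also have "\<dots> = (LINT x|lborel. ech (- (t \<bullet> \<xi>)) * (ech (- (x \<bullet> \<xi>)) * u x))"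
    by (simp add: inner_add_left ech_add[symmetric] mult.assoc[symmetric] add.commute)
  finally show ?thesis by (simp add: ft_def)
qed

lemma ft_modulate: "ft (\<lambda>x. ech (- (t \<bullet> x)) * u x) \<xi> = ft u (\<xi> + t)"
  unfolding ft_def by (simp add: inner_add_right inner_commute[of t] mult.assoc[symmetric] ech_add[symmetric])

text \<open>Gaussian test functions: two tempered functions with equal integrals against all \<open>gam w\<close> agree.\<close>
definition gam :: "'a::euclidean_space \<Rightarrow> 'a \<Rightarrow> complex" where
  "gam w x = ech (w \<bullet> x) * complex_of_real (gauss 1 x)"
definition tau :: "'a::euclidean_space \<Rightarrow> 'a \<Rightarrow> complex" where
  "tau w x = complex_of_real (gauss 1 (x - w))"

lemma integrable_gam: "integrable lborel (gam w)" unfolding gam_def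
  by (intro integrable_ech_mult fourier_gauss) auto
lemma integrable_tau: "integrable lborel (tau w)" unfolding tau_def by (rule gauss_shift_integrable) simp

lemma sq_gauss: assumes "a > 0" shows "sq (\<lambda>x::'a::euclidean_space. complex_of_real (gauss a x))"
proof -
  have *: "(gauss a x)\<^sup>2 = gauss (2 * a) x" for x :: 'a
    by (simp add: gauss_def power2_eq_square exp_add[symmetric])
  have "(\<lambda>x::'a. complex_of_real (gauss a x)) \<in> Borel" by measurable
  then show ?thesis unfolding sq_def n2_def using assms by (simp add: * nn_integral_gauss)
qed

lemma sq_gam: "sq (gam w)"
  by (rule sq_bound[OF sq_gauss[of 1]]) (use borel_measurable_integrable[OF integrable_gam[of w]] in \<open>auto simp: gam_def norm_mult\<close>)
lemma sq_tau: "sq (tau w)" unfolding tau_def using sq_shift(2)[OF sq_gauss[of 1], of w] by simp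

text \<open>Together with \<open>ft_tau\<close> this makes the transform exchange the two Gaussian
  families: every identity tested on \<open>gam\<close> turns into one tested on \<open>tau\<close>,
  and back.\<close>

lemma ft_gam: "ft (gam w) = tau w"
proof
  fix \<xi> :: 'a
  have "ft (gam w) \<xi> = (LINT x|lborel. ech (x \<bullet> (w - \<xi>)) * complex_of_real (gauss 1 x))"
    unfolding ft_def gam_def by (simp add: inner_diff_right inner_commute[of w] mult.assoc[symmetric] ech_add[symmetric])
  also have "\<dots> = gauss 1 (w - \<xi>)" by (subst fourier_gauss(2)) auto
  also have "gauss 1 (w - \<xi>) = gauss 1 (\<xi> - w)" by (metis gauss_minus minus_diff_eq)
  finally show "ft (gam w) \<xi> = tau w \<xi>" by (simp add: tau_def)
qed

lemma ft_tau: "ft (tau w) = gam (- w)"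
proof
  fix \<xi> :: 'a
  have "ft (tau w) \<xi> = ech (- (w \<bullet> \<xi>)) * ft (\<lambda>x. complex_of_real (gauss 1 x)) \<xi>"
    unfolding tau_def by (rule ft_shift) measurable
  also have "ft (\<lambda>x. complex_of_real (gauss 1 x)) \<xi> = gauss 1 (- \<xi>)"
    using fourier_gauss(2)[of 1 "- \<xi>"] by (simp add: ft_def)
  finally show "ft (tau w) \<xi> = gam (- w) \<xi>" by (simp add: gam_def)
qed

text \<open>The integrals against \<open>gam w\<close> are the values of the Fourier transform of
  \<open>v\<close> times a Gaussian, so injectivity on L1 applies. Integrability is asked only after
  multiplication by the Gaussian, which admits functions of all Lebesgue spaces.\<close>

lemma gam_test_zero:
  assumes v: "integrable lborel (\<lambda>x. v x * complex_of_real (gauss 1 x))"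
    and 0: "\<And>w. (LINT x|lborel. v x * gam w x) = 0"
  shows "AE x in lborel. v x = 0"
proof -
  have "AE x in lborel. v x * complex_of_real (gauss 1 x) = 0"
  proof (rule L1_fourier_injective[OF v])
    fix \<xi>
    show "ft (\<lambda>x. v x * complex_of_real (gauss 1 x)) \<xi> = 0"
      using 0[of "- \<xi>"] by (simp add: ft_def gam_def inner_commute mult_ac)
  qed
  then show ?thesis by eventually_elim (simp add: gauss_def)
qed

lemma gam_test_unique:
  assumes u: "integrable lborel (\<lambda>x. u x * complex_of_real (gauss 1 x))"
    and v: "integrable lborel (\<lambda>x. v x * complex_of_real (gauss 1 x))"
    and eq: "\<And>w. (LINT x|lborel. u x * gam w x) = (LINT x|lborel. v x * gam w x)"
  shows "AE x in lborel. u x = v x"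
proof -
  have i: "integrable lborel (\<lambda>x. u x * gam w x)" 
    if u: "integrable lborel (\<lambda>x. u x * complex_of_real (gauss 1 x))" for u w
    using integrable_ech_mult[OF u, of "\<lambda>x. w \<bullet> x"] by (simp add: gam_def mult_ac)
  have "AE x in lborel. u x - v x = 0"
  proof (rule gam_test_zero)
    show "integrable lborel (\<lambda>x. (u x - v x) * complex_of_real (gauss 1 x))"
      using Bochner_Integration.integrable_diff[OF u v] by (simp add: left_diff_distrib)
    show "(LINT x|lborel. (u x - v x) * gam w x) = 0" for w
      using eq[of w] Bochner_Integration.integral_diff[OF i[OF u, of w] i[OF v, of w]] by (simp add: left_diff_distrib)
  qed
  then show ?thesis by eventually_elim simp
qed

text \<open>Plancherel pairs, by duality, so that no choice of a representative is involved.\<close>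
definition ft2 :: "('a::euclidean_space \<Rightarrow> complex) \<Rightarrow> ('a \<Rightarrow> complex) \<Rightarrow> bool" where
  "ft2 u g \<longleftrightarrow> sq u \<and> sq g \<and>
    (\<forall>\<phi>. integrable lborel \<phi> \<longrightarrow> sq \<phi> \<longrightarrow> (LINT x|lborel. u x * ft \<phi> x) = (LINT x|lborel. g x * \<phi> x))"

lemma ft2_sq: "ft2 u g \<Longrightarrow> sq u" "ft2 u g \<Longrightarrow> sq g" by (auto simp: ft2_def)
lemma ft2D: "ft2 u g \<Longrightarrow> integrable lborel \<phi> \<Longrightarrow> sq \<phi> \<Longrightarrow> (LINT x|lborel. u x * ft \<phi> x) = (LINT x|lborel. g x * \<phi> x)"
  by (auto simp: ft2_def)

lemma sq_ft: "integrable lborel \<phi> \<Longrightarrow> sq \<phi> \<Longrightarrow> sq (ft \<phi>)"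
  using ft_contraction[of \<phi>] by (auto simp: sq_def elim: order_le_less_trans)

lemma ft2_ft: "integrable lborel u \<Longrightarrow> sq u \<Longrightarrow> ft2 u (ft u)"
  unfolding ft2_def using ft_multiplication(1) sq_ft by metis

lemma sq_gauss_integrable: "sq u \<Longrightarrow> integrable lborel (\<lambda>x. u x * complex_of_real (gauss 1 x))"
  by (intro sq_mult_integrable sq_gauss) auto

lemma sq_gam_unique:
  "sq u \<Longrightarrow> sq v \<Longrightarrow> (\<And>w. (LINT x|lborel. u x * gam w x) = (LINT x|lborel. v x * gam w x)) \<Longrightarrow> AE x in lborel. u x = v x"
  by (rule gam_test_unique) (auto intro: sq_gauss_integrable)

lemma ft2_unique:
  assumes "ft2 u g" "ft2 u h" shows "AE x in lborel. g x = h x"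
  by (rule sq_gam_unique) (use assms ft2D[OF _ integrable_gam sq_gam] ft2_sq in metis)+

text \<open>By contraction the transforms of the truncations of \<open>u\<close> form a fast Cauchy
  sequence in L2. Its pointwise limit \<open>g\<close> inherits the norm bound by Fatou, and the
  multiplication formula for the truncations passes to the limit on both sides.\<close>

lemma ft2_exists_le:
  assumes u: "sq u" shows "\<exists>g. ft2 u g \<and> n2 g \<le> n2 u"
proof -
  obtain v where v1: "\<And>n. integrable lborel (v n)" and v2: "\<And>n. sq (v n)" and vle: "\<And>n x. norm (v n x) \<le> norm (u x)"
    and vn: "\<And>n. n2 (\<lambda>x. u x - v n x) \<le> ennreal ((1/4) ^ (n + 2))"
    using n2_fast_approx[OF u] by metis
  have mu [measurable]: "u \<in> Borel" "v n \<in> Borel" for n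
    using u v2[of n] by (auto simp: sq_def)
  have vv: "n2 (\<lambda>x. ft (v m) x - ft (v n) x) \<le> ennreal ((1/4) ^ n)" if "m \<ge> n" for m n
  proof -
    have "n2 (\<lambda>x. ft (v m) x - ft (v n) x) = n2 (ft (\<lambda>x. v m x - v n x))"
      by (intro arg_cong[where f = n2] ext)
        (simp add: ft_def right_diff_distrib Bochner_Integration.integral_diff integrable_ech_mult v1)
    also have "\<dots> \<le> n2 (\<lambda>x. v m x - v n x)"
      by (intro ft_contraction Bochner_Integration.integrable_diff v1 sq_diff v2)
    also have "\<dots> = n2 (\<lambda>x. (u x - v n x) - (u x - v m x))" by simp
    also have "\<dots> \<le> 2 * (n2 (\<lambda>x. u x - v n x) + n2 (\<lambda>x. u x - v m x))" by (intro n2_diff) measurable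
    also have "\<dots> \<le> 2 * (ennreal ((1/4) ^ (n + 2)) + ennreal ((1/4) ^ (n + 2)))"
    proof (intro mult_left_mono add_mono vn order_trans[OF vn])
      show "ennreal ((1/4) ^ (m + 2)) \<le> ennreal ((1/4) ^ (n + 2))"
        using that by (intro ennreal_leI power_decreasing) auto
    qed auto
    also have "\<dots> = ennreal (2 * ((1/4) ^ (n + 2) + (1/4) ^ (n + 2)))"
    proof -
      have "2 * (ennreal c + ennreal c) = ennreal (2 * (c + c))" if "c \<ge> 0" for c
      proof -
        have "ennreal (2 * (c + c)) = ennreal 2 * ennreal (c + c)" using that by (intro ennreal_mult) auto
        moreover have "ennreal (c + c) = ennreal c + ennreal c" using that by (intro ennreal_plus)
        ultimately show ?thesis by (simp only: ennreal_numeral)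
      qed
      then show ?thesis by simp
    qed
    also have "\<dots> \<le> ennreal ((1/4) ^ n)" by (intro ennreal_leI) simp
    finally show ?thesis .
  qed
  have "\<exists>g. g \<in> Borel \<and> (AE x in lborel. (\<lambda>n. ft (v n) x) \<longlonglongrightarrow> g x)"
  proof (rule fast_cauchy_convergent)
    show "ft (v n) \<in> Borel" for n by measurable
    show "n2 (\<lambda>x. ft (v (Suc n)) x - ft (v n) x) \<le> ennreal ((1/4) ^ n)" for n by (rule vv) simp
  qed
  then obtain g where [measurable]: "g \<in> Borel" and g: "AE x in lborel. (\<lambda>n. ft (v n) x) \<longlonglongrightarrow> g x"
    by blast
  have gu: "n2 g \<le> n2 u"
  proof (rule n2_fatou[OF _ _ g])
    show "n2 (ft (v n)) \<le> n2 u" for n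
      by (rule order_trans[OF ft_contraction[OF v1 v2] n2_mono[OF vle]])
  qed measurable
  have sg: "sq g" using gu u by (auto simp: sq_def elim: order_le_less_trans)
  have gn: "n2 (\<lambda>x. ft (v n) x - g x) \<le> ennreal ((1/4) ^ n)" for n
    unfolding n2_diff_commute[of "ft (v n)"]
  proof (rule n2_fatou[where u = "\<lambda>m x. ft (v m) x - ft (v n) x" and N = n])
    show "AE x in lborel. (\<lambda>m. ft (v m) x - ft (v n) x) \<longlonglongrightarrow> g x - ft (v n) x"
      using g by eventually_elim (intro tendsto_intros)
    show "n2 (\<lambda>x. ft (v m) x - ft (v n) x) \<le> ennreal ((1/4) ^ n)" if "m \<ge> n" for m by (rule vv[OF that])
  qed measurable
  have lim: "(\<lambda>n. ennreal ((1/4) ^ (n + k))) \<longlonglongrightarrow> 0" for k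
  proof -
    have "(\<lambda>n. (1/4::real) ^ (n + k)) \<longlonglongrightarrow> 0"
      by (intro LIMSEQ_ignore_initial_segment LIMSEQ_power_zero) simp
    from tendsto_ennrealI[OF this] show ?thesis by simp
  qed
  have "ft2 u g" unfolding ft2_def
  proof (intro conjI allI impI u sg)
    fix \<phi> :: "'a \<Rightarrow> complex" assume \<phi>: "integrable lborel \<phi>" "sq \<phi>"
    have "(\<lambda>n. n2 (\<lambda>x. ft (v n) x - g x)) \<longlonglongrightarrow> 0"
      by (rule tendsto_sandwich[OF _ _ tendsto_const lim[of 0]]) (simp_all add: gn)
    then have 1: "(\<lambda>n. LINT x|lborel. ft (v n) x * \<phi> x) \<longlonglongrightarrow> (LINT x|lborel. g x * \<phi> x)"
      by (intro sq_inner_tendsto sq_ft v1 v2 sg \<phi>)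
    have "(\<lambda>n. n2 (\<lambda>x. v n x - u x)) \<longlonglongrightarrow> 0"
      unfolding n2_diff_commute[of _ u]
      by (rule tendsto_sandwich[OF _ _ tendsto_const lim[of 2]]) (simp_all only: vn eventually_sequentially zero_le, auto)
    then have 2: "(\<lambda>n. LINT x|lborel. v n x * ft \<phi> x) \<longlonglongrightarrow> (LINT x|lborel. u x * ft \<phi> x)"
      by (intro sq_inner_tendsto v2 u sq_ft \<phi>)
    show "(LINT x|lborel. u x * ft \<phi> x) = (LINT x|lborel. g x * \<phi> x)"
      using LIMSEQ_unique[OF 2] 1 unfolding ft_multiplication(1)[OF v1 \<phi>(1)] by blast
  qed
  with gu show ?thesis by blast
qed

lemma ft2_exists: "sq u \<Longrightarrow> \<exists>g. ft2 u g" using ft2_exists_le by blast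

lemma ft2_n2_le: "ft2 u g \<Longrightarrow> n2 g \<le> n2 u"
  using ft2_exists_le[of u] ft2_unique[of u g] n2_cong_AE[of g] ft2_sq(1) by (metis (mono_tags, lifting) eventually_mono)

lemma ft2_reflect:
  assumes "ft2 u g" shows "ft2 (\<lambda>x. u (- x)) (\<lambda>x. g (- x))"
  unfolding ft2_def
proof (intro conjI allI impI)
  show "sq (\<lambda>x. u (- x))" "sq (\<lambda>x. g (- x))" using assms by (auto intro: sq_shift ft2_sq)
  have [measurable]: "u \<in> Borel" "g \<in> Borel" using ft2_sq[OF assms] by (auto simp: sq_def)
  fix \<phi> :: "'a \<Rightarrow> complex" assume \<phi>: "integrable lborel \<phi>" "sq \<phi>"
  then have [measurable]: "\<phi> \<in> Borel" by (simp add: sq_def)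
  have "(LINT x|lborel. u (- x) * ft \<phi> x) = (LINT x|lborel. u x * ft \<phi> (- x))"
    using lborel_integral_shift(4)[of "\<lambda>x. u x * ft \<phi> (- x)"] by simp
  also have "\<dots> = (LINT x|lborel. g x * \<phi> (- x))"
    using ft2D[OF assms lborel_integrable_shift(4)[OF \<phi>(1)] sq_shift(3)[OF \<phi>(2)]] by (simp add: ft_integrable_uminus)
  also have "\<dots> = (LINT x|lborel. g (- x) * \<phi> x)"
    using lborel_integral_shift(4)[of "\<lambda>x. g x * \<phi> (- x)"] by simp
  finally show "(LINT x|lborel. u (- x) * ft \<phi> x) = (LINT x|lborel. g (- x) * \<phi> x)" .
qed

lemma ft2_shift:
  assumes "ft2 u g" shows "ft2 (\<lambda>x. u (x - t)) (\<lambda>\<xi>. ech (- (t \<bullet> \<xi>)) * g \<xi>)"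
  unfolding ft2_def
proof (intro conjI allI impI)
  have [measurable]: "u \<in> Borel" "g \<in> Borel" using ft2_sq[OF assms] by (auto simp: sq_def)
  show "sq (\<lambda>x. u (x - t))" using assms by (auto intro: sq_shift ft2_sq)
  show "sq (\<lambda>\<xi>. ech (- (t \<bullet> \<xi>)) * g \<xi>)" by (rule sq_bound[OF ft2_sq(2)[OF assms]]) (auto simp: norm_mult)
  fix \<phi> :: "'a \<Rightarrow> complex" assume \<phi>: "integrable lborel \<phi>" "sq \<phi>"
  then have [measurable]: "\<phi> \<in> Borel" by (simp add: sq_def)
  have "(LINT x|lborel. u (x - t) * ft \<phi> x) = (LINT x|lborel. u x * ft \<phi> (x + t))"
    using lborel_integral_shift(2)[of "\<lambda>x. u x * ft \<phi> (x + t)" t] by simp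
  also have "\<dots> = (LINT x|lborel. g x * (ech (- (t \<bullet> x)) * \<phi> x))"
    unfolding ft_modulate[symmetric]
    by (rule ft2D[OF assms]) (intro integrable_ech_mult \<phi>, simp, rule sq_bound[OF \<phi>(2)], auto simp: norm_mult)
  finally show "(LINT x|lborel. u (x - t) * ft \<phi> x) = (LINT x|lborel. ech (- (t \<bullet> x)) * g x * \<phi> x)"
    by (simp add: mult_ac)
qed

text \<open>Fourier inversion. The transform \<open>h\<close> of \<open>g\<close> is tested on
  \<open>gam w\<close>: duality moves this to \<open>g\<close> against \<open>tau w\<close>, a
  second use to \<open>u\<close> against \<open>gam (- w)\<close>, and a change of sign to the
  reflected \<open>u\<close> against \<open>gam w\<close>.\<close>

lemma ft2_swap:
  assumes "ft2 u g" shows "ft2 g (\<lambda>x. u (- x))"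
proof -
  obtain h where h: "ft2 g h" using ft2_exists ft2_sq(2)[OF assms] by blast
  have [measurable]: "u \<in> Borel" using ft2_sq[OF assms] by (auto simp: sq_def)
  have "AE x in lborel. h x = u (- x)"
  proof (rule sq_gam_unique)
    show "sq h" "sq (\<lambda>x. u (- x))" using h assms by (auto intro: sq_shift ft2_sq)
    fix w
    have "(LINT x|lborel. h x * gam w x) = (LINT x|lborel. g x * tau w x)"
      using ft2D[OF h integrable_gam sq_gam, of w] by (simp add: ft_gam)
    also have "\<dots> = (LINT x|lborel. u x * gam (- w) x)"
      using ft2D[OF assms integrable_tau sq_tau, of w] by (simp add: ft_tau)
    also have "\<dots> = (LINT x|lborel. u (- x) * gam w x)"
      using lborel_integral_shift(4)[of "\<lambda>x. u (- x) * gam w x"] integrable_gam[of w] by (simp add: gam_def)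
    finally show "(LINT x|lborel. h x * gam w x) = (LINT x|lborel. u (- x) * gam w x)" .
  qed
  then have "(LINT x|lborel. h x * \<phi> x) = (LINT x|lborel. u (- x) * \<phi> x)" if "sq \<phi>" for \<phi>
    using that ft2_sq(2)[OF h] by (intro integral_cong_AE) (auto simp: sq_def)
  with h show ?thesis unfolding ft2_def using assms by (auto intro: sq_shift ft2_sq)
qed

text \<open>Plancherel: the contraction applied to a pair and to the swapped pair gives both
  inequalities.\<close>

lemma ft2_n2: "ft2 u g \<Longrightarrow> n2 g = n2 u"
  using ft2_n2_le[of u g] ft2_n2_le[OF ft2_swap[of u g]] n2_shift(3)[of u] ft2_sq(1)[of u g]
  by (auto simp: sq_def)

lemma ft2_inverse_exists: 
  assumes "sq g" shows "\<exists>u. ft2 u g"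
proof -
  obtain h where "ft2 g h" using ft2_exists assms by blast
  then have "ft2 (\<lambda>x. h (- x)) g" using ft2_reflect[OF ft2_swap] by fastforce
  then show ?thesis by blast
qed

lemma ft2_add:
  assumes "ft2 u g" "ft2 v h" shows "ft2 (\<lambda>x. u x + v x) (\<lambda>x. g x + h x)"
  unfolding ft2_def
proof (intro conjI allI impI)
  fix \<phi> :: "'a \<Rightarrow> complex" assume \<phi>: "integrable lborel \<phi>" "sq \<phi>"
  show "(LINT x|lborel. (u x + v x) * ft \<phi> x) = (LINT x|lborel. (g x + h x) * \<phi> x)"
    using sq_mult_integrable[OF ft2_sq(1) sq_ft[OF \<phi>]] sq_mult_integrable[OF ft2_sq(2) \<phi>(2)]
      ft2D[OF assms(1) \<phi>] ft2D[OF assms(2) \<phi>] assms by (simp add: distrib_right)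
qed (use assms in \<open>auto intro: sq_add ft2_sq\<close>)

lemma ft2_cmult:
  assumes "ft2 u g" shows "ft2 (\<lambda>x. c * u x) (\<lambda>x. c * g x)"
  using assms unfolding ft2_def by (auto intro: sq_cmult simp: mult.assoc)

lemma ft2_diff:
  assumes "ft2 u g" "ft2 v h" shows "ft2 (\<lambda>x. u x - v x) (\<lambda>x. g x - h x)"
  using ft2_add[OF assms(1) ft2_cmult[OF assms(2), of "-1"]] by simp

lemma ft2_cong_AE:
  assumes "ft2 u g" and "AE x in lborel. u x = u' x" "AE x in lborel. g x = g' x"
    and [measurable]: "u' \<in> Borel" "g' \<in> Borel"
  shows "ft2 u' g'"
proof -
  have sq: "sq u" "sq g" by (rule ft2_sq[OF assms(1)])+
  have "n2 u' = n2 u" "n2 g' = n2 g" using assms(2,3) by (auto intro!: n2_cong_AE elim: eventually_mono)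
  then have sq': "sq u'" "sq g'" using sq by (auto simp: sq_def)
  have "(LINT x|lborel. u' x * \<phi> x) = (LINT x|lborel. u x * \<phi> x)" "(LINT x|lborel. g' x * \<phi> x) = (LINT x|lborel. g x * \<phi> x)"
    if "sq \<phi>" for \<phi>
    using that sq sq' assms(2,3) by (auto intro!: integral_cong_AE simp: sq_def elim: eventually_mono)
  then show ?thesis using sq' assms(1) sq_ft unfolding ft2_def by metis
qed

lemma ft2_unique_inverse:
  assumes "ft2 u g" "ft2 v g" shows "AE x in lborel. u x = v x"
  using AE_lborel_shifts(4)[OF ft2_unique[OF ft2_swap[OF assms(1)] ft2_swap[OF assms(2)]]] by simp

text \<open>A transform \<open>h\<close> of \<open>u\<close> exists, and it has the same integrals
  against all \<open>gam w\<close> as \<open>g\<close>; these determine a function in L2.\<close>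

lemma ft2_gam_test:
  assumes "sq u" "sq g" "\<And>w. (LINT x|lborel. u x * tau w x) = (LINT x|lborel. g x * gam w x)"
  shows "ft2 u g"
proof -
  obtain h where h: "ft2 u h" using ft2_exists assms by blast
  have "AE x in lborel. h x = g x"
    by (rule sq_gam_unique[OF ft2_sq(2)[OF h] assms(2)])
       (use ft2D[OF h integrable_gam sq_gam] assms(3) in \<open>simp add: ft_gam\<close>)
  then show ?thesis by (intro ft2_cong_AE[OF h]) (use assms in \<open>auto simp: sq_def\<close>)
qed

lemma ft2_inverse_ft:
  assumes "integrable lborel g" "sq g" shows "ft2 (\<lambda>x. ft g (- x)) g"
  using ft2_reflect[OF ft2_swap[OF ft2_ft[OF assms]]] by simp

subsection \<open>The Riesz rearrangement inequality on the line and in space\<close>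

lemma lborel_swap:
  fixes f :: "'a::euclidean_space \<Rightarrow> 'b::euclidean_space \<Rightarrow> ennreal"
  assumes "(\<lambda>(x, y). f x y) \<in> borel_measurable (lborel \<Otimes>\<^sub>M lborel)"
  shows "(\<J> x. \<J> y. f x y) = (\<J> y. \<J> x. f x y)"
  using lborel_pair.Fubini'[OF assms] by simp

text \<open>Fubini along an arbitrary direction, with a slab of unit thickness in the role of the
  hyperplane orthogonal to \<open>e\<close>: for each \<open>x\<close> the \<open>t\<close> with
  \<open>x - t *\<^sub>R e\<close> in the slab form an interval of length exactly 1.\<close>

lemma slab_fubini:
  fixes F :: "'a::euclidean_space \<Rightarrow> ennreal"
  assumes [measurable]: "F \<in> Borel" and e: "norm e = 1"
  shows "(\<J> x. F x) = (\<J> x. \<J> t. indicator {x. 0 \<le> x \<bullet> e \<and> x \<bullet> e < 1} x * F (x + t *\<^sub>R e))"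
proof -
  let ?S = "{x::'a. 0 \<le> x \<bullet> e \<and> x \<bullet> e < 1}"
  have [measurable]: "?S \<in> sets borel" by measurable
  have "(\<J> x. \<J> t. indicator ?S x * F (x + t *\<^sub>R e)) =
     (\<J> t. \<J> x. indicator ?S x * F (x + t *\<^sub>R e))"
    by (rule lborel_swap) measurable
  also have "\<dots> = (\<J> t. \<J> x. indicator ?S (x - t *\<^sub>R e) * F x)"
  proof (rule nn_integral_cong)
    fix t :: real
    show "(\<J> x. indicator ?S x * F (x + t *\<^sub>R e)) = (\<J> x. indicator ?S (x - t *\<^sub>R e) * F x)"
      using lborel_nn_integral_shift(1)[of "\<lambda>x. indicator ?S (x - t *\<^sub>R e) * F x" "t *\<^sub>R e"] by simp
  qed
  also have "\<dots> = (\<J> x. \<J> t. indicator ?S (x - t *\<^sub>R e) * F x)"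
    by (rule lborel_swap) measurable
  also have "\<dots> = (\<J> x. F x)"
  proof (rule nn_integral_cong)
    fix x :: 'a
    have "e \<bullet> e = 1" using e by (simp add: dot_square_norm)
    then have eq: "indicator ?S (x - t *\<^sub>R e) = (indicator {x \<bullet> e - 1 <.. x \<bullet> e} t :: ennreal)" for t
      by (auto simp: indicator_def inner_diff_left)
    have "(\<J> t. indicator ?S (x - t *\<^sub>R e) * F x) = (\<J> t. indicator {x \<bullet> e - 1 <.. x \<bullet> e} t) * F x"
      unfolding eq by (rule nn_integral_multc) simp
    also have "(\<integral>\<^sup>+t. indicator {x \<bullet> e - 1 <.. x \<bullet> e} t \<partial>(lborel::real measure)) = 1" by simp
    finally show "(\<J> t. indicator ?S (x - t *\<^sub>R e) * F x) = F x" by simp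
  qed
  finally show ?thesis by simp
qed

text \<open>With \<open>x + y\<close> in the third place the form is symmetric in \<open>A\<close>
  and \<open>B\<close> and equals the integral over \<open>C\<close> of the convolution of their
  indicators (\<open>riesz_conv\<close>).\<close>

definition riesz :: "'a::euclidean_space set \<Rightarrow> 'a set \<Rightarrow> 'a set \<Rightarrow> ennreal" where
  "riesz A B C = (\<J> x. \<J> y. indicator A x * indicator B y * indicator C (x + y))"

lemma riesz_mono: "A \<subseteq> A' \<Longrightarrow> B \<subseteq> B' \<Longrightarrow> C \<subseteq> C' \<Longrightarrow> riesz A B C \<le> riesz A' B' C'"
  unfolding riesz_def by (intro nn_integral_mono mult_mono) (auto simp: indicator_def)

lemma emeasure_shift_indicator:
  fixes A :: "'a::euclidean_space set"
  assumes "A \<in> sets borel"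
  shows "(\<J> x. indicator A (t + x)) = vol A"
    and "(\<J> x. indicator A (x + t)) = vol A"
    and "(\<J> x. indicator A (t - x)) = vol A"
  using lborel_nn_integral_shift(1,3)[of "indicator A" t] assms by (simp_all add: add.commute)

lemma riesz_commute:
  assumes [measurable]: "A \<in> sets borel" "B \<in> sets borel" "C \<in> sets borel"
  shows "riesz A B C = riesz B A C"
  unfolding riesz_def by (subst lborel_swap) (measurable, simp add: mult_ac add.commute)

lemma riesz_conv:
  assumes [measurable]: "A \<in> sets borel" "B \<in> sets borel" "C \<in> sets borel"
  shows "riesz A B C = (\<J> z. indicator C z * (\<J> x. indicator A x * indicator B (z - x)))"
proof -
  have "riesz A B C = (\<J> x. \<J> z. indicator A x * indicator B (z - x) * indicator C z)"
    unfolding riesz_def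
  proof (rule nn_integral_cong)
    fix x
    show "(\<J> y. indicator A x * indicator B y * indicator C (x + y)) = (\<J> z. indicator A x * indicator B (z - x) * indicator C z)"
      using lborel_nn_integral_shift(1)[of "\<lambda>z. indicator A x * indicator B (z - x) * indicator C z" x] by (simp add: add.commute)
  qed
  also have "\<dots> = (\<J> z. \<J> x. indicator A x * indicator B (z - x) * indicator C z)"
    by (rule lborel_swap) measurable
  also have "\<dots> = (\<J> z. indicator C z * (\<J> x. indicator A x * indicator B (z - x)))"
    by (intro nn_integral_cong, subst nn_integral_multc) (measurable, rule mult.commute)
  finally show ?thesis .
qed

lemma riesz_le:
  assumes [measurable]: "A \<in> sets borel" "B \<in> sets borel" "C \<in> sets borel"
  shows "riesz A B C \<le> vol A * vol B"
    and "riesz A B C \<le> vol A * vol C"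
    and "riesz A B C \<le> vol B * vol C"
proof -
  have 1: "riesz A B C \<le> vol A * vol C"
    if [measurable]: "A \<in> sets borel" "B \<in> sets borel" "C \<in> sets borel" for A B C :: "'a set"
  proof -
    have "riesz A B C \<le> (\<J> x. \<J> y. indicator A x * indicator C (x + y))"
      unfolding riesz_def by (intro nn_integral_mono) (auto simp: indicator_def)
    also have "\<dots> = vol A * vol C"
      by (simp add: nn_integral_cmult emeasure_shift_indicator nn_integral_multc)
    finally show ?thesis .
  qed
  show "riesz A B C \<le> vol A * vol C" by (rule 1) measurable
  show "riesz A B C \<le> vol B * vol C" by (subst riesz_commute) (measurable, rule 1, measurable)
  have "riesz A B C \<le> (\<J> x. \<J> y. indicator A x * indicator B y)"
    unfolding riesz_def by (intro nn_integral_mono) (auto simp: indicator_def)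
  also have "\<dots> = vol A * vol B"
    by (simp add: nn_integral_cmult nn_integral_multc)
  finally show "riesz A B C \<le> vol A * vol B" .
qed

lemma riesz_Un1:
  assumes [measurable]: "A \<in> sets borel" "A' \<in> sets borel" "B \<in> sets borel" "C \<in> sets borel" and "A \<inter> A' = {}"
  shows "riesz (A \<union> A') B C = riesz A B C + riesz A' B C"
proof -
  have "indicator (A \<union> A') x = indicator A x + (indicator A' x :: ennreal)" for x
    using assms(5) by (auto simp: indicator_def)
  then show ?thesis unfolding riesz_def by (simp add: distrib_right nn_integral_add)
qed

lemma riesz_Un2:
  assumes [measurable]: "A \<in> sets borel" "B' \<in> sets borel" "B \<in> sets borel" "C \<in> sets borel" and "B \<inter> B' = {}"
  shows "riesz A (B \<union> B') C = riesz A B C + riesz A B' C"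
proof -
  have "indicator (B \<union> B') x = indicator B x + (indicator B' x :: ennreal)" for x
    using assms(5) by (auto simp: indicator_def)
  then show ?thesis unfolding riesz_def by (simp add: distrib_left distrib_right nn_integral_add)
qed

lemma riesz_Un3:
  assumes [measurable]: "A \<in> sets borel" "C' \<in> sets borel" "B \<in> sets borel" "C \<in> sets borel" and "C \<inter> C' = {}"
  shows "riesz A B (C \<union> C') = riesz A B C + riesz A B C'"
proof -
  have "indicator (C \<union> C') x = indicator C x + (indicator C' x :: ennreal)" for x
    using assms(5) by (auto simp: indicator_def)
  then show ?thesis unfolding riesz_def by (simp add: distrib_left nn_integral_add)
qed

text \<open>The measure of \<open>A\<close> to the left of a point is a 1-Lipschitz function of the
  point with limits 0 and \<open>a\<close>, so the intermediate value theorem applies.\<close>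

lemma real_set_split:
  fixes A :: "real set"
  assumes [measurable]: "A \<in> sets borel" and a: "vol A = ennreal a" "0 < t" "t < a"
  shows "\<exists>\<alpha>. vol (A \<inter> {..\<alpha>}) = ennreal t"
proof -
  define F where "F \<alpha> = measure lborel (A \<inter> {..\<alpha>})" for \<alpha>
  have fin: "vol (A \<inter> X) \<noteq> \<infinity>" if "X \<in> sets borel" for X
    using emeasure_mono[of "A \<inter> X" A lborel] a(1) by (auto simp: top_unique)
  have fm: "A \<inter> X \<in> fmeasurable lborel" if "X \<in> sets borel" for X
    using fin[OF that] that by (intro fmeasurableI) (auto simp: less_top)
  have A: "measure lborel A = a" using a by (simp add: measure_def)
  have step: "F \<beta> \<le> F \<alpha> + (\<beta> - \<alpha>)" and mono: "F \<alpha> \<le> F \<beta>" if "\<alpha> \<le> \<beta>" for \<alpha> \<beta>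
  proof -
    have "F \<beta> \<le> measure lborel ((A \<inter> {..\<alpha>}) \<union> {\<alpha><..\<beta>})"
      unfolding F_def using that
      by (intro measure_mono_fmeasurable fmeasurable.Un fm) (auto intro!: fmeasurableI)
    also have "\<dots> \<le> F \<alpha> + measure lborel {\<alpha><..\<beta>}"
      unfolding F_def by (rule measure_Un_le) auto
    finally show "F \<beta> \<le> F \<alpha> + (\<beta> - \<alpha>)" using that by simp
    show "F \<alpha> \<le> F \<beta>" unfolding F_def using that
      by (intro measure_mono_fmeasurable fm) auto
  qed
  have cont: "isCont F x" for x
  proof -
    have "\<bar>F y - F x\<bar> \<le> \<bar>y - x\<bar>" for y
      using step[of x y] mono[of x y] step[of y x] mono[of y x] by (cases "x \<le> y") auto
    then have "dist (F y) (F x) \<le> dist y x" for y by (simp add: dist_real_def)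
    then show ?thesis unfolding continuous_at_eps_delta by (metis order_le_less_trans)
  qed
  have "(\<lambda>n. F (real n)) \<longlonglongrightarrow> measure lborel (\<Union>n::nat. A \<inter> {..real n})"
    unfolding F_def
  proof (rule Lim_measure_incseq)
    have "vol (A \<inter> (\<Union>n::nat. {..real n})) \<noteq> \<infinity>" by (rule fin) auto
    then show "vol (\<Union>n::nat. A \<inter> {..real n}) \<noteq> \<infinity>" by simp
    show "incseq (\<lambda>n::nat. A \<inter> {..real n})" unfolding incseq_def by (auto intro: order_trans)
  qed auto
  moreover have "(\<Union>n::nat. A \<inter> {..real n}) = A" using real_arch_simple by auto
  ultimately have "(\<lambda>n. F (real n)) \<longlonglongrightarrow> a" using A by simp
  then have "eventually (\<lambda>n. F (real n) > t) sequentially" using a(3) by (rule order_tendstoD)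
  then obtain n where n: "F (real n) > t" by (auto simp: eventually_sequentially)
  have "(\<lambda>n. F (- real n)) \<longlonglongrightarrow> measure lborel (\<Inter>n::nat. A \<inter> {..- real n})"
    unfolding F_def
  proof (rule Lim_measure_decseq)
    show "vol (A \<inter> {..- real n}) \<noteq> \<infinity>" for n :: nat by (rule fin) auto
    show "decseq (\<lambda>n::nat. A \<inter> {..- real n})" unfolding decseq_def by (auto intro: order_trans)
  qed auto
  moreover have "(\<Inter>n::nat. A \<inter> {..- real n}) = {}"
  proof -
    have "x \<notin> (\<Inter>n::nat. A \<inter> {..- real n})" for x
    proof -
      obtain n where "- x < real n" using reals_Archimedean2 by blast
      then have "x \<notin> A \<inter> {..- real n}" by auto
      then show ?thesis by blast
    qed
    then show ?thesis by blast
  qed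
  ultimately have "(\<lambda>n. F (- real n)) \<longlonglongrightarrow> 0" by simp
  then have "eventually (\<lambda>n. F (- real n) < t) sequentially" using a(2) by (rule order_tendstoD)
  then obtain m where m: "F (- real m) < t" by (auto simp: eventually_sequentially)
  have "\<exists>x\<ge>- real m. x \<le> real n \<and> F x = t"
    by (rule IVT) (use m n cont in auto)
  then obtain x where "F x = t" by blast
  then have "vol (A \<inter> {..x}) = ennreal t"
    using fin[of "{..x}"] unfolding F_def by (subst emeasure_eq_ennreal_measure) auto
  then show ?thesis by blast
qed

text \<open>Cutting off the left part of \<open>A\<close> and the right part of \<open>B\<close>, both of measure \<open>t\<close>: the two
  remaining pieces of \<open>A \<times> B\<close> meet each line \<open>x + y = z\<close> in measure at most \<open>t\<close>.\<close>

lemma riesz_real_le: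
  fixes A B C :: "real set"
  assumes [measurable]: "A \<in> sets borel" "B \<in> sets borel" "C \<in> sets borel"
    and a: "vol A = ennreal a" and b: "vol B = ennreal b"
    and t: "0 < t" "t < a" "t < b"
  shows "riesz A B C \<le> ennreal ((a - t) * (b - t)) + ennreal t * vol C"
proof -
  obtain \<alpha> where \<alpha>: "vol (A \<inter> {..\<alpha>}) = ennreal t" using real_set_split[OF _ a t(1,2)] by auto
  obtain \<beta> where \<beta>: "vol (B \<inter> {..\<beta>}) = ennreal (b - t)"
    using real_set_split[OF _ b, of "b - t"] t by auto
  define A1 A2 B1 B2 where "A1 = A \<inter> {..\<alpha>}" and "A2 = A \<inter> {\<alpha><..}" and "B1 = B \<inter> {..\<beta>}" and "B2 = B \<inter> {\<beta><..}"
  have [measurable]: "A1 \<in> sets borel" "A2 \<in> sets borel" "B1 \<in> sets borel" "B2 \<in> sets borel"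
    unfolding A1_def A2_def B1_def B2_def by auto
  have AU: "A = A1 \<union> A2" "A1 \<inter> A2 = {}" and BU: "B = B1 \<union> B2" "B1 \<inter> B2 = {}"
    by (auto simp: A1_def A2_def B1_def B2_def)
  have eA1: "vol A1 = ennreal t" and eB1: "vol B1 = ennreal (b - t)"
    using \<alpha> \<beta> by (auto simp: A1_def B1_def)
  have A2: "A2 = A - A1" and B2: "B2 = B - B1" using AU BU by auto
  have eA2: "vol A2 = ennreal (a - t)"
    unfolding A2 using AU(1) a eA1 t by (subst emeasure_Diff) (auto simp: ennreal_minus)
  have eB2: "vol B2 = ennreal t"
    unfolding B2 using BU(1) b eB1 t by (subst emeasure_Diff) (auto simp: ennreal_minus)
  define k where "k A B z = (\<J> x. indicator A x * indicator B (z - x))" for A B and z :: real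
  have kle1: "k X Y z \<le> vol X" if "X \<in> sets borel" for X Y z
  proof -
    have "k X Y z \<le> (\<J> x. indicator X x)" unfolding k_def by (intro nn_integral_mono) (auto simp: indicator_def)
    then show ?thesis using that by simp
  qed
  have kle2: "k X Y z \<le> vol Y" if "Y \<in> sets borel" for X Y z
  proof -
    have "k X Y z \<le> (\<J> x. indicator Y (z - x))" unfolding k_def by (intro nn_integral_mono) (auto simp: indicator_def)
    then show ?thesis using that by (simp add: emeasure_shift_indicator)
  qed
  have [measurable]: "k X Y \<in> Borel" if "X \<in> sets borel" "Y \<in> sets borel" for X Y
    using that unfolding k_def by measurable
  \<comment> \<open>Sums from \<open>A2\<close> and \<open>B2\<close> exceed
    \<open>\<alpha> + \<beta>\<close>, sums from \<open>A1\<close> and \<open>B1\<close> do not. Up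
    to this threshold the second term is 0 and the first is at most the measure of
    \<open>A1\<close>; beyond it \<open>B\<close> may be replaced by \<open>B2\<close> in the first
    term, and the total is at most the measure of \<open>B2\<close>. Both measures are
    \<open>t\<close>.\<close>
  have k: "k A1 B z + k A2 B2 z \<le> ennreal t" for z
  proof (cases "z \<le> \<alpha> + \<beta>")
    case True
    have "k A2 B2 z = 0" unfolding k_def
      by (subst nn_integral_0_iff_AE) (use True in \<open>auto simp: A2_def B2_def indicator_def intro!: AE_I2\<close>)
    with kle1[of A1 B z] eA1 show ?thesis by simp
  next
    case False
    have "k A1 B z = k A1 B2 z" unfolding k_def
      by (intro nn_integral_cong) (use False in \<open>auto simp: A1_def B2_def indicator_def\<close>)
    also have "k A1 B2 z + k A2 B2 z = k A B2 z"
      unfolding k_def by (subst nn_integral_add[symmetric]) (auto simp: A1_def A2_def indicator_def intro!: nn_integral_cong)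
    finally show ?thesis using kle2[of B2 A z] eB2 by simp
  qed
  have "riesz A B C = riesz A1 B C + (riesz A2 B1 C + riesz A2 B2 C)"
    using riesz_Un1[of A1 A2 B C] riesz_Un2[of A2 B2 B1 C] AU BU by simp
  \<comment> \<open>The rectangle \<open>A2\<close> times \<open>B1\<close> is estimated by its area
    \<open>(a - t) * (b - t)\<close>; the other two pieces are integrated over \<open>C\<close> with
    density at most \<open>t\<close>.\<close>
  also have "\<dots> = riesz A2 B1 C + (riesz A1 B C + riesz A2 B2 C)" by (simp add: ac_simps)
  also have "\<dots> \<le> ennreal ((a - t) * (b - t)) + ennreal t * vol C"
  proof (intro add_mono)
    show "riesz A2 B1 C \<le> ennreal ((a - t) * (b - t))"
      using riesz_le(1)[of A2 B1 C] t by (simp add: eA2 eB1 ennreal_mult)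
    have "riesz A1 B C + riesz A2 B2 C = (\<J> z. indicator C z * (k A1 B z + k A2 B2 z))"
      by (simp add: riesz_conv k_def[symmetric] distrib_left nn_integral_add)
    also have "\<dots> \<le> (\<J> z. indicator C z * ennreal t)"
      by (intro nn_integral_mono mult_left_mono k) auto
    also have "\<dots> = (\<J> z. ennreal t * indicator C z)" by (simp only: mult.commute)
    also have "\<dots> = ennreal t * vol C" by (rule nn_integral_cmult_indicator) simp
    finally show "riesz A1 B C + riesz A2 B2 C \<le> ennreal t * vol C" .
  qed
  finally show ?thesis .
qed

section \<open>Centred intervals and the sharp inequality on the line\<close>

definition cint :: "real \<Rightarrow> real set" where "cint a = {- (a / 2) <..< a / 2}"

lemma cint_sets [measurable]: "cint a \<in> sets borel" by (simp add: cint_def)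
lemma emeasure_cint: "a \<ge> 0 \<Longrightarrow> vol (cint a) = ennreal a" by (simp add: cint_def)

text \<open>For \<open>x\<close> in \<open>cint a\<close> and \<open>x + y\<close> in
  \<open>cint c\<close>, the hypothesis \<open>a + c \<le> b\<close> puts \<open>y\<close> into
  \<open>cint b\<close> automatically.\<close>

lemma riesz_cint_ge_contained:
  assumes "0 \<le> a" "0 \<le> c" "a + c \<le> b"
  shows "ennreal (a * c) \<le> riesz (cint a) (cint b) (cint c)"
proof -
  have "ennreal (a * c) = (\<J> x. \<J> y. indicator (cint a) x * indicator (cint c) (x + y))"
    using assms by (simp add: nn_integral_cmult nn_integral_multc emeasure_shift_indicator emeasure_cint ennreal_mult)
  also have "\<dots> \<le> riesz (cint a) (cint b) (cint c)"
    unfolding riesz_def using assms by (intro nn_integral_mono) (auto simp: indicator_def cint_def)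
  finally show ?thesis .
qed

lemma riesz_cint_ge_sum:
  assumes "0 \<le> a" "0 \<le> b" "a + b \<le> c"
  shows "ennreal (a * b) \<le> riesz (cint a) (cint b) (cint c)"
proof -
  have "ennreal (a * b) = (\<J> x. \<J> y. indicator (cint a) x * indicator (cint b) y)"
    using assms by (simp add: nn_integral_cmult nn_integral_multc emeasure_cint ennreal_mult)
  also have "\<dots> \<le> riesz (cint a) (cint b) (cint c)"
    unfolding riesz_def using assms by (intro nn_integral_mono) (auto simp: indicator_def cint_def)
  finally show ?thesis .
qed

text \<open>The region is the right triangle with vertex \<open>(p, q)\<close> cut off by the line
  \<open>x + y = r\<close>; both legs have length \<open>p + q - r\<close>.\<close>

lemma triangle_area:
  fixes p q r :: real
  assumes "p + q \<ge> r"
  shows "(\<J> x. \<J> y. indicator {..<p} x * indicator {..<q} y * indicator {r..} (x + y)) \<le> ennreal ((p + q - r)\<^sup>2 / 2)"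
proof -
  have "(\<J> x. \<J> y. indicator {..<p} x * indicator {..<q} y * indicator {r..} (x + y))
     \<le> (\<J> x. ennreal (x - (r - q)) * indicator {r - q..p} x)"
  proof (rule nn_integral_mono)
    fix x :: real
    have "(\<J> y. indicator {..<p} x * indicator {..<q} y * indicator {r..} (x + y)) =
       (\<J> y. indicator {..<p} x * indicator {r - x..<q} y)"
      by (intro nn_integral_cong) (auto simp: indicator_def)
    also have "\<dots> = indicator {..<p} x * vol {r - x..<q}" by (simp add: nn_integral_cmult)
    also have "\<dots> \<le> ennreal (x - (r - q)) * indicator {r - q..p} x"
      by (cases "r - x \<le> q") (auto simp: indicator_def algebra_simps)
    finally show "(\<J> y. indicator {..<p} x * indicator {..<q} y * indicator {r..} (x + y)) \<le>
      ennreal (x - (r - q)) * indicator {r - q..p} x" .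
  qed
  also have "\<dots> = ennreal ((p - (r - q))\<^sup>2 / 2 - ((r - q) - (r - q))\<^sup>2 / 2)"
    by (rule nn_integral_FTC_Icc[where F = "\<lambda>x. (x - (r - q))\<^sup>2 / 2"])
       (use assms in \<open>auto intro!: derivative_eq_intros\<close>)
  finally show ?thesis by (simp add: algebra_simps)
qed

text \<open>From the rectangle with sides \<open>a\<close> and \<open>b\<close>, the condition that
  \<open>x + y\<close> lies in \<open>cint c\<close> removes at most two opposite corner triangles
  with legs \<open>(a + b - c) / 2\<close>, which are exchanged by reflecting both
  variables.\<close>

lemma riesz_cint_ge_overlap:
  assumes ab: "0 \<le> a" "0 \<le> b" and d: "0 \<le> a + b - c"
  shows "ennreal (a * b - ((a + b - c) / 2)\<^sup>2) \<le> riesz (cint a) (cint b) (cint c)"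
proof -
  let ?d = "(a + b - c) / 2"
  define g :: "real \<Rightarrow> real \<Rightarrow> ennreal" where
    "g x y = indicator {..<a/2} x * indicator {..<b/2} y * indicator {c/2..} (x + y)" for x y
  have [measurable]: "(\<lambda>(x, y). g x y) \<in> borel_measurable (borel \<Otimes>\<^sub>M borel)" unfolding g_def by measurable
  have g_le: "indicator (cint a) x * indicator (cint b) y * indicator (- cint c) (x + y) \<le> g x y + g (- x) (- y)" for x y
  proof (cases "x \<in> cint a \<and> y \<in> cint b \<and> x + y \<notin> cint c")
    case True
    then consider "c/2 \<le> x + y" | "c/2 \<le> - x + - y" by (force simp: cint_def)
    then have "g x y = 1 \<or> g (- x) (- y) = 1"
      using True by cases (auto simp: g_def cint_def)
    then have "1 \<le> g x y + g (- x) (- y)" by (metis add_increasing add_increasing2 order_refl zero_le)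
    with True show ?thesis by simp
  qed (auto simp: indicator_def)
  have "riesz (cint a) (cint b) (- cint c) \<le> (\<J> x. \<J> y. g x y + g (- x) (- y))"
    unfolding riesz_def by (intro nn_integral_mono g_le)
  also have "\<dots> = (\<J> x. \<J> y. g x y) + (\<J> x. \<J> y. g (- x) (- y))"
    by (simp add: nn_integral_add)
  also have "(\<J> x. \<J> y. g (- x) (- y)) = (\<J> x. \<J> y. g x y)"
  proof -
    have "(\<J> y. g (- x) (- y)) = (\<J> y. g (- x) y)" for x
      by (rule lborel_nn_integral_shift(4)[of "g (- x)"]) measurable
    then have "(\<J> x. \<J> y. g (- x) (- y)) = (\<J> x. \<J> y. g (- x) y)" by simp
    also have "\<dots> = (\<J> x. \<J> y. g x y)"
      by (rule lborel_nn_integral_shift(4)[of "\<lambda>x. \<J> y. g x y"]) measurable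
    finally show ?thesis .
  qed
  also have "(\<J> x. \<J> y. g x y) + (\<J> x. \<J> y. g x y)
      \<le> ennreal (?d\<^sup>2 / 2) + ennreal (?d\<^sup>2 / 2)"
  proof -
    have eq: "?d = a / 2 + b / 2 - c / 2" by (simp add: field_simps)
    have "(\<J> x. \<J> y. g x y) \<le> ennreal (?d\<^sup>2 / 2)"
      unfolding g_def eq by (rule triangle_area) (use d in simp)
    then show ?thesis by (intro add_mono) auto
  qed
  also have "ennreal (?d\<^sup>2 / 2) + ennreal (?d\<^sup>2 / 2) = ennreal (?d\<^sup>2)"
    by (subst ennreal_plus[symmetric]) auto
  finally have le: "riesz (cint a) (cint b) (- cint c) \<le> ennreal (?d\<^sup>2)" .
  have "ennreal (a * b) = riesz (cint a) (cint b) UNIV"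
    using ab by (simp add: riesz_def nn_integral_cmult nn_integral_multc emeasure_cint ennreal_mult)
  also have "\<dots> = riesz (cint a) (cint b) (cint c) + riesz (cint a) (cint b) (- cint c)"
    using riesz_Un3[of "cint a" "- cint c" "cint b" "cint c"] by (simp add: Compl_partition)
  also have "\<dots> \<le> riesz (cint a) (cint b) (cint c) + ennreal (?d\<^sup>2)"
    by (intro add_left_mono le)
  finally have "ennreal (a * b) - ennreal (?d\<^sup>2) \<le> riesz (cint a) (cint b) (cint c)"
    by (simp add: ennreal_minus_le_iff add.commute)
  then show ?thesis by (simp add: ennreal_minus)
qed

lemma riesz_sobolev_real:
  fixes A B C :: "real set"
  assumes m [measurable]: "A \<in> sets borel" "B \<in> sets borel" "C \<in> sets borel"
    and a: "vol A = ennreal a" "a \<ge> 0" and b: "vol B = ennreal b" "b \<ge> 0"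
    and c: "vol C = ennreal c" "c \<ge> 0"
  shows "riesz A B C \<le> riesz (cint a) (cint b) (cint c)"
proof -
  \<comment> \<open>The minimiser over \<open>t\<close> of the upper bound
    \<open>(a - t) * (b - t) + t * c\<close>; the minimum \<open>a * b - t\<^sup>2\<close> is
    exactly the lower bound for centred intervals. The strict inequalities of the last case say
    \<open>0 < t\<close>, \<open>t < a\<close> and \<open>t < b\<close>.\<close>
  let ?t = "(a + b - c) / 2"
  consider "a + b \<le> c" | "a + c \<le> b" | "b + c \<le> a" | "c < a + b" "b < a + c" "a < b + c" by linarith
  then show ?thesis
  proof cases
    case 1
    have "riesz A B C \<le> ennreal (a * b)" using riesz_le(1)[OF m] a b by (simp add: ennreal_mult)
    also have "\<dots> \<le> riesz (cint a) (cint b) (cint c)" by (rule riesz_cint_ge_sum) (use 1 a b in auto)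
    finally show ?thesis .
  next
    case 2
    have "riesz A B C \<le> ennreal (a * c)" using riesz_le(2)[OF m] a c by (simp add: ennreal_mult)
    also have "\<dots> \<le> riesz (cint a) (cint b) (cint c)" by (rule riesz_cint_ge_contained) (use 2 a c in auto)
    finally show ?thesis .
  next
    case 3
    have "riesz A B C \<le> ennreal (b * c)" using riesz_le(3)[OF m] b c by (simp add: ennreal_mult)
    also have "\<dots> \<le> riesz (cint b) (cint a) (cint c)" by (rule riesz_cint_ge_contained) (use 3 b c in auto)
    finally show ?thesis by (subst riesz_commute) auto
  next
    case 4
    have "riesz A B C \<le> ennreal ((a - ?t) * (b - ?t)) + ennreal ?t * ennreal c"
      using riesz_real_le[OF m a(1) b(1), of ?t] 4 c by simp
    also have "\<dots> = ennreal ((a - ?t) * (b - ?t) + ?t * c)"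
    proof -
      have "ennreal ?t * ennreal c = ennreal (?t * c)" using 4 c by (intro ennreal_mult[symmetric]) auto
      moreover have "ennreal ((a - ?t) * (b - ?t)) + ennreal (?t * c) = ennreal ((a - ?t) * (b - ?t) + ?t * c)"
        using 4 c by (intro ennreal_plus[symmetric] mult_nonneg_nonneg) auto
      ultimately show ?thesis by simp
    qed
    also have "(a - ?t) * (b - ?t) + ?t * c = a * b - ?t\<^sup>2" by (simp add: power2_eq_square field_simps)
    also have "ennreal (a * b - ?t\<^sup>2) \<le> riesz (cint a) (cint b) (cint c)"
      by (rule riesz_cint_ge_overlap) (use 4 a b in auto)
    finally show ?thesis .
  qed
qed

section \<open>Steiner symmetrization in one direction\<close>

definition fib :: "'a::euclidean_space \<Rightarrow> 'a set \<Rightarrow> 'a \<Rightarrow> real set" where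
  "fib e A x = {t. x + t *\<^sub>R e \<in> A}"

definition flen :: "'a::euclidean_space \<Rightarrow> 'a set \<Rightarrow> 'a \<Rightarrow> real" where
  "flen e A x = measure lborel (fib e A x)"

text \<open>\<open>flen e A\<close> is constant along lines in direction \<open>e\<close>, so each
  such line meets the set in an open interval centred on the hyperplane orthogonal to
  \<open>e\<close> and as long as the fibre. A fibre of infinite measure would get
  \<open>flen\<close> 0, which is why the sets below are bounded.\<close>

definition steiner :: "'a::euclidean_space \<Rightarrow> 'a set \<Rightarrow> 'a set" where
  "steiner e A = {x. \<bar>x \<bullet> e\<bar> < flen e A x / 2}"

lemma fib_sets [measurable]: 
  assumes "A \<in> sets borel" shows "fib e A x \<in> sets borel"
proof -
  have "(\<lambda>t. x + t *\<^sub>R e) -` A \<inter> space borel \<in> sets borel" by (rule measurable_sets[of _ borel borel]) (auto simp: assms)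
  then show ?thesis by (simp add: fib_def vimage_def)
qed

lemma indicator_fib: "indicator (fib e A x) t = indicator A (x + t *\<^sub>R e)"
  by (simp add: indicator_def fib_def)

lemma flen_measurable [measurable]:
  assumes [measurable]: "A \<in> sets borel" shows "flen e A \<in> Borel"
proof -
  have "flen e A x = enn2real (\<J> t. indicator A (x + t *\<^sub>R e))" for x
    unfolding flen_def measure_def using assms by (simp add: indicator_fib[symmetric])
  then have eq: "flen e A = (\<lambda>x. enn2real (\<J> t. indicator A (x + t *\<^sub>R e)))" ..
  show ?thesis unfolding eq by measurable
qed

lemma steiner_sets [measurable]:
  assumes [measurable]: "A \<in> sets borel" shows "steiner e A \<in> sets borel"
  unfolding steiner_def by measurable

lemma emeasure_fib_shift: 
  assumes "A \<in> sets borel" shows "vol (fib e A (x + t *\<^sub>R e)) = vol (fib e A x)"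
proof -
  have "vol (fib e A (x + t *\<^sub>R e)) = (\<J> s. indicator (fib e A x) (s + t))"
    using assms by (simp add: indicator_fib scaleR_add_left add_ac flip: nn_integral_indicator)
  then show ?thesis using assms by (simp add: emeasure_shift_indicator)
qed

lemma fib_steiner:
  assumes "A \<in> sets borel" and e: "norm e = 1"
  shows "fib e (steiner e A) x = {t. \<bar>x \<bullet> e + t\<bar> < flen e A x / 2}"
proof -
  have "e \<bullet> e = 1" using e by (simp add: dot_square_norm)
  moreover have "flen e A (x + t *\<^sub>R e) = flen e A x" for t
    unfolding flen_def measure_def emeasure_fib_shift[OF assms(1)] ..
  ultimately have "t \<in> fib e (steiner e A) x \<longleftrightarrow> \<bar>x \<bullet> e + t\<bar> < flen e A x / 2" for t
    unfolding fib_def mem_Collect_eq steiner_def by (simp add: inner_add_left)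
  then show ?thesis by blast
qed

text \<open>Pythagoras: the squared distance of the line from the origin is
  \<open>(norm x)\<^sup>2 - (x \<bullet> e)\<^sup>2\<close>. The maximum with 0 gives the empty
  interval to lines that miss the ball, and \<open>r > 0\<close> is kept because squaring forgets
  the sign of \<open>r\<close>.\<close>

lemma fib_ball:
  assumes e: "norm e = 1"
  shows "fib e (ball 0 r) x = {t. r > 0 \<and> \<bar>x \<bullet> e + t\<bar> < sqrt (max 0 (r\<^sup>2 - ((norm x)\<^sup>2 - (x \<bullet> e)\<^sup>2)))}"
proof (rule set_eqI)
  fix t
  have ee: "e \<bullet> e = 1" using e by (simp add: dot_square_norm)
  have n: "(norm (x + t *\<^sub>R e))\<^sup>2 = (x \<bullet> e + t)\<^sup>2 + ((norm x)\<^sup>2 - (x \<bullet> e)\<^sup>2)"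
    unfolding power2_norm_eq_inner by (simp add: inner_add_left inner_add_right ee inner_commute[of e x] power2_eq_square algebra_simps)
  have "t \<in> fib e (ball 0 r) x \<longleftrightarrow> r > 0 \<and> norm (x + t *\<^sub>R e) < r"
    unfolding fib_def using norm_ge_zero[of "x + t *\<^sub>R e"] by (auto simp del: norm_ge_zero)
  also have "\<dots> \<longleftrightarrow> r > 0 \<and> (norm (x + t *\<^sub>R e))\<^sup>2 < r\<^sup>2"
    by (auto intro: power_strict_mono power2_less_imp_less)
  also have "\<dots> \<longleftrightarrow> r > 0 \<and> (x \<bullet> e + t)\<^sup>2 < r\<^sup>2 - ((norm x)\<^sup>2 - (x \<bullet> e)\<^sup>2)" unfolding n by auto
  also have "\<dots> \<longleftrightarrow> r > 0 \<and> (x \<bullet> e + t)\<^sup>2 < max 0 (r\<^sup>2 - ((norm x)\<^sup>2 - (x \<bullet> e)\<^sup>2))"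
    by (auto simp: max_def) (smt (verit) zero_le_power2)+
  also have "\<dots> \<longleftrightarrow> r > 0 \<and> \<bar>x \<bullet> e + t\<bar> < sqrt (max 0 (r\<^sup>2 - ((norm x)\<^sup>2 - (x \<bullet> e)\<^sup>2)))"
    by (subst real_sqrt_abs[symmetric]) (simp only: real_sqrt_less_iff)
  finally show "t \<in> fib e (ball 0 r) x \<longleftrightarrow> t \<in> {t. r > 0 \<and> \<bar>x \<bullet> e + t\<bar> < sqrt (max 0 (r\<^sup>2 - ((norm x)\<^sup>2 - (x \<bullet> e)\<^sup>2)))}"
    by simp
qed

lemma cint_translate: "{t. \<bar>p + t\<bar> < a / 2} = (\<lambda>t. t + p) -` cint a"
  unfolding cint_def set_eq_iff mem_Collect_eq vimage_eq greaterThanLessThan_iff by arith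

lemma emeasure_centered: "vol {t. \<bar>p + t\<bar> < a} = ennreal (2 * max 0 a)" for a p :: real
proof -
  have "{t. \<bar>p + t\<bar> < a} = {- a - p <..< a - p}" by (auto simp: abs_less_iff)
  then show ?thesis by (cases "a \<ge> 0") (auto simp: max_def)
qed

lemma fib_bounded:
  assumes A: "A \<subseteq> ball 0 R" and R: "R > 0" and e: "norm e = 1" and m: "A \<in> sets borel"
  shows "vol (fib e A x) = ennreal (flen e A x)" and "flen e A x \<le> 2 * R"
   and "fib e A x \<in> fmeasurable lborel"
proof -
  have "\<bar>x \<bullet> e\<bar> \<le> norm x" using Cauchy_Schwarz_ineq2[of x e] e by simp
  then have "(x \<bullet> e)\<^sup>2 \<le> (norm x)\<^sup>2" using abs_le_square_iff[of "x \<bullet> e" "norm x"] by simp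
  then have "max 0 (R\<^sup>2 - ((norm x)\<^sup>2 - (x \<bullet> e)\<^sup>2)) \<le> R\<^sup>2" by simp
  from real_sqrt_le_mono[OF this] have "sqrt (max 0 (R\<^sup>2 - ((norm x)\<^sup>2 - (x \<bullet> e)\<^sup>2))) \<le> R"
    using R by simp
  then have "fib e (ball 0 R) x \<subseteq> {t. \<bar>x \<bullet> e + t\<bar> < R}"
    unfolding fib_ball[OF e] by auto
  moreover have "fib e A x \<subseteq> fib e (ball 0 R) x" using A by (auto simp: fib_def)
  ultimately have "vol (fib e A x) \<le> vol {t. \<bar>x \<bullet> e + t\<bar> < R}"
    by (intro emeasure_mono) auto
  then have le: "vol (fib e A x) \<le> ennreal (2 * R)" using R by (simp add: emeasure_centered)
  then have fin: "vol (fib e A x) < top" by (rule order_le_less_trans) simp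
  then show *: "vol (fib e A x) = ennreal (flen e A x)"
    unfolding flen_def by (intro emeasure_eq_ennreal_measure) simp
  show "flen e A x \<le> 2 * R" using le R unfolding * by simp
  show "fib e A x \<in> fmeasurable lborel" using fin m by (intro fmeasurableI) auto
qed

definition slab :: "'a::euclidean_space \<Rightarrow> 'a set" where "slab e = {x. 0 \<le> x \<bullet> e \<and> x \<bullet> e < 1}"

lemma slab_sets [measurable]: "slab e \<in> sets borel" unfolding slab_def by measurable

lemma emeasure_via_fib:
  assumes [measurable]: "A \<in> sets borel" and e: "norm e = 1"
  shows "vol A = (\<J> x. indicator (slab e) x * vol (fib e A x))"
proof -
  have "vol A = (\<J> x. \<J> t. indicator (slab e) x * indicator (fib e A x) t)"
    using slab_fubini[of "indicator A" e] assms by (simp add: slab_def indicator_fib)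
  also have "\<dots> = (\<J> x. indicator (slab e) x * vol (fib e A x))"
    by (intro nn_integral_cong) (simp add: nn_integral_cmult)
  finally show ?thesis .
qed

lemma emeasure_fib_steiner:
  assumes "A \<in> sets borel" and "norm e = 1"
  shows "vol (fib e (steiner e A) x) = ennreal (flen e A x)"
  unfolding fib_steiner[OF assms] emeasure_centered by (simp add: flen_def max_def)

lemma emeasure_steiner:
  assumes A: "A \<subseteq> ball 0 R" "R > 0" and e: "norm e = 1" and m: "A \<in> sets borel"
  shows "vol (steiner e A) = vol A"
  unfolding emeasure_via_fib[OF m e] emeasure_via_fib[OF steiner_sets[OF m] e]
    emeasure_fib_steiner[OF m e] fib_bounded(1)[OF A e m] ..

text \<open>On each line the fibre of the ball is itself a centred interval, at least as long as the
  fibre of \<open>A\<close>, and so contains the centred interval that replaces the latter.\<close>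

lemma steiner_subset_ball:
  assumes A: "A \<subseteq> ball 0 R" "R > 0" and e: "norm e = 1" and m: "A \<in> sets borel"
  shows "steiner e A \<subseteq> ball 0 R"
proof
  fix x assume x: "x \<in> steiner e A"
  let ?r = "sqrt (max 0 (R\<^sup>2 - ((norm x)\<^sup>2 - (x \<bullet> e)\<^sup>2)))"
  have "fib e A x \<subseteq> fib e (ball 0 R) x" using A by (auto simp: fib_def)
  then have "vol (fib e A x) \<le> vol {t. \<bar>x \<bullet> e + t\<bar> < ?r}"
    unfolding fib_ball[OF e] using A(2) by (intro emeasure_mono) auto
  then have "ennreal (flen e A x) \<le> ennreal (2 * ?r)"
    unfolding fib_bounded(1)[OF A e m] emeasure_centered by simp
  then have "flen e A x \<le> 2 * ?r" by simp
  with x have "\<bar>x \<bullet> e + 0\<bar> < ?r" by (simp add: steiner_def)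
  then have "0 \<in> fib e (ball 0 R) x" unfolding fib_ball[OF e] using A(2) by simp
  then show "x \<in> ball 0 R" by (simp add: fib_def)
qed

lemma riesz_via_fib:
  assumes [measurable]: "A \<in> sets borel" "B \<in> sets borel" "C \<in> sets borel" and e: "norm e = 1"
  shows "riesz A B C = (\<J> x. \<J> y. indicator (slab e) x * (indicator (slab e) y * 
     riesz (fib e A x) (fib e B y) (fib e C (x + y))))"
proof -
  define f where "f x y = (indicator A x * indicator B y * indicator C (x + y) :: ennreal)" for x y
  have [measurable]: "(\<lambda>(x, y). f x y) \<in> borel_measurable (borel \<Otimes>\<^sub>M borel)" unfolding f_def by measurable
  have "riesz A B C = (\<J> x. \<J> y. f x y)" by (simp add: riesz_def f_def)
  also have "\<dots> = (\<J> x. \<J> y. \<J> t. indicator (slab e) y * f x (y + t *\<^sub>R e))"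
    by (subst slab_fubini[OF _ e, folded slab_def]) auto
  also have "\<dots> = (\<J> x. \<J> s. indicator (slab e) x * (\<J> y. \<J> t. indicator (slab e) y * f (x + s *\<^sub>R e) (y + t *\<^sub>R e)))"
    by (rule slab_fubini[OF _ e, folded slab_def]) measurable
  also have "\<dots> = (\<J> x. \<J> s. \<J> y. \<J> t. indicator (slab e) x * (indicator (slab e) y * f (x + s *\<^sub>R e) (y + t *\<^sub>R e)))"
    by (simp add: nn_integral_cmult)
  also have "\<dots> = (\<J> x. \<J> y. \<J> s. \<J> t. indicator (slab e) x * (indicator (slab e) y * f (x + s *\<^sub>R e) (y + t *\<^sub>R e)))"
    by (intro nn_integral_cong lborel_swap) measurable
  also have "\<dots> = (\<J> x. \<J> y. indicator (slab e) x * (indicator (slab e) y * 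
     (\<J> s. \<J> t. f (x + s *\<^sub>R e) (y + t *\<^sub>R e))))"
    by (simp add: nn_integral_cmult)
  also have "\<dots> = (\<J> x. \<J> y. indicator (slab e) x * (indicator (slab e) y * 
     riesz (fib e A x) (fib e B y) (fib e C (x + y))))"
    unfolding riesz_def indicator_fib f_def by (simp add: scaleR_add_left add_ac)
  finally show ?thesis .
qed

lemma riesz_translate:
  fixes A B C :: "real set"
  assumes [measurable]: "A \<in> sets borel" "B \<in> sets borel" "C \<in> sets borel"
  shows "riesz ((\<lambda>t. t + p) -` A) ((\<lambda>t. t + q) -` B) ((\<lambda>t. t + (p + q)) -` C) = riesz A B C"
proof -
  define g where "g x y = (indicator A x * indicator B y * indicator C (x + y) :: ennreal)" for x y
  have [measurable]: "(\<lambda>(x, y). g x y) \<in> borel_measurable (borel \<Otimes>\<^sub>M borel)" unfolding g_def by measurable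
  have "riesz ((\<lambda>t. t + p) -` A) ((\<lambda>t. t + q) -` B) ((\<lambda>t. t + (p + q)) -` C) = (\<J> x. \<J> y. g (x + p) (y + q))"
    unfolding riesz_def g_def by (intro nn_integral_cong) (auto simp: indicator_def add_ac)
  also have "\<dots> = (\<J> x. \<J> y. g (x + p) y)"
    by (intro nn_integral_cong lborel_nn_integral_shift(1)) measurable
  also have "\<dots> = (\<J> x. \<J> y. g x y)"
    by (rule lborel_nn_integral_shift(1)) measurable
  finally show ?thesis by (simp add: g_def riesz_def)
qed

text \<open>On every pair of lines in direction \<open>e\<close> the inequality on the line applies.
  The symmetrized fibres are centred at \<open>- (x \<bullet> e)\<close>, at
  \<open>- (y \<bullet> e)\<close> and at the sum of the two, and translations related in this way
  leave the form unchanged.\<close>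

lemma riesz_steiner:
  assumes A: "A \<subseteq> ball 0 R" "A \<in> sets borel" and B: "B \<subseteq> ball 0 R" "B \<in> sets borel"
    and C: "C \<subseteq> ball 0 R" "C \<in> sets borel" and R: "R > 0" and e: "norm e = 1"
  shows "riesz A B C \<le> riesz (steiner e A) (steiner e B) (steiner e C)"
proof -
  have "riesz (fib e A x) (fib e B y) (fib e C (x + y)) \<le> 
     riesz (fib e (steiner e A) x) (fib e (steiner e B) y) (fib e (steiner e C) (x + y))" for x y
  proof -
    have "riesz (fib e A x) (fib e B y) (fib e C (x + y)) \<le> 
      riesz (cint (flen e A x)) (cint (flen e B y)) (cint (flen e C (x + y)))"
      by (rule riesz_sobolev_real)
        (auto simp: fib_sets A B C fib_bounded(1)[OF A(1) R e A(2)] fib_bounded(1)[OF B(1) R e B(2)] fib_bounded(1)[OF C(1) R e C(2)], auto simp: flen_def)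
    also have "\<dots> = riesz (fib e (steiner e A) x) (fib e (steiner e B) y) (fib e (steiner e C) (x + y))"
      unfolding fib_steiner[OF A(2) e] fib_steiner[OF B(2) e] fib_steiner[OF C(2) e] cint_translate inner_add_left
      by (rule riesz_translate[symmetric]) auto
    finally show ?thesis .
  qed
  then show ?thesis
    unfolding riesz_via_fib[OF A(2) B(2) C(2) e] riesz_via_fib[OF steiner_sets[OF A(2)] steiner_sets[OF B(2)] steiner_sets[OF C(2)] e]
    by (intro nn_integral_mono mult_left_mono) auto
qed

section \<open>Decrease of the distance to the ball under Steiner symmetrization\<close>

lemma fib_Diff: "fib e (A - B) x = fib e A x - fib e B x" by (auto simp: fib_def)

lemma centered_diff_emeasure_le:
  fixes p :: real
  assumes "a \<ge> 0" "b \<ge> 0"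
  shows "vol ({t. \<bar>p + t\<bar> < a} - {t. \<bar>p + t\<bar> < b}) \<le> ennreal (max 0 (2 * a - 2 * b))"
proof (cases "b \<le> a")
  case True
  have "vol ({t. \<bar>p + t\<bar> < a} - {t. \<bar>p + t\<bar> < b}) = vol {t. \<bar>p + t\<bar> < a} - vol {t. \<bar>p + t\<bar> < b}"
    using True by (intro emeasure_Diff) (auto simp: emeasure_centered)
  also have "\<dots> = ennreal (2 * a - 2 * b)"
    unfolding emeasure_centered using assms True by (simp add: ennreal_minus max_def)
  finally show ?thesis using True by (simp add: max_def)
next
  case False
  then have "{t. \<bar>p + t\<bar> < a} - {t. \<bar>p + t\<bar> < b} = {}" by auto
  then show ?thesis by (simp only: emeasure_empty zero_le)
qed

text \<open>On a line let \<open>p\<close> and \<open>q\<close> be the lengths of the fibres of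
  \<open>A - ball 0 r\<close> and of \<open>ball 0 r - A\<close>. Symmetrization makes the fibres of
  \<open>A\<close> and of the ball concentric, so only the excess \<open>max 0 (p - q)\<close>
  survives and \<open>min p q\<close> is gained. Since both lengths are at most
  \<open>2 * R\<close>, the gain is at least \<open>p * q / (2 * R)\<close>, whose integral counts
  the pairs of points joined in direction \<open>e\<close>.\<close>

lemma steiner_deficit:
  assumes A: "A \<subseteq> ball 0 R" "A \<in> sets borel" and R: "R > 0" and r: "r \<le> R" and e: "norm e = 1"
  shows "vol (steiner e A - ball 0 r) + 
     ennreal (1 / (2 * R)) * (\<J> y. \<J> t. indicator (A - ball 0 r) y * indicator (ball 0 r - A) (y + t *\<^sub>R e))
    \<le> vol (A - ball 0 r)"
proof -
  note [measurable] = A(2)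
  define B where "B = ball (0::'a) r"
  have [measurable]: "B \<in> sets borel" by (simp add: B_def)
  have B: "B \<subseteq> ball 0 R" using r by (auto simp: B_def)
  define P Q where "P = A - B" and "Q = B - A"
  have [measurable]: "P \<in> sets borel" "Q \<in> sets borel" by (auto simp: P_def Q_def)
  have PR: "P \<subseteq> ball 0 R" "Q \<subseteq> ball 0 R" using A(1) B by (auto simp: P_def Q_def)
  have "(\<J> y. \<J> t. indicator P y * indicator Q (y + t *\<^sub>R e)) = 
     (\<J> x. \<J> s. indicator (slab e) x * (\<J> t. indicator P (x + s *\<^sub>R e) * indicator Q (x + s *\<^sub>R e + t *\<^sub>R e)))"
    by (rule slab_fubini[OF _ e, folded slab_def]) measurable
  also have "\<dots> = (\<J> x. indicator (slab e) x * (vol (fib e P x) * vol (fib e Q x)))"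
  proof (rule nn_integral_cong)
    fix x
    have 1: "(\<J> t. indicator P (x + s *\<^sub>R e) * indicator Q (x + s *\<^sub>R e + t *\<^sub>R e)) = 
       indicator (fib e P x) s * vol (fib e Q x)" for s
    proof -
      have "(\<J> t. indicator P (x + s *\<^sub>R e) * indicator Q (x + s *\<^sub>R e + t *\<^sub>R e)) = 
       indicator (fib e P x) s * vol (fib e Q (x + s *\<^sub>R e))"
        by (subst nn_integral_cmult) (auto simp: indicator_fib[symmetric])
      then show ?thesis by (simp add: emeasure_fib_shift)
    qed
    show "(\<J> s. indicator (slab e) x * (\<J> t. indicator P (x + s *\<^sub>R e) * indicator Q (x + s *\<^sub>R e + t *\<^sub>R e))) = 
      indicator (slab e) x * (vol (fib e P x) * vol (fib e Q x))"
      unfolding 1 by (simp add: nn_integral_cmult nn_integral_multc)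
  qed
  finally have PQ: "(\<J> y. \<J> t. indicator P y * indicator Q (y + t *\<^sub>R e)) = 
    (\<J> x. indicator (slab e) x * (vol (fib e P x) * vol (fib e Q x)))" .
  have fibre: "vol (fib e (steiner e A - B) x) + ennreal (1 / (2 * R)) * (vol (fib e P x) * vol (fib e Q x))
      \<le> vol (fib e P x)" for x
  proof -
    define a b p q where "a = flen e A x" and "b = flen e B x" and "p = flen e P x" and "q = flen e Q x"
    have nn: "a \<ge> 0" "b \<ge> 0" "p \<ge> 0" "q \<ge> 0" by (auto simp: a_def b_def p_def q_def flen_def)
    have pq: "p \<le> 2 * R" "q \<le> 2 * R" unfolding p_def q_def
      by (rule fib_bounded(2)[OF _ R e], use PR in auto)+
    have em: "vol (fib e P x) = ennreal p" "vol (fib e Q x) = ennreal q"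
      unfolding p_def q_def by (rule fib_bounded(1)[OF _ R e], use PR in auto)+
    have fmA: "fib e A x \<in> fmeasurable lborel" "fib e B x \<in> fmeasurable lborel"
      by (rule fib_bounded(3)[OF _ R e], use A B in auto)+
    have ab: "a - b = p - q"
    proof -
      have "a = p + measure lborel (fib e A x \<inter> fib e B x)"
        using measurable_measure_Diff[OF fmA(1), of "fib e A x \<inter> fib e B x"] fmA
        by (simp add: a_def p_def P_def flen_def fib_Diff Diff_Int fmeasurableD)
      moreover have "b = q + measure lborel (fib e A x \<inter> fib e B x)"
        using measurable_measure_Diff[OF fmA(2), of "fib e A x \<inter> fib e B x"] fmA
        by (simp add: b_def q_def Q_def flen_def fib_Diff Diff_Int fmeasurableD)
      ultimately show ?thesis by simp
    qed
    define \<rho> where "\<rho> = (if r > 0 then sqrt (max 0 (r\<^sup>2 - ((norm x)\<^sup>2 - (x \<bullet> e)\<^sup>2))) else 0)"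
    have fB: "fib e B x = {t. \<bar>x \<bullet> e + t\<bar> < \<rho>}" unfolding B_def fib_ball[OF e] by (auto simp: \<rho>_def)
    have \<rho>: "\<rho> \<ge> 0" by (simp add: \<rho>_def)
    have "b = 2 * \<rho>" using \<rho> unfolding b_def flen_def measure_def fB emeasure_centered by (simp add: max_def)
    then have "vol (fib e (steiner e A - B) x) \<le> ennreal (max 0 (a - b))"
      unfolding fib_Diff fib_steiner[OF A(2) e] fB
      using centered_diff_emeasure_le[of "a / 2" \<rho> "x \<bullet> e"] nn \<rho> by (simp add: a_def)
    then have "vol (fib e (steiner e A - B) x) + ennreal (1 / (2 * R)) * (ennreal p * ennreal q) \<le> 
       ennreal (max 0 (p - q)) + ennreal (1 / (2 * R)) * (ennreal p * ennreal q)"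
      unfolding ab by (intro add_mono) auto
    also have "\<dots> = ennreal (max 0 (p - q) + 1 / (2 * R) * (p * q))"
    proof -
      have "ennreal (1 / (2 * R)) * (ennreal p * ennreal q) = ennreal (1 / (2 * R) * (p * q))"
        using nn R by (simp add: ennreal_mult[symmetric])
      then show ?thesis using nn R by (simp add: ennreal_plus)
    qed
    also have "\<dots> \<le> ennreal p"
    proof (intro ennreal_leI)
      have "p * q \<le> 2 * R * q" "p * q \<le> p * (2 * R)" using pq nn by (auto intro!: mult_left_mono mult_right_mono)
      then have "1 / (2 * R) * (p * q) \<le> q" "1 / (2 * R) * (p * q) \<le> p" using R by (auto simp: field_simps)
      then show "max 0 (p - q) + 1 / (2 * R) * (p * q) \<le> p" by (simp add: max_def)
    qed
    finally show ?thesis unfolding em .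
  qed
  have "vol (steiner e A - B) + ennreal (1 / (2 * R)) * (\<J> y. \<J> t. indicator P y * indicator Q (y + t *\<^sub>R e))
    = (\<J> x. indicator (slab e) x * (vol (fib e (steiner e A - B) x) + ennreal (1 / (2 * R)) * (vol (fib e P x) * vol (fib e Q x))))"
  proof -
    have m [measurable]: "(\<lambda>x. vol (fib e X x)) \<in> Borel" if [measurable]: "X \<in> sets borel" for X
    proof -
      have "(\<lambda>x. vol (fib e X x)) = (\<lambda>x. \<J> t. indicator X (x + t *\<^sub>R e))"
        by (simp add: indicator_fib[symmetric])
      also have "\<dots> \<in> Borel" by measurable
      finally show ?thesis .
    qed
    have d: "steiner e A - B \<in> sets borel" by measurable
    note m' = m[OF d] m[of P] m[of Q]
    show ?thesis unfolding PQ emeasure_via_fib[OF d e]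
      using m' by (subst nn_integral_cmult[symmetric], measurable, subst nn_integral_add[symmetric])
        (auto simp: distrib_left mult.left_commute)
  qed
  also have "\<dots> \<le> (\<J> x. indicator (slab e) x * vol (fib e P x))"
    by (intro nn_integral_mono mult_left_mono fibre) auto
  also have "\<dots> = vol P" by (rule emeasure_via_fib[symmetric]) (auto simp: e)
  finally show ?thesis by (simp add: P_def Q_def B_def)
qed

text \<open>Substitute \<open>z = y + t *\<^sub>R v\<close> for fixed \<open>t\<close>. If
  \<open>y\<close> and \<open>z\<close> have distance \<open>\<rho> \<le> 2 * R\<close>, then for
  positive \<open>t\<close> the vector \<open>(1/t) *\<^sub>R (z - y)\<close> lies in the annulus
  exactly on an interval of length \<open>\<rho> / 2\<close>, where the Jacobian factor
  \<open>(1/t) ^ DIM('a)\<close> is at least \<open>(1/\<rho>) ^ DIM('a)\<close>. Each pair thus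
  contributes at least \<open>(1/\<rho>) ^ (DIM('a) - 1) / 2\<close>. An annulus of directions in
  place of the sphere keeps the average within Lebesgue measure.\<close>

lemma annulus_average:
  fixes P Q :: "'a::euclidean_space set"
  assumes P: "P \<subseteq> ball 0 R" and Q: "Q \<subseteq> ball 0 R" and d: "P \<inter> Q = {}"
    and [measurable]: "P \<in> sets borel" "Q \<in> sets borel"
  shows "ennreal ((1 / (2 * R)) ^ (DIM('a) - 1) / 2) * (vol P * vol Q) \<le>
    (\<J> v. indicator (ball 0 2 - ball 0 1) v * (\<J> y. \<J> t. indicator P y * indicator Q (y + t *\<^sub>R v)))"
proof -
  let ?k = "(1 / (2 * R)) ^ (DIM('a) - 1) / 2"
  define N where "N = ball (0::'a) 2 - ball 0 1"
  have [measurable]: "N \<in> sets borel" by (simp add: N_def)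
  have inner: "ennreal ?k * (indicator P y * vol Q) \<le> (\<J> t. \<J> v. indicator N v * (indicator P y * indicator Q (y + t *\<^sub>R v)))" for y
  proof (cases "y \<in> P")
    case False then show ?thesis by simp
  next
    case True
    have "ennreal ?k * (indicator P y * vol Q) = (\<J> z. ennreal ?k * indicator Q z)"
      using True by (simp add: nn_integral_cmult)
    also have "\<dots> \<le> (\<J> z. \<J> t. indicator {0<..} t * (ennreal ((1/t) ^ DIM('a)) * (indicator N ((1/t) *\<^sub>R (z - y)) * indicator Q z)))"
    proof (rule nn_integral_mono)
      fix z
      show "ennreal ?k * indicator Q z \<le> (\<J> t. indicator {0<..} t * (ennreal ((1/t) ^ DIM('a)) * (indicator N ((1/t) *\<^sub>R (z - y)) * indicator Q z)))"
      proof (cases "z \<in> Q")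
        case zQ: True
        define \<rho> where "\<rho> = norm (z - y)"
        have "z \<noteq> y" using zQ True d by auto
        then have \<rho>0: "\<rho> > 0" by (simp add: \<rho>_def)
        have "norm z < R" "norm y < R" using zQ True P Q by auto
        then have \<rho>R: "\<rho> \<le> 2 * R" unfolding \<rho>_def using norm_triangle_ineq4[of z y] by linarith
        have R: "R > 0" using \<rho>0 \<rho>R by simp
        have "?k \<le> (1/\<rho>) ^ (DIM('a) - 1) / 2"
          using \<rho>0 \<rho>R R by (intro divide_right_mono power_mono) (auto simp: divide_simps)
        also have "(1/\<rho>) ^ (DIM('a) - 1) / 2 = (1/\<rho>) ^ DIM('a) * (\<rho> / 2)"
          using \<rho>0 by (cases "DIM('a)") (auto simp: field_simps)
        finally have "ennreal ?k \<le> ennreal ((1/\<rho>) ^ DIM('a) * (\<rho> / 2))" by (rule ennreal_leI)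
        also have "\<dots> = (\<J> t. ennreal ((1/\<rho>) ^ DIM('a)) * indicator {\<rho>/2<..\<rho>} t)"
          using \<rho>0 by (subst nn_integral_cmult_indicator) (auto simp: ennreal_mult[symmetric] ennreal_mult'')
        also have "\<dots> \<le> (\<J> t. indicator {0<..} t * (ennreal ((1/t) ^ DIM('a)) * (indicator N ((1/t) *\<^sub>R (z - y)) * indicator Q z)))"
        proof (rule nn_integral_mono)
          fix t
          show "ennreal ((1/\<rho>) ^ DIM('a)) * indicator {\<rho>/2<..\<rho>} t \<le> indicator {0<..} t * (ennreal ((1/t) ^ DIM('a)) * (indicator N ((1/t) *\<^sub>R (z - y)) * indicator Q z))"
          proof (cases "t \<in> {\<rho>/2<..\<rho>}")
            case t: True
            then have t0: "t > 0" using \<rho>0 by auto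
            have n: "norm ((1/t) *\<^sub>R (z - y)) = \<rho> / t" using t0 by (simp add: \<rho>_def)
            have "\<rho> / t < 2" "1 \<le> \<rho> / t" using t t0 by (auto simp: divide_simps)
            then have "(1/t) *\<^sub>R (z - y) \<in> N" unfolding N_def Diff_iff mem_ball_0 n by simp
            moreover have "(1/\<rho>) ^ DIM('a) \<le> (1/t) ^ DIM('a)" using t t0 \<rho>0 by (intro power_mono) (auto simp: divide_simps)
            ultimately show ?thesis using t t0 zQ by (simp add: ennreal_leI)
          qed simp
        qed
        finally show ?thesis using zQ by simp
      qed simp
    qed
    also have "\<dots> = (\<J> t. \<J> z. indicator {0<..} t * (ennreal ((1/t) ^ DIM('a)) * (indicator N ((1/t) *\<^sub>R (z - y)) * indicator Q z)))"
      by (rule lborel_swap) measurable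
    also have "\<dots> \<le> (\<J> t. \<J> v. indicator N v * (indicator P y * indicator Q (y + t *\<^sub>R v)))"
    proof (rule nn_integral_mono)
      fix t :: real
      show "(\<J> z. indicator {0<..} t * (ennreal ((1/t) ^ DIM('a)) * (indicator N ((1/t) *\<^sub>R (z - y)) * indicator Q z)))
         \<le> (\<J> v. indicator N v * (indicator P y * indicator Q (y + t *\<^sub>R v)))"
      proof (cases "t > 0")
        case t: True
        have "(\<J> z. indicator N ((1/t) *\<^sub>R (z - y)) * indicator Q z) = 
          ennreal (\<bar>t\<bar> ^ DIM('a)) * (\<J> v. indicator N ((1/t) *\<^sub>R (y + t *\<^sub>R v - y)) * indicator Q (y + t *\<^sub>R v))"
          using t by (intro lborel_nn_integral_affine) auto
        also have "\<dots> = ennreal (t ^ DIM('a)) * (\<J> v. indicator N v * (indicator P y * indicator Q (y + t *\<^sub>R v)))"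
          using t True by simp
        finally have eq: "(\<J> z. indicator N ((1/t) *\<^sub>R (z - y)) * indicator Q z) = 
          ennreal (t ^ DIM('a)) * (\<J> v. indicator N v * (indicator P y * indicator Q (y + t *\<^sub>R v)))" .
        have "(\<J> z. indicator {0<..} t * (ennreal ((1/t) ^ DIM('a)) * (indicator N ((1/t) *\<^sub>R (z - y)) * indicator Q z)))
           = ennreal ((1/t) ^ DIM('a)) * (\<J> z. indicator N ((1/t) *\<^sub>R (z - y)) * indicator Q z)"
          using t by (simp add: nn_integral_cmult)
        also have "\<dots> = ennreal ((1/t) ^ DIM('a) * t ^ DIM('a)) * (\<J> v. indicator N v * (indicator P y * indicator Q (y + t *\<^sub>R v)))"
          unfolding eq using t by (simp add: ennreal_mult mult.assoc)
        also have "(1/t) ^ DIM('a) * t ^ DIM('a) = 1" using t by (simp add: power_mult_distrib[symmetric])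
        finally show ?thesis by simp
      qed simp
    qed
    finally show ?thesis .
  qed
  have "ennreal ?k * (vol P * vol Q) = (\<J> y. ennreal ?k * (indicator P y * vol Q))"
    by (simp add: nn_integral_cmult nn_integral_multc)
  also have "\<dots> \<le> (\<J> y. \<J> t. \<J> v. indicator N v * (indicator P y * indicator Q (y + t *\<^sub>R v)))"
    by (intro nn_integral_mono inner)
  also have "\<dots> = (\<J> y. \<J> v. \<J> t. indicator N v * (indicator P y * indicator Q (y + t *\<^sub>R v)))"
    by (intro nn_integral_cong lborel_swap) measurable
  also have "\<dots> = (\<J> v. \<J> y. \<J> t. indicator N v * (indicator P y * indicator Q (y + t *\<^sub>R v)))"
    by (rule lborel_swap) measurable
  also have "\<dots> = (\<J> v. indicator N v * (\<J> y. \<J> t. indicator P y * indicator Q (y + t *\<^sub>R v)))"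
    by (simp add: nn_integral_cmult)
  finally show ?thesis by (simp add: N_def)
qed

definition cross_lines :: "'a::euclidean_space \<Rightarrow> 'a set \<Rightarrow> 'a set \<Rightarrow> ennreal" where
  "cross_lines e P Q = (\<J> y. \<J> t. indicator P y * indicator Q (y + t *\<^sub>R e))"

text \<open>If every vector of the annulus fell below the average, integration would contradict
  \<open>annulus_average\<close>. Normalising the vector found to length 1 multiplies the line
  integrals by its norm, which is at least 1. One direction serves three pairs at once, because the
  three sets of the Riesz form are symmetrized together.\<close>

lemma good_direction:
  fixes R :: real
  assumes "R > 0"
  shows "\<exists>\<kappa>>0. \<forall>P Q :: nat \<Rightarrow> 'a::euclidean_space set. (\<forall>i<3. P i \<subseteq> ball 0 R \<and> Q i \<subseteq> ball 0 R \<and> P i \<inter> Q i = {} \<and> P i \<in> sets borel \<and> Q i \<in> sets borel)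
     \<longrightarrow> (\<exists>e. norm e = 1 \<and> ennreal \<kappa> * (\<Sum>i<3. vol (P i) * vol (Q i)) \<le> (\<Sum>i<3. cross_lines e (P i) (Q i)))"
proof -
  define k where "k = (1 / (2 * R)) ^ (DIM('a) - 1) / 2"
  have k: "k > 0" using assms by (simp add: k_def)
  define N where "N = ball (0::'a) 2 - ball 0 1"
  have [measurable]: "N \<in> sets borel" by (simp add: N_def)
  define V where "V = measure lborel (ball (0::'a) 2)"
  have V: "V > 0" by (simp add: V_def content_ball_pos)
  have NV: "vol N \<le> ennreal V"
  proof -
    have "vol N \<le> vol (ball (0::'a) 2)" by (intro emeasure_mono) (auto simp: N_def)
    also have "\<dots> = ennreal V" unfolding V_def
      using emeasure_lborel_ball_finite[of "0::'a" 2] by (intro emeasure_eq_ennreal_measure) auto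
    finally show ?thesis .
  qed
  \<comment> \<open>\<open>V\<close> bounds the measure of the annulus; the additional 2 makes the
    contradiction strict, \<open>k * S\<close> against \<open>k / 2 * S\<close>.\<close>
  define \<kappa> where "\<kappa> = k / (2 * V)"
  have \<kappa>: "\<kappa> > 0" using k V by (simp add: \<kappa>_def)
  show ?thesis
  proof (intro exI[of _ \<kappa>] conjI allI impI \<kappa>)
    fix P Q :: "nat \<Rightarrow> 'a set"
    assume PQ: "\<forall>i<3. P i \<subseteq> ball 0 R \<and> Q i \<subseteq> ball 0 R \<and> P i \<inter> Q i = {} \<and> P i \<in> sets borel \<and> Q i \<in> sets borel"
    have [measurable]: "P i \<in> sets borel" "Q i \<in> sets borel" if "i < 3" for i using PQ that by auto
    define S where "S = (\<Sum>i<3. vol (P i) * vol (Q i))"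
    have Sfin: "S < \<infinity>"
    proof -
      have "vol X < \<infinity>" if "X \<subseteq> ball 0 R" for X :: "'a set"
        using emeasure_mono[OF that, of lborel] emeasure_lborel_ball_finite[of "0::'a" R] by (auto intro: order_le_less_trans)
      then show ?thesis unfolding S_def using PQ by (auto simp: ennreal_mult_less_top)
    qed
    have scale: "cross_lines v X Y \<le> cross_lines ((1 / norm v) *\<^sub>R v) X Y" if "v \<in> N" and [measurable]: "X \<in> sets borel" "Y \<in> sets borel" for v :: 'a and X Y
    proof -
      have n: "norm v \<ge> 1" using that by (auto simp: N_def)
      show ?thesis unfolding cross_lines_def
      proof (rule nn_integral_mono)
        fix y
        have "(\<J> t. indicator X y * indicator Y (y + t *\<^sub>R ((1 / norm v) *\<^sub>R v))) = 
           ennreal (norm v) * (\<J> t. indicator X y * indicator Y (y + t *\<^sub>R v))"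
          using lborel_nn_integral_affine[of "\<lambda>t::real. indicator X y * indicator Y (y + t *\<^sub>R ((1 / norm v) *\<^sub>R v))" "norm v" 0] n
          by (cases "norm v = 0") (auto simp: mult.commute)
        moreover have "1 * (\<J> t. indicator X y * indicator Y (y + t *\<^sub>R v)) \<le> ennreal (norm v) * (\<J> t. indicator X y * indicator Y (y + t *\<^sub>R v))"
          using n by (intro mult_right_mono) auto
        ultimately show "(\<J> t. indicator X y * indicator Y (y + t *\<^sub>R v)) \<le> (\<J> t. indicator X y * indicator Y (y + t *\<^sub>R ((1 / norm v) *\<^sub>R v)))"
          by simp
      qed
    qed
    show "\<exists>e. norm e = 1 \<and> ennreal \<kappa> * (\<Sum>i<3. vol (P i) * vol (Q i)) \<le> (\<Sum>i<3. cross_lines e (P i) (Q i))"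
    proof (cases "S = 0")
      case True
      obtain b :: 'a where "b \<in> Basis" using nonempty_Basis by blast
      then show ?thesis unfolding S_def[symmetric] True by (intro exI[of _ b]) simp
    next
      case False
      have "\<exists>v\<in>N. ennreal \<kappa> * S \<le> (\<Sum>i<3. cross_lines v (P i) (Q i))"
      proof (rule ccontr)
        assume "\<not> ?thesis"
        then have less: "(\<Sum>i<3. cross_lines v (P i) (Q i)) \<le> ennreal \<kappa> * S" if "v \<in> N" for v using that by force
        have "ennreal k * S = (\<Sum>i<3. ennreal k * (vol (P i) * vol (Q i)))"
          by (simp add: S_def sum_distrib_left)
        also have "\<dots> \<le> (\<Sum>i<3. \<J> v. indicator N v * cross_lines v (P i) (Q i))"
          unfolding cross_lines_def k_def N_def by (intro sum_mono annulus_average) (use PQ in auto)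
        also have "\<dots> = (\<J> v. (\<Sum>i<3. indicator N v * cross_lines v (P i) (Q i)))"
          unfolding cross_lines_def by (intro nn_integral_sum[symmetric]) (simp, measurable)
        also have "\<dots> \<le> (\<J> v. (ennreal \<kappa> * S) * indicator N v)"
          using less by (intro nn_integral_mono) (auto simp: sum_distrib_left[symmetric] indicator_def)
        also have "\<dots> = (ennreal \<kappa> * S) * vol N" by (rule nn_integral_cmult_indicator) simp
        also have "\<dots> \<le> (ennreal \<kappa> * S) * ennreal V" by (intro mult_left_mono NV) auto
        also have "\<dots> = ennreal (\<kappa> * V) * S" using \<kappa> V by (simp add: ennreal_mult mult_ac)
        also have "\<kappa> * V = k / 2" using V by (simp add: \<kappa>_def)
        finally have "ennreal k * S \<le> ennreal (k / 2) * S" .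
        moreover obtain s where s: "S = ennreal s" "s \<ge> 0" using Sfin by (cases S) auto
        ultimately have "k * s \<le> k / 2 * s" using k by (simp add: ennreal_mult[symmetric])
        moreover have "s > 0" using False s by auto
        ultimately show False using k by simp
      qed
      then obtain v where v: "v \<in> N" "ennreal \<kappa> * S \<le> (\<Sum>i<3. cross_lines v (P i) (Q i))" by blast
      have "(\<Sum>i<3. cross_lines v (P i) (Q i)) \<le> (\<Sum>i<3. cross_lines ((1 / norm v) *\<^sub>R v) (P i) (Q i))"
        by (intro sum_mono scale v) auto
      moreover have "norm ((1 / norm v) *\<^sub>R v) = 1" using v(1) by (auto simp: N_def)
      ultimately show ?thesis using v(2) unfolding S_def by (blast intro: order_trans)
    qed
  qed
qed

section \<open>From Steiner symmetrization to balls\<close>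

definition brad :: "'a::euclidean_space set \<Rightarrow> real" where
  "brad A = root DIM('a) (measure lborel A / unit_ball_vol (real DIM('a)))"

text \<open>For a set of infinite measure \<open>measure\<close> is 0 and the ball is empty;
  equality of the two measures therefore comes with a finiteness hypothesis.\<close>

definition sball :: "'a::euclidean_space set \<Rightarrow> 'a set" where "sball A = ball 0 (brad A)"

lemma sball_sets [measurable]: "sball A \<in> sets borel" by (simp add: sball_def)

lemma brad_nonneg: "brad A \<ge> 0" by (simp add: brad_def)

lemma emeasure_sball:
  fixes A :: "'a::euclidean_space set"
  assumes "vol A < \<infinity>" shows "vol (sball A) = vol A"
proof -
  have "brad A ^ DIM('a) = measure lborel A / unit_ball_vol (real DIM('a))"
    unfolding brad_def by (simp add: real_root_pow_pos2)
  then have "vol (sball A) = ennreal (measure lborel A)"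
    unfolding sball_def emeasure_ball[OF brad_nonneg]
    using unit_ball_vol_pos[OF of_nat_0_le_iff, of "DIM('a)"] by (simp del: unit_ball_vol_pos)
  with assms show ?thesis by (simp add: emeasure_eq_ennreal_measure)
qed

lemma brad_le:
  fixes A :: "'a::euclidean_space set"
  assumes "A \<subseteq> ball 0 R" "R > 0" shows "brad A \<le> R"
proof -
  have "measure lborel A \<le> measure lborel (ball (0::'a) R)"
  proof (cases "A \<in> sets borel")
    case True then show ?thesis using assms emeasure_lborel_ball_finite[of "0::'a" R]
      by (intro measure_mono_fmeasurable) (auto intro!: fmeasurableI)
  qed (simp add: measure_notin_sets)
  also have "\<dots> = unit_ball_vol (real DIM('a)) * R ^ DIM('a)" using assms by (simp add: content_ball)
  finally have "measure lborel A / unit_ball_vol (real DIM('a)) \<le> R ^ DIM('a)"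
    using unit_ball_vol_pos[of "real DIM('a)"] by (simp add: field_simps)
  then have "brad A \<le> root DIM('a) (R ^ DIM('a))" unfolding brad_def by (intro real_root_le_mono) auto
  then show ?thesis using assms by (simp add: real_root_power_cancel)
qed

text \<open>The sets are exchanged one at a time; the loss in each exchange is a Riesz form with a
  difference set in it, bounded by a product of two measures.\<close>

lemma riesz_perturb:
  assumes m: "A \<in> sets borel" "B \<in> sets borel" "C \<in> sets borel" "A' \<in> sets borel" "B' \<in> sets borel" "C' \<in> sets borel"
  shows "riesz A B C \<le> riesz A' B' C' + (vol (A - A') * vol B + 
     (vol A' * vol (B - B') + vol A' * vol (C - C')))"
proof -
  have a: "riesz A B C \<le> riesz A' B C + riesz (A - A') B C"
    by (subst riesz_Un1[symmetric]) (use m in \<open>auto intro!: riesz_mono\<close>)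
  have b: "riesz A' B C \<le> riesz A' B' C + riesz A' (B - B') C"
    by (subst riesz_Un2[symmetric]) (use m in \<open>auto intro!: riesz_mono\<close>)
  have c: "riesz A' B' C \<le> riesz A' B' C' + riesz A' B' (C - C')"
    by (subst riesz_Un3[symmetric]) (use m in \<open>auto intro!: riesz_mono\<close>)
  have "riesz A B C \<le> riesz A' B' C' + riesz A' B' (C - C') + riesz A' (B - B') C + riesz (A - A') B C"
    by (rule order_trans[OF a add_right_mono[OF order_trans[OF b add_right_mono[OF c]]]])
  also have "\<dots> \<le> riesz A' B' C' + vol A' * vol (C - C') + vol A' * vol (B - B') + vol (A - A') * vol B"
    by (intro add_mono order_refl riesz_le) (use m in auto)
  finally show ?thesis by (simp only: ac_simps)
qed

text \<open>\<open>D\<close> measures how far three sets protrude from their balls, and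
  \<open>K\<close> collects the admissible triples: same measures, same bounding ball, Riesz form
  not smaller. A Steiner step stays in \<open>K\<close> and lowers \<open>D\<close> by at least
  \<open>\<eta> * ((D X)\<^sup>2 / 3)\<close>, so a positive infimum could be undercut. Triples with
  arbitrarily small \<open>D\<close> then compare the original form with that of the balls.\<close>

lemma riesz_sobolev_bounded:
  fixes A :: "nat \<Rightarrow> 'a::euclidean_space set"
  assumes A: "\<And>i. i < 3 \<Longrightarrow> A i \<subseteq> ball 0 R" "\<And>i. i < 3 \<Longrightarrow> A i \<in> sets borel" and R: "R > 0"
  shows "riesz (A 0) (A 1) (A 2) \<le> riesz (sball (A 0)) (sball (A 1)) (sball (A 2))"
proof -
  have fin: "vol X < \<infinity>" if "X \<subseteq> ball 0 R" for X :: "'a set"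
    using emeasure_mono[OF that, of lborel] emeasure_lborel_ball_finite[of "0::'a" R] by (auto intro: order_le_less_trans)
  have fm: "X \<in> fmeasurable lborel" if "X \<subseteq> ball 0 R" "X \<in> sets borel" for X :: "'a set"
    using fin[OF that(1)] that(2) by (intro fmeasurableI) auto
  define b where "b i = sball (A i)" for i
  have [measurable]: "b i \<in> sets borel" for i by (simp add: b_def)
  have bR: "b i \<subseteq> ball 0 R" if "i < 3" for i using brad_le[OF A(1)[OF that] R] by (auto simp: b_def sball_def)
  have be: "vol (b i) = vol (A i)" if "i < 3" for i
    unfolding b_def by (rule emeasure_sball) (use A fin that in auto)
  define K where "K X \<longleftrightarrow> (\<forall>i<3. X i \<subseteq> ball 0 R \<and> X i \<in> sets borel \<and> vol (X i) = vol (A i))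
     \<and> riesz (A 0) (A 1) (A 2) \<le> riesz (X 0) (X 1) (X 2)" for X :: "nat \<Rightarrow> 'a set"
  define D where "D X = (\<Sum>i<3. measure lborel (X i - b i))" for X
  have KA: "K A" using A by (simp add: K_def)
  have D0: "D X \<ge> 0" for X by (simp add: D_def sum_nonneg)
  obtain \<kappa> where \<kappa>: "\<kappa> > 0" and good: "\<forall>P Q :: nat \<Rightarrow> 'a set. (\<forall>i<3. P i \<subseteq> ball 0 R \<and> Q i \<subseteq> ball 0 R \<and> P i \<inter> Q i = {} \<and> P i \<in> sets borel \<and> Q i \<in> sets borel)
     \<longrightarrow> (\<exists>e. norm e = 1 \<and> ennreal \<kappa> * (\<Sum>i<3. vol (P i) * vol (Q i)) \<le> (\<Sum>i<3. cross_lines e (P i) (Q i)))"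
    using good_direction[OF R, where 'a = 'a] by (elim exE conjE)
  define \<eta> where "\<eta> = \<kappa> / (2 * R)"
  have \<eta>: "\<eta> > 0" using \<kappa> R by (simp add: \<eta>_def)
  have step: "\<exists>X'. K X' \<and> D X' \<le> D X - \<eta> * ((D X)\<^sup>2 / 3)" if KX: "K X" for X
  proof -
    have X: "X i \<subseteq> ball 0 R" "X i \<in> sets borel" "vol (X i) = vol (A i)" if "i < 3" for i
      using KX that by (auto simp: K_def)
    have "\<forall>i<3. X i - b i \<subseteq> ball 0 R \<and> b i - X i \<subseteq> ball 0 R \<and> (X i - b i) \<inter> (b i - X i) = {} \<and> X i - b i \<in> sets borel \<and> b i - X i \<in> sets borel"
    proof (intro allI impI)
      fix i :: nat assume i: "i < 3"
      show "X i - b i \<subseteq> ball 0 R \<and> b i - X i \<subseteq> ball 0 R \<and> (X i - b i) \<inter> (b i - X i) = {} \<and> X i - b i \<in> sets borel \<and> b i - X i \<in> sets borel"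
        using X(1,2)[OF i] bR[OF i] by (intro conjI; (blast | simp))
    qed
    with good[rule_format, of "\<lambda>i. X i - b i" "\<lambda>i. b i - X i"]
    obtain e where e: "norm e = 1" and cl: "ennreal \<kappa> * (\<Sum>i<3. vol (X i - b i) * vol (b i - X i)) \<le> (\<Sum>i<3. cross_lines e (X i - b i) (b i - X i))"
      by blast
    define X' where "X' i = steiner e (X i)" for i
    have X': "X' i \<subseteq> ball 0 R" "X' i \<in> sets borel" "vol (X' i) = vol (A i)" if "i < 3" for i
      unfolding X'_def using steiner_subset_ball[OF X(1)[OF that] R e X(2)[OF that]] steiner_sets[OF X(2)[OF that]] 
        emeasure_steiner[OF X(1)[OF that] R e X(2)[OF that]] X(3)[OF that] by auto
    have "riesz (X 0) (X 1) (X 2) \<le> riesz (X' 0) (X' 1) (X' 2)"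
      unfolding X'_def by (rule riesz_steiner[OF X(1,2) X(1,2) X(1,2) R e]) auto
    with KX X' have KX': "K X'" unfolding K_def by (blast intro: order_trans)
    define m where "m i = measure lborel (X i - b i)" for i
    have em: "vol (X i - b i) = ennreal (m i)" "vol (b i - X i) = ennreal (m i)" 
       "vol (X' i - b i) = ennreal (measure lborel (X' i - b i))" if "i < 3" for i
    proof -
      note f = fm[OF X(1,2)[OF that]] fm[OF bR[OF that]]
      have "measure lborel (X i) = measure lborel (b i)" using X(3) be that by (simp add: measure_def)
      then have "measure lborel (b i - X i) = m i"
        using measurable_measure_Diff[OF f(1), of "X i \<inter> b i"] measurable_measure_Diff[OF f(2), of "X i \<inter> b i"] f
        by (simp add: m_def Diff_Int fmeasurableD)
      moreover have "vol Y = ennreal (measure lborel Y)" if "Y \<subseteq> ball 0 R" for Y :: "'a set"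
        using fin[OF that] by (intro emeasure_eq_ennreal_measure) auto
      moreover have "X i - b i \<subseteq> ball 0 R" "b i - X i \<subseteq> ball 0 R" "X' i - b i \<subseteq> ball 0 R"
        using X(1)[OF that] bR[OF that] X'(1)[OF that] by auto
      ultimately show "vol (X i - b i) = ennreal (m i)" "vol (b i - X i) = ennreal (m i)" 
       "vol (X' i - b i) = ennreal (measure lborel (X' i - b i))" by (auto simp: m_def)
    qed
    have m0: "m i \<ge> 0" for i by (simp add: m_def)
    have "ennreal (D X' + \<eta> * (\<Sum>i<3. (m i)\<^sup>2)) = (\<Sum>i<3. vol (X' i - b i)) + ennreal (1 / (2 * R)) * (ennreal \<kappa> * (\<Sum>i<3. vol (X i - b i) * vol (b i - X i)))"
    proof -
      have "(\<Sum>i<3. vol (X i - b i) * vol (b i - X i)) = (\<Sum>i<3. ennreal ((m i)\<^sup>2))"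
        by (intro sum.cong) (auto simp: em power2_eq_square ennreal_mult m0)
      also have "\<dots> = ennreal (\<Sum>i<3. (m i)\<^sup>2)" by (rule sum_ennreal) auto
      finally have 1: "(\<Sum>i<3. vol (X i - b i) * vol (b i - X i)) = ennreal (\<Sum>i<3. (m i)\<^sup>2)" .
      have "(\<Sum>i<3. vol (X' i - b i)) = (\<Sum>i<3. ennreal (measure lborel (X' i - b i)))"
        by (intro sum.cong) (auto simp: em)
      also have "\<dots> = ennreal (D X')" unfolding D_def by (rule sum_ennreal) auto
      finally have 2: "(\<Sum>i<3. vol (X' i - b i)) = ennreal (D X')" .
      have "ennreal (1 / (2 * R)) * (ennreal \<kappa> * ennreal (\<Sum>i<3. (m i)\<^sup>2)) = ennreal (1 / (2 * R) * (\<kappa> * (\<Sum>i<3. (m i)\<^sup>2)))"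
      proof -
        have "ennreal x * (ennreal y * ennreal z) = ennreal (x * (y * z))" if "x \<ge> 0" "y \<ge> 0" "z \<ge> 0" for x y z
          using that by (simp add: ennreal_mult[symmetric])
        then show ?thesis using R \<kappa> by (simp add: sum_nonneg)
      qed
      also have "1 / (2 * R) * (\<kappa> * (\<Sum>i<3. (m i)\<^sup>2)) = \<eta> * (\<Sum>i<3. (m i)\<^sup>2)" by (simp add: \<eta>_def)
      finally show ?thesis unfolding 1 2 using D0 \<eta> by (subst ennreal_plus) (auto simp: sum_nonneg)
    qed
    also have "\<dots> \<le> (\<Sum>i<3. vol (X' i - b i)) + ennreal (1 / (2 * R)) * (\<Sum>i<3. cross_lines e (X i - b i) (b i - X i))"
      by (intro add_left_mono mult_left_mono cl) auto
    also have "\<dots> = (\<Sum>i<3. vol (X' i - b i) + ennreal (1 / (2 * R)) * cross_lines e (X i - b i) (b i - X i))"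
      by (simp add: sum.distrib sum_distrib_left)
    also have "\<dots> \<le> (\<Sum>i<3. vol (X i - b i))"
    proof (intro sum_mono)
      fix i assume "i \<in> {..<3::nat}"
      then have i: "i < 3" by simp
      show "vol (X' i - b i) + ennreal (1 / (2 * R)) * cross_lines e (X i - b i) (b i - X i) \<le> vol (X i - b i)"
        unfolding X'_def cross_lines_def b_def sball_def
        by (rule steiner_deficit[OF X(1,2)[OF i] R brad_le[OF A(1)[OF i] R] e])
    qed
    also have "\<dots> = ennreal (D X)"
    proof -
      have "(\<Sum>i<3. vol (X i - b i)) = (\<Sum>i<3. ennreal (m i))" by (intro sum.cong) (auto simp: em)
      also have "\<dots> = ennreal (D X)" unfolding D_def m_def by (rule sum_ennreal) auto
      finally show ?thesis .
    qed
    finally have "D X' + \<eta> * (\<Sum>i<3. (m i)\<^sup>2) \<le> D X" using D0 by simp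
    \<comment> \<open>Cauchy-Schwarz for three terms: the gain is a sum of squares, while
      \<open>D\<close> is a plain sum.\<close>
    moreover have "(D X)\<^sup>2 / 3 \<le> (\<Sum>i<3. (m i)\<^sup>2)"
    proof -
      have "(x + y + z)\<^sup>2 \<le> 3 * (x\<^sup>2 + y\<^sup>2 + z\<^sup>2)" for x y z :: real
      proof -
        have "0 \<le> (x - y)\<^sup>2 + (y - z)\<^sup>2 + (x - z)\<^sup>2" by simp
        then show ?thesis by (simp add: power2_eq_square algebra_simps)
      qed
      from this[of "m 0" "m 1" "m 2"] show ?thesis
        by (simp add: D_def m_def[symmetric] numeral_3_eq_3 lessThan_Suc numeral_2_eq_2 add_ac)
    qed
    then have "\<eta> * ((D X)\<^sup>2 / 3) \<le> \<eta> * (\<Sum>i<3. (m i)\<^sup>2)" using \<eta> by (intro mult_left_mono) auto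
    ultimately show ?thesis using KX' by (intro exI[of _ X']) auto
  qed
  define \<delta> where "\<delta> = Inf (D ` Collect K)"
  have bdd: "bdd_below (D ` Collect K)" using D0 by (intro bdd_belowI[of _ 0]) auto
  have low: "\<delta> \<le> D X" if "K X" for X unfolding \<delta>_def using that bdd by (intro cInf_lower) auto
  have \<delta>0: "\<delta> \<ge> 0" unfolding \<delta>_def using KA D0 by (intro cInf_greatest) auto
  have "\<delta> = 0"
  proof (rule ccontr)
    assume "\<delta> \<noteq> 0"
    with \<delta>0 have pos: "\<delta> > 0" by simp
    \<comment> \<open>A triple this close to the infimum is pushed below it by one step, because its
      own \<open>D\<close> is at least \<open>\<delta>\<close>.\<close>
    then have "\<delta> < \<delta> + \<eta> * (\<delta>\<^sup>2 / 3)" using \<eta> by simp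
    then obtain X where X: "K X" "D X < \<delta> + \<eta> * (\<delta>\<^sup>2 / 3)"
      using cInf_lessD[of "D ` Collect K"] KA unfolding \<delta>_def by blast
    obtain X' where X': "K X'" "D X' \<le> D X - \<eta> * ((D X)\<^sup>2 / 3)" using step[OF X(1)] by blast
    have "\<delta>\<^sup>2 \<le> (D X)\<^sup>2" using low[OF X(1)] pos by (intro power_mono) auto
    then have "\<eta> * (\<delta>\<^sup>2 / 3) \<le> \<eta> * ((D X)\<^sup>2 / 3)" using \<eta> by (intro mult_left_mono) auto
    with X' X low[OF X'(1)] show False by linarith
  qed
  define M where "M = measure lborel (A 0) + measure lborel (A 1)"
  have M0: "M \<ge> 0" by (simp add: M_def)
  have emA: "vol (A i) = ennreal (measure lborel (A i))" if "i < 3" for i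
    using fin[OF A(1)[OF that]] by (intro emeasure_eq_ennreal_measure) auto
  show ?thesis
  proof (rule ennreal_le_epsilon)
    fix \<epsilon> :: real assume \<epsilon>: "\<epsilon> > 0"
    have "\<exists>X. K X \<and> D X < \<epsilon> / (M + 1)"
      using cInf_lessD[of "D ` Collect K" "\<epsilon> / (M + 1)"] KA \<open>\<delta> = 0\<close> M0 \<epsilon> unfolding \<delta>_def by auto
    then obtain X where KX: "K X" and DX: "D X < \<epsilon> / (M + 1)" by blast
    have X: "X i \<subseteq> ball 0 R" "X i \<in> sets borel" "vol (X i) = vol (A i)" if "i < 3" for i
      using KX that by (auto simp: K_def)
    define m where "m i = measure lborel (X i - b i)" for i
    have em: "vol (X i - b i) = ennreal (m i)" if "i < 3" for i
      unfolding m_def using X(1)[OF that] by (intro emeasure_eq_ennreal_measure less_imp_neq fin[unfolded infinity_ennreal_def]) auto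
    have m: "m i \<ge> 0" for i by (simp add: m_def)
    have Dm: "D X = m 0 + m 1 + m 2" by (simp add: D_def m_def numeral_3_eq_3 lessThan_Suc numeral_2_eq_2 add_ac)
    have "riesz (A 0) (A 1) (A 2) \<le> riesz (X 0) (X 1) (X 2)" using KX by (simp add: K_def)
    also have "\<dots> \<le> riesz (b 0) (b 1) (b 2) + (vol (X 0 - b 0) * vol (X 1) + 
     (vol (b 0) * vol (X 1 - b 1) + vol (b 0) * vol (X 2 - b 2)))"
      by (rule riesz_perturb) (use X in auto)
    also have "vol (X 0 - b 0) * vol (X 1) + 
     (vol (b 0) * vol (X 1 - b 1) + vol (b 0) * vol (X 2 - b 2)) = 
       ennreal (m 0 * measure lborel (A 1) + (measure lborel (A 0) * m 1 + measure lborel (A 0) * m 2))"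
      using m by (simp add: em be X emA ennreal_mult ennreal_plus)
    also have "\<dots> \<le> ennreal \<epsilon>"
    proof (intro ennreal_leI)
      have "m 0 * measure lborel (A 1) \<le> m 0 * M" "measure lborel (A 0) * m 1 \<le> M * m 1" "measure lborel (A 0) * m 2 \<le> M * m 2"
        using m by (auto simp: M_def intro!: mult_left_mono mult_right_mono)
      then have "m 0 * measure lborel (A 1) + (measure lborel (A 0) * m 1 + measure lborel (A 0) * m 2) \<le> M * D X"
        by (simp add: Dm algebra_simps)
      also have "\<dots> \<le> (M + 1) * D X" using D0[of X] by (simp add: algebra_simps)
      also have "\<dots> \<le> \<epsilon>" using DX M0 by (simp add: field_simps)
      finally show "m 0 * measure lborel (A 1) + (measure lborel (A 0) * m 1 + measure lborel (A 0) * m 2) \<le> \<epsilon>" .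
    qed
    finally show "riesz (A 0) (A 1) (A 2) \<le> riesz (sball (A 0)) (sball (A 1)) (sball (A 2)) + ennreal \<epsilon>"
      by (simp add: b_def add_left_mono)
  qed
qed

lemma riesz_sobolev:
  assumes "A \<subseteq> ball 0 R" "B \<subseteq> ball 0 R" "C \<subseteq> ball 0 R" "R > 0"
    "A \<in> sets borel" "B \<in> sets borel" "C \<in> sets borel"
  shows "riesz A B C \<le> riesz (sball A) (sball B) (sball C)"
  using riesz_sobolev_bounded[of "\<lambda>i. if i = 0 then A else if i = 1 then B else C" R] assms by simp

subsection \<open>Symmetric decreasing rearrangement and convolution\<close>

definition lv :: "('a::euclidean_space \<Rightarrow> ennreal) \<Rightarrow> real \<Rightarrow> 'a set" where
  "lv f t = {x. ennreal t < f x}"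

text \<open>\<open>ennreal\<close> sends negative reals to 0, so without \<open>0 < t\<close> the
  layers with negative \<open>t\<close> would count; with it the integral over the whole line is the
  layer-cake formula.\<close>

definition lay :: "('a::euclidean_space \<Rightarrow> ennreal) \<Rightarrow> real \<Rightarrow> 'a \<Rightarrow> ennreal" where
  "lay f t x = (if 0 < t \<and> ennreal t < f x then 1 else 0)"

lemma lv_sets [measurable]: "f \<in> Borel \<Longrightarrow> lv f t \<in> sets borel"
  unfolding lv_def by measurable

lemma lay_measurable [measurable (raw)]:
  assumes [measurable]: "f \<in> Borel" "g \<in> borel_measurable M" "h \<in> M \<rightarrow>\<^sub>M borel"
  shows "(\<lambda>x. lay f (g x) (h x)) \<in> borel_measurable M"
  unfolding lay_def by measurable

lemma lay_eq: "lay f t x = (if 0 < t then indicator (lv f t) x else 0)"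
  by (simp add: lay_def lv_def indicator_def)

lemma nn_integral_below: "(\<J> t. (if 0 < t \<and> ennreal t < c then 1 else 0)) = c"
proof (cases c)
  case (real r)
  have "(\<J> t. (if 0 < t \<and> ennreal t < c then 1 else 0)) = (\<J> t. indicator {0<..<r} t)"
    using real by (intro nn_integral_cong) (auto simp: indicator_def ennreal_less_iff)
  then show ?thesis using real by simp
next
  case top
  have "ennreal n \<le> (\<J> t. (if 0 < t \<and> ennreal t < c then 1 else 0))" for n
  proof -
    have "ennreal n \<le> (\<integral>\<^sup>+t. indicator {0<..max 0 n} t \<partial>(lborel::real measure))"
      by (simp add: ennreal_leI)
    also have "\<dots> \<le> (\<J> t. (if 0 < t \<and> ennreal t < c then 1 else 0))"
      using top by (intro nn_integral_mono) (auto simp: indicator_def)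
    finally show ?thesis .
  qed
  then show ?thesis using top ennreal_le_epsilon by (metis ennreal_Ex_less_of_nat ennreal_of_nat_eq_real_of_nat less_top linorder_not_le)
qed

lemma layer_cake: "f x = (\<J> t. lay f t x)"
  unfolding lay_def by (simp add: nn_integral_below)

lemma layer_cake_integral:
  assumes [measurable]: "f \<in> Borel" "w \<in> Borel"
  shows "(\<J> x. f x * w x) = (\<J> t. \<J> x. lay f t x * w x)"
proof -
  have "(\<J> x. f x * w x) = (\<J> x. \<J> t. lay f t x * w x)"
    by (subst layer_cake[of f]) (simp add: nn_integral_multc)
  also have "\<dots> = (\<J> t. \<J> x. lay f t x * w x)"
    by (rule lborel_swap) measurable
  finally show ?thesis .
qed

lemma emeasure_ball_strict_mono:
  assumes "0 \<le> r"
  shows "vol (ball (0::'a::euclidean_space) r) < vol (ball (0::'a) s) \<longleftrightarrow> r < s"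
proof (cases "s \<ge> 0")
  case True
  have "r ^ DIM('a) < s ^ DIM('a) \<longleftrightarrow> r < s" using assms True
    by (metis DIM_positive linorder_not_le power_mono power_strict_mono)
  then show ?thesis using assms True unit_ball_vol_pos[OF of_nat_0_le_iff, of "DIM('a)"]
    by (simp add: emeasure_ball ennreal_less_iff)
next
  case False
  then have "ball (0::'a) s = {}" by simp
  then have "vol (ball (0::'a) s) = 0" by (simp only: emeasure_empty)
  with False assms show ?thesis by simp
qed

text \<open>Membership of \<open>x\<close> in the centred ball with the volume of the level set is
  expressed by comparing volumes. This also makes sense for level sets of infinite measure, and it
  makes measurability in \<open>x\<close> and \<open>t\<close> visible.\<close>

definition star :: "('a::euclidean_space \<Rightarrow> ennreal) \<Rightarrow> 'a \<Rightarrow> ennreal" where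
  "star f x = (\<J> t. (if 0 < t \<and> vol (ball (0::'a) (norm x)) < vol (lv f t) then 1 else 0))"

lemma lv_antimono: "s \<le> t \<Longrightarrow> lv f t \<subseteq> lv f s"
  unfolding lv_def by (auto intro: le_less_trans ennreal_leI)

lemma lv_right_continuous: "lv f t = (\<Union>n. lv f (t + 1 / real (Suc n)))" if "t \<ge> 0"
proof (intro equalityI subsetI)
  fix x assume "x \<in> lv f t"
  then have "ennreal t < f x" by (simp add: lv_def)
  then obtain c where c: "ennreal t < c" "c < f x" using dense by blast
  then obtain s where s: "c = ennreal s" "s \<ge> 0" by (cases c) auto
  then have "t < s" using c that by (simp add: ennreal_less_iff)
  then obtain n where "1 / real (Suc n) < s - t" using nat_approx_posE[of "s - t"] by auto
  then have "ennreal (t + 1 / real (Suc n)) \<le> ennreal s" by (intro ennreal_leI) simp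
  from le_less_trans[OF this c(2)[unfolded s(1)]] have "x \<in> lv f (t + 1 / real (Suc n))"
    unfolding lv_def by (rule CollectI)
  then show "x \<in> (\<Union>n. lv f (t + 1 / real (Suc n)))" by blast
next
  fix x assume "x \<in> (\<Union>n. lv f (t + 1 / real (Suc n)))"
  then obtain n where "x \<in> lv f (t + 1 / real (Suc n))" by blast
  moreover have "lv f (t + 1 / real (Suc n)) \<subseteq> lv f t" by (rule lv_antimono) simp
  ultimately show "x \<in> lv f t" by blast
qed

text \<open>The level sets grow continuously as the level decreases to \<open>t\<close>, so a strict
  inequality of volumes at \<open>t\<close> persists slightly above \<open>t\<close> and makes the
  integral exceed \<open>t\<close>. With strict signs on both sides, the level sets of
  \<open>star f\<close> come out as open balls.\<close>

lemma star_greater_iff: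
  fixes f :: "'a::euclidean_space \<Rightarrow> ennreal"
  assumes f [measurable]: "f \<in> Borel" and t: "t \<ge> 0"
  shows "ennreal t < star f x \<longleftrightarrow> vol (ball (0::'a) (norm x)) < vol (lv f t)"
proof
  assume less: "vol (ball (0::'a) (norm x)) < vol (lv f t)"
  have "vol (lv f t) = (SUP n. vol (lv f (t + 1 / real (Suc n))))"
  proof (subst lv_right_continuous[OF t], rule SUP_emeasure_incseq[symmetric])
    show "incseq (\<lambda>n. lv f (t + 1 / real (Suc n)))"
      by (intro incseq_SucI lv_antimono add_left_mono divide_left_mono) auto
  qed auto
  with less obtain n where n: "vol (ball (0::'a) (norm x)) < vol (lv f (t + 1 / real (Suc n)))"
    by (auto simp: less_SUP_iff)
  let ?s = "t + 1 / real (Suc n)"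
  have "ennreal t < ennreal ?s" using t by (intro ennreal_lessI) (auto intro: add_nonneg_pos)
  also have "\<dots> = (\<J> s. indicator {0<..?s} s)" using t by simp
  also have "\<dots> \<le> star f x" unfolding star_def
  proof (rule nn_integral_mono)
    fix s
    have "vol (lv f ?s) \<le> vol (lv f s)" if "s \<le> ?s"
      using that by (intro emeasure_mono lv_antimono) auto
    then show "indicator {0<..?s} s \<le> (if 0 < s \<and> vol (ball (0::'a) (norm x)) < vol (lv f s) then 1 else (0::ennreal))"
      using n by (auto simp: indicator_def intro: less_le_trans)
  qed
  finally show "ennreal t < star f x" .
next
  assume gr: "ennreal t < star f x"
  show "vol (ball (0::'a) (norm x)) < vol (lv f t)"
  proof (rule ccontr)
    assume not: "\<not> ?thesis"
    have "star f x \<le> (\<J> s. indicator {0<..t} s)" unfolding star_def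
    proof (rule nn_integral_mono)
      fix s
      have "vol (lv f s) \<le> vol (lv f t)" if "t \<le> s"
        using that by (intro emeasure_mono lv_antimono) auto
      then show "(if 0 < s \<and> vol (ball (0::'a) (norm x)) < vol (lv f s) then 1 else (0::ennreal)) \<le> indicator {0<..t} s"
        using not by (cases "s \<le> t") (auto simp: not_less intro: order_trans)
    qed
    also have "\<dots> = ennreal t" using t by simp
    finally show False using gr by simp
  qed
qed

lemma lv_star:
  assumes "f \<in> Borel" "t \<ge> 0" "vol (lv f t) < \<infinity>"
  shows "lv (star f) t = sball (lv f t)"
proof -
  have "x \<in> lv (star f) t \<longleftrightarrow> x \<in> sball (lv f t)" for x
  proof -
    have "x \<in> lv (star f) t \<longleftrightarrow> vol (ball (0::'a) (norm x)) < vol (lv f t)"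
      using star_greater_iff[OF assms(1,2)] by (simp add: lv_def)
    also have "\<dots> \<longleftrightarrow> norm x < brad (lv f t)"
      unfolding emeasure_sball[OF assms(3), symmetric] sball_def by (rule emeasure_ball_strict_mono) simp
    finally show ?thesis by (simp add: sball_def)
  qed
  then show ?thesis by blast
qed

definition sdec :: "('a::euclidean_space \<Rightarrow> ennreal) \<Rightarrow> bool" where
  "sdec v \<longleftrightarrow> (\<forall>x y. norm x \<le> norm y \<longrightarrow> v y \<le> v x)"

lemma sdecD: "sdec v \<Longrightarrow> norm x \<le> norm y \<Longrightarrow> v y \<le> v x" by (simp add: sdec_def)
lemma sdec_eq: "sdec v \<Longrightarrow> norm x = norm y \<Longrightarrow> v x = v y" by (metis sdecD order_refl order_antisym)

lemma sdec_star: "sdec (star f)"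
  unfolding sdec_def star_def
proof (intro allI impI nn_integral_mono)
  fix x y :: 'a and t :: real assume "norm x \<le> norm y"
  then have "vol (ball (0::'a) (norm x)) \<le> vol (ball (0::'a) (norm y))"
    by (intro emeasure_mono) auto
  then show "(if 0 < t \<and> vol (ball (0::'a) (norm y)) < vol (lv f t) then 1 else 0) 
    \<le> (if 0 < t \<and> vol (ball (0::'a) (norm x)) < vol (lv f t) then 1 else (0::ennreal))"
    by (auto intro: le_less_trans)
qed

lemma star_measurable [measurable]:
  assumes [measurable]: "f \<in> Borel" shows "star f \<in> Borel"
proof -
  have 1: "vol (lv f t) = (\<J> y. (if ennreal t < f y then 1 else 0))" for t
  proof -
    have "vol (lv f t) = (\<J> y. indicator (lv f t) y)" by simp
    also have "\<dots> = (\<J> y. (if ennreal t < f y then 1 else 0))"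
      by (intro nn_integral_cong) (simp add: lv_def indicator_def)
    finally show ?thesis .
  qed
  have 2: "vol (ball (0::'a) (norm x)) = ennreal (unit_ball_vol (real DIM('a)) * norm x ^ DIM('a))" for x :: 'a
    by (simp add: emeasure_ball)
  show ?thesis unfolding star_def 1 2 by measurable
qed

lemma star_mono: "(\<And>x. f x \<le> g x) \<Longrightarrow> f \<in> Borel \<Longrightarrow> g \<in> Borel \<Longrightarrow> star f x \<le> star g x"
proof -
  assume le: "\<And>x. f x \<le> g x" and [measurable]: "f \<in> Borel" "g \<in> Borel"
  have "lv f t \<subseteq> lv g t" for t using le by (auto simp: lv_def intro: less_le_trans)
  then have "vol (lv f t) \<le> vol (lv g t)" for t by (intro emeasure_mono) auto
  then show ?thesis unfolding star_def by (intro nn_integral_mono) (auto intro: less_le_trans)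
qed

text \<open>On each line in direction \<open>e\<close> the reflection acts as
  \<open>t \<mapsto> c - t\<close> with a constant \<open>c\<close>, which preserves length.\<close>

lemma nn_integral_reflect:
  fixes F :: "'a::euclidean_space \<Rightarrow> ennreal"
  assumes [measurable]: "F \<in> Borel" and e: "norm e = 1"
  shows "(\<J> z. F (z - (2 * ((z - m) \<bullet> e)) *\<^sub>R e)) = (\<J> z. F z)"
proof -
  have ee: "e \<bullet> e = 1" using e by (simp add: dot_square_norm)
  have "(\<J> z. F (z - (2 * ((z - m) \<bullet> e)) *\<^sub>R e)) = 
    (\<J> z. \<J> t. indicator (slab e) z * F ((z + t *\<^sub>R e) - (2 * ((z + t *\<^sub>R e - m) \<bullet> e)) *\<^sub>R e))"
    by (rule slab_fubini[OF _ e, folded slab_def]) measurable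
  also have "\<dots> = (\<J> z. \<J> t. indicator (slab e) z * F (z + t *\<^sub>R e))"
  proof (rule nn_integral_cong)
    fix z
    let ?c = "- (2 * ((z - m) \<bullet> e))"
    have eq: "(z + t *\<^sub>R e) - (2 * ((z + t *\<^sub>R e - m) \<bullet> e)) *\<^sub>R e = z + (?c - t) *\<^sub>R e" for t
    proof -
      have "2 * ((z + t *\<^sub>R e - m) \<bullet> e) = 2 * ((z - m) \<bullet> e) + t + t"
        by (simp add: inner_add_left inner_diff_left ee)
      then show ?thesis by (simp only: scaleR_add_left scaleR_diff_left scaleR_minus_left) simp
    qed
    show "(\<J> t. indicator (slab e) z * F ((z + t *\<^sub>R e) - (2 * ((z + t *\<^sub>R e - m) \<bullet> e)) *\<^sub>R e)) = 
      (\<J> t. indicator (slab e) z * F (z + t *\<^sub>R e))"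
      unfolding eq by (rule lborel_nn_integral_shift(3)[of "\<lambda>t::real. indicator (slab e) z * F (z + t *\<^sub>R e)" ?c]) measurable
  qed
  also have "\<dots> = (\<J> z. F z)" by (rule slab_fubini[OF _ e, folded slab_def, symmetric]) measurable
  finally show ?thesis .
qed

definition nconv :: "('a::euclidean_space \<Rightarrow> ennreal) \<Rightarrow> ('a \<Rightarrow> ennreal) \<Rightarrow> 'a \<Rightarrow> ennreal" where
  "nconv f g x = (\<J> y. f y * g (x - y))"

lemma nconv_measurable [measurable]:
  assumes [measurable]: "f \<in> Borel" "g \<in> Borel"
  shows "nconv f g \<in> Borel"
  unfolding nconv_def by measurable

lemma nconv_mono: "(\<And>x. f x \<le> f' x) \<Longrightarrow> (\<And>x. g x \<le> g' x) \<Longrightarrow> nconv f g x \<le> nconv f' g' x"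
  unfolding nconv_def by (intro nn_integral_mono mult_mono) auto

lemma nn_integral_nconv:
  assumes [measurable]: "f \<in> Borel" "g \<in> Borel"
  shows "(\<J> x. nconv f g x) = (\<J> x. f x) * (\<J> x. g x)"
proof -
  have "(\<J> x. nconv f g x) = (\<J> y. \<J> x. f y * g (x - y))"
    unfolding nconv_def by (rule lborel_swap) measurable
  also have "\<dots> = (\<J> y. f y * (\<J> x. g x))"
    by (simp add: nn_integral_cmult lborel_nn_integral_shift(2)[of g])
  finally show ?thesis by (simp add: nn_integral_multc)
qed

lemma ennreal_rearrange_le:
  fixes p q a b :: ennreal assumes "q \<le> p" "b \<le> a" shows "p * b + q * a \<le> p * a + q * b"
proof -
  obtain r c where "p = q + r" "a = b + c" using assms by (auto simp: le_iff_add)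
  then show ?thesis by (simp add: distrib_left distrib_right ac_simps add_left_mono)
qed

text \<open>Reflect in the hyperplane bisecting \<open>x\<close> and \<open>y\<close> and pair each point with its mirror image.\<close>

lemma sdec_nconv:
  fixes u v :: "'a::euclidean_space \<Rightarrow> ennreal"
  assumes [measurable]: "u \<in> Borel" "v \<in> Borel" and u: "sdec u" and v: "sdec v"
  shows "sdec (nconv u v)"
  unfolding sdec_def
proof (intro allI impI)
  fix x y :: 'a assume xy: "norm x \<le> norm y"
  show "nconv u v y \<le> nconv u v x"
  proof (cases "x = y")
    case False
    \<comment> \<open>\<open>m\<close> is the midpoint of \<open>x\<close> and \<open>y\<close>,
      \<open>e\<close> the unit vector from \<open>x\<close> to \<open>y\<close>, and
      \<open>h\<close> half their distance. Below, \<open>s\<close> reflects in the bisecting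
      hyperplane and \<open>H\<close> is the open half-space containing \<open>x\<close>.\<close>
    define h where "h = norm (y - x) / 2"
    define e where "e = (1 / norm (y - x)) *\<^sub>R (y - x)"
    define m where "m = (1/2) *\<^sub>R (x + y)"
    have h: "h > 0" using False by (simp add: h_def)
    have e: "norm e = 1" using False by (simp add: e_def)
    then have ee: "e \<bullet> e = 1" by (simp add: dot_square_norm)
    have he: "h *\<^sub>R e = (1/2) *\<^sub>R (y - x)" using False by (simp add: h_def e_def)
    have ym: "y = m + h *\<^sub>R e" unfolding he m_def by (simp add: algebra_simps flip: scaleR_add_left)
    have xm: "x = m - h *\<^sub>R e" unfolding he m_def by (simp add: algebra_simps flip: scaleR_add_left)
    define s where "s z = z - (2 * ((z - m) \<bullet> e)) *\<^sub>R e" for z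
    have [measurable]: "s \<in> Borel" unfolding s_def by measurable
    define H where "H = {z. (z - m) \<bullet> e < 0}"
    define H1 where "H1 = {z. (z - m) \<bullet> e > 0}"
    define H0 where "H0 = {z. (z - m) \<bullet> e = 0}"
    have [measurable]: "H \<in> sets borel" "H0 \<in> sets borel" "H1 \<in> sets borel" unfolding H_def H0_def H1_def by measurable
    have sH: "s z \<in> H1 \<longleftrightarrow> z \<in> H" for z
      by (simp add: s_def H_def H1_def inner_diff_left ee algebra_simps)
    have split: "(\<J> z. K z) = (\<J> z. indicator H z * (K z + K (s z)) + indicator H0 z * K z)"
      if [measurable]: "K \<in> Borel" for K :: "'a \<Rightarrow> ennreal"
    proof -
      have "K z = indicator H z * K z + indicator H0 z * K z + indicator H1 z * K z" for z
        by (auto simp: H_def H0_def H1_def indicator_def)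
      then have "(\<J> z. K z) = (\<J> z. indicator H z * K z + indicator H0 z * K z + indicator H1 z * K z)" by simp
      also have "\<dots> = (\<J> z. indicator H z * K z + indicator H0 z * K z) + (\<J> z. indicator H1 z * K z)"
        by (rule nn_integral_add) measurable
      also have "(\<J> z. indicator H1 z * K z) = (\<J> z. indicator H1 (s z) * K (s z))"
        unfolding s_def by (rule nn_integral_reflect[OF _ e, symmetric, of "\<lambda>z. indicator H1 z * K z"]) measurable
      also have "\<dots> = (\<J> z. indicator H z * K (s z))" by (simp add: indicator_def sH)
      also have "(\<J> z. indicator H z * K z + indicator H0 z * K z) + (\<J> z. indicator H z * K (s z)) = 
         (\<J> z. indicator H z * K z + indicator H0 z * K z + indicator H z * K (s z))"
        by (rule nn_integral_add[symmetric]) measurable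
      finally show ?thesis by (simp add: distrib_left ac_simps)
    qed
    have nrm: "(norm (y - s z))\<^sup>2 = (norm (x - z))\<^sup>2" "(norm (x - s z))\<^sup>2 = (norm (y - z))\<^sup>2"
       "(norm (y - z))\<^sup>2 = (norm (x - z))\<^sup>2 - 4 * h * ((z - m) \<bullet> e)" 
       "(norm (s z))\<^sup>2 = (norm z)\<^sup>2 - 4 * ((z - m) \<bullet> e) * (m \<bullet> e)" for z
      unfolding power2_norm_eq_inner ym xm s_def
      by (simp_all add: inner_add_left inner_add_right inner_diff_left inner_diff_right ee inner_commute algebra_simps power2_eq_square)
    \<comment> \<open>As \<open>norm x \<le> norm y\<close>, the origin lies on the side of
      \<open>x\<close>; hence reflection brings no point of \<open>H\<close> closer to the origin,
      just as it brings none closer to \<open>x\<close>.\<close>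
    have "m \<bullet> e \<ge> 0"
    proof -
      have "(norm y)\<^sup>2 = (norm x)\<^sup>2 + 4 * h * (m \<bullet> e)"
        unfolding power2_norm_eq_inner ym xm
        by (simp add: inner_add_left inner_add_right inner_diff_left inner_diff_right ee inner_commute algebra_simps)
      moreover have "(norm x)\<^sup>2 \<le> (norm y)\<^sup>2" using xy by (intro power_mono) auto
      ultimately have "0 \<le> h * (m \<bullet> e)" by simp
      then show ?thesis using h by (simp add: zero_le_mult_iff)
    qed
    have "nconv u v y = (\<J> z. indicator H z * (u z * v (y - z) + u (s z) * v (y - s z)) + indicator H0 z * (u z * v (y - z)))"
      unfolding nconv_def by (rule split) measurable
    also have "\<dots> \<le> (\<J> z. indicator H z * (u z * v (x - z) + u (s z) * v (x - s z)) + indicator H0 z * (u z * v (x - z)))"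
    proof (intro nn_integral_mono add_mono)
      fix z
      have eq: "v (y - s z) = v (x - z)" "v (x - s z) = v (y - z)"
        using nrm(1,2)[of z] by (auto intro!: sdec_eq[OF v] simp: power2_eq_iff_nonneg)
      show "indicator H z * (u z * v (y - z) + u (s z) * v (y - s z)) \<le> indicator H z * (u z * v (x - z) + u (s z) * v (x - s z))"
      proof (cases "z \<in> H")
        case True
        then have w: "(z - m) \<bullet> e < 0" by (simp add: H_def)
        have "h * ((z - m) \<bullet> e) \<le> 0" "(m \<bullet> e) * ((z - m) \<bullet> e) \<le> 0"
          using w h \<open>m \<bullet> e \<ge> 0\<close> by (auto simp: mult_le_0_iff)
        then have "(norm (x - z))\<^sup>2 \<le> (norm (y - z))\<^sup>2" "(norm z)\<^sup>2 \<le> (norm (s z))\<^sup>2"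
          using nrm(3,4)[of z] by (auto simp: mult.commute)
        then have "norm (x - z) \<le> norm (y - z)" "norm z \<le> norm (s z)"
          by (auto simp: power2_le_iff_abs_le)
        then have "v (y - z) \<le> v (x - z)" "u (s z) \<le> u z" using u v by (auto intro: sdecD)
        then show ?thesis unfolding eq by (intro mult_left_mono ennreal_rearrange_le) auto
      qed simp
      have "v (y - z) = v (x - z)" if "z \<in> H0"
        using nrm(3)[of z] that by (auto intro!: sdec_eq[OF v] simp: power2_eq_iff_nonneg H0_def)
      then show "indicator H0 z * (u z * v (y - z)) \<le> indicator H0 z * (u z * v (x - z))"
        by (auto simp: indicator_def)
    qed
    also have "\<dots> = nconv u v x"
      unfolding nconv_def by (rule split[symmetric]) measurable
    finally show ?thesis .
  qed simp
qed

lemma sdec_indicator_sball: "sdec (indicator (sball E) :: 'a::euclidean_space \<Rightarrow> ennreal)"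
  by (auto simp: sdec_def sball_def indicator_def)

subsection \<open>Majorization and convolution powers\<close>

text \<open>For radially decreasing \<open>G\<close> this is weak majorization of
  \<open>star F\<close> by \<open>G\<close> in the sense of Hardy, Littlewood and Polya, stated
  without rearranging \<open>F\<close>. Unlike pointwise comparison of \<open>star F\<close> with
  \<open>G\<close>, it passes to convolutions (\<open>maj_nconv\<close>).\<close>

definition maj :: "('a::euclidean_space \<Rightarrow> ennreal) \<Rightarrow> ('a \<Rightarrow> ennreal) \<Rightarrow> bool" where
  "maj F G \<longleftrightarrow> (\<forall>E. bounded E \<longrightarrow> E \<in> sets borel \<longrightarrow> 
     (\<J> x. indicator E x * F x) \<le> (\<J> x. indicator (sball E) x * G x))"

lemma bounded_emeasure_finite: "bounded (E::'a::euclidean_space set) \<Longrightarrow> vol E < \<infinity>"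
  using emeasure_bounded_finite by blast

lemma lv_bounded: 
  assumes "\<And>x. norm x \<ge> R \<Longrightarrow> f x = 0" shows "lv f t \<subseteq> ball 0 R"
proof
  fix x assume "x \<in> lv f t"
  then have "\<not> norm x \<ge> R" using assms[of x] by (auto simp: lv_def)
  then show "x \<in> ball 0 R" by simp
qed

lemma lv_bounded': "(\<And>x. norm x \<ge> R \<Longrightarrow> f x = 0) \<Longrightarrow> bounded (lv f t)"
  using lv_bounded bounded_ball bounded_subset by metis

lemma emeasure_lv_le:
  assumes [measurable]: "f \<in> Borel" and "t > 0"
  shows "ennreal t * vol (lv f t) \<le> (\<J> x. f x)"
proof -
  have "ennreal t * vol (lv f t) = (\<J> x. ennreal t * indicator (lv f t) x)"
    by (simp add: nn_integral_cmult_indicator)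
  also have "\<dots> \<le> (\<J> x. f x)" by (intro nn_integral_mono) (auto simp: lv_def indicator_def)
  finally show ?thesis .
qed

lemma emeasure_lv_finite:
  assumes "f \<in> Borel" and "t > 0" and "(\<J> x. f x) < \<infinity>"
  shows "vol (lv f t) < \<infinity>"
proof (rule ccontr)
  assume "\<not> ?thesis"
  then have "vol (lv f t) = \<infinity>" by (simp add: not_less top_unique)
  then have "ennreal t * vol (lv f t) = \<infinity>" using assms(2) by (simp add: ennreal_mult_top)
  with emeasure_lv_le[OF assms(1,2)] assms(3) show False by (simp add: top_unique)
qed

text \<open>The layers of \<open>c\<close> above the level \<open>\<tau>\<close>, shifted down by
  \<open>\<tau>\<close>, are the layers of the truncated difference.\<close>

lemma nn_integral_minus_const:
  assumes "\<tau> \<ge> 0"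
  shows "(\<J> t. (if \<tau> < t \<and> ennreal t < c then 1 else 0)) = c - ennreal \<tau>"
proof -
  have "(\<J> t. (if \<tau> < t \<and> ennreal t < c then 1 else 0)) = 
    (\<integral>\<^sup>+t. (if \<tau> < t + \<tau> \<and> ennreal (t + \<tau>) < c then 1 else 0) \<partial>(lborel :: real measure))"
    by (rule lborel_nn_integral_shift(1)[symmetric, where f = "\<lambda>t. (if \<tau> < t \<and> ennreal t < c then 1 else 0)"]) measurable
  also have "\<dots> = (\<J> t. (if 0 < t \<and> ennreal t < c - ennreal \<tau> then 1 else 0))"
  proof (intro nn_integral_cong if_cong)
    fix t :: real
    show "(\<tau> < t + \<tau> \<and> ennreal (t + \<tau>) < c) = (0 < t \<and> ennreal t < c - ennreal \<tau>)"
      using assms by (cases c) (auto simp: ennreal_minus ennreal_less_iff simp del: ennreal_plus)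
  qed auto
  finally show ?thesis by (simp add: nn_integral_below)
qed

text \<open>With \<open>T\<close> the supremum of \<open>Fb\<close> outside \<open>B\<close>, the
  function \<open>Fb\<close> is at least \<open>T\<close> on \<open>B\<close> and at most
  \<open>T\<close> off it. Hence its integral over \<open>B\<close> is \<open>T\<close> times the
  measure of \<open>B\<close> plus the integral of its excess over \<open>T\<close>. The same
  expression for \<open>F\<close> bounds the left side by layers, and \<open>maj\<close> on the set
  where \<open>F\<close> exceeds \<open>T\<close> compares the two excesses.\<close>

lemma maj_ball_claim:
  fixes F Fb :: "'a::euclidean_space \<Rightarrow> ennreal"
  assumes [measurable]: "F \<in> Borel" "Fb \<in> Borel" "B \<in> sets borel"
    and supp: "\<And>x. norm x \<ge> R \<Longrightarrow> F x = 0" and maj: "maj F Fb" and Fb: "sdec Fb" and fin: "(\<J> x. Fb x) < \<infinity>"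
    and B: "\<And>x y. y \<in> B \<Longrightarrow> norm x \<le> norm y \<Longrightarrow> x \<in> B" and Bfin: "vol B < \<infinity>"
  shows "(\<J> x. indicator B x * star F x) \<le> (\<J> x. indicator B x * Fb x)"
proof (cases "vol B = 0")
  case True
  then have "AE x in lborel. x \<notin> B" by (intro AE_not_in) (auto simp: null_sets_def)
  then have "(\<J> x. indicator B x * star F x) = (\<integral>\<^sup>+x. 0 \<partial>(lborel :: 'a measure))"
    by (intro nn_integral_cong_AE) (auto elim: eventually_mono)
  then show ?thesis by simp
next
  case False
  have "B \<noteq> UNIV" using Bfin by auto
  then obtain y0 where y0: "y0 \<notin> B" by blast
  define T where "T = (SUP y\<in>-B. Fb y)"
  have out: "Fb y \<le> T" if "y \<notin> B" for y unfolding T_def using that by (intro SUP_upper) auto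
  have inn: "T \<le> Fb x" if "x \<in> B" for x unfolding T_def
  proof (rule SUP_least)
    fix y assume "y \<in> - B"
    then have "norm x \<le> norm y" using B[OF that, of y] by (metis ComplD linear)
    then show "Fb y \<le> Fb x" by (rule sdecD[OF Fb])
  qed
  have "T * vol B = (\<J> x. T * indicator B x)" by (simp add: nn_integral_cmult_indicator)
  also have "\<dots> \<le> (\<J> x. Fb x)" by (intro nn_integral_mono) (auto simp: indicator_def inn)
  finally have "T * vol B < \<infinity>" using fin by (rule le_less_trans)
  then have "T < \<infinity>" using False by (auto simp: ennreal_mult_less_top ennreal_mult_eq_top_iff less_top)
  then obtain \<tau> where \<tau>: "T = ennreal \<tau>" "\<tau> \<ge> 0" by (cases T) auto
  have bl: "bounded (lv F t)" for t by (rule lv_bounded'[of R]) (rule supp)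
  have le1: "vol (sball (lv F t) \<inter> B) \<le> vol B" for t by (intro emeasure_mono) auto
  have le2: "vol (sball (lv F t) \<inter> B) \<le> vol (lv F t)" for t
    using emeasure_sball[OF bounded_emeasure_finite[OF bl[of t]]]
    by (metis emeasure_mono inf_le1 sball_sets sets_lborel)
  define G where "G t = (if \<tau> < t then vol (lv F t) else 0)" for t
  have Geq: "G t = (\<J> x. (if \<tau> < t \<and> ennreal t < F x then 1 else 0))" for t
  proof (cases "\<tau> < t")
    case True
    have "vol (lv F t) = (\<J> x. indicator (lv F t) x)" by simp
    then show ?thesis using True by (simp add: G_def lv_def indicator_def of_bool_def)
  qed (simp add: G_def)
  have [measurable]: "G \<in> Borel" unfolding Geq by measurable
  have "(\<J> t. G t) = (\<J> x. \<J> t. (if \<tau> < t \<and> ennreal t < F x then 1 else 0))"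
    unfolding Geq by (rule lborel_swap) measurable
  also have "\<dots> = (\<J> x. F x - T)" unfolding \<tau>(1) nn_integral_minus_const[OF \<tau>(2)] ..
  also have "\<dots> \<le> (\<J> x. Fb x - T)"
  proof -
    define E where "E = lv F \<tau>"
    have Eb: "bounded E" unfolding E_def by (rule bl)
    have [measurable]: "E \<in> sets borel" by (simp add: E_def)
    have eE: "vol (sball E) = vol E" by (rule emeasure_sball[OF bounded_emeasure_finite[OF Eb]])
    have "(\<J> x. F x - T) + T * vol E = (\<J> x. (F x - T) + T * indicator E x)"
      by (subst nn_integral_add) (auto simp: nn_integral_cmult_indicator)
    also have "\<dots> = (\<J> x. indicator E x * F x)"
    proof (rule nn_integral_cong)
      fix x
      show "F x - T + T * indicator E x = indicator E x * F x"
      proof (cases "x \<in> E")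
        case True
        then have "T \<le> F x" by (simp add: E_def lv_def \<tau>(1))
        then show ?thesis using True by (simp add: diff_add_cancel_ennreal)
      next
        case False
        then have "F x \<le> T" by (simp add: E_def lv_def \<tau>(1) not_less)
        moreover from this have "F x < top" by (rule le_less_trans) (simp add: \<tau>(1))
        ultimately have "F x - T = 0" by (simp add: diff_eq_0_iff_ennreal)
        then show ?thesis using False by simp
      qed
    qed
    also have "\<dots> \<le> (\<J> x. indicator (sball E) x * Fb x)"
      using maj Eb unfolding maj_def by simp
    also have "\<dots> \<le> (\<J> x. (Fb x - T) + T * indicator (sball E) x)"
    proof (rule nn_integral_mono)
      fix x show "indicator (sball E) x * Fb x \<le> Fb x - T + T * indicator (sball E) x"
      proof (cases "T \<le> Fb x")
        case True then show ?thesis by (auto simp: indicator_def diff_add_cancel_ennreal)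
      next
        case False then show ?thesis by (auto simp: indicator_def intro: add_increasing)
      qed
    qed
    also have "\<dots> = (\<J> x. Fb x - T) + T * vol E"
      unfolding eE[symmetric] by (subst nn_integral_add) (auto simp: nn_integral_cmult_indicator)
    finally have "T * vol E + (\<J> x. F x - T) \<le> T * vol E + (\<J> x. Fb x - T)"
      by (simp add: add.commute)
    moreover have "T * vol E \<noteq> \<infinity>"
      using bounded_emeasure_finite[OF Eb] \<tau>(1) by (simp add: ennreal_mult_eq_top_iff)
    ultimately show ?thesis by (simp add: ennreal_add_left_cancel_le)
  qed
  finally have Gle: "(\<J> t. G t) \<le> (\<J> x. Fb x - T)" .
  have "(\<J> x. indicator B x * star F x) = (\<J> x. star F x * indicator B x)" by (simp only: mult.commute)
  also have "\<dots> = (\<J> t. \<J> x. lay (star F) t x * indicator B x)"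
    by (rule layer_cake_integral) measurable
  also have "\<dots> \<le> (\<J> t. vol B * indicator {0..\<tau>} t + G t)"
  proof (rule nn_integral_mono)
    fix t :: real
    show "(\<J> x. lay (star F) t x * indicator B x) \<le> vol B * indicator {0..\<tau>} t + G t"
    proof (cases "0 < t")
      case True
      have "lv (star F) t = sball (lv F t)"
        using True bounded_emeasure_finite[OF bl[of t]] by (intro lv_star) auto
      then have "(\<J> x. lay (star F) t x * indicator B x) = (\<J> x. indicator (sball (lv F t) \<inter> B) x)"
        using True by (simp add: lay_eq indicator_inter_arith)
      also have "\<dots> = vol (sball (lv F t) \<inter> B)" by simp
      finally show ?thesis using True le1[of t] le2[of t] by (auto simp: G_def indicator_def)
    qed (simp add: lay_eq)
  qed
  also have "\<dots> = (\<J> t. vol B * indicator {0..\<tau>} t) + (\<J> t. G t)"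
    by (rule nn_integral_add) measurable
  also have "\<dots> \<le> (\<J> t. vol B * indicator {0..\<tau>} t) + (\<J> x. Fb x - T)"
    by (intro add_left_mono Gle)
  also have "(\<J> t. vol B * indicator {0..\<tau>} t) = vol B * ennreal \<tau>"
    using \<tau> by (subst nn_integral_cmult_indicator) auto
  also have "vol B * ennreal \<tau> = (\<J> x. T * indicator B x)"
    by (simp add: nn_integral_cmult_indicator \<tau>(1) mult.commute)
  also have "(\<J> x. T * indicator B x) + (\<J> x. Fb x - T) = (\<J> x. T * indicator B x + (Fb x - T))"
    by (rule nn_integral_add[symmetric]) auto
  also have "\<dots> = (\<J> x. indicator B x * Fb x)"
  proof (rule nn_integral_cong)
    fix x show "T * indicator B x + (Fb x - T) = indicator B x * Fb x"
    proof (cases "x \<in> B")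
      case True then show ?thesis using inn[OF True] by (simp add: add.commute diff_add_cancel_ennreal)
    next
      case False
      have "Fb x < top" by (rule le_less_trans[OF out[OF False]]) (simp add: \<tau>(1))
      then have "Fb x - T = 0" using out[OF False] by (simp add: diff_eq_0_iff_ennreal)
      with False show ?thesis by simp
    qed
  qed
  finally show ?thesis .
qed

text \<open>The level sets of a radially decreasing \<open>v\<close> are centred balls, so
  decomposing \<open>v\<close> into layers reduces the claim to
  \<open>maj_ball_claim\<close>.\<close>

lemma maj_star_integral:
  fixes F Fb v :: "'a::euclidean_space \<Rightarrow> ennreal"
  assumes [measurable]: "F \<in> Borel" "Fb \<in> Borel" "v \<in> Borel"
    and supp: "\<And>x. norm x \<ge> R \<Longrightarrow> F x = 0" and maj: "maj F Fb" and Fb: "sdec Fb" and fin: "(\<J> x. Fb x) < \<infinity>"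
    and v: "sdec v" and vfin: "(\<J> x. v x) < \<infinity>"
  shows "(\<J> x. v x * star F x) \<le> (\<J> x. v x * Fb x)"
proof -
  have "(\<J> x. v x * star F x) = (\<J> t. \<J> x. lay v t x * star F x)"
    by (rule layer_cake_integral) measurable
  also have "\<dots> \<le> (\<J> t. \<J> x. lay v t x * Fb x)"
  proof (rule nn_integral_mono)
    fix t :: real
    show "(\<J> x. lay v t x * star F x) \<le> (\<J> x. lay v t x * Fb x)"
    proof (cases "0 < t")
      case True
      have "(\<J> x. indicator (lv v t) x * star F x) \<le> (\<J> x. indicator (lv v t) x * Fb x)"
      proof (rule maj_ball_claim[OF _ _ _ supp maj Fb fin])
        show "x \<in> lv v t" if "y \<in> lv v t" "norm x \<le> norm y" for x y
          using that sdecD[OF v that(2)] by (auto simp: lv_def intro: less_le_trans)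
        show "vol (lv v t) < \<infinity>" by (rule emeasure_lv_finite[OF _ True vfin]) measurable
      qed measurable
      then show ?thesis using True by (simp add: lay_eq)
    qed (simp add: lay_eq)
  qed
  also have "\<dots> = (\<J> x. v x * Fb x)" by (rule layer_cake_integral[symmetric]) measurable
  finally show ?thesis .
qed

lemma nn_integral_star:
  assumes [measurable]: "f \<in> Borel" and fin: "\<And>t. t > 0 \<Longrightarrow> vol (lv f t) < \<infinity>"
  shows "(\<J> x. star f x) = (\<J> x. f x)"
proof -
  have 1: "(\<J> x. f x) = (\<J> t. (if 0 < t then vol (lv f t) else 0))"
    if [measurable]: "f \<in> Borel" for f :: "'a \<Rightarrow> ennreal"
  proof -
    have "(\<J> x. f x) = (\<J> t. \<J> x. lay f t x)"
      using layer_cake_integral[of f "\<lambda>_. 1"] by simp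
    also have "\<dots> = (\<J> t. (if 0 < t then vol (lv f t) else 0))"
      by (intro nn_integral_cong) (simp add: lay_eq)
    finally show ?thesis .
  qed
  have "vol (lv (star f) t) = vol (lv f t)" if "t > 0" for t
    using that fin[OF that] lv_star[of f t] emeasure_sball[of "lv f t"] by simp
  then show ?thesis unfolding 1[OF assms(1)] 1[OF star_measurable[OF assms(1)]] by (intro nn_integral_cong) simp
qed

lemma trilinear_nconv:
  assumes [measurable]: "g \<in> Borel" "F \<in> Borel" "h \<in> Borel"
  shows "(\<J> z. h z * nconv g F z) = (\<J> x. \<J> y. g x * (F y * h (x + y)))"
proof -
  have "(\<J> z. h z * nconv g F z) = (\<J> z. \<J> x. h z * (g x * F (z - x)))"
    unfolding nconv_def by (simp add: nn_integral_cmult)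
  also have "\<dots> = (\<J> x. \<J> z. h z * (g x * F (z - x)))" by (rule lborel_swap) measurable
  also have "\<dots> = (\<J> x. \<J> y. g x * (F y * h (x + y)))"
  proof (rule nn_integral_cong)
    fix x
    show "(\<J> z. h z * (g x * F (z - x))) = (\<J> y. g x * (F y * h (x + y)))"
      using lborel_nn_integral_shift(1)[of "\<lambda>z. h z * (g x * F (z - x))" x] by (simp add: ac_simps)
  qed
  finally show ?thesis .
qed

lemma layer_cake_trilinear:
  assumes [measurable]: "g \<in> Borel" "F \<in> Borel" "E \<in> sets borel"
  shows "(\<J> x. \<J> y. g x * (F y * indicator E (x + y))) = 
    (\<J> s. \<J> t. (if 0 < s \<and> 0 < t then riesz (lv g s) (lv F t) E else 0))"
proof -
  have "(\<J> x. \<J> y. g x * (F y * indicator E (x + y))) = (\<J> x. g x * (\<J> y. F y * indicator E (x + y)))"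
    by (simp add: nn_integral_cmult)
  also have "\<dots> = (\<J> s. \<J> x. lay g s x * (\<J> y. F y * indicator E (x + y)))"
    by (rule layer_cake_integral) measurable
  also have "\<dots> = (\<J> s. \<J> x. lay g s x * (\<J> t. \<J> y. lay F t y * indicator E (x + y)))"
    by (subst layer_cake_integral[of F]) auto
  also have "\<dots> = (\<J> s. \<J> x. \<J> t. \<J> y. lay g s x * (lay F t y * indicator E (x + y)))"
    by (simp add: nn_integral_cmult)
  also have "\<dots> = (\<J> s. \<J> t. \<J> x. \<J> y. lay g s x * (lay F t y * indicator E (x + y)))"
    by (intro nn_integral_cong lborel_swap) measurable
  also have "\<dots> = (\<J> s. \<J> t. (if 0 < s \<and> 0 < t then riesz (lv g s) (lv F t) E else 0))"
    by (intro nn_integral_cong) (auto simp: lay_eq riesz_def mult.assoc)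
  finally show ?thesis .
qed

lemma riesz_functions:
  assumes [measurable]: "g \<in> Borel" "F \<in> Borel" "E \<in> sets borel"
    and g: "\<And>x. norm x \<ge> R \<Longrightarrow> g x = 0" and F: "\<And>x. norm x \<ge> R' \<Longrightarrow> F x = 0" and E: "bounded E"
  shows "(\<J> x. \<J> y. g x * (F y * indicator E (x + y))) \<le> 
    (\<J> x. \<J> y. star g x * (star F y * indicator (sball E) (x + y)))"
proof -
  obtain R'' where R'': "\<And>x. x \<in> E \<Longrightarrow> norm x \<le> R''" using E by (auto simp: bounded_iff)
  define r where "r = max (max R R') (max (R'' + 1) 1)"
  have r: "r > 0" by (simp add: r_def)
  have sub: "lv g s \<subseteq> ball 0 r" "lv F s \<subseteq> ball 0 r" "E \<subseteq> ball 0 r" for s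
  proof -
    have "lv g s \<subseteq> ball 0 R" by (rule lv_bounded[OF g])
    then show "lv g s \<subseteq> ball 0 r" by (auto simp: r_def)
    have "lv F s \<subseteq> ball 0 R'" by (rule lv_bounded[OF F])
    then show "lv F s \<subseteq> ball 0 r" by (auto simp: r_def)
    show "E \<subseteq> ball 0 r" using R'' by (force simp: r_def)
  qed
  have fin: "vol (lv g s) < \<infinity>" "vol (lv F s) < \<infinity>" for s
    by (intro bounded_emeasure_finite bounded_subset[OF bounded_ball sub(1)] bounded_subset[OF bounded_ball sub(2)])+
  have "riesz (lv g s) (lv F t) E \<le> riesz (lv (star g) s) (lv (star F) t) (sball E)" if "s > 0" "t > 0" for s t
    using riesz_sobolev[OF sub(1)[of s] sub(2)[of t] sub(3) r] that fin by (simp add: lv_star)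
  then have "(\<J> s. \<J> t. (if 0 < s \<and> 0 < t then riesz (lv g s) (lv F t) E else 0)) \<le> 
     (\<J> s. \<J> t. (if 0 < s \<and> 0 < t then riesz (lv (star g) s) (lv (star F) t) (sball E) else 0))"
    by (intro nn_integral_mono) auto
  then show ?thesis by (simp add: layer_cake_trilinear)
qed

text \<open>Integrating the convolution over \<open>E\<close> gives a Riesz form. Rearranged, it is
  the integral of \<open>star F\<close> against \<open>v\<close>, the convolution of
  \<open>star g\<close> with the indicator of the ball of \<open>E\<close>. As \<open>v\<close> is
  radially decreasing by \<open>sdec_nconv\<close>, the majorant \<open>Fb\<close> may take the
  place of \<open>star F\<close>.\<close>

lemma maj_nconv:
  fixes g F Fb :: "'a::euclidean_space \<Rightarrow> ennreal"
  assumes [measurable]: "g \<in> Borel" "F \<in> Borel" "Fb \<in> Borel"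
    and g: "\<And>x. norm x \<ge> R \<Longrightarrow> g x = 0" and F: "\<And>x. norm x \<ge> R' \<Longrightarrow> F x = 0" 
    and maj: "maj F Fb" and Fb: "sdec Fb" and fin: "(\<J> x. Fb x) < \<infinity>" and gfin: "(\<J> x. star g x) < \<infinity>"
  shows "maj (nconv g F) (nconv (star g) Fb)"
  unfolding maj_def
proof (intro allI impI)
  fix E :: "'a set" assume E: "bounded E" and [measurable]: "E \<in> sets borel"
  define v where "v y = (\<J> x. star g x * indicator (sball E) (x + y))" for y
  have [measurable]: "v \<in> Borel" unfolding v_def by measurable
  have v_eq: "v y = nconv (star g) (indicator (sball E)) (- y)" for y
  proof -
    have "- y - x = - (x + y)" for x by simp
    then have "norm (- y - x) = norm (x + y)" for x by (simp only: norm_minus_cancel)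
    then show ?thesis unfolding v_def nconv_def by (simp add: sball_def indicator_def)
  qed
  have sd: "sdec (nconv (star g) (indicator (sball E)))"
    by (intro sdec_nconv sdec_star sdec_indicator_sball) measurable
  have v: "sdec v" unfolding sdec_def v_eq using sdecD[OF sd] by simp
  have "(\<J> y. v y) = (\<J> x. star g x) * vol (sball E)"
    unfolding v_eq using lborel_nn_integral_shift(4)[of "nconv (star g) (indicator (sball E))"] by (simp add: nn_integral_nconv)
  also have "\<dots> < \<infinity>" using gfin emeasure_sball[OF bounded_emeasure_finite[OF E]] bounded_emeasure_finite[OF E] by (simp add: ennreal_mult_less_top)
  finally have vfin: "(\<J> y. v y) < \<infinity>" .
  have tri: "(\<J> x. \<J> y. star g x * (H y * indicator (sball E) (x + y))) = (\<J> y. v y * H y)"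
    if [measurable]: "H \<in> Borel" for H
  proof -
    have "(\<J> x. \<J> y. star g x * (H y * indicator (sball E) (x + y))) = 
       (\<J> y. \<J> x. star g x * (H y * indicator (sball E) (x + y)))" by (rule lborel_swap) measurable
    also have "\<dots> = (\<J> y. \<J> x. (star g x * indicator (sball E) (x + y)) * H y)"
      by (simp only: ac_simps)
    also have "\<dots> = (\<J> y. v y * H y)" unfolding v_def by (intro nn_integral_cong nn_integral_multc) measurable
    finally show ?thesis .
  qed
  have "(\<J> x. indicator E x * nconv g F x) = (\<J> x. \<J> y. g x * (F y * indicator E (x + y)))"
    by (rule trilinear_nconv) measurable
  also have "\<dots> \<le> (\<J> x. \<J> y. star g x * (star F y * indicator (sball E) (x + y)))"
    by (rule riesz_functions[OF _ _ _ g F E]) measurable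
  also have "\<dots> = (\<J> y. v y * star F y)" by (rule tri) measurable
  also have "\<dots> \<le> (\<J> y. v y * Fb y)"
    by (rule maj_star_integral[OF _ _ _ F maj Fb fin v vfin]) measurable
  also have "\<dots> = (\<J> x. \<J> y. star g x * (Fb y * indicator (sball E) (x + y)))" by (rule tri[symmetric]) measurable
  also have "\<dots> = (\<J> x. indicator (sball E) x * nconv (star g) Fb x)" by (rule trilinear_nconv[symmetric]) measurable
  finally show "(\<J> x. indicator E x * nconv g F x) \<le> (\<J> x. indicator (sball E) x * nconv (star g) Fb x)" .
qed

lemma maj_star:
  assumes [measurable]: "g \<in> Borel" and g: "\<And>x. norm x \<ge> R \<Longrightarrow> g x = 0"
  shows "maj g (star g)"
  unfolding maj_def
proof (intro allI impI)
  fix E :: "'a set" assume E: "bounded E" and [measurable]: "E \<in> sets borel"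
  have "(\<J> x. indicator E x * g x) = (\<J> t. \<J> x. lay g t x * indicator E x)"
    unfolding mult.commute[of "indicator E _"] by (rule layer_cake_integral) measurable
  also have "\<dots> \<le> (\<J> t. \<J> x. lay (star g) t x * indicator (sball E) x)"
  proof (rule nn_integral_mono)
    fix t :: real
    show "(\<J> x. lay g t x * indicator E x) \<le> (\<J> x. lay (star g) t x * indicator (sball E) x)"
    proof (cases "t > 0")
      case True
      have fin: "vol (lv g t) < \<infinity>" by (intro bounded_emeasure_finite lv_bounded'[of R]) (rule g)
      have "(\<J> x. lay g t x * indicator E x) = (\<J> x. indicator (lv g t \<inter> E) x)"
        using True by (simp add: lay_eq indicator_inter_arith)
      also have "\<dots> = vol (lv g t \<inter> E)" by simp
      also have "\<dots> \<le> min (vol (lv g t)) (vol E)" by (auto intro!: emeasure_mono)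
      also have "\<dots> = min (vol (sball (lv g t))) (vol (sball E))"
        unfolding emeasure_sball[OF fin] emeasure_sball[OF bounded_emeasure_finite[OF E]] ..
      also have "\<dots> \<le> vol (sball (lv g t) \<inter> sball E)"
      proof -
        have "sball (lv g t) \<inter> sball E = sball (lv g t) \<or> sball (lv g t) \<inter> sball E = sball E"
          unfolding sball_def by auto
        then show ?thesis by (metis min.cobounded1 min.cobounded2)
      qed
      also have "\<dots> = (\<J> x. indicator (sball (lv g t) \<inter> sball E) x)" by simp
      also have "\<dots> = (\<J> x. lay (star g) t x * indicator (sball E) x)"
        using True fin by (simp add: lay_eq indicator_inter_arith lv_star)
      finally show ?thesis .
    qed (simp add: lay_eq)
  qed
  also have "\<dots> = (\<J> x. star g x * indicator (sball E) x)" by (rule layer_cake_integral[symmetric]) measurable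
  finally show "(\<J> x. indicator E x * g x) \<le> (\<J> x. indicator (sball E) x * star g x)"
    by (simp only: mult.commute)
qed

text \<open>Index shift: \<open>cpw g k\<close> is the convolution of \<open>k + 1\<close> copies of \<open>g\<close>.\<close>
definition cpw :: "('a::euclidean_space \<Rightarrow> ennreal) \<Rightarrow> nat \<Rightarrow> 'a \<Rightarrow> ennreal" where
  "cpw g k = ((nconv g) ^^ k) g"

lemma cpw_0 [simp]: "cpw g 0 = g" and cpw_Suc: "cpw g (Suc k) = nconv g (cpw g k)"
  by (simp_all add: cpw_def)

lemma cpw_measurable [measurable]: "g \<in> Borel \<Longrightarrow> cpw g k \<in> Borel"
  by (induction k) (auto simp: cpw_Suc)

lemma nn_integral_cpw: "g \<in> Borel \<Longrightarrow> (\<J> x. cpw g k x) = (\<J> x. g x) ^ Suc k"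
  by (induction k) (auto simp: cpw_Suc nn_integral_nconv)

lemma cpw_mono: "(\<And>x. g x \<le> h x) \<Longrightarrow> cpw g k x \<le> cpw h k x"
  by (induction k arbitrary: x) (auto simp: cpw_Suc intro!: nconv_mono)

lemma sdec_cpw_star: "g \<in> Borel \<Longrightarrow> sdec (cpw (star g) k)"
  by (induction k) (auto simp: cpw_Suc sdec_star intro!: sdec_nconv)

lemma nconv_support:
  assumes g: "\<And>x. norm x \<ge> R \<Longrightarrow> g x = 0" and F: "\<And>x. norm x \<ge> R' \<Longrightarrow> F x = 0" and x: "norm x \<ge> R + R'"
  shows "nconv g F x = 0"
proof -
  have "g y * F (x - y) = 0" for y
  proof (cases "norm y \<ge> R")
    case False
    then have "norm (x - y) \<ge> R'" using norm_triangle_sub[of x y] x by linarith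
    then show ?thesis using F by simp
  qed (simp add: g)
  then show ?thesis unfolding nconv_def by (simp only: nn_integral_0_iff_AE nn_integral_const mult_zero_left)
qed

lemma maj_cpw:
  assumes [measurable]: "g \<in> Borel" and g: "\<And>x. norm x \<ge> R \<Longrightarrow> g x = 0" and fin: "(\<J> x. g x) < \<infinity>"
  shows "maj (cpw g k) (cpw (star g) k)" and "\<exists>R'. \<forall>x. norm x \<ge> R' \<longrightarrow> cpw g k x = 0" 
    and "(\<J> x. cpw (star g) k x) < \<infinity>"
proof -
  have "(\<J> x. star g x) = (\<J> x. g x)"
  proof (rule nn_integral_star)
    show "vol (lv g t) < \<infinity>" for t by (intro bounded_emeasure_finite lv_bounded'[of R]) (rule g)
  qed measurable
  with fin have sfin: "(\<J> x. star g x) < \<infinity>" by simp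
  then show fin': "(\<J> x. cpw (star g) k x) < \<infinity>" for k by (subst nn_integral_cpw) (auto simp: power_less_top_ennreal ennreal_mult_less_top)
  have "maj (cpw g k) (cpw (star g) k) \<and> (\<exists>R'. \<forall>x. norm x \<ge> R' \<longrightarrow> cpw g k x = 0)"
  proof (induction k)
    case 0 then show ?case using maj_star[of g R] g by auto
  next
    case (Suc k)
    then obtain R' where R': "\<And>x. norm x \<ge> R' \<Longrightarrow> cpw g k x = 0" by blast
    have "maj (nconv g (cpw g k)) (nconv (star g) (cpw (star g) k))"
      by (rule maj_nconv[OF _ _ _ g R' _ sdec_cpw_star fin' sfin]) (use Suc in auto)
    moreover have "\<forall>x. norm x \<ge> R + R' \<longrightarrow> nconv g (cpw g k) x = 0"
    proof (intro allI impI)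
      fix x :: 'a assume "norm x \<ge> R + R'"
      then show "nconv g (cpw g k) x = 0" by (intro nconv_support[of R g R' "cpw g k" x] g R')
    qed
    ultimately show ?case by (auto simp: cpw_Suc)
  qed
  then show "maj (cpw g k) (cpw (star g) k)" "\<exists>R'. \<forall>x. norm x \<ge> R' \<longrightarrow> cpw g k x = 0" by auto
qed

text \<open>Majorization is used twice. Write \<open>?F\<close> and \<open>?G\<close> for the two
  convolution powers: on the level sets of \<open>?F\<close> it leads from \<open>?F * ?F\<close> to
  \<open>star ?F * ?G\<close>, and with the radially decreasing weight \<open>?G\<close> from there
  to \<open>?G * ?G\<close>.\<close>

lemma cpw_square_le_bounded:
  assumes [measurable]: "g \<in> Borel" and g: "\<And>x. norm x \<ge> R \<Longrightarrow> g x = 0" and fin: "(\<J> x. g x) < \<infinity>"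
  shows "(\<J> x. cpw g k x * cpw g k x) \<le> (\<J> x. cpw (star g) k x * cpw (star g) k x)"
proof -
  let ?F = "cpw g k" and ?G = "cpw (star g) k"
  note m = maj_cpw[where R = R and k = k, OF assms(1) g fin]
  obtain R' where R': "\<And>x. norm x \<ge> R' \<Longrightarrow> ?F x = 0" using m(2) by blast
  have bl: "bounded (lv ?F t)" for t by (rule lv_bounded'[OF R'])
  have "(\<J> x. ?F x * ?F x) = (\<J> t. \<J> x. lay ?F t x * ?F x)"
    by (rule layer_cake_integral) measurable
  also have "\<dots> \<le> (\<J> t. \<J> x. lay (star ?F) t x * ?G x)"
  proof (rule nn_integral_mono)
    fix t :: real
    show "(\<J> x. lay ?F t x * ?F x) \<le> (\<J> x. lay (star ?F) t x * ?G x)"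
    proof (cases "t > 0")
      case True
      have "(\<J> x. indicator (lv ?F t) x * ?F x) \<le> (\<J> x. indicator (sball (lv ?F t)) x * ?G x)"
        using m(1) bl[of t] unfolding maj_def by simp
      then show ?thesis using True bounded_emeasure_finite[OF bl[of t]] by (simp add: lay_eq lv_star)
    qed (simp add: lay_eq)
  qed
  also have "\<dots> = (\<J> x. star ?F x * ?G x)" by (rule layer_cake_integral[symmetric]) measurable
  also have "\<dots> = (\<J> x. ?G x * star ?F x)" by (simp only: mult.commute)
  also have "\<dots> \<le> (\<J> x. ?G x * ?G x)"
    by (rule maj_star_integral[OF _ _ _ R' m(1) sdec_cpw_star m(3) sdec_cpw_star m(3)]) auto
  finally show ?thesis .
qed

lemma SUP_mult_incseq_ennreal:
  fixes a b :: "nat \<Rightarrow> ennreal"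
  assumes "incseq a" "incseq b"
  shows "(SUP n. a n) * (SUP n. b n) = (SUP n. a n * b n)"
proof (rule antisym)
  have "(SUP n. a n) * (SUP n. b n) = (SUP m. a m * (SUP n. b n))"
    by (rule SUP_mult_right_ennreal)
  also have "\<dots> = (SUP m. SUP n. a m * b n)" by (simp only: SUP_mult_left_ennreal)
  also have "\<dots> \<le> (SUP n. a n * b n)"
  proof (intro SUP_least)
    fix m n
    have "a m * b n \<le> a (max m n) * b (max m n)"
      using assms by (intro mult_mono) (auto simp: incseq_def)
    then show "a m * b n \<le> (SUP n. a n * b n)" by (rule SUP_upper2[rotated]) simp
  qed
  finally show "(SUP n. a n) * (SUP n. b n) \<le> (SUP n. a n * b n)" .
  show "(SUP n. a n * b n) \<le> (SUP n. a n) * (SUP n. b n)"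
    by (intro SUP_least mult_mono SUP_upper) auto
qed

lemma cpw_SUP:
  fixes g :: "nat \<Rightarrow> 'a::euclidean_space \<Rightarrow> ennreal"
  assumes [measurable]: "\<And>n. g n \<in> Borel" and inc: "\<And>x. incseq (\<lambda>n. g n x)"
  shows "cpw (\<lambda>x. SUP n. g n x) k x = (SUP n. cpw (g n) k x)"
proof (induction k arbitrary: x)
  case (Suc k)
  have le: "g m x \<le> g n x" if "m \<le> n" for m n x using inc[of x] that by (simp add: incseq_def)
  have "cpw (\<lambda>x. SUP n. g n x) (Suc k) x = (\<J> y. (SUP n. g n y) * (SUP n. cpw (g n) k (x - y)))"
    by (simp add: cpw_Suc nconv_def Suc)
  also have "\<dots> = (\<J> y. (SUP n. g n y * cpw (g n) k (x - y)))"
    by (intro nn_integral_cong SUP_mult_incseq_ennreal inc) (auto simp: incseq_def intro!: cpw_mono le)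
  also have "\<dots> = (SUP n. \<J> y. g n y * cpw (g n) k (x - y))"
    by (rule nn_integral_monotone_convergence_SUP) (auto simp: incseq_def le_fun_def intro!: mult_mono cpw_mono le)
  finally show ?case by (simp add: cpw_Suc nconv_def)
qed simp

text \<open>Truncation in space and in height produces bounded support and a finite integral.
  Convolution powers are continuous along increasing sequences (\<open>cpw_SUP\<close>), and
  \<open>star\<close> is monotone.\<close>

lemma cpw_square_le_star:
  fixes g :: "'a::euclidean_space \<Rightarrow> ennreal"
  assumes [measurable]: "g \<in> Borel"
  shows "(\<J> x. cpw g k x * cpw g k x) \<le> (\<J> x. cpw (star g) k x * cpw (star g) k x)"
proof -
  define h where "h n x = (if norm x < real n then min (g x) (of_nat n) else 0)" for n x
  have [measurable]: "h n \<in> Borel" for n unfolding h_def by measurable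
  have hle: "h m x \<le> h n x" if "m \<le> n" for m n x
  proof -
    have "min (g x) (of_nat m) \<le> min (g x) (of_nat n)" using that by (intro min.mono) auto
    then show ?thesis using that by (auto simp: h_def)
  qed
  have hg: "h n x \<le> g x" for n x by (simp add: h_def)
  have inc: "incseq (\<lambda>n. h n x)" for x using hle by (simp add: incseq_def)
  have sup: "(SUP n. h n x) = g x" for x
  proof (rule antisym)
    show "(SUP n. h n x) \<le> g x" by (intro SUP_least hg)
    show "g x \<le> (SUP n. h n x)"
    proof (rule dense_le)
      fix c assume c: "c < g x"
      then have "c < top" using order_less_le_trans top_greatest by blast
      then obtain n1 :: nat where n1: "c < of_nat n1" using ennreal_Ex_less_of_nat by blast
      obtain n2 :: nat where n2: "norm x < real n2" using reals_Archimedean2 by blast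
      have "c \<le> h (max n1 n2) x"
      proof -
        have "(of_nat n1 :: ennreal) \<le> of_nat (max n1 n2)" by simp
        then have "c \<le> of_nat (max n1 n2)" using n1 by (metis less_imp_le order_trans)
        then show ?thesis using c n2 by (simp add: h_def less_imp_le)
      qed
      then show "c \<le> (SUP n. h n x)" by (rule SUP_upper2[rotated]) simp
    qed
  qed
  have geq: "g = (\<lambda>x. SUP n. h n x)" using sup by auto
  have "(\<J> x. cpw g k x * cpw g k x) = (\<J> x. (SUP n. cpw (h n) k x) * (SUP n. cpw (h n) k x))"
    unfolding geq using inc by (subst (1 2) cpw_SUP) auto
  also have "\<dots> = (\<J> x. (SUP n. cpw (h n) k x * cpw (h n) k x))"
    by (intro nn_integral_cong SUP_mult_incseq_ennreal) (auto simp: incseq_def intro!: cpw_mono hle)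
  also have "\<dots> = (SUP n. \<J> x. cpw (h n) k x * cpw (h n) k x)"
    by (rule nn_integral_monotone_convergence_SUP) (auto simp: incseq_def le_fun_def intro!: mult_mono cpw_mono hle)
  also have "\<dots> \<le> (\<J> x. cpw (star g) k x * cpw (star g) k x)"
  proof (rule SUP_least)
    fix n
    have "(\<J> x. h n x) \<le> (\<J> x. of_nat n * indicator (ball (0::'a) (real n)) x)"
      by (intro nn_integral_mono) (auto simp: h_def indicator_def)
    also have "\<dots> = of_nat n * vol (ball (0::'a) (real n))" by (rule nn_integral_cmult_indicator) simp
    also have "\<dots> < \<infinity>" using emeasure_lborel_ball_finite[of "0::'a" "real n"] by (simp add: ennreal_mult_less_top of_nat_less_top)
    finally have "(\<J> x. cpw (h n) k x * cpw (h n) k x) \<le> (\<J> x. cpw (star (h n)) k x * cpw (star (h n)) k x)"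
      by (intro cpw_square_le_bounded[of "h n" "real n"]) (auto simp: h_def)
    also have "\<dots> \<le> (\<J> x. cpw (star g) k x * cpw (star g) k x)"
      by (intro nn_integral_mono mult_mono cpw_mono star_mono hg) auto
    finally show "(\<J> x. cpw (h n) k x * cpw (h n) k x) \<le> (\<J> x. cpw (star g) k x * cpw (star g) k x)" .
  qed
  finally show ?thesis .
qed

subsection \<open>Young's inequality and even powers\<close>

definition epowr :: "ennreal \<Rightarrow> real \<Rightarrow> ennreal" where
  "epowr c \<theta> = (if c = top then top else ennreal (enn2real c powr \<theta>))"

lemma epowr_measurable [measurable]: "(\<lambda>c. epowr c \<theta>) \<in> Borel"
  unfolding epowr_def by measurable

lemma amgm3:
  fixes a b c :: real
  assumes l: "l1 > 0" "l2 > 0" "l3 > 0" "l1 + l2 + l3 = 1" and nn: "a \<ge> 0" "b \<ge> 0" "c \<ge> 0"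
  shows "a powr l1 * b powr l2 * c powr l3 \<le> l1 * a + l2 * b + l3 * c"
proof (cases "a = 0 \<or> b = 0 \<or> c = 0")
  case True then show ?thesis using l nn by auto
next
  case False
  then have pos: "a > 0" "b > 0" "c > 0" using nn by auto
  define \<beta> where "\<beta> = l2 + l3"
  have \<beta>: "\<beta> > 0" "l1 + \<beta> = 1" using l by (auto simp: \<beta>_def)
  define d where "d = b powr (l2 / \<beta>) * c powr (l3 / \<beta>)"
  have d: "d > 0" using pos by (simp add: d_def)
  have "d powr \<beta> = b powr l2 * c powr l3" using \<beta> pos by (simp add: d_def powr_mult powr_powr)
  then have "a powr l1 * b powr l2 * c powr l3 = a powr l1 * d powr \<beta>" by simp
  also have "\<dots> \<le> l1 * a + \<beta> * d" using Youngs_inequality_0[of l1 \<beta> a d] l \<beta> pos d by simp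
  also have "\<beta> * d \<le> \<beta> * (l2 / \<beta> * b + l3 / \<beta> * c)"
    unfolding d_def using Youngs_inequality_0[of "l2 / \<beta>" "l3 / \<beta>" b c] l \<beta> pos
    by (intro mult_left_mono) (auto simp: add_divide_distrib[symmetric] \<beta>_def)
  also have "\<dots> = l2 * b + l3 * c" using \<beta> by (simp add: distrib_left)
  finally show ?thesis by simp
qed

text \<open>Let \<open>S\<close> be the convolution at \<open>x\<close> and
  \<open>l1 = \<theta> - 1 / p\<close>, \<open>l2 = 1 - \<theta>\<close>, \<open>l3 = 1 / p\<close>,
  which add up to 1. The integrand is \<open>S powr l1\<close> times the weighted geometric mean of
  \<open>\<gamma> * H / S\<close>, \<open>\<gamma>\<close> and \<open>H\<close>. The arithmetic mean
  bounds it by three terms with known integrals; the first gives \<open>l1\<close>, since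
  \<open>\<gamma> * H / S\<close> has integral 1.\<close>

lemma young_step:
  fixes \<gamma> :: "'a::euclidean_space \<Rightarrow> real" and H :: "'a \<Rightarrow> ennreal"
  assumes [measurable]: "\<gamma> \<in> Borel" "H \<in> Borel" and \<gamma>: "\<And>x. \<gamma> x \<ge> 0"
    and p: "p > 0" and \<theta>: "1 / p < \<theta>" "\<theta> < 1"
  shows "nconv (\<lambda>y. ennreal (\<gamma> y powr (1 - 1 / p))) (\<lambda>y. epowr (H y) \<theta>) x \<le> 
    epowr (nconv (\<lambda>y. ennreal (\<gamma> y)) H x) (\<theta> - 1 / p) * (ennreal (\<theta> - 1 / p) + ennreal (1 - \<theta>) * (\<J> y. ennreal (\<gamma> y)) + ennreal (1 / p) * (\<J> y. H y))"
proof -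
  define S where "S = nconv (\<lambda>y. ennreal (\<gamma> y)) H x"
  define l1 l2 l3 where "l1 = \<theta> - 1 / p" and "l2 = 1 - \<theta>" and "l3 = 1 / p"
  have l: "l1 > 0" "l2 > 0" "l3 > 0" "l1 + l2 + l3 = 1" "1 - 1 / p = l1 + l2" "\<theta> = l1 + l3"
    using p \<theta> by (auto simp: l1_def l2_def l3_def)
  let ?C = "ennreal l1 + ennreal l2 * (\<J> y. ennreal (\<gamma> y)) + ennreal l3 * (\<J> y. H y)"
  have "(\<J> y. ennreal (\<gamma> y powr (1 - 1 / p)) * epowr (H (x - y)) \<theta>) \<le> epowr S l1 * ?C"
  proof (cases S)
    case top
    have "ennreal l1 \<noteq> 0" using l by simp
    then have "?C \<noteq> 0" by (simp only: add_eq_0_iff_both_eq_0 simp_thms)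
    then have "epowr S l1 * ?C = top" unfolding top epowr_def by (simp only: if_True ennreal_top_mult if_False simp_thms)
    then show ?thesis by (simp only: top_greatest)
  next
    case (real s)
    show ?thesis
    proof (cases "s = 0")
      case True
      then have "(\<J> y. ennreal (\<gamma> y) * H (x - y)) = 0" using real by (simp add: S_def nconv_def)
      then have "AE y in lborel. ennreal (\<gamma> y) * H (x - y) = 0" by (subst (asm) nn_integral_0_iff_AE) auto
      then have "AE y in lborel. ennreal (\<gamma> y powr (1 - 1 / p)) * epowr (H (x - y)) \<theta> = 0"
        by eventually_elim (use \<gamma> in \<open>auto simp: epowr_def ennreal_eq_0_iff order_antisym\<close>)
      then have "(\<J> y. ennreal (\<gamma> y powr (1 - 1 / p)) * epowr (H (x - y)) \<theta>) = 0"
        by (subst nn_integral_0_iff_AE) auto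
      then show ?thesis by simp
    next
      case False
      then have s: "s > 0" using real by simp
      have pw: "ennreal (\<gamma> y powr (1 - 1 / p)) * epowr (H (x - y)) \<theta> \<le> 
         ennreal (s powr l1) * (ennreal (l1 / s) * (ennreal (\<gamma> y) * H (x - y)) + ennreal l2 * ennreal (\<gamma> y) + ennreal l3 * H (x - y))" for y
      proof (cases "H (x - y)")
        case top
        show ?thesis
        proof (cases "\<gamma> y = 0")
          case False
          then have "\<gamma> y > 0" using \<gamma>[of y] by simp
          then show ?thesis using top l s by (simp add: ennreal_mult_top ennreal_top_mult ennreal_mult_eq_top_iff)
        qed simp
      next
        case (real h)
        have "\<gamma> y powr (l1 + l2) * h powr (l1 + l3) = s powr l1 * ((\<gamma> y * h / s) powr l1 * \<gamma> y powr l2 * h powr l3)"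
          using s \<gamma>[of y] real by (simp add: powr_add powr_mult powr_divide)
        also have "\<dots> \<le> s powr l1 * (l1 * (\<gamma> y * h / s) + l2 * \<gamma> y + l3 * h)"
          by (intro mult_left_mono amgm3) (use s \<gamma>[of y] real l in auto)
        finally have "ennreal (\<gamma> y powr (l1 + l2) * h powr (l1 + l3)) \<le> ennreal (s powr l1 * (l1 / s * (\<gamma> y * h) + l2 * \<gamma> y + l3 * h))"
          by (simp add: ennreal_leI)
        also have "\<dots> = ennreal (s powr l1) * (ennreal (l1 / s) * (ennreal (\<gamma> y) * ennreal h) + ennreal l2 * ennreal (\<gamma> y) + ennreal l3 * ennreal h)"
        proof -
          have dist: "ennreal (x1 * (x2 * (x3 * x4) + x5 * x3 + x6 * x4)) = ennreal x1 * (ennreal x2 * (ennreal x3 * ennreal x4) + ennreal x5 * ennreal x3 + ennreal x6 * ennreal x4)"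
            if "x1 \<ge> 0" "x2 \<ge> 0" "x3 \<ge> 0" "x4 \<ge> 0" "x5 \<ge> 0" "x6 \<ge> 0" for x1 x2 x3 x4 x5 x6
            using that by (simp add: ennreal_mult)
          show ?thesis by (rule dist) (use s \<gamma>[of y] real l in auto)
        qed
        finally show ?thesis using real unfolding l(5,6) by (simp add: epowr_def ennreal_mult')
      qed
      have "(\<J> y. ennreal (\<gamma> y powr (1 - 1 / p)) * epowr (H (x - y)) \<theta>) \<le> 
        (\<J> y. ennreal (s powr l1) * (ennreal (l1 / s) * (ennreal (\<gamma> y) * H (x - y)) + ennreal l2 * ennreal (\<gamma> y) + ennreal l3 * H (x - y)))"
        by (intro nn_integral_mono pw)
      also have "\<dots> = ennreal (s powr l1) * (ennreal (l1 / s) * S + ennreal l2 * (\<J> y. ennreal (\<gamma> y)) + ennreal l3 * (\<J> y. H y))"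
        by (simp add: nn_integral_cmult nn_integral_add S_def nconv_def lborel_nn_integral_shift(3)[of H])
      also have "ennreal (l1 / s) * S = ennreal l1" using real s l by (simp add: ennreal_mult[symmetric])
      finally show ?thesis using real by (simp add: epowr_def)
    qed
  qed
  then show ?thesis by (simp add: nconv_def S_def l1_def l2_def l3_def)
qed

text \<open>In the application \<open>\<gamma>\<close> is the power \<open>p'\<close> of the modulus
  of \<open>G\<close>, so that \<open>\<gamma> y powr (1 - 1 / p)\<close> is that modulus itself.
  Every further factor lowers the exponent on the right by \<open>1 / p\<close>, and
  \<open>real (Suc k) < p\<close> keeps it positive.\<close>

lemma young_cpw:
  fixes \<gamma> :: "'a::euclidean_space \<Rightarrow> real"
  assumes [measurable]: "\<gamma> \<in> Borel" and \<gamma>: "\<And>x. \<gamma> x \<ge> 0" and fin: "(\<J> y. ennreal (\<gamma> y)) < \<infinity>"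
    and p: "p > 0" and k: "real (Suc k) < p"
  shows "\<exists>C<\<infinity>. \<forall>x. cpw (\<lambda>y. ennreal (\<gamma> y powr (1 - 1 / p))) k x \<le> C * epowr (cpw (\<lambda>y. ennreal (\<gamma> y)) k x) (1 - real (Suc k) / p)"
  using k
proof (induction k)
  case 0
  show ?case using \<gamma> by (intro exI[of _ 1]) (auto simp: epowr_def)
next
  case (Suc k)
  let ?g = "\<lambda>y. ennreal (\<gamma> y powr (1 - 1 / p))" and ?G = "\<lambda>y. ennreal (\<gamma> y)" and ?\<theta> = "1 - real (Suc k) / p"
  obtain C where C: "C < \<infinity>" "\<And>x. cpw ?g k x \<le> C * epowr (cpw ?G k x) ?\<theta>" using Suc by auto
  define C' where "C' = ennreal (?\<theta> - 1 / p) + ennreal (1 - ?\<theta>) * (\<J> y. ?G y) + ennreal (1 / p) * (\<J> y. cpw ?G k y)"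
  have C': "C' < \<infinity>" using fin unfolding C'_def by (simp add: nn_integral_cpw ennreal_mult_less_top power_less_top_ennreal)
  have "1 / p < ?\<theta>" "?\<theta> < 1" using Suc.prems p by (auto simp: field_simps)
  then have step: "nconv ?g (\<lambda>y. epowr (cpw ?G k y) ?\<theta>) x \<le> epowr (nconv ?G (cpw ?G k) x) (?\<theta> - 1 / p) * C'" for x
    unfolding C'_def by (intro young_step \<gamma> p) measurable
  have "cpw ?g (Suc k) x \<le> (C * C') * epowr (cpw ?G (Suc k) x) (1 - real (Suc (Suc k)) / p)" for x
  proof -
    have "cpw ?g (Suc k) x \<le> nconv ?g (\<lambda>y. C * epowr (cpw ?G k y) ?\<theta>) x"
      unfolding cpw_Suc by (intro nconv_mono C) auto
    also have "\<dots> = C * nconv ?g (\<lambda>y. epowr (cpw ?G k y) ?\<theta>) x"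
      unfolding nconv_def by (subst nn_integral_cmult[symmetric]) (auto simp: ac_simps)
    also have "\<dots> \<le> C * (epowr (nconv ?G (cpw ?G k) x) (?\<theta> - 1 / p) * C')"
      by (rule mult_left_mono[OF step]) simp
    also have "?\<theta> - 1 / p = 1 - real (Suc (Suc k)) / p" using p by (simp add: field_simps)
    finally show ?thesis by (simp add: cpw_Suc ac_simps)
  qed
  moreover have "C * C' < \<infinity>" using C C' by (simp add: ennreal_mult_less_top)
  ultimately show ?case by blast
qed

text \<open>At \<open>p = 2 * real (Suc k)\<close> the exponent has come down to 1/2, so squaring
  leaves the convolution power of \<open>\<gamma>\<close>, whose integral is a power of the integral
  of \<open>\<gamma>\<close>.\<close>

lemma young_finite:
  fixes \<gamma> :: "'a::euclidean_space \<Rightarrow> real"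
  assumes [measurable]: "\<gamma> \<in> Borel" and \<gamma>: "\<And>x. \<gamma> x \<ge> 0" and fin: "(\<J> y. ennreal (\<gamma> y)) < \<infinity>"
    and p: "p = 2 * real (Suc k)"
  shows "(\<J> x. cpw (\<lambda>y. ennreal (\<gamma> y powr (1 - 1 / p))) k x * cpw (\<lambda>y. ennreal (\<gamma> y powr (1 - 1 / p))) k x) < \<infinity>"
proof -
  let ?g = "\<lambda>y. ennreal (\<gamma> y powr (1 - 1 / p))" and ?G = "\<lambda>y. ennreal (\<gamma> y)"
  obtain C where C: "C < \<infinity>" "\<And>x. cpw ?g k x \<le> C * epowr (cpw ?G k x) (1 - real (Suc k) / p)"
    using young_cpw[OF assms(1) \<gamma> fin, of p k] p by auto
  have half: "1 - real (Suc k) / p = 1 / 2" using p by simp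
  have "epowr c (1/2) * epowr c (1/2) = c" for c
    by (cases c) (auto simp: epowr_def ennreal_mult[symmetric] powr_add[symmetric])
  then have sq: "C * epowr c (1/2) * (C * epowr c (1/2)) = C * C * c" for c by (metis mult.assoc mult.left_commute)
  have "(\<J> x. cpw ?g k x * cpw ?g k x) \<le> (\<J> x. C * C * cpw ?G k x)"
    unfolding sq[symmetric] using C(2) unfolding half by (intro nn_integral_mono mult_mono) auto
  also have "\<dots> = C * C * (\<J> x. ?G x) ^ Suc k"
    by (subst nn_integral_cmult) (auto simp: nn_integral_cpw)
  also have "\<dots> < \<infinity>" using C fin by (simp add: ennreal_mult_less_top power_less_top_ennreal)
  finally show ?thesis .
qed

section \<open>Convolution powers of complex functions and their transforms\<close>

lemma fubini_nn:
  fixes F :: "'a::euclidean_space \<Rightarrow> 'b::euclidean_space \<Rightarrow> complex"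
  assumes [measurable]: "(\<lambda>(x, y). F x y) \<in> borel_measurable (lborel \<Otimes>\<^sub>M lborel)"
    and fin: "(\<J> x. \<J> y. ennreal (norm (F x y))) < \<infinity>"
  shows "(LINT x|lborel. LINT y|lborel. F x y) = (LINT y|lborel. LINT x|lborel. F x y)"
    and "integrable lborel (\<lambda>x. LINT y|lborel. F x y)"
proof -
  have i: "integrable (lborel \<Otimes>\<^sub>M lborel) (\<lambda>(x, y). F x y)"
  proof (rule integrableI_bounded)
    have "(\<integral>\<^sup>+p. ennreal (norm (case p of (x, y) \<Rightarrow> F x y)) \<partial>(lborel \<Otimes>\<^sub>M lborel)) = (\<J> x. \<J> y. ennreal (norm (F x y)))"
      by (subst lborel.nn_integral_fst[symmetric]) auto
    with fin show "(\<integral>\<^sup>+p. ennreal (norm (case p of (x, y) \<Rightarrow> F x y)) \<partial>(lborel \<Otimes>\<^sub>M lborel)) < \<infinity>" by simp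
  qed measurable
  show "(LINT x|lborel. LINT y|lborel. F x y) = (LINT y|lborel. LINT x|lborel. F x y)"
    using lborel_pair.Fubini_integral[OF i] by simp
  show "integrable lborel (\<lambda>x. LINT y|lborel. F x y)"
    using lborel_pair.integrable_fst[OF i] by simp
qed

definition cconv :: "('a::euclidean_space \<Rightarrow> complex) \<Rightarrow> ('a \<Rightarrow> complex) \<Rightarrow> 'a \<Rightarrow> complex" where
  "cconv f g x = (LINT y|lborel. f y * g (x - y))"

lemma cconv_measurable [measurable]:
  assumes [measurable]: "f \<in> Borel" "g \<in> Borel"
  shows "cconv f g \<in> Borel"
  unfolding cconv_def by measurable

lemma norm_cconv_le: "ennreal (norm (cconv f g x)) \<le> nconv (\<lambda>y. ennreal (norm (f y))) (\<lambda>y. ennreal (norm (g y))) x"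
proof (cases "integrable lborel (\<lambda>y. f y * g (x - y))")
  case True
  then show ?thesis unfolding cconv_def nconv_def
    by (intro order_trans[OF integral_norm_bound_ennreal]) (auto simp: norm_mult ennreal_mult)
qed (simp add: cconv_def not_integrable_integral_eq)

lemma cconv_integrable:
  assumes f: "integrable lborel f" and g: "integrable lborel g"
  shows "integrable lborel (cconv f g)" and "ft (cconv f g) \<xi> = ft f \<xi> * ft g \<xi>"
proof -
  have [measurable]: "f \<in> Borel" "g \<in> Borel" using f g by auto
  have fin: "(\<J> x. \<J> y. ennreal (norm (ech (- (x \<bullet> \<xi>)) * (f y * g (x - y))))) < \<infinity>" for \<xi>
  proof -
    have "(\<J> x. \<J> y. ennreal (norm (ech (- (x \<bullet> \<xi>)) * (f y * g (x - y))))) = 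
      (\<J> x. nconv (\<lambda>y. ennreal (norm (f y))) (\<lambda>y. ennreal (norm (g y))) x)"
      unfolding nconv_def by (simp add: norm_mult ennreal_mult)
    also have "\<dots> = (\<J> x. ennreal (norm (f x))) * (\<J> x. ennreal (norm (g x)))" by (rule nn_integral_nconv) measurable
    also have "\<dots> < \<infinity>" using f g by (auto simp: integrable_iff_bounded ennreal_mult_less_top)
    finally show ?thesis .
  qed
  have m: "(\<lambda>(x, y). ech (- (x \<bullet> \<xi>)) * (f y * g (x - y))) \<in> borel_measurable (lborel \<Otimes>\<^sub>M lborel)" for \<xi> by measurable
  show "integrable lborel (cconv f g)"
    using fubini_nn(2)[OF m fin, of 0] by (simp add: cconv_def[abs_def])
  have "ft (cconv f g) \<xi> = (LINT x|lborel. LINT y|lborel. ech (- (x \<bullet> \<xi>)) * (f y * g (x - y)))"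
    unfolding ft_def cconv_def by simp
  also have "\<dots> = (LINT y|lborel. LINT x|lborel. ech (- (x \<bullet> \<xi>)) * (f y * g (x - y)))"
    by (rule fubini_nn(1)[OF m fin])
  also have "\<dots> = (LINT y|lborel. f y * ft (\<lambda>x. g (x - y)) \<xi>)"
    unfolding ft_def by (simp only: mult.left_commute integral_mult_right_zero)
  also have "\<dots> = (LINT y|lborel. (ech (- (y \<bullet> \<xi>)) * f y) * ft g \<xi>)"
    by (simp add: ft_shift ac_simps)
  also have "\<dots> = ft f \<xi> * ft g \<xi>" unfolding ft_def[of f] by simp
  finally show "ft (cconv f g) \<xi> = ft f \<xi> * ft g \<xi>" .
qed

text \<open>Cauchy-Schwarz with the modulus of \<open>f\<close> split into two square roots, one of
  them attached to \<open>g\<close>: up to the integral of the modulus of \<open>f\<close>, the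
  squared convolution is bounded by the convolution of that modulus with the squared modulus of
  \<open>g\<close>.\<close>

lemma cconv_sq:
  assumes f: "integrable lborel f" and g: "sq g"
  shows "sq (cconv f g)"
proof -
  have [measurable]: "f \<in> Borel" "g \<in> Borel" using f g by (auto simp: sq_def)
  define If where "If = (\<J> y. ennreal (norm (f y)))"
  have pw: "ennreal ((norm (cconv f g x))\<^sup>2) \<le> If * nconv (\<lambda>y. ennreal (norm (f y))) (\<lambda>y. ennreal ((norm (g y))\<^sup>2)) x" for x
  proof -
    have "ennreal ((norm (cconv f g x))\<^sup>2) = (ennreal (norm (cconv f g x)))\<^sup>2" by (simp add: ennreal_power)
    also have "\<dots> \<le> (nconv (\<lambda>y. ennreal (norm (f y))) (\<lambda>y. ennreal (norm (g y))) x)\<^sup>2"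
      by (intro power_mono norm_cconv_le) auto
    also have "nconv (\<lambda>y. ennreal (norm (f y))) (\<lambda>y. ennreal (norm (g y))) x = 
       (\<J> y. ennreal (sqrt (norm (f y))) * ennreal (sqrt (norm (f y)) * norm (g (x - y))))"
      unfolding nconv_def by (intro nn_integral_cong) (simp add: ennreal_mult[symmetric] mult.assoc[symmetric])
    also have "(\<dots>)\<^sup>2 \<le> (\<J> y. (ennreal (sqrt (norm (f y))))\<^sup>2) * (\<J> y. (ennreal (sqrt (norm (f y)) * norm (g (x - y))))\<^sup>2)"
      by (rule Cauchy_Schwarz_nn_integral) measurable
    also have "\<dots> = If * nconv (\<lambda>y. ennreal (norm (f y))) (\<lambda>y. ennreal ((norm (g y))\<^sup>2)) x"
      unfolding If_def nconv_def by (simp add: ennreal_power power_mult_distrib ennreal_mult)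
    finally show ?thesis .
  qed
  have "n2 (cconv f g) \<le> (\<J> x. If * nconv (\<lambda>y. ennreal (norm (f y))) (\<lambda>y. ennreal ((norm (g y))\<^sup>2)) x)"
    unfolding n2_def by (intro nn_integral_mono pw)
  also have "\<dots> = If * (If * n2 g)" unfolding If_def n2_def by (simp add: nn_integral_cmult nn_integral_nconv)
  also have "\<dots> < \<infinity>" using f g by (auto simp: If_def integrable_iff_bounded sq_def ennreal_mult_less_top)
  finally show ?thesis unfolding sq_def by simp
qed

definition ccpw :: "('a::euclidean_space \<Rightarrow> complex) \<Rightarrow> nat \<Rightarrow> 'a \<Rightarrow> complex" where
  "ccpw g k = ((cconv g) ^^ k) g"

lemma ccpw_0 [simp]: "ccpw g 0 = g" and ccpw_Suc: "ccpw g (Suc k) = cconv g (ccpw g k)"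
  by (simp_all add: ccpw_def)

lemma ccpw_properties:
  assumes "integrable lborel g" "sq g"
  shows "integrable lborel (ccpw g k)" "sq (ccpw g k)" "ft (ccpw g k) \<xi> = ft g \<xi> ^ Suc k"
  by (induction k) (auto simp: ccpw_Suc assms cconv_integrable cconv_sq)

lemma ft_power_norm:
  assumes "integrable lborel g" "sq g"
  shows "(\<J> x. ennreal (norm (ft g (- x)) ^ (2 * Suc k))) = n2 (ccpw g k)"
proof -
  have [measurable]: "g \<in> Borel" using assms by auto
  note c = ccpw_properties[OF assms, of k]
  have "(\<J> x. ennreal (norm (ft g (- x)) ^ (2 * Suc k))) = (\<J> x. ennreal (norm (ft g x) ^ (2 * Suc k)))"
    by (rule lborel_nn_integral_shift(4)[of "\<lambda>x. ennreal (norm (ft g x) ^ (2 * Suc k))"]) measurable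
  also have "\<dots> = n2 (ft (ccpw g k))"
    unfolding n2_def c(3) norm_power power_mult[symmetric] by (simp only: mult.commute)
  also have "\<dots> = n2 (ccpw g k)" by (rule ft2_n2[OF ft2_ft[OF c(1,2)]])
  finally show ?thesis .
qed

lemma norm_ccpw_le: "ennreal (norm (ccpw g k x)) \<le> cpw (\<lambda>y. ennreal (norm (g y))) k x"
proof (induction k arbitrary: x)
  case (Suc k)
  have "ennreal (norm (ccpw g (Suc k) x)) \<le> nconv (\<lambda>y. ennreal (norm (g y))) (\<lambda>y. ennreal (norm (ccpw g k y))) x"
    unfolding ccpw_Suc by (rule norm_cconv_le)
  also have "\<dots> \<le> cpw (\<lambda>y. ennreal (norm (g y))) (Suc k) x" unfolding cpw_Suc by (intro nconv_mono Suc) auto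
  finally show ?case .
qed simp

text \<open>The identity holds at every point: where the nonnegative convolution is infinite, the
  Bochner integral takes its default value 0, and so does \<open>enn2real\<close>.\<close>

lemma ccpw_of_real:
  fixes r :: "'a::euclidean_space \<Rightarrow> real"
  assumes r: "integrable lborel r" and nn: "\<And>x. r x \<ge> 0"
  shows "ccpw (\<lambda>x. complex_of_real (r x)) k x = complex_of_real (enn2real (cpw (\<lambda>x. ennreal (r x)) k x))"
proof (induction k arbitrary: x)
  case 0 then show ?case using nn by simp
next
  case (Suc k)
  have [measurable]: "r \<in> Borel" using r by auto
  let ?c = "cpw (\<lambda>x. ennreal (r x)) k"
  have "(\<J> x. ennreal (r x)) < \<infinity>" using r nn by (simp add: integrable_iff_bounded)
  then have "(\<J> x. ?c x) \<noteq> \<infinity>"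
    by (subst nn_integral_cpw) (auto simp: ennreal_mult_less_top power_less_top_ennreal less_top)
  then have "AE x in lborel. ?c x \<noteq> \<infinity>" by (intro nn_integral_PInf_AE) auto
  then have fin: "AE y in lborel. ?c (x - y) \<noteq> \<infinity>" by (rule AE_lborel_shifts(3))
  have "ccpw (\<lambda>x. complex_of_real (r x)) (Suc k) x = (LINT y|lborel. complex_of_real (r y * enn2real (?c (x - y))))"
    unfolding ccpw_Suc cconv_def Suc by simp
  also have "\<dots> = complex_of_real (LINT y|lborel. r y * enn2real (?c (x - y)))" by (rule integral_complex_of_real)
  also have "(LINT y|lborel. r y * enn2real (?c (x - y))) = enn2real (\<J> y. ennreal (r y * enn2real (?c (x - y))))"
    by (rule integral_eq_nn_integral) (auto simp: nn)
  also have "(\<J> y. ennreal (r y * enn2real (?c (x - y)))) = (\<J> y. ennreal (r y) * ?c (x - y))"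
    using fin by (intro nn_integral_cong_AE) (auto elim!: eventually_mono simp: ennreal_mult nn less_top)
  finally show ?case by (simp add: cpw_Suc nconv_def)
qed

lemma n2_ccpw_of_real:
  fixes r :: "'a::euclidean_space \<Rightarrow> real"
  assumes r: "integrable lborel r" and nn: "\<And>x. r x \<ge> 0"
  shows "n2 (ccpw (\<lambda>x. complex_of_real (r x)) k) = (\<J> x. cpw (\<lambda>x. ennreal (r x)) k x * cpw (\<lambda>x. ennreal (r x)) k x)"
proof -
  have [measurable]: "r \<in> Borel" using r by auto
  let ?c = "cpw (\<lambda>x. ennreal (r x)) k"
  have "(\<J> x. ennreal (r x)) < \<infinity>" using r nn by (simp add: integrable_iff_bounded)
  then have "(\<J> x. ?c x) \<noteq> \<infinity>"
    by (subst nn_integral_cpw) (auto simp: ennreal_mult_less_top power_less_top_ennreal less_top)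
  then have "AE x in lborel. ?c x \<noteq> \<infinity>" by (intro nn_integral_PInf_AE) auto
  then show ?thesis unfolding n2_def ccpw_of_real[OF assms]
    by (intro nn_integral_cong_AE) (auto elim!: eventually_mono simp: power2_eq_square ennreal_mult less_top)
qed

section \<open>Gaussian damping and the comparison of power integrals\<close>

lemma n2_fast_AE:
  assumes [measurable]: "\<And>n. w n \<in> Borel" and "\<And>n. n2 (w n) \<le> ennreal ((1/4) ^ n)"
  shows "AE x in lborel. (\<lambda>n. w n x) \<longlonglongrightarrow> 0"
proof -
  have "(\<J> x. (\<Sum>n. ennreal ((norm (w n x))\<^sup>2))) = (\<Sum>n. n2 (w n))"
    unfolding n2_def by (rule nn_integral_suminf) auto
  also have "\<dots> \<le> (\<Sum>n. ennreal ((1/4) ^ n))" by (intro suminf_le summableI assms)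
  also have "\<dots> = ennreal (\<Sum>n. (1/4) ^ n)" by (rule suminf_ennreal2) auto
  also have "\<dots> < \<infinity>" by simp
  finally have "AE x in lborel. (\<Sum>n. ennreal ((norm (w n x))\<^sup>2)) \<noteq> \<infinity>"
    by (intro nn_integral_PInf_AE) auto
  then show ?thesis
  proof eventually_elim
    case (elim x)
    have "summable (\<lambda>n. (norm (w n x))\<^sup>2)" by (rule summable_suminf_not_top) (use elim in auto)
    then have "(\<lambda>n. (norm (w n x))\<^sup>2) \<longlonglongrightarrow> 0" by (rule summable_LIMSEQ_zero)
    from tendsto_real_sqrt[OF this] show ?case by (simp add: tendsto_norm_zero_iff)
  qed
qed

lemma gauss_le_1: "a \<ge> 0 \<Longrightarrow> gauss a x \<le> 1" by (simp add: gauss_def)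

lemma sq_gauss_mult:
  assumes G: "sq G" and a: "a > 0"
  shows "integrable lborel (\<lambda>\<xi>. G \<xi> * complex_of_real (gauss a \<xi>))" "sq (\<lambda>\<xi>. G \<xi> * complex_of_real (gauss a \<xi>))"
proof -
  show "integrable lborel (\<lambda>\<xi>. G \<xi> * complex_of_real (gauss a \<xi>))" by (intro sq_mult_integrable G sq_gauss a)
  have "norm (gauss a \<xi>) * norm (G \<xi>) \<le> 1 * norm (G \<xi>)" for \<xi> using a gauss_le_1[of a \<xi>] by (intro mult_right_mono) auto
  then show "sq (\<lambda>\<xi>. G \<xi> * complex_of_real (gauss a \<xi>))"
    by (intro sq_bound[OF G]) (use G in \<open>auto simp: sq_def norm_mult mult.commute\<close>)
qed

text \<open>The damped functions converge to \<open>G\<close> in L2 by dominated convergence. By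
  Plancherel their inverse transforms, which are genuine integrals, converge to \<open>u\<close> in
  L2, and a fast subsequence does so almost everywhere.\<close>

lemma regularisation_AE:
  assumes u: "ft2 u G"
  shows "\<exists>a. (\<forall>n. a n > 0) \<and> a \<longlonglongrightarrow> 0 \<and> (AE x in lborel. (\<lambda>n. ft (\<lambda>\<xi>. G \<xi> * complex_of_real (gauss (a n) \<xi>)) (- x)) \<longlonglongrightarrow> u x)"
proof -
  have sq: "sq u" "sq G" by (rule ft2_sq[OF u])+
  then have [measurable]: "u \<in> Borel" "G \<in> Borel" by (auto simp: sq_def)
  define g where "g a \<xi> = G \<xi> * complex_of_real (gauss a \<xi>)" for a \<xi>
  have [measurable]: "g a \<in> Borel" for a unfolding g_def by measurable
  have lim: "(\<lambda>n. n2 (\<lambda>\<xi>. g (1 / real (Suc n)) \<xi> - G \<xi>)) \<longlonglongrightarrow> n2 (\<lambda>\<xi>::'a. 0)"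
    unfolding n2_def
  proof (rule nn_integral_dominated_convergence[where w = "\<lambda>\<xi>. ennreal ((norm (G \<xi>))\<^sup>2)"])
    show "AE \<xi> in lborel. ennreal ((norm (g (1 / real (Suc j)) \<xi> - G \<xi>))\<^sup>2) \<le> ennreal ((norm (G \<xi>))\<^sup>2)" for j
    proof (rule AE_I2, rule ennreal_leI, rule power_mono)
      fix \<xi> :: 'a
      have "g (1 / real (Suc j)) \<xi> - G \<xi> = G \<xi> * complex_of_real (gauss (1 / real (Suc j)) \<xi> - 1)"
        by (simp add: g_def algebra_simps)
      moreover have "\<bar>gauss (1 / real (Suc j)) \<xi> - 1\<bar> \<le> 1"
        using gauss_le_1[of "1 / real (Suc j)" \<xi>] gauss_pos(2)[of "1 / real (Suc j)" \<xi>] by (simp del: gauss_pos)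
      ultimately show "norm (g (1 / real (Suc j)) \<xi> - G \<xi>) \<le> norm (G \<xi>)"
        by (simp only: norm_mult norm_of_real) (simp add: mult_left_le)
    qed simp
    show "(\<J> \<xi>. ennreal ((norm (G \<xi>))\<^sup>2)) < \<infinity>" using sq by (simp add: sq_def n2_def)
    show "AE \<xi> in lborel. (\<lambda>n. ennreal ((norm (g (1 / real (Suc n)) \<xi> - G \<xi>))\<^sup>2)) \<longlonglongrightarrow> ennreal ((norm (0::complex))\<^sup>2)"
    proof (rule AE_I2)
      fix \<xi> :: 'a
      have "(\<lambda>n. g (1 / real (Suc n)) \<xi> - G \<xi>) \<longlonglongrightarrow> G \<xi> * complex_of_real (exp (- pi * 0 * (norm \<xi>)\<^sup>2)) - G \<xi>"
        unfolding g_def gauss_def by (intro tendsto_intros LIMSEQ_Suc[OF lim_1_over_n])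
      then have "(\<lambda>n. g (1 / real (Suc n)) \<xi> - G \<xi>) \<longlonglongrightarrow> 0" by simp
      then show "(\<lambda>n. ennreal ((norm (g (1 / real (Suc n)) \<xi> - G \<xi>))\<^sup>2)) \<longlonglongrightarrow> ennreal ((norm (0::complex))\<^sup>2)"
        by (intro tendsto_intros)
    qed
  qed measurable
  have "\<exists>m\<ge>n. n2 (\<lambda>\<xi>. g (1 / real (Suc m)) \<xi> - G \<xi>) \<le> ennreal ((1/4) ^ n)" for n
  proof -
    have "eventually (\<lambda>m. n2 (\<lambda>\<xi>. g (1 / real (Suc m)) \<xi> - G \<xi>) < ennreal ((1/4) ^ n)) sequentially"
      by (rule order_tendstoD[OF lim]) (simp add: n2_def)
    then obtain N where "\<And>m. m \<ge> N \<Longrightarrow> n2 (\<lambda>\<xi>. g (1 / real (Suc m)) \<xi> - G \<xi>) < ennreal ((1/4) ^ n)"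
      by (auto simp: eventually_sequentially)
    then show ?thesis by (intro exI[of _ "max n N"]) (auto intro: less_imp_le)
  qed
  then have "\<exists>m. \<forall>n. m n \<ge> n \<and> n2 (\<lambda>\<xi>. g (1 / real (Suc (m n))) \<xi> - G \<xi>) \<le> ennreal ((1/4) ^ n)" by (intro choice allI)
  then obtain m where m: "\<And>n. m n \<ge> n" "\<And>n. n2 (\<lambda>\<xi>. g (1 / real (Suc (m n))) \<xi> - G \<xi>) \<le> ennreal ((1/4) ^ n)" by blast
  define a where "a n = 1 / real (Suc (m n))" for n
  have a0: "a n > 0" for n by (simp add: a_def)
  have "a \<longlonglongrightarrow> 0"
  proof (rule tendsto_sandwich[OF _ _ tendsto_const LIMSEQ_Suc[OF lim_1_over_n]])
    show "\<forall>\<^sub>F n in sequentially. a n \<le> 1 / real (Suc n)"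
      using m(1) by (intro always_eventually allI) (auto simp: a_def intro!: divide_left_mono)
    show "\<forall>\<^sub>F n in sequentially. 0 \<le> a n" using a0 by (intro always_eventually allI) (simp add: less_imp_le)
  qed
  moreover have "AE x in lborel. (\<lambda>n. ft (g (a n)) (- x) - u x) \<longlonglongrightarrow> 0"
  proof (rule n2_fast_AE)
    fix n
    have gi: "integrable lborel (g (a n))" "sq (g (a n))" unfolding g_def by (intro sq_gauss_mult sq a0)+
    have "ft2 (\<lambda>x. ft (g (a n)) (- x) - u x) (\<lambda>\<xi>. g (a n) \<xi> - G \<xi>)"
      by (intro ft2_diff ft2_inverse_ft gi u)
    from ft2_n2[OF this] show "n2 (\<lambda>x. ft (g (a n)) (- x) - u x) \<le> ennreal ((1/4) ^ n)"
      using m(2)[of n] by (simp add: a_def)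
  qed measurable
  then have "AE x in lborel. (\<lambda>n. ft (g (a n)) (- x)) \<longlonglongrightarrow> u x" by (simp only: LIM_zero_iff)
  moreover have "g a = (\<lambda>\<xi>. G \<xi> * complex_of_real (gauss a \<xi>))" for a by (simp add: g_def fun_eq_iff)
  ultimately show ?thesis using a0 by (intro exI[of _ a]) simp
qed

text \<open>For the damped \<open>G\<close> the identity \<open>ft_power_norm\<close> holds, and the
  modulus of a complex convolution power is at most the convolution power of the moduli, which
  damping only lowers. Fatou passes to \<open>u\<close>.\<close>

lemma power_integral_le_cpw:
  assumes u: "ft2 u G"
  shows "(\<J> x. ennreal (norm (u x) ^ (2 * Suc k))) \<le> 
    (\<J> x. cpw (\<lambda>\<xi>. ennreal (norm (G \<xi>))) k x * cpw (\<lambda>\<xi>. ennreal (norm (G \<xi>))) k x)"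
proof -
  have sq: "sq u" "sq G" by (rule ft2_sq[OF u])+
  then have [measurable]: "u \<in> Borel" "G \<in> Borel" by (auto simp: sq_def)
  obtain a where a: "\<And>n. a n > 0" and lim: "AE x in lborel. (\<lambda>n. ft (\<lambda>\<xi>. G \<xi> * complex_of_real (gauss (a n) \<xi>)) (- x)) \<longlonglongrightarrow> u x"
    using regularisation_AE[OF u] by blast
  define g where "g n \<xi> = G \<xi> * complex_of_real (gauss (a n) \<xi>)" for n \<xi>
  have gi: "integrable lborel (g n)" "sq (g n)" for n unfolding g_def by (intro sq_gauss_mult sq a)+
  have [measurable]: "g n \<in> Borel" for n unfolding g_def by measurable
  let ?N = "\<J> x. cpw (\<lambda>\<xi>. ennreal (norm (G \<xi>))) k x * cpw (\<lambda>\<xi>. ennreal (norm (G \<xi>))) k x"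
  have le: "(\<J> x. ennreal (norm (ft (g n) (- x)) ^ (2 * Suc k))) \<le> ?N" for n
  proof -
    have "norm (G \<xi>) * gauss (a n) \<xi> \<le> norm (G \<xi>) * 1" for \<xi>
      using a[of n] by (intro mult_left_mono gauss_le_1) auto
    then have gG: "ennreal (norm (g n \<xi>)) \<le> ennreal (norm (G \<xi>))" for \<xi>
      unfolding g_def by (intro ennreal_leI) (simp add: norm_mult)
    have "ennreal (norm (ccpw (g n) k x)) \<le> cpw (\<lambda>\<xi>. ennreal (norm (G \<xi>))) k x" for x
      by (rule order_trans[OF norm_ccpw_le cpw_mono[OF gG]])
    then have "n2 (ccpw (g n) k) \<le> ?N" unfolding n2_def
      by (intro nn_integral_mono) (auto simp: power2_eq_square ennreal_mult intro!: mult_mono)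
    then show ?thesis unfolding ft_power_norm[OF gi] .
  qed
  have "(\<J> x. ennreal (norm (u x) ^ (2 * Suc k))) = (\<J> x. liminf (\<lambda>n. ennreal (norm (ft (g n) (- x)) ^ (2 * Suc k))))"
  proof (intro nn_integral_cong_AE, use lim in eventually_elim)
    case (elim x)
    then have "(\<lambda>n. ennreal (norm (ft (g n) (- x)) ^ (2 * Suc k))) \<longlonglongrightarrow> ennreal (norm (u x) ^ (2 * Suc k))"
      unfolding g_def by (intro tendsto_intros)
    from lim_imp_Liminf[OF sequentially_bot this] show ?case by (rule sym)
  qed
  also have "\<dots> \<le> liminf (\<lambda>n. \<J> x. ennreal (norm (ft (g n) (- x)) ^ (2 * Suc k)))"
    by (rule nn_integral_liminf) measurable
  also have "\<dots> \<le> ?N" by (rule Liminf_le, simp, rule always_eventually, rule allI, rule le)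
  finally show ?thesis .
qed

text \<open>The graph of \<open>s ^ Suc n\<close> lies above its tangent at \<open>A\<close>; after
  division of \<open>s\<close> by \<open>A\<close> this is Bernoulli's inequality.\<close>

lemma power_tangent: 
  fixes s A :: real assumes "s \<ge> 0" "A \<ge> 0"
  shows "real (Suc n) * (A ^ n * s) \<le> s ^ Suc n + real n * A ^ Suc n"
proof (cases "A = 0")
  case True then show ?thesis using assms by (cases n) auto
next
  case False
  then have A: "A > 0" using assms by simp
  have "1 + real (Suc n) * (s / A - 1) \<le> (1 + (s / A - 1)) ^ Suc n"
    by (rule Bernoulli_inequality) (use assms A in auto)
  then have "A ^ Suc n * (1 + real (Suc n) * (s / A - 1)) \<le> A ^ Suc n * (s / A) ^ Suc n"
    using A by (intro mult_left_mono) auto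
  also have "\<dots> = s ^ Suc n" using A by (simp only: power_mult_distrib[symmetric]) simp
  also have "A ^ Suc n * (1 + real (Suc n) * (s / A - 1)) = real (Suc n) * (A ^ n * s) - real n * A ^ Suc n"
    using A by (simp add: field_simps)
  finally show ?thesis by simp
qed

text \<open>Jensen for the probability density \<open>heat \<epsilon> (x - y)\<close> in
  \<open>y\<close>: the tangent inequality at the mean \<open>A\<close> of the modulus of
  \<open>u\<close> is integrated, and the finite common term is cancelled. Integration in
  \<open>x\<close> uses mass 1 of the kernel once more.\<close>

lemma heat_jensen:
  assumes u: "sq u" and e: "\<epsilon> > 0"
  shows "(\<J> x. ennreal (norm (LINT y|lborel. u y * complex_of_real (heat \<epsilon> (x - y))) ^ Suc n)) \<le> (\<J> x. ennreal (norm (u x) ^ Suc n))"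
proof -
  have [measurable]: "u \<in> Borel" using u by (simp add: sq_def)
  have h0: "heat \<epsilon> x \<ge> 0" for x :: 'a by (rule heat_nonneg[OF e])
  have hs: "sq (\<lambda>y. complex_of_real (heat \<epsilon> (x - y)))" for x :: 'a
  proof -
    have eq: "heat \<epsilon> (x - y) = heat \<epsilon> (y - x)" for y using heat_minus[of \<epsilon> "y - x"] by simp
    have "sq (\<lambda>y. complex_of_real ((1 / \<epsilon>) ^ DIM('a)) * complex_of_real (gauss (1 / \<epsilon>\<^sup>2) (y - x)))"
      using e by (intro sq_cmult sq_shift sq_gauss) auto
    then show ?thesis unfolding eq unfolding heat_def of_real_mult .
  qed
  have pw: "ennreal (norm (LINT y|lborel. u y * complex_of_real (heat \<epsilon> (x - y))) ^ Suc n) \<le> (\<J> y. ennreal (norm (u y) ^ Suc n) * ennreal (heat \<epsilon> (x - y)))" for x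
  proof -
    have i: "integrable lborel (\<lambda>y. norm (u y) * heat \<epsilon> (x - y))"
      using integrable_norm[OF sq_mult_integrable[OF u hs[of x]]] by (simp add: norm_mult abs_of_nonneg[OF h0])
    define A where "A = (LINT y|lborel. norm (u y) * heat \<epsilon> (x - y))"
    have A0: "A \<ge> 0" unfolding A_def by (intro integral_nonneg_AE) (auto simp: h0)
    have Aeq: "(\<J> y. ennreal (norm (u y)) * ennreal (heat \<epsilon> (x - y))) = ennreal A"
      unfolding A_def using nn_integral_eq_integral[OF i] by (simp add: h0 ennreal_mult)
    have h1: "(\<J> y. ennreal (heat \<epsilon> (x - y))) = 1"
      using lborel_nn_integral_shift(3)[of "\<lambda>y::'a. ennreal (heat \<epsilon> y)" x] nn_integral_heat[OF e, where 'a = 'a] by simp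
    have nle: "norm (LINT y|lborel. u y * complex_of_real (heat \<epsilon> (x - y))) \<le> A"
      unfolding A_def by (rule order_trans[OF integral_norm_bound]) (simp add: norm_mult abs_of_nonneg[OF h0])
    let ?J = "\<J> y. ennreal (norm (u y) ^ Suc n) * ennreal (heat \<epsilon> (x - y))"
    have "ennreal (real (Suc n) * A ^ n) * ennreal A = (\<J> y. ennreal (real (Suc n) * A ^ n) * (ennreal (norm (u y)) * ennreal (heat \<epsilon> (x - y))))"
      by (simp add: nn_integral_cmult Aeq)
    also have "\<dots> \<le> (\<J> y. ennreal (norm (u y) ^ Suc n) * ennreal (heat \<epsilon> (x - y)) + ennreal (real n * A ^ Suc n) * ennreal (heat \<epsilon> (x - y)))"
    proof (rule nn_integral_mono)
      fix y
      have "ennreal (real (Suc n) * (A ^ n * norm (u y))) \<le> ennreal (norm (u y) ^ Suc n + real n * A ^ Suc n)"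
        by (intro ennreal_leI power_tangent A0) auto
      then have "ennreal (real (Suc n) * (A ^ n * norm (u y))) * ennreal (heat \<epsilon> (x - y)) \<le> ennreal (norm (u y) ^ Suc n + real n * A ^ Suc n) * ennreal (heat \<epsilon> (x - y))"
        by (intro mult_right_mono) auto
      moreover have "ennreal (real (Suc n) * (A ^ n * norm (u y))) = ennreal (real (Suc n) * A ^ n) * ennreal (norm (u y))"
        using A0 unfolding mult.assoc[symmetric] by (intro ennreal_mult) auto
      moreover have "ennreal (norm (u y) ^ Suc n + real n * A ^ Suc n) = ennreal (norm (u y) ^ Suc n) + ennreal (real n * A ^ Suc n)"
        using A0 by (intro ennreal_plus) auto
      ultimately show "ennreal (real (Suc n) * A ^ n) * (ennreal (norm (u y)) * ennreal (heat \<epsilon> (x - y))) \<le> 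
          ennreal (norm (u y) ^ Suc n) * ennreal (heat \<epsilon> (x - y)) + ennreal (real n * A ^ Suc n) * ennreal (heat \<epsilon> (x - y))"
        by (simp only: mult.assoc distrib_right)
    qed
    also have "\<dots> = ?J + ennreal (real n * A ^ Suc n) * (\<J> y. ennreal (heat \<epsilon> (x - y)))"
      by (subst nn_integral_add) (auto simp: nn_integral_cmult simp del: power_Suc)
    finally have "ennreal (real (Suc n) * A ^ n) * ennreal A \<le> ?J + ennreal (real n * A ^ Suc n)" unfolding h1 by simp
    moreover have "ennreal (real (Suc n) * A ^ n) * ennreal A = ennreal (A ^ Suc n) + ennreal (real n * A ^ Suc n)"
    proof -
      have "ennreal (real (Suc n) * A ^ n) * ennreal A = ennreal (real (Suc n) * A ^ n * A)" using A0 by (intro ennreal_mult[symmetric]) auto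
      also have "real (Suc n) * A ^ n * A = A ^ Suc n + real n * A ^ Suc n" by (simp add: algebra_simps)
      also have "ennreal \<dots> = ennreal (A ^ Suc n) + ennreal (real n * A ^ Suc n)" using A0 by (intro ennreal_plus) auto
      finally show ?thesis .
    qed
    ultimately have "ennreal (real n * A ^ Suc n) + ennreal (A ^ Suc n) \<le> ennreal (real n * A ^ Suc n) + ?J" by (simp only: add.commute)
    then have "ennreal (A ^ Suc n) \<le> ?J" by (simp only: ennreal_add_left_cancel_le) simp
    moreover have "ennreal (norm (LINT y|lborel. u y * complex_of_real (heat \<epsilon> (x - y))) ^ Suc n) \<le> ennreal (A ^ Suc n)"
      by (intro ennreal_leI power_mono nle) auto
    ultimately show ?thesis by (rule order_trans[rotated])
  qed
  have "(\<J> x. ennreal (norm (LINT y|lborel. u y * complex_of_real (heat \<epsilon> (x - y))) ^ Suc n)) \<le> 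
    (\<J> x. nconv (\<lambda>y. ennreal (norm (u y) ^ Suc n)) (\<lambda>y. ennreal (heat \<epsilon> y)) x)"
    unfolding nconv_def by (intro nn_integral_mono pw)
  also have "\<dots> = (\<J> x. ennreal (norm (u x) ^ Suc n))"
    by (subst nn_integral_nconv) (auto simp: nn_integral_heat[OF e] simp del: power_Suc)
  finally show ?thesis .
qed

lemma heat_ft:
  assumes u: "ft2 u G" and e: "\<epsilon> > 0"
  shows "ft (\<lambda>\<xi>. G \<xi> * complex_of_real (gauss (\<epsilon>\<^sup>2) \<xi>)) (- x) = (LINT y|lborel. u y * complex_of_real (heat \<epsilon> (x - y)))"
proof -
  define \<phi> where "\<phi> \<xi> = ech (\<xi> \<bullet> x) * complex_of_real (gauss (\<epsilon>\<^sup>2) \<xi>)" for \<xi>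
  have e2: "\<epsilon>\<^sup>2 > 0" using e by simp
  have \<phi>: "integrable lborel \<phi>" "sq \<phi>"
  proof -
    show "integrable lborel \<phi>" unfolding \<phi>_def by (intro integrable_ech_mult fourier_gauss e2) auto
    then show "sq \<phi>" by (intro sq_bound[OF sq_gauss[OF e2]]) (auto simp: \<phi>_def norm_mult)
  qed
  have "ft \<phi> y = heat \<epsilon> (x - y)" for y
    unfolding ft_def \<phi>_def heat_Fourier[OF e, symmetric]
    by (simp add: mult.assoc[symmetric] ech_add[symmetric] inner_diff_right)
  then have "(LINT y|lborel. u y * complex_of_real (heat \<epsilon> (x - y))) = (LINT \<xi>|lborel. G \<xi> * \<phi> \<xi>)"
    using ft2D[OF u \<phi>] by simp
  also have "\<dots> = ft (\<lambda>\<xi>. G \<xi> * complex_of_real (gauss (\<epsilon>\<^sup>2) \<xi>)) (- x)"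
    unfolding ft_def \<phi>_def by (simp add: ac_simps)
  finally show ?thesis by simp
qed

text \<open>The direction opposite to Fatou. A nonnegative \<open>r\<close> is the increasing limit
  of its damped versions \<open>s n\<close>, so its convolution powers are suprema of theirs. For
  each \<open>n\<close>, damping is convolution of \<open>u\<close> with a heat kernel, and
  \<open>heat_jensen\<close> bounds the resulting power integral by that of
  \<open>u\<close>.\<close>

lemma cpw_le_power_integral:
  fixes r :: "'a::euclidean_space \<Rightarrow> real"
  assumes u: "ft2 u (\<lambda>\<xi>. complex_of_real (r \<xi>))" and nn: "\<And>x. r x \<ge> 0" and [measurable]: "r \<in> Borel"
  shows "(\<J> x. cpw (\<lambda>x. ennreal (r x)) k x * cpw (\<lambda>x. ennreal (r x)) k x) \<le> (\<J> x. ennreal (norm (u x) ^ (2 * Suc k)))"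
proof -
  define e where "e n = 1 / real (Suc n)" for n
  have e: "e n > 0" for n by (simp add: e_def)
  define s where "s n x = r x * gauss ((e n)\<^sup>2) x" for n x
  have [measurable]: "s n \<in> Borel" for n unfolding s_def by measurable
  have s0: "s n x \<ge> 0" for n x by (simp add: s_def nn)
  have inc: "s m x \<le> s n x" if "m \<le> n" for m n x
  proof -
    have "e n \<le> e m" using that by (auto simp: e_def intro!: divide_left_mono)
    then have "(e n)\<^sup>2 \<le> (e m)\<^sup>2" using e[of n] by (intro power_mono) auto
    then have "gauss ((e m)\<^sup>2) x \<le> gauss ((e n)\<^sup>2) x" unfolding gauss_def by (simp add: mult_right_mono)
    then show ?thesis unfolding s_def by (intro mult_left_mono nn)
  qed
  have sup: "(SUP n. ennreal (s n x)) = ennreal (r x)" for x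
  proof (rule LIMSEQ_unique[OF LIMSEQ_SUP])
    show "incseq (\<lambda>n. ennreal (s n x))" using inc by (auto simp: incseq_def intro: ennreal_leI)
    have "(\<lambda>n. s n x) \<longlonglongrightarrow> r x * exp (- pi * 0\<^sup>2 * (norm x)\<^sup>2)"
      unfolding s_def gauss_def e_def by (intro tendsto_intros LIMSEQ_Suc[OF lim_1_over_n])
    then have "(\<lambda>n. s n x) \<longlonglongrightarrow> r x" by simp
    then show "(\<lambda>n. ennreal (s n x)) \<longlonglongrightarrow> ennreal (r x)" by (rule tendsto_ennrealI)
  qed
  have bound: "(\<J> x. cpw (\<lambda>x. ennreal (s n x)) k x * cpw (\<lambda>x. ennreal (s n x)) k x) \<le> (\<J> x. ennreal (norm (u x) ^ (2 * Suc k)))" for n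
  proof -
    have e2: "(e n)\<^sup>2 > 0" using e[of n] by simp
    have gi: "integrable lborel (\<lambda>x. complex_of_real (s n x))" "sq (\<lambda>x. complex_of_real (s n x))"
      using sq_gauss_mult[OF ft2_sq(2)[OF u] e2] by (auto simp: s_def)
    have ri: "integrable lborel (s n)" using integrable_Re[OF gi(1)] by simp
    have ftu: "ft (\<lambda>\<xi>. complex_of_real (s n \<xi>)) (- x) = (LINT y|lborel. u y * complex_of_real (heat (e n) (x - y)))" for x
      using heat_ft[OF u e[of n], of x] by (simp add: s_def)
    have "(\<J> x. cpw (\<lambda>x. ennreal (s n x)) k x * cpw (\<lambda>x. ennreal (s n x)) k x) = (\<J> x. ennreal (norm (LINT y|lborel. u y * complex_of_real (heat (e n) (x - y))) ^ (2 * Suc k)))"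
      unfolding n2_ccpw_of_real[OF ri s0, symmetric] ft_power_norm[OF gi, symmetric] ftu ..
    also have "\<dots> \<le> (\<J> x. ennreal (norm (u x) ^ (2 * Suc k)))"
      \<comment> \<open>The exponent in \<open>heat_jensen\<close> is a successor, so
        \<open>2 * k + 1\<close> stands for \<open>2 * Suc k\<close>.\<close>
      using heat_jensen[OF ft2_sq(1)[OF u] e[of n], of "2 * k + 1"] by simp
    finally show ?thesis .
  qed
  have inc': "incseq (\<lambda>n. ennreal (s n x))" for x using inc by (auto simp: incseq_def intro: ennreal_leI)
  have "(\<J> x. cpw (\<lambda>x. ennreal (r x)) k x * cpw (\<lambda>x. ennreal (r x)) k x) = 
     (\<J> x. (SUP n. cpw (\<lambda>x. ennreal (s n x)) k x) * (SUP n. cpw (\<lambda>x. ennreal (s n x)) k x))"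
    unfolding sup[symmetric] using inc' by (subst (1 2) cpw_SUP) auto
  also have "\<dots> = (\<J> x. (SUP n. cpw (\<lambda>x. ennreal (s n x)) k x * cpw (\<lambda>x. ennreal (s n x)) k x))"
    by (intro nn_integral_cong SUP_mult_incseq_ennreal) (auto simp: incseq_def intro!: cpw_mono ennreal_leI inc)
  also have "\<dots> = (SUP n. \<J> x. cpw (\<lambda>x. ennreal (s n x)) k x * cpw (\<lambda>x. ennreal (s n x)) k x)"
    by (rule nn_integral_monotone_convergence_SUP) (auto simp: incseq_def le_fun_def intro!: mult_mono cpw_mono ennreal_leI inc)
  also have "\<dots> \<le> (\<J> x. ennreal (norm (u x) ^ (2 * Suc k)))"
    by (intro SUP_least bound)
  finally show ?thesis .
qed

subsection \<open>Weighted integrals and the equality cases\<close>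

lemma nn_integral_eq_imp_AE_eq:
  assumes [measurable]: "f \<in> borel_measurable M" "g \<in> borel_measurable M"
    and le: "AE x in M. f x \<le> g x" and eq: "(\<integral>\<^sup>+x. g x \<partial>M) \<le> (\<integral>\<^sup>+x. f x \<partial>M)" and fin: "(\<integral>\<^sup>+x. g x \<partial>M) < \<infinity>"
  shows "AE x in M. f x = g x"
proof -
  have ffin: "(\<integral>\<^sup>+x. f x \<partial>M) \<noteq> \<infinity>" using nn_integral_mono_AE[OF le] fin by (auto simp: top_unique)
  have "(\<integral>\<^sup>+x. g x - f x \<partial>M) = (\<integral>\<^sup>+x. g x \<partial>M) - (\<integral>\<^sup>+x. f x \<partial>M)"
    by (rule nn_integral_diff[OF _ _ ffin le]) auto
  also have "\<dots> = 0" using eq fin by (simp add: diff_eq_0_iff_ennreal)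
  finally have "AE x in M. g x - f x = 0" by (subst (asm) nn_integral_0_iff_AE) auto
  with le show ?thesis by eventually_elim (auto simp: diff_eq_0_iff_ennreal)
qed

lemma emeasure_Diff_eq:
  assumes [measurable]: "A \<in> sets M" "B \<in> sets M" and eq: "emeasure M A = emeasure M B" and fin: "emeasure M A < \<infinity>"
  shows "emeasure M (A - B) = emeasure M (B - A)"
proof -
  have a: "emeasure M (A \<inter> B) + emeasure M (A - B) = emeasure M A"
    by (subst plus_emeasure) (auto intro!: arg_cong[where f = "emeasure M"])
  have b: "emeasure M (A \<inter> B) + emeasure M (B - A) = emeasure M B"
    by (subst plus_emeasure) (auto intro!: arg_cong[where f = "emeasure M"])
  have "emeasure M (A \<inter> B) + emeasure M (A - B) = emeasure M (A \<inter> B) + emeasure M (B - A)"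
    unfolding a b by (rule eq)
  moreover have "emeasure M (A \<inter> B) \<noteq> \<infinity>"
    using fin emeasure_mono[of "A \<inter> B" A M] by (auto simp: top_unique)
  ultimately show ?thesis by (simp add: ennreal_add_left_cancel)
qed

definition incw :: "('a::euclidean_space \<Rightarrow> ennreal) \<Rightarrow> bool" where
  "incw w \<longleftrightarrow> w \<in> Borel \<and> (\<forall>x y. norm x \<le> norm y \<longrightarrow> w x \<le> w y) \<and> (\<forall>x. w x < \<infinity>)"

lemma incw_ball_bound:
  fixes w :: "'a::euclidean_space \<Rightarrow> ennreal"
  assumes w: "incw w" and R: "R \<ge> 0"
  obtains z :: 'a where "norm z = R" "\<And>x. x \<in> ball 0 R \<Longrightarrow> w x \<le> w z" "\<And>x. x \<notin> ball 0 R \<Longrightarrow> w z \<le> w x"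
proof -
  obtain b :: 'a where b: "b \<in> Basis" using nonempty_Basis by blast
  have "norm (R *\<^sub>R b) = R" using b R by simp
  with w show ?thesis by (intro that[of "R *\<^sub>R b"]) (auto simp: incw_def)
qed

lemma set_weight_split:
  fixes w :: "'a::euclidean_space \<Rightarrow> ennreal"
  assumes [measurable]: "w \<in> Borel" "A \<in> sets borel" "B \<in> sets borel"
  shows "(\<J> x. indicator A x * w x) = (\<J> x. indicator (A \<inter> B) x * w x) + (\<J> x. indicator (A - B) x * w x)"
  by (subst nn_integral_add[symmetric]) (auto intro!: nn_integral_cong simp: indicator_def)

text \<open>Bathtub principle: \<open>A - sball A\<close> and \<open>sball A - A\<close> have the
  same measure, and the value of \<open>w\<close> on the boundary sphere separates its values
  outside the ball from those inside.\<close>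

lemma set_weight_le:
  fixes w :: "'a::euclidean_space \<Rightarrow> ennreal"
  assumes w: "incw w" and A: "A \<in> sets borel" and fin: "vol A < \<infinity>"
  shows "(\<J> x. indicator (sball A - A) x * w x) \<le> (\<J> x. indicator (A - sball A) x * w x)"
    and "(\<J> x. indicator (sball A) x * w x) \<le> (\<J> x. indicator A x * w x)"
proof -
  have [measurable]: "w \<in> Borel" "A \<in> sets borel" using w A by (auto simp: incw_def)
  define B where "B = sball A"
  have [measurable]: "B \<in> sets borel" by (simp add: B_def)
  obtain z :: 'a where z: "\<And>x. x \<in> B \<Longrightarrow> w x \<le> w z" "\<And>x. x \<notin> B \<Longrightarrow> w z \<le> w x"
    using incw_ball_bound[OF w brad_nonneg[of A]] unfolding B_def sball_def by metis
  have "(\<J> x. indicator (B - A) x * w x) \<le> (\<J> x. w z * indicator (B - A) x)"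
    by (intro nn_integral_mono) (auto simp: indicator_def z)
  also have "\<dots> = w z * vol (B - A)" by (rule nn_integral_cmult_indicator) simp
  also have "vol (B - A) = vol (A - B)"
    by (rule emeasure_Diff_eq) (auto simp: B_def emeasure_sball fin fin[unfolded infinity_ennreal_def])
  also have "w z * vol (A - B) = (\<J> x. w z * indicator (A - B) x)" by (rule nn_integral_cmult_indicator[symmetric]) simp
  also have "\<dots> \<le> (\<J> x. indicator (A - B) x * w x)"
    by (intro nn_integral_mono) (auto simp: indicator_def z)
  finally show 1: "(\<J> x. indicator (sball A - A) x * w x) \<le> (\<J> x. indicator (A - sball A) x * w x)"
    unfolding B_def .
  show "(\<J> x. indicator (sball A) x * w x) \<le> (\<J> x. indicator A x * w x)"
    using 1 set_weight_split[of w "sball A" A] set_weight_split[of w A "sball A"]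
    by (simp add: Int_commute add_left_mono)
qed

lemma sphere_null: "vol {x::'a::euclidean_space. norm x = R} = 0"
proof (cases "R \<ge> 0")
  case True
  have "{x::'a. norm x = R} = cball 0 R - ball 0 R" by auto
  also have "vol (cball (0::'a) R - ball 0 R) = vol (cball (0::'a) R) - vol (ball (0::'a) R)"
    using emeasure_lborel_ball_finite[of "0::'a" R] by (intro emeasure_Diff) auto
  also have "\<dots> = 0" using True by (simp add: emeasure_ball emeasure_cball)
  finally show ?thesis .
next
  case False
  then have "{x::'a. norm x = R} = {}" by auto
  then show ?thesis by (simp only: emeasure_empty)
qed

text \<open>Under equality the weight on \<open>A - sball A\<close> equals its boundary value almost
  everywhere. Points of that set lie outside the ball and, off the null sphere, have strictly larger
  weight, so the set is null; the opposite difference has the same measure.\<close>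

lemma set_weight_eq_imp:
  fixes w :: "'a::euclidean_space \<Rightarrow> ennreal"
  assumes w: "incw w" and strict: "\<And>x y. norm x < norm y \<Longrightarrow> w x < w y"
    and A: "A \<in> sets borel" and fin: "vol A < \<infinity>"
    and eq: "(\<J> x. indicator A x * w x) = (\<J> x. indicator (sball A) x * w x)"
    and wfin: "(\<J> x. indicator A x * w x) < \<infinity>"
  shows "AE x in lborel. x \<in> A \<longleftrightarrow> x \<in> sball A"
proof -
  have [measurable]: "w \<in> Borel" "A \<in> sets borel" using w A by (auto simp: incw_def)
  define B where "B = sball A"
  have [measurable]: "B \<in> sets borel" by (simp add: B_def)
  obtain z :: 'a where nz: "norm z = brad A" and z: "\<And>x. x \<in> B \<Longrightarrow> w x \<le> w z" "\<And>x. x \<notin> B \<Longrightarrow> w z \<le> w x"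
    using incw_ball_bound[OF w brad_nonneg[of A]] unfolding B_def sball_def by metis
  have emd: "vol (B - A) = vol (A - B)"
    by (rule emeasure_Diff_eq) (auto simp: B_def emeasure_sball fin fin[unfolded infinity_ennreal_def])
  let ?I = "\<lambda>S. \<J> x. indicator S x * w x"
  have "?I (A \<inter> B) + ?I (A - B) = ?I (A \<inter> B) + ?I (B - A)"
    using eq set_weight_split[of w A B] set_weight_split[of w B A] by (simp add: B_def Int_commute)
  moreover have "?I (A \<inter> B) \<noteq> \<infinity>" 
    using wfin nn_integral_mono[of lborel "\<lambda>x. indicator (A \<inter> B) x * w x" "\<lambda>x. indicator A x * w x"]
    by (auto simp: indicator_def top_unique)
  ultimately have I: "?I (A - B) = ?I (B - A)" by (simp add: ennreal_add_left_cancel)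
  have "AE x in lborel. indicator (A - B) x * w z = indicator (A - B) x * w x"
  proof (rule nn_integral_eq_imp_AE_eq)
    show "AE x in lborel. indicator (A - B) x * w z \<le> indicator (A - B) x * w x"
      by (intro AE_I2) (auto simp: indicator_def z)
    have "?I (A - B) \<le> ?I A" by (intro nn_integral_mono) (auto simp: indicator_def)
    then show "?I (A - B) < \<infinity>" using wfin by (rule order_le_less_trans)
    have "?I (B - A) \<le> (\<J> x. w z * indicator (B - A) x)"
      by (intro nn_integral_mono) (auto simp: indicator_def z)
    also have "\<dots> = w z * vol (B - A)" by (rule nn_integral_cmult_indicator) simp
    also have "\<dots> = (\<J> x. w z * indicator (A - B) x)" unfolding emd by (rule nn_integral_cmult_indicator[symmetric]) simp
    finally show "?I (A - B) \<le> (\<J> x. indicator (A - B) x * w z)" unfolding I by (simp only: mult.commute)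
  qed measurable
  moreover have "AE x in lborel. x \<notin> {x. norm x = brad A}"
    by (rule AE_not_in) (auto simp: null_sets_def sphere_null)
  ultimately have "AE x in lborel. x \<notin> A - B"
  proof eventually_elim
    case (elim x)
    show ?case
    proof
      assume x: "x \<in> A - B"
      then have "norm x > norm z" using elim(2) by (auto simp: B_def sball_def nz)
      then have "w z < w x" by (rule strict)
      with elim(1) x show False by simp
    qed
  qed
  then have "vol (A - B) = 0" by (subst (asm) AE_iff_measurable[of "A - B"]) auto
  then have "AE x in lborel. x \<notin> B - A" using emd by (intro AE_not_in) (auto simp: null_sets_def)
  with \<open>AE x in lborel. x \<notin> A - B\<close> show ?thesis unfolding B_def[symmetric] by eventually_elim auto
qed

lemma star_weight_le:
  fixes w h :: "'a::euclidean_space \<Rightarrow> ennreal"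
  assumes w: "incw w" and [measurable]: "h \<in> Borel" and fin: "\<And>t. t > 0 \<Longrightarrow> vol (lv h t) < \<infinity>"
  shows "(\<J> x. star h x * w x) \<le> (\<J> x. h x * w x)"
proof -
  have [measurable]: "w \<in> Borel" using w by (auto simp: incw_def)
  have "(\<J> t. \<J> x. lay (star h) t x * w x) \<le> (\<J> t. \<J> x. lay h t x * w x)"
  proof (rule nn_integral_mono)
    fix t :: real
    show "(\<J> x. lay (star h) t x * w x) \<le> (\<J> x. lay h t x * w x)"
    proof (cases "t > 0")
      case True
      then show ?thesis using set_weight_le(2)[OF w lv_sets fin[OF True]] fin[OF True] by (simp add: lay_eq lv_star)
    qed (simp add: lay_eq)
  qed
  moreover have "(\<J> x. star h x * w x) = (\<J> t. \<J> x. lay (star h) t x * w x)"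
    by (rule layer_cake_integral) measurable
  moreover have "(\<J> x. h x * w x) = (\<J> t. \<J> x. lay h t x * w x)"
    by (rule layer_cake_integral) measurable
  ultimately show ?thesis by simp
qed

text \<open>Equality of the integrals over all layers forces it in almost every layer, where the
  level set must then be a ball. Fubini turns almost every level into almost every point, and adding
  up the layers at such a point gives the claim.\<close>

lemma star_weight_eq_imp:
  fixes w h :: "'a::euclidean_space \<Rightarrow> ennreal"
  assumes w: "incw w" and strict: "\<And>x y. norm x < norm y \<Longrightarrow> w x < w y"
    and [measurable]: "h \<in> Borel" and fin: "\<And>t. t > 0 \<Longrightarrow> vol (lv h t) < \<infinity>"
    and eq: "(\<J> x. h x * w x) \<le> (\<J> x. star h x * w x)" and wfin: "(\<J> x. h x * w x) < \<infinity>"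
  shows "AE x in lborel. star h x = h x"
proof -
  have [measurable]: "w \<in> Borel" using w by (auto simp: incw_def)
  let ?f = "\<lambda>t. \<J> x. lay (star h) t x * w x" and ?g = "\<lambda>t. \<J> x. lay h t x * w x"
  have lays: "lay (star h) t x = (if 0 < t then indicator (sball (lv h t)) x else 0)" for t x
    using fin[of t] by (simp add: lay_eq lv_star)
  have gint: "(\<J> t. ?g t) = (\<J> x. h x * w x)" by (rule layer_cake_integral[symmetric]) measurable
  have fint: "(\<J> t. ?f t) = (\<J> x. star h x * w x)" by (rule layer_cake_integral[symmetric]) measurable
  have gfin: "(\<J> t. ?g t) < \<infinity>" unfolding gint by (rule wfin)
  have "AE t in lborel. ?f t = ?g t"
  proof (rule nn_integral_eq_imp_AE_eq)
    show "AE t in lborel. ?f t \<le> ?g t"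
    proof (rule AE_I2)
      fix t :: real
      show "?f t \<le> ?g t"
      proof (cases "t > 0")
        case True
        then show ?thesis using set_weight_le(2)[OF w lv_sets[of h t] fin[OF True]] by (simp add: lays lay_eq[of h])
      qed (simp add: lays lay_eq[of h])
    qed
  qed (use gfin eq in \<open>auto simp: gint fint\<close>)
  moreover have "AE t in lborel. ?g t \<noteq> \<infinity>" using gfin by (intro nn_integral_PInf_AE) auto
  ultimately have "AE t in lborel. AE x in lborel. lay (star h) t x = lay h t x"
  proof eventually_elim
    case (elim t)
    show ?case
    proof (cases "t > 0")
      case True
      have "AE x in lborel. x \<in> lv h t \<longleftrightarrow> x \<in> sball (lv h t)"
        by (rule set_weight_eq_imp[OF w strict _ fin[OF True]]) (use elim True in \<open>auto simp: lays lay_eq[of h] less_top\<close>)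
      then show ?thesis by eventually_elim (auto simp: lays lay_eq[of h] indicator_def)
    qed (simp add: lays lay_eq[of h])
  qed
  moreover have "{p \<in> space (lborel \<Otimes>\<^sub>M lborel). lay (star h) (fst p) (snd p) = lay h (fst p) (snd p)} \<in> sets (lborel \<Otimes>\<^sub>M lborel)"
    by measurable
  ultimately have "AE x in lborel. AE t in lborel. lay (star h) t x = lay h t x"
    by (subst (asm) lborel_pair.AE_commute)
  then show ?thesis
  proof eventually_elim
    case (elim x)
    then have "(\<J> t. lay (star h) t x) = (\<J> t. lay h t x)" by (rule nn_integral_cong_AE)
    then show ?case by (simp add: layer_cake[symmetric])
  qed
qed

lemma ennreal_eqI_less:
  assumes "\<And>t. t \<ge> 0 \<Longrightarrow> ennreal t < a \<longleftrightarrow> ennreal t < b" shows "a = b"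
proof (rule ccontr)
  have less: "\<not> x < y" if "\<And>t. t \<ge> 0 \<Longrightarrow> ennreal t < x \<longleftrightarrow> ennreal t < y" for x y
  proof
    assume xy: "x < y"
    then have "x < top" using order_less_le_trans top_greatest by blast
    then obtain r where "x = ennreal r" "r \<ge> 0" by (cases x) auto
    with that[of r] xy show False by simp
  qed
  assume "a \<noteq> b"
  then consider "a < b" | "b < a" by fastforce
  then show False using less[of a b] less[of b a] assms by cases auto
qed

lemma less_powr_iff:
  fixes t r q :: real assumes "t \<ge> 0" "r \<ge> 0" and q: "q > 0"
  shows "t < r powr q \<longleftrightarrow> t powr (1 / q) < r"
proof -
  have "(t powr (1 / q)) powr q = t" using assms by (simp add: powr_powr)
  then show ?thesis
    using powr_less_mono2[OF q, of "t powr (1 / q)" r] powr_mono2[of q r "t powr (1 / q)"] assms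
    by (cases "t powr (1 / q) < r") auto
qed

text \<open>Level sets of the power are level sets of \<open>r\<close> at the level
  \<open>t powr (1 / q)\<close>, and \<open>star\<close> sees a function only through the measures
  of its level sets.\<close>

lemma star_powr:
  fixes r :: "'a::euclidean_space \<Rightarrow> real"
  assumes [measurable]: "r \<in> Borel" and nn: "\<And>x. r x \<ge> 0" and q: "q > 0"
  shows "star (\<lambda>x. ennreal (r x powr q)) x = epowr (star (\<lambda>x. ennreal (r x)) x) q"
proof (rule ennreal_eqI_less)
  fix t :: real assume t: "t \<ge> 0"
  have "ennreal t < star (\<lambda>x. ennreal (r x powr q)) x \<longleftrightarrow> vol (ball (0::'a) (norm x)) < vol (lv (\<lambda>x. ennreal (r x powr q)) t)"
    by (rule star_greater_iff[OF _ t]) measurable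
  also have "lv (\<lambda>x. ennreal (r x powr q)) t = lv (\<lambda>x. ennreal (r x)) (t powr (1 / q))"
    using less_powr_iff[OF t nn q] t by (auto simp: lv_def ennreal_less_iff)
  also have "vol (ball (0::'a) (norm x)) < vol (lv (\<lambda>x. ennreal (r x)) (t powr (1 / q))) \<longleftrightarrow> ennreal (t powr (1 / q)) < star (\<lambda>x. ennreal (r x)) x"
    by (rule star_greater_iff[symmetric]) auto
  also have "\<dots> \<longleftrightarrow> ennreal t < epowr (star (\<lambda>x. ennreal (r x)) x) q"
    using less_powr_iff[OF t _ q] t by (cases "star (\<lambda>x. ennreal (r x)) x") (auto simp: epowr_def ennreal_less_iff)
  finally show "ennreal t < star (\<lambda>x. ennreal (r x powr q)) x \<longleftrightarrow> ennreal t < epowr (star (\<lambda>x. ennreal (r x)) x) q" .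
qed

lemma cpw_Suc_iterate: "cpw V (Suc j) = ((nconv V) ^^ j) (nconv V V)"
  unfolding cpw_def by (simp add: funpow_swap1)

lemma nconv_iterate_measurable [measurable]:
  "V \<in> Borel \<Longrightarrow> W \<in> Borel \<Longrightarrow> ((nconv V) ^^ j) W \<in> Borel"
  by (induction j) auto

lemma nconv_iterate_mono: "(\<And>x. W x \<le> W' x) \<Longrightarrow> ((nconv V) ^^ j) W x \<le> ((nconv V) ^^ j) W' x"
  by (induction j arbitrary: x) (auto intro!: nconv_mono)

lemma nconv_iterate_integral:
  "V \<in> Borel \<Longrightarrow> W \<in> Borel \<Longrightarrow> (\<J> x. ((nconv V) ^^ j) W x) = (\<J> x. V x) ^ j * (\<J> x. W x)"
  by (induction j) (auto simp: nn_integral_nconv mult.assoc)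

lemma nconv_add:
  assumes [measurable]: "V \<in> Borel" "W \<in> Borel" "W' \<in> Borel"
  shows "nconv V (\<lambda>x. W x + W' x) x = nconv V W x + nconv V W' x"
  unfolding nconv_def by (simp add: distrib_left nn_integral_add)

lemma nconv_iterate_add:
  assumes [measurable]: "V \<in> Borel" "W \<in> Borel" "W' \<in> Borel"
  shows "((nconv V) ^^ j) (\<lambda>x. W x + W' x) x = ((nconv V) ^^ j) W x + ((nconv V) ^^ j) W' x"
proof (induction j arbitrary: x)
  case (Suc j)
  then have "((nconv V) ^^ j) (\<lambda>x. W x + W' x) = (\<lambda>x. ((nconv V) ^^ j) W x + ((nconv V) ^^ j) W' x)" by blast
  then show ?case by (simp add: nconv_add)
qed simp

text \<open>Dominated convergence in each convolution. At a point where the dominating iterate is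
  finite, for almost every \<open>y\<close> either \<open>V y = 0\<close> or the dominating function
  of the stage before is finite at \<open>x - y\<close>, where the induction hypothesis
  applies.\<close>

lemma nconv_iterate_tendsto:
  fixes V :: "'a::euclidean_space \<Rightarrow> ennreal"
  assumes [measurable]: "V \<in> Borel" "\<And>n. W n \<in> Borel" "W' \<in> Borel" "Wm \<in> Borel"
    and V: "\<And>x. V x < \<infinity>" and le: "\<And>n x. W n x \<le> Wm x" and lim: "\<And>x. (\<lambda>n. W n x) \<longlonglongrightarrow> W' x"
    and fin: "((nconv V) ^^ j) Wm x < \<infinity>"
  shows "(\<lambda>n. ((nconv V) ^^ j) (W n) x) \<longlonglongrightarrow> ((nconv V) ^^ j) W' x"
  using fin
proof (induction j arbitrary: x)
  case 0 then show ?case using lim by simp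
next
  case (Suc j)
  define K K' Km where "K n = ((nconv V) ^^ j) (W n)" and "K' = ((nconv V) ^^ j) W'" and "Km = ((nconv V) ^^ j) Wm" for n
  have [measurable]: "K n \<in> Borel" "K' \<in> Borel" "Km \<in> Borel" for n
    unfolding K_def K'_def Km_def by measurable
  have Kle: "K n y \<le> Km y" for n y unfolding K_def Km_def by (intro nconv_iterate_mono le)
  have IH: "(\<lambda>n. K n y) \<longlonglongrightarrow> K' y" if "Km y < \<infinity>" for y
    using Suc.IH that unfolding K_def K'_def Km_def by blast
  have f: "(\<J> y. V y * Km (x - y)) < \<infinity>" using Suc.prems unfolding funpow.simps o_apply Km_def[symmetric] by (simp only: nconv_def)
  then have "AE y in lborel. V y * Km (x - y) \<noteq> \<infinity>" by (intro nn_integral_PInf_AE) auto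
  then have AE: "AE y in lborel. (\<lambda>n. V y * K n (x - y)) \<longlonglongrightarrow> V y * K' (x - y)"
  proof eventually_elim
    case (elim y)
    show ?case
    proof (cases "V y = 0")
      case False
      then have "Km (x - y) < \<infinity>" using elim by (auto simp: ennreal_mult_eq_top_iff less_top)
      from IH[OF this] show ?thesis using V[of y] by (intro ennreal_tendsto_cmult) auto
    qed simp
  qed
  have "(\<lambda>n. \<J> y. V y * K n (x - y)) \<longlonglongrightarrow> (\<J> y. V y * K' (x - y))"
    by (rule nn_integral_dominated_convergence[OF _ _ _ _ f AE]) (auto intro!: AE_I2 mult_left_mono Kle)
  then show ?case unfolding funpow.simps o_apply K_def[symmetric] K'_def[symmetric] by (simp only: nconv_def)
qed

lemma ennreal_square_eq_imp: "a * a = b * b \<Longrightarrow> a = (b::ennreal)"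
proof (cases "a = top \<or> b = top")
  case False
  assume eq: "a * a = b * b"
  obtain r s where rs: "a = ennreal r" "b = ennreal s" "r \<ge> 0" "s \<ge> 0" using False by (cases a; cases b) auto
  have "ennreal (r * r) = ennreal (s * s)" using eq rs by (simp add: ennreal_mult)
  then have "r\<^sup>2 = s\<^sup>2" using rs by (simp add: power2_eq_square)
  then show ?thesis using rs by (simp add: power2_eq_iff_nonneg)
qed (auto simp: ennreal_mult_eq_top_iff dest: sym)

text \<open>Equality forces the first convolution \<open>G * G\<close> to have no cancellation; the remaining factors enter only
  through their absolute values.\<close>

lemma power_integral_eq_imp_no_cancellation:
  fixes G :: "'a::euclidean_space \<Rightarrow> complex"
  assumes u: "ft2 u G"
  defines "V \<equiv> \<lambda>\<xi>. ennreal (norm (G \<xi>))"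
  assumes fin: "(\<J> x. cpw V (Suc j) x * cpw V (Suc j) x) < \<infinity>"
    and eq: "(\<J> x. cpw V (Suc j) x * cpw V (Suc j) x) \<le> (\<J> x. ennreal (norm (u x) ^ (2 * Suc (Suc j))))"
    and nz: "(\<J> x. V x) \<noteq> 0"
  shows "AE x in lborel. ennreal (norm (cconv G G x)) = nconv V V x"
proof -
  have sq: "sq u" "sq G" by (rule ft2_sq[OF u])+
  then have [measurable]: "u \<in> Borel" "G \<in> Borel" by (auto simp: sq_def)
  have [measurable]: "V \<in> Borel" unfolding V_def by measurable
  obtain a where a: "\<And>n. a n > 0" "a \<longlonglongrightarrow> 0" and lim: "AE x in lborel. (\<lambda>n. ft (\<lambda>\<xi>. G \<xi> * complex_of_real (gauss (a n) \<xi>)) (- x)) \<longlonglongrightarrow> u x"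
    using regularisation_AE[OF u] by blast
  define g where "g n \<xi> = G \<xi> * complex_of_real (gauss (a n) \<xi>)" for n \<xi>
  have geq: "g n = (\<lambda>\<xi>. G \<xi> * complex_of_real (gauss (a n) \<xi>))" for n by (simp add: g_def fun_eq_iff)
  have gi: "integrable lborel (g n)" "sq (g n)" for n unfolding geq by (intro sq_gauss_mult sq a)+
  have [measurable]: "g n \<in> Borel" for n unfolding geq by measurable
  have gG: "norm (g n \<xi>) \<le> norm (G \<xi>)" for n \<xi>
    using a(1)[of n] mult_left_mono[OF gauss_le_1[of "a n" \<xi>], of "norm (G \<xi>)"] by (simp add: g_def norm_mult)
  have glim: "(\<lambda>n. g n \<xi>) \<longlonglongrightarrow> G \<xi>" for \<xi>
  proof -
    have "(\<lambda>n. g n \<xi>) \<longlonglongrightarrow> G \<xi> * complex_of_real (exp (- pi * 0 * (norm \<xi>)\<^sup>2))"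
      unfolding g_def gauss_def by (intro tendsto_intros a)
    then show ?thesis by simp
  qed
  have shq: "sq (\<lambda>y. G (x - y))" for x using sq_shift(1)[OF sq_shift(3)[OF sq(2)], of "- x"] by simp
  \<comment> \<open>\<open>W'\<close> retains the phases of \<open>G\<close> in one convolution,
    while \<open>Wm\<close> is built from moduli. \<open>Wm\<close> is finite everywhere by
    Cauchy-Schwarz, because \<open>G\<close> is in L2.\<close>
  define W where "W n x = ennreal (norm (cconv (g n) (g n) x))" for n x
  define W' where "W' x = ennreal (norm (cconv G G x))" for x
  define Wm where "Wm = nconv V V"
  have [measurable]: "W n \<in> Borel" "W' \<in> Borel" "Wm \<in> Borel" for n
    unfolding W_def W'_def Wm_def by measurable
  have Wm_fin: "Wm x < \<infinity>" for x
  proof -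
    have "Wm x = (\<J> y. ennreal (norm (G y * G (x - y))))" by (simp add: Wm_def nconv_def V_def norm_mult ennreal_mult)
    also have "\<dots> < \<infinity>" using sq_mult_integrable[OF sq(2) shq[of x]] by (simp add: integrable_iff_bounded)
    finally show ?thesis .
  qed
  have Wle: "W n x \<le> Wm x" for n x unfolding W_def Wm_def V_def
    by (rule order_trans[OF norm_cconv_le nconv_mono]) (auto intro: ennreal_leI gG)
  have W'le: "W' x \<le> Wm x" for x unfolding W'_def Wm_def V_def by (rule norm_cconv_le)
  have Wlim: "(\<lambda>n. W n x) \<longlonglongrightarrow> W' x" for x
  proof -
    have "(\<lambda>n. cconv (g n) (g n) x) \<longlonglongrightarrow> cconv G G x"
      unfolding cconv_def
    proof (rule integral_dominated_convergence[where w = "\<lambda>y. norm (G y * G (x - y))"])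
      show "integrable lborel (\<lambda>y. norm (G y * G (x - y)))" by (intro integrable_norm sq_mult_integrable sq shq)
      show "AE y in lborel. norm (g n y * g n (x - y)) \<le> norm (G y * G (x - y))" for n
        by (intro AE_I2) (auto simp: norm_mult intro!: mult_mono gG)
      show "AE y in lborel. (\<lambda>n. g n y * g n (x - y)) \<longlonglongrightarrow> G y * G (x - y)"
        by (intro AE_I2 tendsto_mult glim)
    qed measurable
    then show ?thesis unfolding W_def W'_def by (intro tendsto_intros)
  qed
  let ?it = "\<lambda>W. ((nconv V) ^^ j) W"
  have cpwj: "cpw V (Suc j) = ?it Wm" unfolding Wm_def by (rule cpw_Suc_iterate)
  have cc: "ennreal (norm (ccpw (g n) (Suc j) x)) \<le> ?it (W n) x" for n x
  proof (induction j arbitrary: x)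
    case 0 then show ?case by (simp add: ccpw_Suc W_def)
  next
    case (Suc j)
    have "ennreal (norm (ccpw (g n) (Suc (Suc j)) x)) \<le> nconv (\<lambda>y. ennreal (norm (g n y))) (\<lambda>y. ennreal (norm (ccpw (g n) (Suc j) y))) x"
      unfolding ccpw_Suc[of "g n" "Suc j"] by (rule norm_cconv_le)
    also have "\<dots> \<le> nconv V (((nconv V) ^^ j) (W n)) x" by (intro nconv_mono Suc) (auto simp: V_def intro: ennreal_leI gG)
    finally show ?case by simp
  qed
  have fin': "(\<J> x. ?it Wm x * ?it Wm x) < \<infinity>" using fin unfolding cpwj .
  have itfin: "AE x in lborel. ?it Wm x < \<infinity>"
  proof -
    have "AE x in lborel. ?it Wm x * ?it Wm x \<noteq> \<infinity>" using fin' by (intro nn_integral_PInf_AE) auto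
    then show ?thesis by eventually_elim (auto simp: ennreal_mult_eq_top_iff less_top)
  qed
  have L: "(\<lambda>n. \<J> x. ?it (W n) x * ?it (W n) x) \<longlonglongrightarrow> (\<J> x. ?it W' x * ?it W' x)"
  proof (rule nn_integral_dominated_convergence[OF _ _ _ _ fin'])
    show "AE x in lborel. ?it (W n) x * ?it (W n) x \<le> ?it Wm x * ?it Wm x" for n
      by (intro AE_I2 mult_mono nconv_iterate_mono Wle) auto
    show "AE x in lborel. (\<lambda>n. ?it (W n) x * ?it (W n) x) \<longlonglongrightarrow> ?it W' x * ?it W' x"
      using itfin
    proof eventually_elim
      case (elim x)
      have t: "(\<lambda>n. ?it (W n) x) \<longlonglongrightarrow> ?it W' x"
        by (rule nconv_iterate_tendsto[OF _ _ _ _ _ Wle Wlim elim]) (auto simp: V_def)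
      have f: "?it W' x < \<infinity>" "?it (W n) x < \<infinity>" for n
        by (rule order_le_less_trans[OF nconv_iterate_mono elim], rule W'le Wle)+
      have "(\<lambda>n. enn2real (?it (W n) x)) \<longlonglongrightarrow> enn2real (?it W' x)" using t f by (intro tendsto_enn2real) (auto simp: less_top)
      then have "(\<lambda>n. ennreal (enn2real (?it (W n) x) * enn2real (?it (W n) x))) \<longlonglongrightarrow> ennreal (enn2real (?it W' x) * enn2real (?it W' x))"
        by (intro tendsto_ennrealI tendsto_mult)
      then show ?case using f by (simp add: ennreal_mult less_top)
    qed
  qed measurable
  have "(\<J> x. ennreal (norm (u x) ^ (2 * Suc (Suc j)))) = (\<J> x. liminf (\<lambda>n. ennreal (norm (ft (g n) (- x)) ^ (2 * Suc (Suc j)))))"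
  proof (intro nn_integral_cong_AE, use lim in eventually_elim)
    case (elim x)
    then have "(\<lambda>n. ennreal (norm (ft (g n) (- x)) ^ (2 * Suc (Suc j)))) \<longlonglongrightarrow> ennreal (norm (u x) ^ (2 * Suc (Suc j)))"
      unfolding geq by (intro tendsto_intros)
    from lim_imp_Liminf[OF sequentially_bot this] show ?case by (rule sym)
  qed
  also have "\<dots> \<le> liminf (\<lambda>n. \<J> x. ennreal (norm (ft (g n) (- x)) ^ (2 * Suc (Suc j))))"
    by (rule nn_integral_liminf) measurable
  also have "\<dots> = liminf (\<lambda>n. n2 (ccpw (g n) (Suc j)))" by (simp only: ft_power_norm[OF gi])
  also have "\<dots> \<le> liminf (\<lambda>n. \<J> x. ?it (W n) x * ?it (W n) x)"
  proof (intro Liminf_mono always_eventually allI)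
    fix n
    show "n2 (ccpw (g n) (Suc j)) \<le> (\<J> x. ?it (W n) x * ?it (W n) x)"
      unfolding n2_def power2_eq_square by (intro nn_integral_mono) (simp add: ennreal_mult, intro mult_mono cc, auto)
  qed
  also have "\<dots> = (\<J> x. ?it W' x * ?it W' x)" by (rule lim_imp_Liminf[OF sequentially_bot L])
  \<comment> \<open>Fatou and dominated convergence lead from \<open>u\<close> to the undamped
    \<open>W'\<close>, and the hypothesis on \<open>u\<close> now squeezes the integrals for
    \<open>W'\<close> and \<open>Wm\<close> together.\<close>
  finally have low: "(\<J> x. ?it Wm x * ?it Wm x) \<le> (\<J> x. ?it W' x * ?it W' x)"
    using eq unfolding cpwj by (rule order_trans[rotated])
  have "AE x in lborel. ?it W' x * ?it W' x = ?it Wm x * ?it Wm x"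
    by (rule nn_integral_eq_imp_AE_eq[OF _ _ _ low fin']) (auto intro!: AE_I2 mult_mono nconv_iterate_mono W'le)
  then have ite: "AE x in lborel. ?it W' x = ?it Wm x"
    by eventually_elim (rule ennreal_square_eq_imp)
  \<comment> \<open>The loss by cancellation. Its iterated convolution with \<open>V\<close>
    vanishes almost everywhere and has as integral a power of the integral of \<open>V\<close>,
    which is nonzero, times the integral of \<open>D\<close>.\<close>
  define D where "D x = Wm x - W' x" for x
  have [measurable]: "D \<in> Borel" unfolding D_def by measurable
  have WD: "Wm x = W' x + D x" for x unfolding D_def by (subst add.commute, rule diff_add_cancel_ennreal[OF W'le, symmetric])
  have "AE x in lborel. ?it D x = 0" using ite itfin
  proof eventually_elim
    case (elim x)
    have "?it Wm x = ?it W' x + ?it D x"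
      using nconv_iterate_add[of V W' D j x] unfolding WD[symmetric] by simp
    then have "?it W' x + ?it D x = ?it W' x + 0" using elim by simp
    moreover have "?it W' x \<noteq> \<infinity>" using elim by (auto simp: less_top)
    ultimately show ?case by (simp only: ennreal_add_left_cancel) simp
  qed
  then have "(\<J> x. ?it D x) = 0" by (subst nn_integral_0_iff_AE) auto
  then have "(\<J> x. D x) = 0" using nz by (simp add: nconv_iterate_integral)
  then have "AE x in lborel. D x = 0" by (subst (asm) nn_integral_0_iff_AE) auto
  then show ?thesis by eventually_elim (use WD in \<open>simp add: W'_def Wm_def\<close>)
qed

subsection \<open>Rigidity of the phase\<close>

lemma AE_lborel_continuous_eq:
  fixes f g :: "'a::euclidean_space \<Rightarrow> 'b::t2_space"
  assumes "AE x in lborel. f x = g x" "continuous_on UNIV f" "continuous_on UNIV g"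
  shows "f x = g x"
proof -
  have "closed {x. f x = g x}" by (rule closed_Collect_eq) (use assms in auto)
  moreover have "AE x in lebesgue. x \<in> {x. f x = g x}" using AE_completion[OF assms(1)] by simp
  ultimately show ?thesis using mem_closed_if_AE_lebesgue by blast
qed

text \<open>After a rotation the integral is nonnegative, and
  \<open>norm (h x) - Re (cnj c * h x)\<close> is a nonnegative function with integral 0. If the
  integral of \<open>h\<close> is 0, then \<open>h\<close> vanishes almost everywhere and
  \<open>c = 1\<close> will do.\<close>

lemma norm_integral_eq_imp_phase:
  fixes h :: "'a::euclidean_space \<Rightarrow> complex"
  assumes h: "integrable lborel h" and eq: "norm (LINT x|lborel. h x) = (LINT x|lborel. norm (h x))"
  shows "\<exists>c. norm c = 1 \<and> (AE x in lborel. h x = c * of_real (norm (h x)))"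
proof -
  define I where "I = (LINT x|lborel. h x)"
  define c where "c = (if I = 0 then 1 else sgn I)"
  have c: "norm c = 1" by (simp add: c_def norm_sgn)
  have cc: "c * cnj c = 1" using c by (simp add: complex_norm_square[symmetric])
  have I: "cnj c * I = of_real (norm I)"
  proof (cases "I = 0")
    case False
    then have "c * of_real (norm I) = I" by (simp add: c_def sgn_eq)
    then have "cnj c * I = (c * cnj c) * of_real (norm I)" by (metis mult.commute mult.left_commute)
    then show ?thesis by (simp add: cc)
  qed (simp add: c_def)
  have ih: "integrable lborel (\<lambda>x. cnj c * h x)" using h by simp
  have "(LINT x|lborel. norm (h x) - Re (cnj c * h x)) = (LINT x|lborel. norm (h x)) - Re (LINT x|lborel. cnj c * h x)"
    using h ih by (subst Bochner_Integration.integral_diff) (auto simp: integral_Re[OF ih])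
  also have "\<dots> = 0" using I eq by (simp add: I_def)
  finally have 0: "(LINT x|lborel. norm (h x) - Re (cnj c * h x)) = 0" .
  have nn: "norm (h x) - Re (cnj c * h x) \<ge> 0" for x
    using complex_Re_le_cmod[of "cnj c * h x"] c by (simp add: norm_mult)
  have "AE x in lborel. norm (h x) - Re (cnj c * h x) = 0"
    using 0 nn h ih by (subst (asm) integral_nonneg_eq_0_iff_AE) auto
  then have "AE x in lborel. h x = c * of_real (norm (h x))"
  proof eventually_elim
    case (elim x)
    let ?z = "cnj c * h x"
    have n: "norm ?z = norm (h x)" using c by (simp add: norm_mult)
    then have "Re ?z = norm ?z" using elim by simp
    then have "Im ?z = 0" using cmod_power2[of ?z] by simp
    with \<open>Re ?z = norm ?z\<close> have "?z = of_real (norm (h x))" unfolding n complex_eq_iff by simp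
    then have "c * (cnj c * h x) = c * of_real (norm (h x))" by simp
    then show ?case by (simp add: mult.assoc[symmetric] cc)
  qed
  with c show ?thesis by blast
qed

text \<open>Monotonicity is known only between points where \<open>V\<close> agrees with
  \<open>S\<close>. Such points are dense, and continuity carries the inequality over once the
  approximating points are chosen in the right order of norms.\<close>

lemma sdec_abs_of_AE:
  fixes V :: "'a::euclidean_space \<Rightarrow> real"
  assumes c: "continuous_on UNIV V" and s: "sdec S" and eq: "AE x in lborel. ennreal (V x) = S x"
    and nn: "\<And>x. V x \<ge> 0" and le: "norm x \<le> norm y"
  shows "V y \<le> V x"
proof (rule ccontr)
  assume "\<not> ?thesis"
  then have less: "V x < V y" by simp
  define \<epsilon> where "\<epsilon> = (V y - V x) / 2"
  have \<epsilon>: "\<epsilon> > 0" using less by (simp add: \<epsilon>_def)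
  have cx: "isCont V x" "isCont V y" using c by (auto simp: continuous_on_eq_continuous_at)
  obtain d1 where d1: "d1 > 0" "\<And>z. dist z x < d1 \<Longrightarrow> \<bar>V z - V x\<bar> < \<epsilon>"
    using cx(1) \<epsilon> unfolding continuous_at_eps_delta dist_real_def by metis
  obtain d2 where d2: "d2 > 0" "\<And>z. dist z y < d2 \<Longrightarrow> \<bar>V z - V y\<bar> < \<epsilon>"
    using cx(2) \<epsilon> unfolding continuous_at_eps_delta dist_real_def by metis
  have dense: "\<exists>z\<in>ball p r. ennreal (V z) = S z" if r: "r > 0" for p and r :: real
  proof (rule ccontr)
    assume "\<not> ?thesis"
    then have "AE z in lborel. z \<notin> ball p r" using eq by (auto elim!: eventually_mono)
    then have "vol (ball p r) = 0" by (subst (asm) AE_iff_measurable[of "ball p r"]) auto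
    then show False using r unit_ball_vol_pos[OF of_nat_0_le_iff, of "DIM('a)"]
      by (simp add: emeasure_ball del: unit_ball_vol_pos)
  qed
  have "\<exists>x' y'. dist x' x < d1 \<and> dist y' y < d2 \<and> norm x' \<le> norm y' \<and> ennreal (V x') = S x' \<and> ennreal (V y') = S y'"
  proof -
    \<comment> \<open>Moving \<open>y\<close> outward by \<open>4 * r\<close> leaves room for an
      error below \<open>r\<close> at both points: \<open>norm x' \<le> norm x + r\<close> and
      \<open>norm y' \<ge> norm y + 3 * r\<close>, while \<open>y'\<close> stays within
      \<open>5 * r < d2\<close> of \<open>y\<close>.\<close>
    define r where "r = min d1 d2 / 8"
    have r: "r > 0" using d1 d2 by (simp add: r_def)
    obtain b :: 'a where b: "b \<in> Basis" using nonempty_Basis by blast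
    define e where "e = (if y = 0 then b else (1 / norm y) *\<^sub>R y)"
    have e: "norm e = 1" "norm (y + (4 * r) *\<^sub>R e) = norm y + 4 * r"
    proof -
      show "norm e = 1" using b by (simp add: e_def)
      show "norm (y + (4 * r) *\<^sub>R e) = norm y + 4 * r"
      proof (cases "y = 0")
        case False
        have "y + (4 * r) *\<^sub>R e = (1 + 4 * r / norm y) *\<^sub>R y" using False by (simp add: e_def scaleR_add_left)
        also have "norm \<dots> = (1 + 4 * r / norm y) * norm y" using r by simp
        finally show ?thesis using False by (simp add: distrib_right)
      qed (use r b in \<open>simp add: e_def\<close>)
    qed
    obtain y' where y': "dist (y + (4 * r) *\<^sub>R e) y' < r" "ennreal (V y') = S y'"
      using dense[OF r, of "y + (4 * r) *\<^sub>R e"] by auto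
    obtain x' where x': "dist x x' < r" "ennreal (V x') = S x'" using dense[OF r, of x] by auto
    have "norm (y + (4 * r) *\<^sub>R e) \<le> norm y' + r"
      using norm_triangle_sub[of "y + (4 * r) *\<^sub>R e" y'] y'(1) by (simp add: dist_norm)
    moreover have "norm x' \<le> norm x + r"
      using norm_triangle_sub[of x' x] x'(1) by (simp add: dist_norm norm_minus_commute)
    ultimately have "norm x' \<le> norm y'" using e le r by simp
    moreover have "dist y' y < d2"
    proof -
      have "dist y' y \<le> dist y' (y + (4 * r) *\<^sub>R e) + dist (y + (4 * r) *\<^sub>R e) y" by (rule dist_triangle)
      also have "dist (y + (4 * r) *\<^sub>R e) y = 4 * r" using e r by (simp add: dist_norm)
      finally have "dist y' y < 5 * r" using y'(1) by (simp add: dist_commute)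
      moreover have "8 * r \<le> d2" by (simp add: r_def)
      ultimately show ?thesis using r by linarith
    qed
    moreover have "dist x' x < d1" using x'(1) d1 by (simp add: r_def dist_commute)
    ultimately show ?thesis using x' y' by blast
  qed
  then obtain x' y' where xy: "dist x' x < d1" "dist y' y < d2" "norm x' \<le> norm y'" "ennreal (V x') = S x'" "ennreal (V y') = S y'" by blast
  have "ennreal (V y') \<le> ennreal (V x')" unfolding xy(4,5) by (rule sdecD[OF s xy(3)])
  then have "V y' \<le> V x'" using nn by simp
  moreover have "V x' < V x + \<epsilon>" "V y - \<epsilon> < V y'" using d1(2)[OF xy(1)] d2(2)[OF xy(2)] by auto
  ultimately show False by (simp add: \<epsilon>_def field_simps)
qed

text \<open>Cauchy's functional equation on a centred ball: by \<open>down\<close> the set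
  \<open>D\<close> is such a ball, open or closed, or empty, or the whole space. Additivity is
  available only when the sum stays in \<open>D\<close>, so every multiple that occurs has to be
  kept inside.\<close>

locale local_additive =
  fixes D :: "'a::euclidean_space set" and k :: "'a \<Rightarrow> real"
  assumes down: "\<And>x y. x \<in> D \<Longrightarrow> norm y \<le> norm x \<Longrightarrow> y \<in> D"
    and add: "\<And>x y. x \<in> D \<Longrightarrow> y \<in> D \<Longrightarrow> x + y \<in> D \<Longrightarrow> k (x + y) = k x + k y"
    and cont: "continuous_on D k"
begin

lemma scale_in: "x \<in> D \<Longrightarrow> \<bar>t\<bar> \<le> 1 \<Longrightarrow> t *\<^sub>R x \<in> D"
  by (rule down[of x]) (auto simp: mult_left_le_one_le)

lemma zero: "x \<in> D \<Longrightarrow> k 0 = 0"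
  using add[of 0 0] down[of x 0] by simp

lemma nat_scale: "x \<in> D \<Longrightarrow> n > 0 \<Longrightarrow> j \<le> n \<Longrightarrow> k ((real j / real n) *\<^sub>R x) = real j * k ((1 / real n) *\<^sub>R x)"
proof (induction j)
  case 0 then show ?case using zero by simp
next
  case (Suc j)
  have eq: "(real (Suc j) / real n) *\<^sub>R x = (real j / real n) *\<^sub>R x + (1 / real n) *\<^sub>R x"
    by (simp add: scaleR_add_left[symmetric] add_divide_distrib)
  have "k ((real (Suc j) / real n) *\<^sub>R x) = k ((real j / real n) *\<^sub>R x) + k ((1 / real n) *\<^sub>R x)"
    unfolding eq
  proof (rule add)
    show "(real j / real n) *\<^sub>R x \<in> D" "(1 / real n) *\<^sub>R x \<in> D" using Suc by (auto intro!: scale_in)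
    show "(real j / real n) *\<^sub>R x + (1 / real n) *\<^sub>R x \<in> D" unfolding eq[symmetric] using Suc by (intro scale_in) auto
  qed
  then show ?case using Suc by (simp add: distrib_right)
qed

lemma rat_scale:
  assumes x: "x \<in> D" and "n > 0" "j \<le> n"
  shows "k ((real j / real n) *\<^sub>R x) = real j / real n * k x"
proof -
  have "k x = real n * k ((1 / real n) *\<^sub>R x)" using nat_scale[OF x assms(2), of n] assms(2) by simp
  then show ?thesis using nat_scale[OF assms] assms(2) by simp
qed

text \<open>\<open>t\<close> is approximated from below by multiples of \<open>1 / Suc n\<close>,
  for which \<open>rat_scale\<close> holds, and continuity of \<open>k\<close> on \<open>D\<close>
  passes to the limit.\<close>

lemma scale:
  assumes x: "x \<in> D" and t: "0 \<le> t" "t \<le> 1"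
  shows "k (t *\<^sub>R x) = t * k x"
proof -
  define j where "j n = nat \<lfloor>t * real (Suc n)\<rfloor>" for n
  have j: "real (j n) \<le> t * real (Suc n)" "t * real (Suc n) < real (j n) + 1" for n
    using t by (auto simp: j_def)
  have jn: "j n \<le> Suc n" for n
  proof -
    have "t * real (Suc n) \<le> real (Suc n)" using mult_right_mono[of t 1 "real (Suc n)"] t by simp
    from order_trans[OF j(1)[of n] this] show ?thesis by (simp only: of_nat_le_iff)
  qed
  define q where "q n = real (j n) / real (Suc n)" for n
  have q: "q n \<le> t" "t - 1 / real (Suc n) \<le> q n" for n
  proof -
    have N: "real (Suc n) > 0" by simp
    show "q n \<le> t" unfolding q_def using j(1)[of n] N by (simp only: divide_le_eq if_True)
    have "t = t * real (Suc n) / real (Suc n)" by simp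
    also have "\<dots> \<le> (real (j n) + 1) / real (Suc n)" by (intro divide_right_mono less_imp_le j(2)) simp
    finally show "t - 1 / real (Suc n) \<le> q n" unfolding q_def add_divide_distrib by linarith
  qed
  have "(\<lambda>n. t - 1 / real (Suc n)) \<longlonglongrightarrow> t - 0" by (intro tendsto_intros LIMSEQ_Suc[OF lim_1_over_n])
  then have lt: "(\<lambda>n. t - 1 / real (Suc n)) \<longlonglongrightarrow> t" by (simp only: diff_zero)
  have qt: "q \<longlonglongrightarrow> t"
    by (rule tendsto_sandwich[OF _ _ lt tendsto_const]) (intro always_eventually allI q)+
  have qD: "q n *\<^sub>R x \<in> D" for n using jn[of n] by (intro scale_in x) (simp add: q_def)
  have "(\<lambda>n. k (q n *\<^sub>R x)) \<longlonglongrightarrow> k (t *\<^sub>R x)"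
  proof (rule continuous_on_tendsto_compose[OF cont])
    show "(\<lambda>n. q n *\<^sub>R x) \<longlonglongrightarrow> t *\<^sub>R x" by (intro tendsto_intros qt)
  qed (use qD scale_in[OF x] t in auto)
  moreover have "k (q n *\<^sub>R x) = q n * k x" for n unfolding q_def by (rule rat_scale[OF x _ jn]) simp
  ultimately have "(\<lambda>n. q n * k x) \<longlonglongrightarrow> k (t *\<^sub>R x)" by simp
  moreover have "(\<lambda>n. q n * k x) \<longlonglongrightarrow> t * k x" by (intro tendsto_intros qt)
  ultimately show ?thesis by (rule LIMSEQ_unique)
qed

lemma minus: "x \<in> D \<Longrightarrow> k (- x) = - k x"
  using add[of x "- x"] zero down[of x "- x"] down[of x 0] by simp

lemma linear: 
  assumes op: "open D" shows "\<exists>v. \<forall>x\<in>D. k x = v \<bullet> x"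
proof (cases "D = {}")
  case False
  then have "0 \<in> D" using down by (metis norm_zero norm_ge_zero all_not_in_conv)
  then obtain r where r: "r > 0" "ball 0 r \<subseteq> D" using op open_contains_ball by blast
  \<comment> \<open>The basis vectors themselves may lie outside \<open>D\<close>, so the slope in
    direction \<open>b\<close> is read off at \<open>\<rho> *\<^sub>R b\<close>; points farther out
    are scaled down to it.\<close>
  define \<rho> where "\<rho> = r / 2"
  have \<rho>: "\<rho> > 0" using r by (simp add: \<rho>_def)
  have \<rho>D: "\<rho> *\<^sub>R b \<in> D" if "b \<in> Basis" for b using that r by (intro subsetD[OF r(2)]) (simp add: \<rho>_def)
  define v where "v = (\<Sum>b\<in>Basis. (k (\<rho> *\<^sub>R b) / \<rho>) *\<^sub>R b)"
  have pos: "k (s *\<^sub>R b) = s * (k (\<rho> *\<^sub>R b) / \<rho>)" if b: "b \<in> Basis" and s: "s \<ge> 0" "s *\<^sub>R b \<in> D" for s b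
  proof (cases "s \<le> \<rho>")
    case True
    have "k ((s / \<rho>) *\<^sub>R (\<rho> *\<^sub>R b)) = (s / \<rho>) * k (\<rho> *\<^sub>R b)"
      by (rule scale[OF \<rho>D[OF b]]) (use True s \<rho> in auto)
    then show ?thesis using \<rho> by simp
  next
    case False
    have "k ((\<rho> / s) *\<^sub>R (s *\<^sub>R b)) = (\<rho> / s) * k (s *\<^sub>R b)"
      by (rule scale[OF s(2)]) (use False s \<rho> in auto)
    then show ?thesis using \<rho> False by (simp add: field_simps)
  qed
  have coord: "k (s *\<^sub>R b) = s * (k (\<rho> *\<^sub>R b) / \<rho>)" if b: "b \<in> Basis" and s: "s *\<^sub>R b \<in> D" for s b
  proof (cases "s \<ge> 0")
    case False
    have "k (- (s *\<^sub>R b)) = (- s) * (k (\<rho> *\<^sub>R b) / \<rho>)"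
      using pos[OF b, of "- s"] False down[OF s, of "- (s *\<^sub>R b)"] by simp
    then show ?thesis using minus[OF s] by simp
  qed (rule pos[OF b _ s])
  have "k x = v \<bullet> x" if x: "x \<in> D" for x
  proof -
    have part: "k (\<Sum>b\<in>B. (x \<bullet> b) *\<^sub>R b) = (\<Sum>b\<in>B. (x \<bullet> b) * (k (\<rho> *\<^sub>R b) / \<rho>))" if "B \<subseteq> Basis" "finite B" for B
      using that(2,1)
    proof (induction B rule: finite_induct)
      case empty then show ?case using zero[OF x] by simp
    next
      case (insert b B)
      \<comment> \<open>Dropping coordinates does not increase the norm, so all partial sums of the
        expansion stay in \<open>D\<close>.\<close>
      have inD: "(\<Sum>b\<in>C. (x \<bullet> b) *\<^sub>R b) \<in> D" if C: "C \<subseteq> Basis" for C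
      proof (rule down[OF x], rule norm_le_componentwise)
        fix i :: 'a assume i: "i \<in> Basis"
        have "(\<Sum>b\<in>C. (x \<bullet> b) *\<^sub>R b) \<bullet> i = (if i \<in> C then x \<bullet> i else 0)"
          using C i finite_subset[OF C finite_Basis]
          by (simp add: inner_sum_left inner_Basis subset_iff if_distrib sum.If_cases cong: sum.cong)
        then show "\<bar>(\<Sum>b\<in>C. (x \<bullet> b) *\<^sub>R b) \<bullet> i\<bar> \<le> \<bar>x \<bullet> i\<bar>" by simp
      qed
      have b: "(x \<bullet> b) *\<^sub>R b \<in> D" using inD[of "{b}"] insert by simp
      have "k ((x \<bullet> b) *\<^sub>R b + (\<Sum>b\<in>B. (x \<bullet> b) *\<^sub>R b)) = k ((x \<bullet> b) *\<^sub>R b) + k (\<Sum>b\<in>B. (x \<bullet> b) *\<^sub>R b)"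
        using inD[of B] inD[of "insert b B"] insert by (intro add b) auto
      then show ?case using insert coord[OF _ b] by simp
    qed
    have "k x = k (\<Sum>b\<in>Basis. (x \<bullet> b) *\<^sub>R b)" by (simp only: euclidean_representation)
    also have "\<dots> = (\<Sum>b\<in>Basis. (x \<bullet> b) * (k (\<rho> *\<^sub>R b) / \<rho>))" by (rule part) auto
    also have "\<dots> = v \<bullet> x" unfolding v_def inner_sum_left by (intro sum.cong) (auto simp: inner_commute)
    finally show ?thesis .
  qed
  then show ?thesis by blast
qed simp

end

text \<open>Equality in the triangle inequality for the convolution at \<open>\<zeta>\<close> gives
  all values of the integrand one common phase. In the form \<open>a * norm b = b * norm a\<close>,
  which makes sense also where factors vanish, this is a relation between continuous functions and
  extends from almost every point to all, first in the integration variable, then in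
  \<open>\<zeta>\<close>.\<close>

lemma cconv_integrand_phase:
  fixes G :: "'a::euclidean_space \<Rightarrow> complex"
  assumes sq: "sq G" and c: "continuous_on UNIV G"
    and eq: "AE \<zeta> in lborel. ennreal (norm (cconv G G \<zeta>)) = nconv (\<lambda>x. ennreal (norm (G x))) (\<lambda>x. ennreal (norm (G x))) \<zeta>"
  shows "(G x * G (\<zeta> - x)) * of_real (norm (G y * G (\<zeta> - y))) = (G y * G (\<zeta> - y)) * of_real (norm (G x * G (\<zeta> - x)))"
proof -
  have [measurable]: "G \<in> Borel" using sq by (simp add: sq_def)
  have cG: "continuous_on UNIV (\<lambda>z. G (h z))" if "continuous_on UNIV h" for h :: "'a \<Rightarrow> 'a"
    using continuous_on_compose2[OF c that] by simp
  have "AE \<zeta> in lborel. (G x * G (\<zeta> - x)) * of_real (norm (G y * G (\<zeta> - y))) = (G y * G (\<zeta> - y)) * of_real (norm (G x * G (\<zeta> - x)))"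
    using eq
  proof eventually_elim
    case (elim \<zeta>)
    have i: "integrable lborel (\<lambda>x. G x * G (\<zeta> - x))" using sq_mult_integrable[OF sq sq_shift(3)[OF sq_shift(1)[OF sq, of \<zeta>]]] by (simp add: add.commute)
    have "ennreal (LINT x|lborel. norm (G x * G (\<zeta> - x))) = (\<J> x. ennreal (norm (G x * G (\<zeta> - x))))"
      using i by (subst nn_integral_eq_integral) auto
    also have "\<dots> = ennreal (norm (cconv G G \<zeta>))" using elim by (simp add: nconv_def norm_mult ennreal_mult)
    finally have "norm (cconv G G \<zeta>) = (LINT x|lborel. norm (G x * G (\<zeta> - x)))" by simp
    then obtain c where c: "AE x in lborel. G x * G (\<zeta> - x) = c * of_real (norm (G x * G (\<zeta> - x)))"
      using norm_integral_eq_imp_phase[OF i] unfolding cconv_def by blast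
    have e: "G x * G (\<zeta> - x) = c * of_real (norm (G x * G (\<zeta> - x)))" for x
      by (rule AE_lborel_continuous_eq[OF c]) (intro continuous_intros cG)+
    have "a * s = b * r" if "a = c * r" "b = c * s" for a b r s :: complex using that by simp
    from this[OF e e] show ?case .
  qed
  then show ?thesis by (rule AE_lborel_continuous_eq) (intro continuous_intros cG)+
qed

text \<open>The pairs \<open>(X, Y)\<close> and \<open>(X + Y, 0)\<close> have the same sum, so by
  \<open>ph\<close> their products have equal phase, and the defect of additivity of
  \<open>k\<close> is a multiple of \<open>2 * pi\<close>. Along \<open>s *\<^sub>R x\<close> and
  \<open>s *\<^sub>R y\<close> the defect is continuous in \<open>s\<close>, hence constant, and it
  vanishes at \<open>s = 0\<close>. A continuous logarithm exists because \<open>D\<close> is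
  convex.\<close>

lemma phase_linear:
  fixes G :: "'a::euclidean_space \<Rightarrow> complex"
  assumes c: "continuous_on UNIV G"
    and ph: "\<And>x y \<zeta>. (G x * G (\<zeta> - x)) * of_real (norm (G y * G (\<zeta> - y))) = (G y * G (\<zeta> - y)) * of_real (norm (G x * G (\<zeta> - x)))"
    and dec: "\<And>x y. norm x \<le> norm y \<Longrightarrow> norm (G y) \<le> norm (G x)"
  shows "\<exists>\<alpha> v. \<forall>x. G x = cis \<alpha> * ech (v \<bullet> x) * of_real (norm (G x))"
proof -
  define D where "D = {x. G x \<noteq> 0}"
  have down: "y \<in> D" if "x \<in> D" "norm y \<le> norm x" for x y using dec[OF that(2)] that(1) by (auto simp: D_def)
  have op: "open D" unfolding D_def using c by (intro open_Collect_neq) auto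
  have "convex D" unfolding convex_alt
  proof safe
    fix x y :: 'a and u :: real assume x: "x \<in> D" and y: "y \<in> D" and u: "0 \<le> u" "u \<le> 1"
    have "norm ((1 - u) *\<^sub>R x + u *\<^sub>R y) \<le> (1 - u) * norm x + u * norm y"
      using norm_triangle_ineq[of "(1 - u) *\<^sub>R x" "u *\<^sub>R y"] u by simp
    also have "\<dots> \<le> (1 - u) * max (norm x) (norm y) + u * max (norm x) (norm y)"
      using u by (intro add_mono mult_left_mono) auto
    finally have "norm ((1 - u) *\<^sub>R x + u *\<^sub>R y) \<le> max (norm x) (norm y)" by (simp add: algebra_simps)
    then show "(1 - u) *\<^sub>R x + u *\<^sub>R y \<in> D" using down[OF x] down[OF y] by (auto simp: max_def split: if_splits)
  qed
  then have cD: "contractible D" by (rule convex_imp_contractible)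
  have cGD: "continuous_on D G" by (rule continuous_on_subset[OF c]) simp
  have nz: "G z \<noteq> 0" if "z \<in> D" for z using that by (simp add: D_def)
  obtain l where l: "continuous_on D l" "\<And>x. x \<in> D \<Longrightarrow> G x = exp (l x)"
    by (rule continuous_logarithm_on_contractible[OF cGD cD nz]) (assumption, rule that)
  define k where "k x = Im (l x) - Im (l 0)" for x
  have ck: "continuous_on D k" unfolding k_def by (intro continuous_intros l)
  have Gk: "G x = of_real (norm (G x)) * cis (Im (l x))" if "x \<in> D" for x
    unfolding l(2)[OF that] by (simp add: exp_eq_polar[of "l x"] norm_mult)
  interpret local_additive D k
  proof
    show "y \<in> D" if "x \<in> D" "norm y \<le> norm x" for x y using down that by blast
    show "continuous_on D k" by (rule ck)
    fix x y assume x: "x \<in> D" and y: "y \<in> D" and xy: "x + y \<in> D"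
    have sD: "s *\<^sub>R z \<in> D" if "z \<in> D" "s \<in> {0..1}" for z s using that
      by (intro down[OF that(1)]) (auto simp: mult_left_le_one_le)
    define m where "m s = k (s *\<^sub>R x) + k (s *\<^sub>R y) - k (s *\<^sub>R (x + y))" for s
    have cm: "continuous_on {0..1} m" unfolding m_def
      by (intro continuous_intros continuous_on_compose2[OF ck]) (auto intro: sD x y xy)
    have int: "m s \<in> (\<lambda>n. 2 * pi * of_int n) ` (UNIV :: int set)" if s: "s \<in> {0..1}" for s
    proof -
      have 0: "0 \<in> D" using sD[OF x, of 0] by simp
      define X where "X = s *\<^sub>R x" define Y where "Y = s *\<^sub>R y"
      have D: "X \<in> D" "Y \<in> D" "X + Y \<in> D" using sD[OF x s] sD[OF y s] sD[OF xy s] by (auto simp: X_def Y_def scaleR_add_right)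
      then have nz: "norm (G X) \<noteq> 0" "norm (G Y) \<noteq> 0" "norm (G (X + Y)) \<noteq> 0" "norm (G 0) \<noteq> 0" using 0 by (auto simp: D_def)
      have "(G X * G Y) * of_real (norm (G (X + Y) * G 0)) = (G (X + Y) * G 0) * of_real (norm (G X * G Y))"
        using ph[of X "X + Y" "X + Y"] by simp
      then have "(of_real (norm (G X)) * cis (Im (l X)) * (of_real (norm (G Y)) * cis (Im (l Y)))) * of_real (norm (G (X + Y)) * norm (G 0)) =
          (of_real (norm (G (X + Y))) * cis (Im (l (X + Y))) * (of_real (norm (G 0)) * cis (Im (l 0)))) * of_real (norm (G X) * norm (G Y))"
        unfolding Gk[OF D(1), symmetric] Gk[OF D(2), symmetric] Gk[OF D(3), symmetric] Gk[OF 0, symmetric] norm_mult .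
      then have "cis (Im (l X)) * cis (Im (l Y)) = cis (Im (l (X + Y))) * cis (Im (l 0))" using nz by (simp add: ac_simps)
      then have "cis (Im (l X) + Im (l Y)) = cis (Im (l (X + Y)) + Im (l 0))" by (simp add: cis_mult)
      then obtain n :: int where "Im (l X) + Im (l Y) = Im (l (X + Y)) + Im (l 0) + 2 * pi * of_int n"
        using sin_cos_eq_iff by (auto simp: complex_eq_iff)
      then have "m s = 2 * pi * of_int n" by (simp add: m_def k_def X_def Y_def scaleR_add_right)
      then show ?thesis by blast
    qed
    have "m constant_on {0..1}"
    proof (rule continuous_discrete_range_constant[OF connected_Icc cm])
      fix s :: real assume s: "s \<in> {0..1}"
      show "\<exists>e>0. \<forall>t. t \<in> {0..1} \<and> m t \<noteq> m s \<longrightarrow> e \<le> norm (m t - m s)"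
      proof (intro exI[of _ "2 * pi"] conjI allI impI)
        fix t assume t: "t \<in> {0..1} \<and> m t \<noteq> m s"
        obtain i j :: int where ij: "m t = 2 * pi * of_int i" "m s = 2 * pi * of_int j" using int t s by blast
        then have "i \<noteq> j" using t by auto
        then have "1 \<le> \<bar>real_of_int (i - j)\<bar>" by linarith
        then have "2 * pi * 1 \<le> 2 * pi * \<bar>real_of_int (i - j)\<bar>" by (intro mult_left_mono) auto
        also have "\<dots> = norm (m t - m s)" unfolding ij real_norm_def by (simp add: right_diff_distrib[symmetric] abs_mult)
        finally show "2 * pi \<le> norm (m t - m s)" by simp
      qed simp
    qed
    then have "m 0 = m 1" by (auto simp: constant_on_def)
    then show "k (x + y) = k x + k y" by (simp add: m_def k_def)
  qed
  obtain v where v: "\<forall>x\<in>D. k x = v \<bullet> x" using linear[OF op] by blast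
  \<comment> \<open>\<open>ech\<close> carries a factor \<open>2 * pi\<close>, for which the vector
    has to compensate.\<close>
  have "G x = cis (Im (l 0)) * ech (((1 / (2 * pi)) *\<^sub>R v) \<bullet> x) * of_real (norm (G x))" for x
  proof (cases "x \<in> D")
    case True
    have "k x = v \<bullet> x" using v True by blast
    then have "Im (l x) = Im (l 0) + v \<bullet> x" unfolding k_def by linarith
    then show ?thesis using Gk[OF True] by (simp add: ech_def cis_mult mult.commute)
  qed (simp add: D_def)
  then show ?thesis by blast
qed

subsection \<open>Comparison of a function with its Fourier rearrangement\<close>

lemma lv_powr:
  assumes "\<And>x. r x \<ge> 0" "q > 0" "t \<ge> 0"
  shows "lv (\<lambda>x. ennreal (r x powr q)) t = lv (\<lambda>x. ennreal (r x)) (t powr (1 / q))"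
  using less_powr_iff[OF assms(3,1,2)] assms by (auto simp: lv_def ennreal_less_iff)

lemma sq_lv_finite:
  assumes sq: "sq G" and t: "t > 0"
  shows "vol (lv (\<lambda>\<xi>. ennreal (norm (G \<xi>))) t) < \<infinity>"
proof -
  have [measurable]: "G \<in> Borel" using sq by (simp add: sq_def)
  have "lv (\<lambda>\<xi>. ennreal (norm (G \<xi>))) t = lv (\<lambda>\<xi>. ennreal ((norm (G \<xi>))\<^sup>2)) (t\<^sup>2)"
    using t by (auto simp: lv_def ennreal_less_iff power_strict_mono dest: power_less_imp_less_base)
  moreover have "vol (lv (\<lambda>\<xi>. ennreal ((norm (G \<xi>))\<^sup>2)) (t\<^sup>2)) < \<infinity>"
    using sq t by (intro emeasure_lv_finite) (auto simp: sq_def n2_def)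
  ultimately show ?thesis by simp
qed

lemma sq_lv_powr_finite:
  assumes sq: "sq G" and t: "t > 0" and q: "q > 0"
  shows "vol (lv (\<lambda>\<xi>. ennreal (norm (G \<xi>) powr q)) t) < \<infinity>"
  using sq_lv_finite[OF sq, of "t powr (1 / q)"] t q by (subst lv_powr) auto

text \<open>Where \<open>star\<close> is infinite (for square-integrable \<open>G\<close> at most at the origin) the value is the junk value \<open>0\<close>.\<close>
definition rs :: "('a::euclidean_space \<Rightarrow> complex) \<Rightarrow> 'a \<Rightarrow> real" where
  "rs G \<xi> = enn2real (star (\<lambda>\<eta>. ennreal (norm (G \<eta>))) \<xi>)"

lemma rs_nonneg [simp]: "rs G \<xi> \<ge> 0" by (simp add: rs_def)

lemma rs_radial: "norm x = norm y \<Longrightarrow> rs G x = rs G y"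
  unfolding rs_def by (rule arg_cong[OF sdec_eq[OF sdec_star]])

lemma rs_measurable [measurable]: "G \<in> Borel \<Longrightarrow> rs G \<in> Borel"
  unfolding rs_def by measurable

text \<open>\<open>star\<close> of the squared modulus has the same finite integral as the squared
  modulus, so it is finite almost everywhere, and there the passage to real values in
  \<open>rs\<close> loses nothing.\<close>

lemma star_powr_rs:
  assumes sq: "sq G" and q: "q > 0"
  shows "AE x in lborel. star (\<lambda>\<xi>. ennreal (norm (G \<xi>) powr q)) x = ennreal (rs G x powr q)"
    and "AE x in lborel. star (\<lambda>\<xi>. ennreal (norm (G \<xi>))) x = ennreal (rs G x)"
proof -
  have [measurable]: "G \<in> Borel" using sq by (simp add: sq_def)
  let ?V = "\<lambda>\<xi>. ennreal (norm (G \<xi>))"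
  have sp: "star (\<lambda>\<xi>. ennreal (norm (G \<xi>) powr r)) x = epowr (star ?V x) r" if "r > 0" for r x
    using that by (intro star_powr) auto
  have "(\<J> x. star (\<lambda>\<xi>. ennreal (norm (G \<xi>) powr 2)) x) = (\<J> x. ennreal (norm (G x) powr 2))"
    by (intro nn_integral_star sq_lv_powr_finite sq) auto
  also have "\<dots> = n2 G" unfolding n2_def by (intro nn_integral_cong) simp
  finally have "(\<J> x. star (\<lambda>\<xi>. ennreal (norm (G \<xi>) powr 2)) x) \<noteq> \<infinity>" using sq by (simp add: sq_def)
  then have "AE x in lborel. star (\<lambda>\<xi>. ennreal (norm (G \<xi>) powr 2)) x \<noteq> \<infinity>"
    by (intro nn_integral_PInf_AE) auto
  then have fin: "AE x in lborel. star ?V x \<noteq> top"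
  proof eventually_elim
    case (elim x) then show ?case using sp[of 2 x] by (auto simp: epowr_def)
  qed
  then show "AE x in lborel. star ?V x = ennreal (rs G x)"
    by eventually_elim (simp add: rs_def ennreal_enn2real_if)
  show "AE x in lborel. star (\<lambda>\<xi>. ennreal (norm (G \<xi>) powr q)) x = ennreal (rs G x powr q)"
    using fin by eventually_elim (simp add: sp q epowr_def rs_def)
qed

lemma nn_integral_rs_powr:
  assumes sq: "sq G" and q: "q > 0"
  shows "(\<J> x. ennreal (rs G x powr q)) = (\<J> x. ennreal (norm (G x) powr q))"
proof -
  have [measurable]: "G \<in> Borel" using sq by (simp add: sq_def)
  have "(\<J> x. ennreal (rs G x powr q)) = (\<J> x. star (\<lambda>\<xi>. ennreal (norm (G \<xi>) powr q)) x)"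
    using star_powr_rs(1)[OF assms] by (intro nn_integral_cong_AE) auto
  also have "\<dots> = (\<J> x. ennreal (norm (G x) powr q))"
    by (intro nn_integral_star sq_lv_powr_finite sq q) auto
  finally show ?thesis .
qed

lemma sq_rs: assumes sq: "sq G" shows "sq (\<lambda>\<xi>. complex_of_real (rs G \<xi>))"
proof -
  have [measurable]: "G \<in> Borel" using sq by (simp add: sq_def)
  have "n2 (\<lambda>\<xi>. complex_of_real (rs G \<xi>)) = n2 G"
    using nn_integral_rs_powr[OF sq, of 2] unfolding n2_def by simp
  then show ?thesis using sq by (simp add: sq_def)
qed

lemma rs_weight_le:
  assumes w: "incw w" and sq: "sq G"
  shows "(\<J> x. ennreal ((rs G x)\<^sup>2) * w x) \<le> (\<J> x. ennreal ((norm (G x))\<^sup>2) * w x)"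
    and "(\<And>x y. norm x < norm y \<Longrightarrow> w x < w y) \<Longrightarrow> (\<J> x. ennreal ((norm (G x))\<^sup>2) * w x) < \<infinity> \<Longrightarrow>
      (\<J> x. ennreal ((norm (G x))\<^sup>2) * w x) \<le> (\<J> x. ennreal ((rs G x)\<^sup>2) * w x) \<Longrightarrow> AE x in lborel. rs G x = norm (G x)"
proof -
  have [measurable]: "G \<in> Borel" using sq by (simp add: sq_def)
  define h where "h \<xi> = ennreal ((norm (G \<xi>))\<^sup>2)" for \<xi>
  have [measurable]: "h \<in> Borel" unfolding h_def by measurable
  have h: "h = (\<lambda>\<xi>. ennreal (norm (G \<xi>) powr 2))" by (simp add: h_def fun_eq_iff)
  have fin: "vol (lv h t) < \<infinity>" if "t > 0" for t unfolding h by (intro sq_lv_powr_finite sq that) simp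
  have sh: "AE x in lborel. star h x = ennreal ((rs G x)\<^sup>2)" using star_powr_rs(1)[OF sq, of 2] unfolding h by simp
  have eq: "(\<J> x. ennreal ((rs G x)\<^sup>2) * w x) = (\<J> x. star h x * w x)"
    using sh by (intro nn_integral_cong_AE) auto
  show "(\<J> x. ennreal ((rs G x)\<^sup>2) * w x) \<le> (\<J> x. ennreal ((norm (G x))\<^sup>2) * w x)"
    unfolding eq h_def[symmetric] by (rule star_weight_le[OF w _ fin]) auto
  assume *: "\<And>x y. norm x < norm y \<Longrightarrow> w x < w y" "(\<J> x. ennreal ((norm (G x))\<^sup>2) * w x) < \<infinity>"
    "(\<J> x. ennreal ((norm (G x))\<^sup>2) * w x) \<le> (\<J> x. ennreal ((rs G x)\<^sup>2) * w x)"
  have "AE x in lborel. star h x = h x"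
    by (rule star_weight_eq_imp[OF w *(1) _ fin *(3)[unfolded eq h_def[symmetric]] *(2)[unfolded h_def[symmetric]]]) auto
  with sh show "AE x in lborel. rs G x = norm (G x)"
    by eventually_elim (simp add: h_def)
qed

lemma nconv_cong_AE:
  assumes "AE x in lborel. f x = f' x" "AE x in lborel. g x = g' x"
  shows "nconv f g x = nconv f' g' x"
  unfolding nconv_def using assms(1) AE_lborel_shifts(3)[OF assms(2), of x]
  by (intro nn_integral_cong_AE) auto

lemma cpw_cong_AE:
  assumes "AE x in lborel. f x = f' x" shows "AE x in lborel. cpw f k x = cpw f' k x"
proof (induction k)
  case (Suc k) then show ?case using nconv_cong_AE[OF assms Suc] by (simp add: cpw_Suc)
qed (simp add: assms)

text \<open>The chain runs from \<open>u\<close> to the convolution powers of \<open>V\<close>, of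
  \<open>star V\<close> and of \<open>rs G\<close>, and on to \<open>us\<close>. The bound on the
  powers of \<open>V\<close> is a conclusion of its own: in the equality case they are squeezed
  between equal ends.\<close>

lemma power_integral_rs:
  assumes u: "ft2 u G" and us: "ft2 us (\<lambda>\<xi>. complex_of_real (rs G \<xi>))"
  defines "V \<equiv> \<lambda>\<xi>. ennreal (norm (G \<xi>))"
  shows "(\<J> x. ennreal (norm (u x) ^ (2 * Suc k))) \<le> (\<J> x. ennreal (norm (us x) ^ (2 * Suc k)))"
    and "(\<J> x. cpw V k x * cpw V k x) \<le> (\<J> x. ennreal (norm (us x) ^ (2 * Suc k)))"
proof -
  have sq: "sq G" by (rule ft2_sq[OF u])
  then have [measurable]: "G \<in> Borel" by (simp add: sq_def)
  have [measurable]: "V \<in> Borel" unfolding V_def by measurable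
  have "AE x in lborel. cpw (star V) k x = cpw (\<lambda>x. ennreal (rs G x)) k x"
    by (rule cpw_cong_AE) (unfold V_def, rule star_powr_rs(2)[OF sq, of 1], simp)
  then have "(\<J> x. cpw (star V) k x * cpw (star V) k x) = (\<J> x. cpw (\<lambda>x. ennreal (rs G x)) k x * cpw (\<lambda>x. ennreal (rs G x)) k x)"
    by (intro nn_integral_cong_AE) auto
  also have "\<dots> \<le> (\<J> x. ennreal (norm (us x) ^ (2 * Suc k)))"
    by (rule cpw_le_power_integral[OF us]) auto
  finally have "(\<J> x. cpw (star V) k x * cpw (star V) k x) \<le> (\<J> x. ennreal (norm (us x) ^ (2 * Suc k)))" .
  from order_trans[OF cpw_square_le_star this]
  show 2: "(\<J> x. cpw V k x * cpw V k x) \<le> (\<J> x. ennreal (norm (us x) ^ (2 * Suc k)))" by simp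
  show "(\<J> x. ennreal (norm (u x) ^ (2 * Suc k))) \<le> (\<J> x. ennreal (norm (us x) ^ (2 * Suc k)))"
    by (rule order_trans[OF power_integral_le_cpw[OF u] 2[unfolded V_def]])
qed

lemma power_integral_rs_eq_imp_phase:
  assumes u: "ft2 u G" and us: "ft2 us (\<lambda>\<xi>. complex_of_real (rs G \<xi>))" and c: "continuous_on UNIV G"
    and p: "p = 2 * real (Suc (Suc j))" and fin: "(\<J> x. ennreal (norm (G x) powr (p / (p - 1)))) < \<infinity>"
    and abs: "AE x in lborel. rs G x = norm (G x)"
    and eq: "(\<J> x. ennreal (norm (us x) ^ (2 * Suc (Suc j)))) \<le> (\<J> x. ennreal (norm (u x) ^ (2 * Suc (Suc j))))"
  shows "\<exists>\<alpha> v. \<forall>\<xi>. G \<xi> = cis \<alpha> * ech (v \<bullet> \<xi>) * of_real (norm (G \<xi>))"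
proof -
  let ?V = "\<lambda>\<xi>. ennreal (norm (G \<xi>))"
  have sq: "sq G" by (rule ft2_sq[OF u])
  then have [measurable]: "G \<in> Borel" by (simp add: sq_def)
  show ?thesis
  proof (cases "(\<J> x. ?V x) = 0")
    case True
    then have "AE x in lborel. G x = 0" by (subst (asm) nn_integral_0_iff_AE) auto
    then have "G x = 0" for x by (rule AE_lborel_continuous_eq[OF _ c]) simp
    then show ?thesis by simp
  next
    case False
    have p1: "p > 1" using p by simp
    \<comment> \<open>Young's bound is applied to \<open>norm (G y) powr (p / (p - 1))\<close>,
      integrable by \<open>fin\<close>; its power \<open>1 - 1 / p\<close> is the modulus of
      \<open>G\<close>.\<close>
    have e: "p / (p - 1) * (1 - 1 / p) = 1" using p1 by (simp add: field_simps)
    have V: "(\<lambda>y. ennreal ((norm (G y) powr (p / (p - 1))) powr (1 - 1 / p))) = ?V"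
      unfolding powr_powr e by simp
    have N: "(\<J> x. cpw ?V (Suc j) x * cpw ?V (Suc j) x) < \<infinity>"
      using young_finite[of "\<lambda>y. norm (G y) powr (p / (p - 1))" p "Suc j", unfolded V] fin p by simp
    have "AE x in lborel. ennreal (norm (cconv G G x)) = nconv ?V ?V x"
      by (rule power_integral_eq_imp_no_cancellation[OF u N order_trans[OF power_integral_rs(2)[OF u us] eq] False])
    note ph = cconv_integrand_phase[OF sq c this]
    have "norm (G y) \<le> norm (G x)" if "norm x \<le> norm y" for x y
    proof (rule sdec_abs_of_AE[OF _ sdec_star[of ?V] _ _ that])
      show "AE x in lborel. ennreal (norm (G x)) = star ?V x"
        using abs star_powr_rs(2)[OF sq, of 1] by (auto elim: eventually_elim2)
    qed (auto intro!: continuous_intros c)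
    then show ?thesis by (rule phase_linear[OF c ph])
  qed
qed

section \<open>Radial symmetry under the Fourier transform\<close>

lemma lborel_distr_reflect:
  fixes e :: "'a::euclidean_space"
  assumes e: "norm e = 1"
  shows "distr lborel borel (\<lambda>z. z - (2 * (z \<bullet> e)) *\<^sub>R e) = lborel"
proof (rule measure_eqI)
  fix A assume "A \<in> sets (distr lborel borel (\<lambda>z. z - (2 * (z \<bullet> e)) *\<^sub>R e))"
  then have A [measurable]: "A \<in> sets borel" by simp
  have "emeasure (distr lborel borel (\<lambda>z. z - (2 * (z \<bullet> e)) *\<^sub>R e)) A = (\<integral>\<^sup>+z. indicator A z \<partial>(distr lborel borel (\<lambda>z. z - (2 * (z \<bullet> e)) *\<^sub>R e)))"
    by simp
  also have "\<dots> = (\<J> z. indicator A (z - (2 * (z \<bullet> e)) *\<^sub>R e))" by (rule nn_integral_distr) auto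
  also have "\<dots> = vol A" using nn_integral_reflect[OF _ e, of "indicator A" 0] by simp
  finally show "emeasure (distr lborel borel (\<lambda>z. z - (2 * (z \<bullet> e)) *\<^sub>R e)) A = vol A" .
qed simp

text \<open>Two vectors of equal norm are exchanged by the reflection in the hyperplane orthogonal
  to their difference, which preserves Lebesgue measure, inner products and
  \<open>r\<close>.\<close>

lemma ft_radial:
  fixes r :: "'a::euclidean_space \<Rightarrow> complex"
  assumes [measurable]: "r \<in> Borel" and r: "\<And>x y. norm x = norm y \<Longrightarrow> r x = r y" and n: "norm \<xi> = norm \<eta>"
  shows "ft r \<xi> = ft r \<eta>"
proof (cases "\<xi> = \<eta>")
  case False
  define d where "d = \<xi> - \<eta>"
  have d: "norm d \<noteq> 0" using False by (simp add: d_def)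
  define e where "e = (1 / norm d) *\<^sub>R d"
  have e: "norm e = 1" using d by (simp add: e_def)
  define R where "R z = z - (2 * (z \<bullet> e)) *\<^sub>R e" for z
  have [measurable]: "R \<in> Borel" unfolding R_def by measurable
  have ee: "e \<bullet> e = 1" using e by (simp add: dot_square_norm)
  have RR: "R x \<bullet> R y = x \<bullet> y" for x y
    by (simp add: R_def inner_diff_left inner_diff_right ee inner_commute algebra_simps)
  have nR: "norm (R x) = norm x" for x by (simp add: norm_eq_sqrt_inner RR)
  have "2 * (\<xi> \<bullet> d) = d \<bullet> d"
    using n by (simp add: d_def inner_diff_left inner_diff_right inner_commute norm_eq_sqrt_inner)
  also have "\<dots> = norm d * norm d" by (simp add: dot_square_norm power2_eq_square)
  finally have "2 * (\<xi> \<bullet> e) = norm d" using d by (simp add: e_def field_simps)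
  then have "R \<xi> = \<xi> - d" using d by (simp add: R_def e_def)
  then have "R \<xi> = \<eta>" by (simp add: d_def)
  have "ft r \<eta> = (LINT x|distr lborel borel R. ech (- (x \<bullet> \<eta>)) * r x)"
    unfolding ft_def R_def lborel_distr_reflect[OF e] ..
  also have "\<dots> = (LINT x|lborel. ech (- (R x \<bullet> \<eta>)) * r (R x))" by (rule integral_distr) (auto simp: R_def)
  also have "\<dots> = ft r \<xi>" unfolding ft_def \<open>R \<xi> = \<eta>\<close>[symmetric] RR using r[OF nR] by simp
  finally show ?thesis by simp
qed simp

text \<open>\<open>u\<close> is determined only almost everywhere, whereas radial symmetry is asked
  at every point. The damped transforms are radial and real everywhere. Points of equal norm have
  the same sequence of values, hence the same \<open>lim\<close>, even where the sequence
  diverges.\<close>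

lemma ft2_radial_representative:
  fixes r :: "'a::euclidean_space \<Rightarrow> real"
  assumes u: "ft2 u (\<lambda>\<xi>. complex_of_real (r \<xi>))" and [measurable]: "r \<in> Borel"
    and r: "\<And>x y. norm x = norm y \<Longrightarrow> r x = r y"
  shows "\<exists>h::'a \<Rightarrow> real. radially_symmetric h \<and> (AE x in lborel. u x = of_real (h x))"
proof -
  obtain a where lim: "AE x in lborel. (\<lambda>n. ft (\<lambda>\<xi>. complex_of_real (r \<xi>) * complex_of_real (gauss (a n) \<xi>)) (- x)) \<longlonglongrightarrow> u x"
    using regularisation_AE[OF u] by blast
  define F where "F n x = ft (\<lambda>\<xi>. complex_of_real (r \<xi>) * complex_of_real (gauss (a n) \<xi>)) (- x)" for n x
  have rad: "F n x = F n y" if "norm x = norm y" for n x y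
    unfolding F_def by (rule ft_radial) (auto simp: gauss_def that intro: r)
  have real: "Im (F n x) = 0" for n x
  proof -
    have "cnj (F n x) = F n (- x)" unfolding F_def ft_def unfolding Bochner_Integration.integral_cnj[symmetric] by (simp add: cnj_ech)
    also have "\<dots> = F n x" by (rule rad) simp
    finally show ?thesis by (simp add: complex_eq_iff)
  qed
  define h where "h x = Re (lim (\<lambda>n. F n x))" for x
  have "radially_symmetric h" unfolding radially_symmetric_def
  proof (intro allI impI)
    fix x y :: 'a assume "norm x = norm y"
    then have "(\<lambda>n. F n x) = (\<lambda>n. F n y)" using rad by blast
    then show "h x = h y" unfolding h_def by (rule arg_cong)
  qed
  moreover have "AE x in lborel. u x = of_real (h x)"
    using lim unfolding F_def[symmetric]
  proof eventually_elim
    case (elim x)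
    from limI[OF elim] have "h x = Re (u x)" by (simp add: h_def)
    moreover have "(\<lambda>n. Im (F n x)) \<longlonglongrightarrow> Im (u x)" by (intro tendsto_Im elim)
    then have "Im (u x) = 0" unfolding real by (metis LIMSEQ_unique tendsto_const)
    ultimately show ?case by (simp add: complex_eq_iff)
  qed
  ultimately show ?thesis by blast
qed

subsection \<open>The case of the supremum norm\<close>

text \<open>The difference of two values is bounded by an integral that depends on the two points
  only through their difference and tends to 0 with it by dominated convergence.\<close>

lemma ft_uniformly_continuous:
  fixes u :: "'a::euclidean_space \<Rightarrow> complex"
  assumes u: "integrable lborel u" shows "uniformly_continuous_on UNIV (ft u)"
  unfolding uniformly_continuous_on_sequentially
proof (intro allI impI, elim conjE)
  fix x y :: "nat \<Rightarrow> 'a" assume xy: "(\<lambda>n. dist (x n) (y n)) \<longlonglongrightarrow> 0"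
  have [measurable]: "u \<in> Borel" using u by auto
  have d0: "(\<lambda>n. x n - y n) \<longlonglongrightarrow> 0" using xy by (simp add: tendsto_norm_zero_iff dist_norm)
  define k where "k n \<xi> = norm ((ech (- (\<xi> \<bullet> (x n - y n))) - 1) * u \<xi>)" for n \<xi>
  have k: "k n \<xi> \<le> 2 * norm (u \<xi>)" for n \<xi>
    using norm_triangle_ineq4[of "ech (- (\<xi> \<bullet> (x n - y n)))" 1] unfolding k_def norm_mult
    by (intro mult_right_mono) auto
  have lim: "(\<lambda>n. LINT \<xi>|lborel. k n \<xi>) \<longlonglongrightarrow> (LINT \<xi>::'a|lborel. 0)"
  proof (rule integral_dominated_convergence[where w = "\<lambda>\<xi>. 2 * norm (u \<xi>)"])
    show "AE \<xi> in lborel. (\<lambda>n. k n \<xi>) \<longlonglongrightarrow> 0"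
    proof (rule AE_I2)
      fix \<xi>
      have c0: "isCont ech 0" using continuous_ech[OF continuous_on_id, of UNIV] by (simp add: continuous_on_eq_continuous_at)
      have "(\<lambda>n. - (\<xi> \<bullet> (x n - y n))) \<longlonglongrightarrow> - (\<xi> \<bullet> 0)" by (intro tendsto_intros d0)
      then have "(\<lambda>n. - (\<xi> \<bullet> (x n - y n))) \<longlonglongrightarrow> 0" by (simp only: inner_zero_right minus_zero)
      from isCont_tendsto_compose[OF c0 this] have "(\<lambda>n. ech (- (\<xi> \<bullet> (x n - y n)))) \<longlonglongrightarrow> ech 0" .
      then have "(\<lambda>n. k n \<xi>) \<longlonglongrightarrow> norm ((ech 0 - 1) * u \<xi>)" unfolding k_def by (intro tendsto_intros)
      then show "(\<lambda>n. k n \<xi>) \<longlonglongrightarrow> 0" by simp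
    qed
    show "k n \<in> borel_measurable lborel" for n unfolding k_def by measurable
    show "AE \<xi> in lborel. norm (k n \<xi>) \<le> 2 * norm (u \<xi>)" for n using k by (auto simp: k_def)
  qed (use u in auto)
  have le: "dist (ft u (x n)) (ft u (y n)) \<le> (LINT \<xi>|lborel. k n \<xi>)" for n
  proof -
    have "ft u (x n) - ft u (y n) = (LINT \<xi>|lborel. ech (- (\<xi> \<bullet> x n)) * u \<xi> - ech (- (\<xi> \<bullet> y n)) * u \<xi>)"
      unfolding ft_def by (intro Bochner_Integration.integral_diff[symmetric] integrable_ech_mult u) auto
    also have "norm \<dots> \<le> (LINT \<xi>|lborel. norm (ech (- (\<xi> \<bullet> x n)) * u \<xi> - ech (- (\<xi> \<bullet> y n)) * u \<xi>))" by (rule integral_norm_bound)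
    also have "\<dots> = (LINT \<xi>|lborel. k n \<xi>)"
    proof (rule Bochner_Integration.integral_cong[OF refl])
      fix \<xi>
      have "ech (- (\<xi> \<bullet> x n)) * u \<xi> - ech (- (\<xi> \<bullet> y n)) * u \<xi> = ech (- (\<xi> \<bullet> y n)) * ((ech (- (\<xi> \<bullet> (x n - y n))) - 1) * u \<xi>)"
        by (simp add: ech_add[symmetric] inner_diff_right left_diff_distrib right_diff_distrib mult.assoc[symmetric])
      then show "norm (ech (- (\<xi> \<bullet> x n)) * u \<xi> - ech (- (\<xi> \<bullet> y n)) * u \<xi>) = k n \<xi>" by (simp add: k_def norm_mult)
    qed
    finally show ?thesis by (simp add: dist_norm)
  qed
  show "(\<lambda>n. dist (ft u (x n)) (ft u (y n))) \<longlonglongrightarrow> 0"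
    by (rule tendsto_sandwich[OF _ _ tendsto_const]) (use lim le in auto)
qed

lemma ft_continuous: "integrable lborel u \<Longrightarrow> continuous_on UNIV (ft u)"
  by (rule uniformly_continuous_imp_continuous[OF ft_uniformly_continuous])

text \<open>Around each point where the modulus is at least \<open>c\<close> there is a ball of
  fixed radius on which it is at least \<open>c / 2\<close>. The set where it is at least
  \<open>c / 2\<close> has finite measure, so far from the origin too little of it remains to
  contain such a ball.\<close>

lemma uniformly_continuous_sq_bounded:
  fixes f :: "'a::euclidean_space \<Rightarrow> complex"
  assumes uc: "uniformly_continuous_on UNIV f" and sq: "sq f" and c: "c > 0"
  shows "bounded {x. c \<le> norm (f x)}"
proof (rule ccontr)
  assume unb: "\<not> ?thesis"
  have cf: "continuous_on UNIV f" by (rule uniformly_continuous_imp_continuous[OF uc])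
  have [measurable]: "f \<in> Borel" using sq by (simp add: sq_def)
  obtain d where d: "d > 0" "\<And>x y. dist y x < d \<Longrightarrow> dist (f y) (f x) < c / 2"
    using uc c unfolding uniformly_continuous_on_def by (metis UNIV_I half_gt_zero)
  define E where "E n = {x. c / 2 \<le> norm (f x)} - ball 0 (real n)" for n
  have Em [measurable]: "E n \<in> sets borel" for n unfolding E_def by measurable
  have fin: "vol {x. c / 2 \<le> norm (f x)} < \<infinity>"
  proof -
    have "{x. c / 2 \<le> norm (f x)} \<subseteq> lv (\<lambda>x. ennreal (norm (f x))) (c / 4)" using c by (auto simp: lv_def ennreal_less_iff)
    then have "vol {x. c / 2 \<le> norm (f x)} \<le> vol (lv (\<lambda>x. ennreal (norm (f x))) (c / 4))"
      by (rule emeasure_mono) auto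
    also have "\<dots> < \<infinity>" using c by (intro sq_lv_finite sq) simp
    finally show ?thesis .
  qed
  have "(\<lambda>n. vol (E n)) \<longlonglongrightarrow> vol (\<Inter>n. E n)"
  proof (rule Lim_emeasure_decseq)
    show "decseq E" unfolding E_def decseq_def by auto
    fix n
    have "vol (E n) \<le> vol {x. c / 2 \<le> norm (f x)}" by (rule emeasure_mono) (auto simp: E_def)
    then show "vol (E n) \<noteq> \<infinity>" using fin by (auto simp: top_unique)
  qed (auto simp: Em)
  moreover have "(\<Inter>n. E n) = {}"
  proof -
    have "\<exists>n. x \<notin> E n" for x
    proof -
      obtain n where "norm x < real n" using reals_Archimedean2 by blast
      then show ?thesis by (intro exI[of _ n]) (simp add: E_def)
    qed
    then show ?thesis by blast
  qed
  ultimately have lim: "(\<lambda>n. vol (E n)) \<longlonglongrightarrow> 0" by simp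
  have "vol (ball (0::'a) d) \<le> vol (E n)" for n
  proof -
    have "\<exists>x\<in>{x. c \<le> norm (f x)}. \<not> norm x \<le> real n + d" using unb unfolding bounded_iff by blast
    then obtain x where x: "c \<le> norm (f x)" "real n + d < norm x" by auto
    have "ball x d \<subseteq> E n"
    proof
      fix y assume y: "y \<in> ball x d"
      then have "dist (f y) (f x) < c / 2" by (intro d(2)) (simp add: dist_commute)
      then have "c / 2 \<le> norm (f y)" using x(1) norm_triangle_ineq2[of "f x" "f y"] by (simp add: dist_norm norm_minus_commute)
      moreover have "real n \<le> norm y" using x(2) y norm_triangle_ineq2[of x y] by (simp add: dist_norm)
      ultimately show "y \<in> E n" by (simp add: E_def)
    qed
    then have "vol (ball x d) \<le> vol (E n)" by (rule emeasure_mono) auto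
    then show ?thesis using d(1) by (simp add: emeasure_ball)
  qed
  then have "vol (ball (0::'a) d) \<le> 0" by (intro LIMSEQ_le_const[OF lim]) auto
  moreover have "unit_ball_vol (real DIM('a)) > 0" by simp
  ultimately show False using d(1) by (simp add: emeasure_ball)
qed

text \<open>A superlevel set at a value that is taken is closed and, by the preceding lemma,
  bounded. The maximum point found in it serves as the translation in the equality case.\<close>

lemma ft_attains_sup:
  fixes u :: "'a::euclidean_space \<Rightarrow> complex"
  assumes u: "integrable lborel u" and sq: "sq (ft u)"
  shows "\<exists>x0. \<forall>x. norm (ft u x) \<le> norm (ft u x0)"
proof (cases "\<forall>x. ft u x = 0")
  case False
  then obtain x1 where x1: "norm (ft u x1) > 0" by auto
  let ?A = "{x. norm (ft u x1) \<le> norm (ft u x)}"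
  have "closed ?A" by (intro closed_Collect_le continuous_intros ft_continuous u)
  then have "compact ?A" using uniformly_continuous_sq_bounded[OF ft_uniformly_continuous[OF u] sq x1] by (simp add: compact_eq_bounded_closed)
  moreover have "continuous_on ?A (\<lambda>x. norm (ft u x))"
    by (intro continuous_intros continuous_on_subset[OF ft_continuous[OF u]]) simp
  moreover have "x1 \<in> ?A" by simp
  ultimately obtain x0 where x0: "x0 \<in> ?A" "\<And>x. x \<in> ?A \<Longrightarrow> norm (ft u x) \<le> norm (ft u x0)"
    using continuous_attains_sup[of ?A "\<lambda>x. norm (ft u x)"] by blast
  have "norm (ft u x) \<le> norm (ft u x0)" for x using x0(2)[of x] x0(1) by (cases "x \<in> ?A") auto
  then show ?thesis by blast
qed simp

lemma ft2_eq_ft: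
  assumes "ft2 u G" "integrable lborel G" shows "AE x in lborel. u x = ft G (- x)"
  by (rule ft2_unique_inverse[OF assms(1) ft2_inverse_ft[OF assms(2) ft2_sq(2)[OF assms(1)]]])

lemma esssup_norm_le:
  assumes [measurable]: "u \<in> Borel" and "AE x in lborel. norm (u x) \<le> c"
  shows "esssup lebesgue (\<lambda>x. ennreal (norm (u x))) \<le> ennreal c"
proof (rule esssup_I)
  show "(\<lambda>x. ennreal (norm (u x))) \<in> borel_measurable lebesgue" by (rule measurable_completion) measurable
  show "AE x in lebesgue. ennreal (norm (u x)) \<le> ennreal c" using AE_completion[OF assms(2)] by eventually_elim (rule ennreal_leI)
qed

lemma esssup_ft2_le:
  assumes u: "ft2 u G" and G: "integrable lborel G"
  shows "esssup lebesgue (\<lambda>x. ennreal (norm (u x))) \<le> ennreal (LINT \<xi>|lborel. norm (G \<xi>))"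
proof (rule esssup_norm_le)
  show "AE x in lborel. norm (u x) \<le> (LINT \<xi>|lborel. norm (G \<xi>))"
    using ft2_eq_ft[OF u G] by eventually_elim (simp add: ft_norm_le)
qed (use ft2_sq[OF u] in \<open>simp add: sq_def\<close>)

text \<open>\<open>u\<close> has a continuous representative whose value at 0 is the integral of
  \<open>r\<close>, and an almost everywhere bound on a continuous function holds at every
  point.\<close>

lemma esssup_ft2_ge:
  assumes u: "ft2 u (\<lambda>\<xi>. complex_of_real (r \<xi>))" and r: "integrable lborel (\<lambda>\<xi>. complex_of_real (r \<xi>))" and nn: "\<And>\<xi>. r \<xi> \<ge> 0"
  shows "ennreal (LINT \<xi>|lborel. r \<xi>) \<le> esssup lebesgue (\<lambda>x. ennreal (norm (u x)))"
proof (rule ccontr)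
  let ?f = "\<lambda>x. ft (\<lambda>\<xi>. complex_of_real (r \<xi>)) (- x)"
  assume "\<not> ?thesis"
  then have less: "esssup lebesgue (\<lambda>x. ennreal (norm (u x))) < ennreal (LINT \<xi>|lborel. r \<xi>)" by simp
  then obtain m where m: "m \<ge> 0" "esssup lebesgue (\<lambda>x. ennreal (norm (u x))) = ennreal m"
    by (cases "esssup lebesgue (\<lambda>x. ennreal (norm (u x)))") auto
  have "AE x in lebesgue. norm (?f x) \<le> m"
    using esssup_AE[of "\<lambda>x. ennreal (norm (u x))" lebesgue] AE_completion[OF ft2_eq_ft[OF u r]]
    by eventually_elim (use m in simp)
  moreover have "closed {x. norm (?f x) \<le> m}"
    by (intro closed_Collect_le continuous_intros continuous_on_compose2[OF ft_continuous[OF r]]) auto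
  ultimately have "norm (?f 0) \<le> m" using mem_closed_if_AE_lebesgue[of "{x. norm (?f x) \<le> m}" 0] by simp
  moreover have "?f 0 = complex_of_real (LINT \<xi>|lborel. r \<xi>)" unfolding ft_def by (simp add: integral_complex_of_real)
  ultimately have "(LINT \<xi>|lborel. r \<xi>) \<le> m" by simp
  then show False using less m by (simp add: ennreal_less_iff)
qed

lemma esssup_ft2_eq_imp_phase:
  assumes u: "ft2 u G" and G: "integrable lborel G" and c: "continuous_on UNIV G"
    and eq: "ennreal (LINT \<xi>|lborel. norm (G \<xi>)) \<le> esssup lebesgue (\<lambda>x. ennreal (norm (u x)))"
  shows "\<exists>\<alpha> v. \<forall>\<xi>. G \<xi> = cis \<alpha> * ech (v \<bullet> \<xi>) * of_real (norm (G \<xi>))"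
proof -
  have [measurable]: "G \<in> Borel" using G by auto
  have "sq (ft G)" using sq_shift(3)[OF ft2_sq(1)[OF ft2_inverse_ft[OF G ft2_sq(2)[OF u]]]] by simp
  then obtain x0 where x0: "\<And>x. norm (ft G x) \<le> norm (ft G x0)" using ft_attains_sup[OF G] by blast
  have "esssup lebesgue (\<lambda>x. ennreal (norm (u x))) \<le> ennreal (norm (ft G x0))"
  proof (rule esssup_norm_le)
    show "AE x in lborel. norm (u x) \<le> norm (ft G x0)"
      using ft2_eq_ft[OF u G] by eventually_elim (simp add: x0)
  qed (use ft2_sq[OF u] in \<open>simp add: sq_def\<close>)
  then have "ennreal (LINT \<xi>|lborel. norm (G \<xi>)) \<le> ennreal (norm (ft G x0))" using eq by (rule order_trans[rotated])
  then have "(LINT \<xi>|lborel. norm (G \<xi>)) \<le> norm (ft G x0)" by simp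
  then have "norm (ft G x0) = (LINT \<xi>|lborel. norm (G \<xi>))" using ft_norm_le[of G x0] by simp
  then have "norm (LINT \<xi>|lborel. ech (- (\<xi> \<bullet> x0)) * G \<xi>) = (LINT \<xi>|lborel. norm (ech (- (\<xi> \<bullet> x0)) * G \<xi>))"
    by (simp add: ft_def norm_mult)
  moreover have "integrable lborel (\<lambda>\<xi>. ech (- (\<xi> \<bullet> x0)) * G \<xi>)" by (intro integrable_ech_mult G) measurable
  ultimately obtain z where z: "norm z = 1" "AE \<xi> in lborel. ech (- (\<xi> \<bullet> x0)) * G \<xi> = z * of_real (norm (ech (- (\<xi> \<bullet> x0)) * G \<xi>))"
    using norm_integral_eq_imp_phase by blast
  have e: "ech (- (\<xi> \<bullet> x0)) * G \<xi> = z * of_real (norm (ech (- (\<xi> \<bullet> x0)) * G \<xi>))" for \<xi>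
    by (rule AE_lborel_continuous_eq[OF z(2)]) (intro continuous_intros c)+
  have "G \<xi> = cis (Arg z) * ech (x0 \<bullet> \<xi>) * of_real (norm (G \<xi>))" for \<xi>
  proof -
    have "G \<xi> = ech (x0 \<bullet> \<xi>) * (ech (- (\<xi> \<bullet> x0)) * G \<xi>)"
      by (simp add: mult.assoc[symmetric] ech_add[symmetric] inner_commute)
    also have "\<dots> = ech (x0 \<bullet> \<xi>) * (z * of_real (norm (G \<xi>)))" using e[of \<xi>] by (simp add: norm_mult)
    also have "z = cis (Arg z)" using z(1) by (metis cis_Arg norm_zero sgn_eq div_by_1 of_real_1 zero_neq_one)
    finally show ?thesis by (simp add: mult_ac)
  qed
  then show ?thesis by blast
qed

subsection \<open>Schwartz functions\<close>

definition decay :: "'a::euclidean_space \<Rightarrow> real" where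
  "decay x = 1 / (1 + norm x) ^ (DIM('a) + 2)"

lemma decay_measurable [measurable]: "decay \<in> Borel" unfolding decay_def by measurable
lemma decay_nonneg [simp]: "decay x \<ge> 0" by (simp add: decay_def)
lemma decay_le_1: "decay (x::'a::euclidean_space) \<le> 1"
proof -
  have "1 \<le> (1 + norm x) ^ (DIM('a) + 2)" by (rule one_le_power) simp
  moreover from this have "0 < (1 + norm x) ^ (DIM('a) + 2)" by linarith
  ultimately show ?thesis unfolding decay_def by (simp only: divide_le_eq_1_pos)
qed

text \<open>On the shell between the radii \<open>n\<close> and \<open>n + 1\<close> the function is
  at most \<open>(1 / real (Suc n)) ^ (DIM('a) + 2)\<close>. Summing over full balls of radius
  \<open>Suc n\<close> in place of shells costs \<open>real (Suc n) ^ DIM('a)\<close> up to a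
  constant and leaves the convergent series of inverse squares; hence the exponent in
  \<open>decay\<close>.\<close>

lemma integrable_decay: "integrable lborel (decay :: 'a::euclidean_space \<Rightarrow> real)"
proof (rule integrableI_nonneg)
  define U where "U = unit_ball_vol (real DIM('a))"
  have U: "U \<ge> 0" by (simp add: U_def)
  have le: "ennreal (decay x) \<le> (\<Sum>n. ennreal ((1 / real (Suc n)) ^ (DIM('a) + 2)) * indicator (ball 0 (real (Suc n))) x)" for x :: 'a
  proof -
    define n where "n = nat \<lfloor>norm x\<rfloor>"
    have n: "real n \<le> norm x" unfolding n_def by (rule of_nat_floor) simp
    have n2: "norm x < real (Suc n)" unfolding n_def by linarith
    have "1 / (1 + norm x) \<le> 1 / real (Suc n)" using n by (intro divide_left_mono mult_pos_pos) (auto simp: add_pos_nonneg)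
    then have "decay x \<le> (1 / real (Suc n)) ^ (DIM('a) + 2)" unfolding decay_def power_one_over[symmetric]
      by (intro power_mono) auto
    then have "ennreal (decay x) \<le> ennreal ((1 / real (Suc n)) ^ (DIM('a) + 2)) * indicator (ball 0 (real (Suc n))) x"
      using n2 by (simp add: ennreal_leI del: of_nat_Suc)
    also have "\<dots> \<le> (\<Sum>n. ennreal ((1 / real (Suc n)) ^ (DIM('a) + 2)) * indicator (ball 0 (real (Suc n))) x)" (is "?T n \<le> _")
    proof -
      define T where "T = ?T"
      have "T n \<le> (\<Sum>n. T n)" using sum_le_suminf[OF summableI, of "{n}" T] by simp
      then show ?thesis unfolding T_def .
    qed
    finally show ?thesis .
  qed
  have t: "(\<J> (x::'a). ennreal ((1 / real (Suc n)) ^ (DIM('a) + 2)) * indicator (ball 0 (real (Suc n))) x) = ennreal (U * (1 / real (Suc n))\<^sup>2)" for n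
  proof -
    have "(\<J> (x::'a). ennreal ((1 / real (Suc n)) ^ (DIM('a) + 2)) * indicator (ball 0 (real (Suc n))) x) =
        ennreal ((1 / real (Suc n)) ^ (DIM('a) + 2)) * ennreal (U * real (Suc n) ^ DIM('a))"
      by (subst nn_integral_cmult_indicator) (simp_all add: emeasure_ball U_def del: of_nat_Suc)
    also have "\<dots> = ennreal ((1 / real (Suc n)) ^ (DIM('a) + 2) * (U * real (Suc n) ^ DIM('a)))" using U by (intro ennreal_mult[symmetric]) auto
    also have "(1 / real (Suc n)) ^ (DIM('a) + 2) * (U * real (Suc n) ^ DIM('a)) = U * (1 / real (Suc n))\<^sup>2"
      by (simp add: power_add power_one_over power2_eq_square del: of_nat_Suc)
    finally show ?thesis .
  qed
  have "(\<J> (x::'a). ennreal (decay x)) \<le> (\<J> (x::'a). (\<Sum>n. ennreal ((1 / real (Suc n)) ^ (DIM('a) + 2)) * indicator (ball 0 (real (Suc n))) x))"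
    by (intro nn_integral_mono le)
  also have "\<dots> = (\<Sum>n. \<J> (x::'a). ennreal ((1 / real (Suc n)) ^ (DIM('a) + 2)) * indicator (ball 0 (real (Suc n))) x)"
    by (intro nn_integral_suminf borel_measurable_times_ennreal borel_measurable_const borel_measurable_indicator) simp
  also have "\<dots> = (\<Sum>n. ennreal (U * (1 / real (Suc n))\<^sup>2))" by (simp only: t)
  also have "\<dots> < \<infinity>"
  proof -
    have "summable (\<lambda>n. (1 / real (Suc n))\<^sup>2)"
    proof -
      have "summable (\<lambda>n. inverse ((real n)\<^sup>2))" by (rule inverse_power_summable) simp
      then have "summable (\<lambda>n. inverse ((real (Suc n))\<^sup>2))" by (rule summable_Suc_iff[THEN iffD2])
      then show ?thesis by (simp only: power_one_over inverse_eq_divide)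
    qed
    then have sm: "summable (\<lambda>n. U * (1 / real (Suc n))\<^sup>2)" by (rule summable_mult)
    have "(\<Sum>n. ennreal (U * (1 / real (Suc n))\<^sup>2)) = ennreal (\<Sum>n. U * (1 / real (Suc n))\<^sup>2)"
      by (rule suminf_ennreal2[OF _ sm]) (intro mult_nonneg_nonneg U zero_le_power2)
    then show ?thesis by (simp only: ennreal_less_top infinity_ennreal_def)
  qed
  finally show "(\<J> (x::'a). ennreal (decay x)) < \<infinity>" .
qed auto

lemma sq_decay: "sq (\<lambda>x::'a::euclidean_space. complex_of_real (decay x))"
  unfolding sq_def n2_def
proof
  have "(\<J> (x::'a). ennreal ((norm (complex_of_real (decay x)))\<^sup>2)) \<le> (\<J> (x::'a). ennreal (decay x))"
    using decay_le_1 by (intro nn_integral_mono ennreal_leI) (simp add: power2_eq_square mult_left_le decay_le_1)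
  also have "\<dots> < \<infinity>" using integrable_decay by (simp add: integrable_iff_bounded)
  finally show "(\<J> (x::'a). ennreal ((norm (complex_of_real (decay x)))\<^sup>2)) < \<infinity>" .
qed measurable

lemma one_plus_norm_power_le: "(1 + r) ^ N \<le> 2 ^ N * (1 + r ^ N)" if "r \<ge> 0" for r :: real
proof -
  have "(1 + r) ^ N \<le> (2 * max 1 r) ^ N" using that by (intro power_mono) auto
  also have "\<dots> = 2 ^ N * max 1 r ^ N" by (simp add: power_mult_distrib)
  also have "max 1 r ^ N \<le> 1 + r ^ N" using that by (auto simp: max_def)
  finally show ?thesis by simp
qed

text \<open>The empty list of derivatives is among those in the seminorm. That the supremum is
  finite has to be shown: each list gives a bounded function, and only finitely many lists have
  length at most \<open>N\<close>.\<close>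

lemma schwartz_bound:
  assumes \<phi>: "\<phi> \<in> schwartz" and N: "N \<ge> DIM('a)+2"
  shows "norm (\<phi> x) \<le> schwartz_seminorm N \<phi> * decay (x::'a::euclidean_space)"
proof -
  define S where "S = {bs::'a list. set bs \<subseteq> Basis \<and> length bs \<le> N} \<times> (UNIV::'a set)"
  have fin: "finite {bs::'a list. set bs \<subseteq> Basis \<and> length bs \<le> N}" by (intro finite_lists_length_le) simp
  have "\<exists>B. \<forall>x. (1 + norm x) ^ N * norm (iter_partial bs \<phi> x) \<le> B" if "set bs \<subseteq> Basis" for bs
  proof -
    have b: "bounded (range (\<lambda>x. (norm x) ^ k *\<^sub>R iter_partial bs \<phi> x))" for k using \<phi> that by (auto simp: schwartz_def)
    obtain B0 where B0: "norm (iter_partial bs \<phi> x) \<le> B0" for x using b[of 0] by (auto simp: bounded_iff)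
    obtain B1 where B1: "norm x ^ N * norm (iter_partial bs \<phi> x) \<le> B1" for x using b[of N] by (auto simp: bounded_iff)
    have "(1 + norm x) ^ N * norm (iter_partial bs \<phi> x) \<le> 2 ^ N * (B0 + B1)" for x
    proof -
      have "(1 + norm x) ^ N * norm (iter_partial bs \<phi> x) \<le> (2 ^ N * (1 + norm x ^ N)) * norm (iter_partial bs \<phi> x)"
        by (intro mult_right_mono one_plus_norm_power_le) auto
      also have "\<dots> = 2 ^ N * (norm (iter_partial bs \<phi> x) + norm x ^ N * norm (iter_partial bs \<phi> x))" by (simp add: algebra_simps)
      also have "\<dots> \<le> 2 ^ N * (B0 + B1)" by (intro mult_left_mono add_mono B0 B1) simp
      finally show ?thesis .
    qed
    then show ?thesis by blast
  qed
  then obtain B where B: "\<And>bs x. set bs \<subseteq> Basis \<Longrightarrow> (1 + norm x) ^ N * norm (iter_partial bs \<phi> x) \<le> B bs" by metis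
  have bdd: "bdd_above ((\<lambda>(bs, x). (1 + norm x) ^ N * norm (iter_partial bs \<phi> x)) ` S)"
  proof (rule bdd_aboveI2)
    fix s assume "s \<in> S"
    then obtain bs x where s: "s = (bs, x)" "set bs \<subseteq> Basis" "length bs \<le> N" by (auto simp: S_def)
    have "(1 + norm x) ^ N * norm (iter_partial bs \<phi> x) \<le> B bs" by (rule B[OF s(2)])
    also have "B bs \<le> Max (B ` {bs. set bs \<subseteq> Basis \<and> length bs \<le> N})" using fin s by (intro Max_ge) auto
    finally show "(case s of (bs, x) \<Rightarrow> (1 + norm x) ^ N * norm (iter_partial bs \<phi> x)) \<le> Max (B ` {bs. set bs \<subseteq> Basis \<and> length bs \<le> N})" using s by simp
  qed
  have "(\<lambda>(bs, x). (1 + norm x) ^ N * norm (iter_partial bs \<phi> x)) ([], x) \<le> schwartz_seminorm N \<phi>"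
    unfolding schwartz_seminorm_def S_def[symmetric] by (rule cSUP_upper[OF _ bdd]) (simp add: S_def)
  then have "(1 + norm x) ^ N * norm (\<phi> x) \<le> schwartz_seminorm N \<phi>" by (simp add: iter_partial_def)
  moreover have "(1 + norm x) ^ (DIM('a) + 2) * norm (\<phi> x) \<le> (1 + norm x) ^ N * norm (\<phi> x)"
    by (intro mult_right_mono power_increasing N) auto
  ultimately have "norm (\<phi> x) * (1 + norm x) ^ (DIM('a) + 2) \<le> schwartz_seminorm N \<phi>" by (simp only: mult.commute)
  moreover have "0 < (1 + norm x) ^ (DIM('a) + 2)" by (intro zero_less_power) (simp add: add_pos_nonneg)
  ultimately show ?thesis unfolding decay_def times_divide_eq_right mult_1_right by (simp only: pos_le_divide_eq)
qed

lemma schwartz_measurable [measurable_dest]: "\<phi> \<in> schwartz \<Longrightarrow> \<phi> \<in> Borel"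
proof -
  assume "\<phi> \<in> schwartz"
  then have "\<forall>x. iter_partial [] \<phi> differentiable (at x)" unfolding schwartz_def by (auto dest: spec[of _ "[]"])
  then have "continuous_on UNIV \<phi>"
    by (auto simp: iter_partial_def continuous_on_eq_continuous_at intro: differentiable_imp_continuous_within)
  then show ?thesis by (rule borel_measurable_continuous_onI)
qed

lemma schwartz_integrable: "\<phi> \<in> schwartz \<Longrightarrow> integrable lborel (\<phi> :: 'a::euclidean_space \<Rightarrow> complex)"
  and schwartz_sq: "\<phi> \<in> schwartz \<Longrightarrow> sq \<phi>"
proof -
  assume \<phi>: "\<phi> \<in> schwartz"
  define S where "S = schwartz_seminorm (DIM('a)+2) \<phi>"
  have b: "norm (\<phi> x) \<le> norm (complex_of_real S * complex_of_real (decay x))" for x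
    using schwartz_bound[OF \<phi>, of "DIM('a)+2" x] by (simp add: S_def norm_mult abs_mult)
       (metis abs_ge_self abs_mult abs_of_nonneg decay_nonneg order_trans)
  have [measurable]: "\<phi> \<in> Borel" by (rule schwartz_measurable[OF \<phi>])
  show "integrable lborel \<phi>"
    by (rule Bochner_Integration.integrable_bound[of _ "\<lambda>x. complex_of_real S * complex_of_real (decay x)"])
       (use b integrable_decay in auto)
  show "sq \<phi>" by (rule sq_bound[OF sq_cmult[OF sq_decay] _ b]) measurable
qed

lemma integral_schwartz_bound:
  fixes f :: "'a::euclidean_space \<Rightarrow> complex"
  assumes f: "sq f"
  shows "\<exists>C. \<forall>\<phi>\<in>schwartz. norm (LINT x|lborel. f x * \<phi> x) \<le> C * schwartz_seminorm (DIM('a)+2) \<phi>"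
proof (intro exI ballI)
  fix \<phi> :: "'a \<Rightarrow> complex" assume \<phi>: "\<phi> \<in> schwartz"
  let ?S = "schwartz_seminorm (DIM('a)+2) \<phi>"
  have i: "integrable lborel (\<lambda>x. norm (f x * complex_of_real (decay x)))" by (intro integrable_norm sq_mult_integrable f sq_decay)
  have "norm (LINT x|lborel. f x * \<phi> x) \<le> (LINT x|lborel. norm (f x * \<phi> x))" by (rule integral_norm_bound)
  also have "\<dots> \<le> (LINT x|lborel. norm (f x * complex_of_real (decay x)) * ?S)"
  proof (rule integral_mono)
    show "integrable lborel (\<lambda>x. norm (f x * \<phi> x))" by (intro integrable_norm sq_mult_integrable f schwartz_sq \<phi>)
    show "integrable lborel (\<lambda>x. norm (f x * complex_of_real (decay x)) * ?S)" using i by (rule integrable_mult_left)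
    show "norm (f x * \<phi> x) \<le> norm (f x * complex_of_real (decay x)) * ?S" for x
      using mult_left_mono[OF schwartz_bound[OF \<phi>, of "DIM('a)+2" x], of "norm (f x)"] by (simp add: norm_mult mult_ac)
  qed
  also have "\<dots> = (LINT x|lborel. norm (f x * complex_of_real (decay x))) * ?S" by simp
  finally show "norm (LINT x|lborel. f x * \<phi> x) \<le> (LINT x|lborel. norm (f x * complex_of_real (decay x))) * ?S" .
qed

text \<open>Polynomials times one complex Gaussian; unlike Gaussians alone, this family is closed under derivatives.\<close>
inductive_set gfam :: "'a::euclidean_space \<Rightarrow> 'a \<Rightarrow> ('a \<Rightarrow> complex) set" for a b :: 'a where
  base: "(\<lambda>x. exp (of_real (a \<bullet> x - pi * (x \<bullet> x)) + \<i> * of_real (b \<bullet> x))) \<in> gfam a b"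
| coord: "f \<in> gfam a b \<Longrightarrow> (\<lambda>x. of_real (x \<bullet> i) * f x) \<in> gfam a b"
| plus: "f \<in> gfam a b \<Longrightarrow> g \<in> gfam a b \<Longrightarrow> (\<lambda>x. f x + g x) \<in> gfam a b"
| cmult: "f \<in> gfam a b \<Longrightarrow> (\<lambda>x. c * f x) \<in> gfam a b"

text \<open>The induction carries a derivative all of whose directional components stay in the
  family; it is identified with \<open>frechet_derivative\<close> afterwards.\<close>

lemma gfam_derivative:
  assumes "f \<in> gfam a b"
  shows "\<exists>f'. (\<forall>x. (f has_derivative f' x) (at x)) \<and> (\<forall>i. (\<lambda>x. f' x i) \<in> gfam a b)"
  using assms
proof induction
  case base
  let ?E = "\<lambda>x. exp (of_real (a \<bullet> x - pi * (x \<bullet> x)) + \<i> * of_real (b \<bullet> x)) :: complex"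
  have "(?E has_derivative (\<lambda>h. ?E x * (of_real (a \<bullet> h - pi * (2 * (x \<bullet> h))) + \<i> * of_real (b \<bullet> h)))) (at x)" for x
  proof -
    have "((\<lambda>x. of_real (a \<bullet> x - pi * (x \<bullet> x)) + \<i> * of_real (b \<bullet> x) :: complex) has_derivative
      (\<lambda>h. of_real (a \<bullet> h - pi * (2 * (x \<bullet> h))) + \<i> * of_real (b \<bullet> h))) (at x)"
      by (rule has_derivative_eq_rhs, (rule derivative_intros)+) (simp add: fun_eq_iff inner_commute)
    from has_derivative_compose[OF this DERIV_exp[unfolded has_field_derivative_def]] show ?thesis .
  qed
  moreover have "(\<lambda>x. ?E x * (of_real (a \<bullet> i - pi * (2 * (x \<bullet> i))) + \<i> * of_real (b \<bullet> i))) \<in> gfam a b" for i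
  proof -
    have "(\<lambda>x. (of_real (a \<bullet> i) + \<i> * of_real (b \<bullet> i)) * ?E x + of_real (- 2 * pi) * (of_real (x \<bullet> i) * ?E x)) \<in> gfam a b"
      by (intro gfam.intros)
    then show ?thesis by (rule back_subst[of "\<lambda>f. f \<in> gfam a b"]) (auto simp: algebra_simps)
  qed
  ultimately show ?case by (intro exI[of _ "\<lambda>x h. ?E x * (of_real (a \<bullet> h - pi * (2 * (x \<bullet> h))) + \<i> * of_real (b \<bullet> h))"]) blast
next
  case (coord f j)
  then obtain f' where f': "\<And>x. (f has_derivative f' x) (at x)" "\<And>i. (\<lambda>x. f' x i) \<in> gfam a b" by blast
  have "((\<lambda>x. of_real (x \<bullet> j) * f x) has_derivative (\<lambda>h. of_real (x \<bullet> j) * f' x h + of_real (h \<bullet> j) * f x)) (at x)" for x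
    by (auto intro!: derivative_eq_intros f'(1))
  moreover have "(\<lambda>x. of_real (x \<bullet> j) * f' x i + of_real (i \<bullet> j) * f x) \<in> gfam a b" for i
    by (intro gfam.plus gfam.coord gfam.cmult f'(2) coord.hyps)
  ultimately show ?case by (intro exI[of _ "\<lambda>x h. of_real (x \<bullet> j) * f' x h + of_real (h \<bullet> j) * f x"]) blast
next
  case (plus f g)
  then obtain f' g' where f': "\<And>x. (f has_derivative f' x) (at x)" "\<And>i. (\<lambda>x. f' x i) \<in> gfam a b"
    and g': "\<And>x. (g has_derivative g' x) (at x)" "\<And>i. (\<lambda>x. g' x i) \<in> gfam a b" by blast
  show ?case
    by (intro exI[of _ "\<lambda>x h. f' x h + g' x h"] conjI allI has_derivative_add gfam.plus f' g')
next
  case (cmult f c)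
  then obtain f' where f': "\<And>x. (f has_derivative f' x) (at x)" "\<And>i. (\<lambda>x. f' x i) \<in> gfam a b" by blast
  show ?case
    by (intro exI[of _ "\<lambda>x h. c * f' x h"] conjI allI has_derivative_mult_right gfam.cmult f')
qed

lemma gfam_partial:
  assumes "f \<in> gfam a b"
  shows "f differentiable (at x)" and "(\<lambda>x. frechet_derivative f (at x) i) \<in> gfam a b"
proof -
  obtain f' where f': "\<And>x. (f has_derivative f' x) (at x)" "\<And>i. (\<lambda>x. f' x i) \<in> gfam a b" using gfam_derivative[OF assms] by blast
  show "f differentiable (at x)" using f'(1) by (auto simp: differentiable_def)
  have "frechet_derivative f (at x) = f' x" for x using frechet_derivative_at[OF f'(1)] by simp
  then show "(\<lambda>x. frechet_derivative f (at x) i) \<in> gfam a b" using f'(2) by simp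
qed

lemma gfam_iter_partial: "f \<in> gfam a b \<Longrightarrow> iter_partial bs f \<in> gfam a b"
  unfolding iter_partial_def by (induction bs arbitrary: f) (auto intro: gfam_partial(2))

lemma power_le_exp: "(1 + r) ^ k \<le> real k ^ k * exp r" if r: "r \<ge> 0" for r :: real
proof (cases k)
  case (Suc m)
  have "1 + r \<le> real k * exp (r / real k)"
  proof -
    have "1 + r \<le> real k * (1 + r / real k)" using r Suc by (simp add: distrib_left)
    also have "\<dots> \<le> real k * exp (r / real k)" by (intro mult_left_mono exp_ge_add_one_self) simp
    finally show ?thesis .
  qed
  then have "(1 + r) ^ k \<le> (real k * exp (r / real k)) ^ k" using r by (intro power_mono) auto
  also have "exp (r / real k) ^ k = exp r" using Suc by (subst exp_of_nat_mult[symmetric]) simp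
  then have "(real k * exp (r / real k)) ^ k = real k ^ k * exp r" by (simp add: power_mult_distrib)
  finally show ?thesis .
qed (use r in simp)

text \<open>The power \<open>k\<close> stays arbitrary in the induction because a coordinate factor
  uses up one power of \<open>1 + norm x\<close>.\<close>

lemma gfam_bounded:
  assumes "f \<in> gfam a b" shows "\<exists>C. \<forall>x. (1 + norm x) ^ k * norm (f x) \<le> C"
  using assms
proof (induction arbitrary: k)
  case base
  have "(1 + norm x) ^ k * norm (exp (of_real (a \<bullet> x - pi * (x \<bullet> x)) + \<i> * of_real (b \<bullet> x)) :: complex) \<le>
     real k ^ k * exp ((1 + norm a)\<^sup>2 / (4 * pi))" for x
  proof -
    have n: "norm (exp (of_real (a \<bullet> x - pi * (x \<bullet> x)) + \<i> * of_real (b \<bullet> x)) :: complex) = exp (a \<bullet> x - pi * (x \<bullet> x))"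
      by (simp add: norm_exp_eq_Re)
    have "norm x + (a \<bullet> x - pi * (x \<bullet> x)) \<le> norm x + (norm a * norm x - pi * (norm x)\<^sup>2)"
      using norm_cauchy_schwarz[of a x] by (simp add: dot_square_norm)
    \<comment> \<open>The maximum over \<open>r\<close> of
      \<open>(1 + norm a) * r - pi * r\<^sup>2\<close>, found by completing the square.\<close>
    also have "\<dots> \<le> (1 + norm a)\<^sup>2 / (4 * pi)"
    proof -
      have "0 \<le> (1 + norm a - 2 * pi * norm x)\<^sup>2" by simp
      then show ?thesis by (simp add: field_simps power2_eq_square)
    qed
    finally have le: "norm x + (a \<bullet> x - pi * (x \<bullet> x)) \<le> (1 + norm a)\<^sup>2 / (4 * pi)" .
    have "(1 + norm x) ^ k * exp (a \<bullet> x - pi * (x \<bullet> x)) \<le> (real k ^ k * exp (norm x)) * exp (a \<bullet> x - pi * (x \<bullet> x))"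
      by (intro mult_right_mono power_le_exp) auto
    also have "\<dots> = real k ^ k * exp (norm x + (a \<bullet> x - pi * (x \<bullet> x)))" by (simp add: exp_add)
    also have "\<dots> \<le> real k ^ k * exp ((1 + norm a)\<^sup>2 / (4 * pi))" using le by (intro mult_left_mono) auto
    finally show ?thesis unfolding n .
  qed
  then show ?case by blast
next
  case (coord f j)
  obtain C where C: "\<And>x. (1 + norm x) ^ Suc k * norm (f x) \<le> C" using coord.IH[of "Suc k"] by blast
  have "(1 + norm x) ^ k * norm (of_real (x \<bullet> j) * f x) \<le> norm j * C" for x
  proof -
    have "(1 + norm x) ^ k * norm (of_real (x \<bullet> j) * f x) = \<bar>x \<bullet> j\<bar> * ((1 + norm x) ^ k * norm (f x))" by (simp add: norm_mult)
    also have "\<dots> \<le> ((1 + norm x) * norm j) * ((1 + norm x) ^ k * norm (f x))"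
      using Cauchy_Schwarz_ineq2[of x j] by (intro mult_right_mono) (auto simp: distrib_right intro: order_trans)
    also have "\<dots> = norm j * ((1 + norm x) ^ Suc k * norm (f x))" by (simp add: mult_ac)
    also have "\<dots> \<le> norm j * C" by (intro mult_left_mono C) simp
    finally show ?thesis .
  qed
  then show ?case by blast
next
  case (plus f g)
  obtain C D where C: "\<And>x. (1 + norm x) ^ k * norm (f x) \<le> C" and D: "\<And>x. (1 + norm x) ^ k * norm (g x) \<le> D"
    using plus.IH[of k] by blast
  have "(1 + norm x) ^ k * norm (f x + g x) \<le> C + D" for x
    using mult_left_mono[OF norm_triangle_ineq[of "f x" "g x"], of "(1 + norm x) ^ k"] C[of x] D[of x] by (simp add: distrib_left)
  then show ?case by blast
next
  case (cmult f c)
  obtain C where C: "\<And>x. (1 + norm x) ^ k * norm (f x) \<le> C" using cmult.IH[of k] by blast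
  have "(1 + norm x) ^ k * norm (c * f x) \<le> norm c * C" for x
    using mult_left_mono[OF C[of x], of "norm c"] by (simp add: norm_mult mult_ac)
  then show ?case by blast
qed

lemma gfam_schwartz: assumes f: "f \<in> gfam a b" shows "f \<in> schwartz"
  unfolding schwartz_def
proof (intro CollectI allI impI conjI)
  fix bs :: "'a list"
  have g: "iter_partial bs f \<in> gfam a b" by (rule gfam_iter_partial[OF f])
  show "iter_partial bs f differentiable (at x)" for x by (rule gfam_partial(1)[OF g])
  fix k
  obtain C where C: "\<And>x. (1 + norm x) ^ k * norm (iter_partial bs f x) \<le> C" using gfam_bounded[OF g] by blast
  have "norm (norm x ^ k *\<^sub>R iter_partial bs f x) \<le> C" for x
  proof -
    have "norm x ^ k * norm (iter_partial bs f x) \<le> (1 + norm x) ^ k * norm (iter_partial bs f x)"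
      by (intro mult_right_mono power_mono) auto
    with C[of x] show ?thesis by simp
  qed
  then show "bounded (range (\<lambda>x. norm x ^ k *\<^sub>R iter_partial bs f x))" by (auto simp: bounded_iff)
qed

text \<open>The parameters of \<open>gfam\<close> cover both test families: \<open>a = 0\<close> and
  \<open>b = (2 * pi) *\<^sub>R w\<close> give \<open>gam w\<close>; the values exchanged give
  \<open>tau w\<close> up to a constant factor.\<close>

lemma gam_schwartz: "gam w \<in> schwartz"
proof -
  have "gam w = (\<lambda>x. exp (of_real (0 \<bullet> x - pi * (x \<bullet> x)) + \<i> * of_real (((2 * pi) *\<^sub>R w) \<bullet> x)))"
    by (simp add: fun_eq_iff gam_def ech_def gauss_def cis_conv_exp exp_add exp_diff exp_minus divide_inverse dot_square_norm mult_ac flip: exp_of_real)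
  then show ?thesis by (simp only: gfam_schwartz[OF gfam.base])
qed

lemma tau_schwartz: "tau w \<in> schwartz"
proof -
  have "tau w = (\<lambda>x. of_real (exp (- pi * (w \<bullet> w))) * exp (of_real (((2 * pi) *\<^sub>R w) \<bullet> x - pi * (x \<bullet> x)) + \<i> * of_real (0 \<bullet> x)))"
  proof
    fix x
    have "- pi * (norm (x - w))\<^sup>2 = - pi * (w \<bullet> w) + (((2 * pi) *\<^sub>R w) \<bullet> x - pi * (x \<bullet> x))"
      by (simp add: power2_norm_eq_inner inner_diff_left inner_diff_right inner_commute algebra_simps)
    then have "gauss 1 (x - w) = exp (- pi * (w \<bullet> w)) * exp (((2 * pi) *\<^sub>R w) \<bullet> x - pi * (x \<bullet> x))"
      by (simp add: gauss_def exp_add[symmetric])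
    then show "tau w x = of_real (exp (- pi * (w \<bullet> w))) * exp (of_real (((2 * pi) *\<^sub>R w) \<bullet> x - pi * (x \<bullet> x)) + \<i> * of_real (0 \<bullet> x))"
      by (simp add: tau_def flip: exp_of_real)
  qed
  then show ?thesis by (simp only: gfam_schwartz[OF gfam.cmult[OF gfam.base]])
qed

subsection \<open>Lebesgue measurable representatives\<close>

text \<open>\<open>f0\<close> is a Borel representative of \<open>f\<close>.\<close>
definition brep :: "('a::euclidean_space \<Rightarrow> complex) \<Rightarrow> ('a \<Rightarrow> complex) \<Rightarrow> bool" where
  "brep f f0 \<longleftrightarrow> f \<in> borel_measurable lebesgue \<and> f0 \<in> Borel \<and> (AE x in lborel. f x = f0 x)"

lemma brepD: assumes "brep f f0"
  shows "f \<in> borel_measurable lebesgue" "f0 \<in> Borel" "AE x in lborel. f x = f0 x" "AE x in lebesgue. f x = f0 x"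
  using assms AE_completion by (auto simp: brep_def)

lemma brep_exists:
  assumes [measurable]: "f \<in> borel_measurable lebesgue" shows "\<exists>f0. brep f f0"
proof -
  have m: "(\<lambda>x. Re (f x)) \<in> borel_measurable lebesgue" "(\<lambda>x. Im (f x)) \<in> borel_measurable lebesgue" by measurable
  obtain r where r: "r \<in> borel_measurable lborel" "AE x in lborel. Re (f x) = r x"
    using completion_ex_borel_measurable_real[OF m(1)] by blast
  obtain i where i: "i \<in> borel_measurable lborel" "AE x in lborel. Im (f x) = i x"
    using completion_ex_borel_measurable_real[OF m(2)] by blast
  have "brep f (\<lambda>x. Complex (r x) (i x))" unfolding brep_def
  proof (intro conjI assms)
    show "(\<lambda>x. Complex (r x) (i x)) \<in> Borel" using r(1) i(1) by (simp add: Complex_eq)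
    show "AE x in lborel. f x = Complex (r x) (i x)" using r(2) i(2) by eventually_elim (simp add: complex_eq_iff)
  qed
  then show ?thesis by blast
qed

lemma borel_measurable_lebesgueI: "f \<in> Borel \<Longrightarrow> f \<in> borel_measurable lebesgue"
  by (rule measurable_completion) (simp only: measurable_lborel2)

lemma brep_refl: "f \<in> Borel \<Longrightarrow> brep f f"
  unfolding brep_def by (intro conjI borel_measurable_lebesgueI) (assumption, assumption, rule AE_I2, rule refl)

lemma brep_nn_integral:
  assumes f: "brep f f0" shows "(\<integral>\<^sup>+x. F x (f x) \<partial>lebesgue) = (\<J> x. F x (f0 x))"
  unfolding nn_integral_completion
proof (rule nn_integral_cong_AE)
  show "AE x in lborel. F x (f x) = F x (f0 x)" using brepD(3)[OF f] by eventually_elim (simp only:)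
qed

lemma brep_distr_of:
  assumes f: "brep f f0" and \<phi> [measurable]: "\<phi> \<in> Borel"
  shows "distr_of f \<phi> = (LINT x|lborel. f0 x * \<phi> x)"
proof -
  note f0 [measurable] = brepD(2)[OF f]
  note [measurable] = brepD(1)[OF f] borel_measurable_lebesgueI[OF \<phi>] borel_measurable_lebesgueI[OF f0]
  have "distr_of f \<phi> = (LINT x|lebesgue. f0 x * \<phi> x)" unfolding distr_of_def
  proof (rule integral_cong_AE)
    show "AE x in lebesgue. f x * \<phi> x = f0 x * \<phi> x" using brepD(4)[OF f] by eventually_elim (simp only:)
  qed measurable
  then show ?thesis by (simp add: integral_completion)
qed

lemma fourier_eq_ft: assumes [measurable]: "\<phi> \<in> Borel" shows "fourier \<phi> = ft \<phi>"
proof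
  fix \<xi>
  have "exp (- 2 * complex_of_real pi * \<i> * complex_of_real (x \<bullet> \<xi>)) = ech (- (x \<bullet> \<xi>))" for x :: 'a
    by (simp add: ech_def cis_conv_exp mult_ac)
  then have "fourier \<phi> \<xi> = (LINT x|lebesgue. ech (- (x \<bullet> \<xi>)) * \<phi> x)" by (simp add: fourier_def)
  also have "\<dots> = ft \<phi> \<xi>" unfolding ft_def by (rule integral_completion) measurable
  finally show "fourier \<phi> \<xi> = ft \<phi> \<xi>" .
qed

lemma Lp_iff:
  assumes f: "brep f f0" and r: "r > 0"
  shows "f \<in> Lp (ennreal r) \<longleftrightarrow> (\<J> x. ennreal (norm (f0 x) powr r)) < \<infinity>"
  unfolding Lp_def Lp_norm_def Let_def
  using brepD(1)[OF f] brep_nn_integral[OF f, of "\<lambda>x z. ennreal (norm z powr r)"] r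
  by (auto simp: less_top)

lemma Lp_2_iff: assumes f: "brep f f0" shows "f \<in> Lp 2 \<longleftrightarrow> sq f0"
proof -
  have "(\<J> x. ennreal (norm (f0 x) powr 2)) = n2 f0" unfolding n2_def by simp
  then show ?thesis using Lp_iff[OF f, of 2] brepD(2)[OF f] by (simp add: sq_def)
qed

text \<open>From left to right the identity is tested on the functions \<open>gam w\<close>, which
  suffices by \<open>ft2_gam_test\<close>. From right to left, Schwartz functions are integrable and
  square-integrable, so the duality that defines \<open>ft2\<close> covers them.\<close>

lemma distr_eq_fourier_iff_ft2:
  fixes f g :: "'a::euclidean_space \<Rightarrow> complex"
  assumes f: "brep f f0" "sq f0" and g: "brep g g0" "sq g0"
  shows "distr_eq (fourier_distr (distr_of f)) (distr_of g) \<longleftrightarrow> ft2 f0 g0"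
proof
  assume *: "distr_eq (fourier_distr (distr_of f)) (distr_of g)"
  show "ft2 f0 g0"
  proof (rule ft2_gam_test[OF f(2) g(2)])
    fix w :: 'a
    have m: "gam w \<in> Borel" by (rule schwartz_measurable[OF gam_schwartz])
    have "distr_of f (fourier (gam w)) = distr_of g (gam w)" using * gam_schwartz by (auto simp: distr_eq_def fourier_distr_def)
    then show "(LINT x|lborel. f0 x * tau w x) = (LINT x|lborel. g0 x * gam w x)"
      by (simp add: fourier_eq_ft[OF m] ft_gam brep_distr_of[OF f(1)] brep_distr_of[OF g(1)] m schwartz_measurable[OF tau_schwartz])
  qed
next
  assume *: "ft2 f0 g0"
  show "distr_eq (fourier_distr (distr_of f)) (distr_of g)" unfolding distr_eq_def fourier_distr_def
  proof
    fix \<phi> :: "'a \<Rightarrow> complex" assume \<phi>: "\<phi> \<in> schwartz"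
    then have [measurable]: "\<phi> \<in> Borel" by (rule schwartz_measurable)
    have "ft \<phi> \<in> Borel" by measurable
    then show "distr_of f (fourier \<phi>) = distr_of g \<phi>"
      using ft2D[OF * schwartz_integrable[OF \<phi>] schwartz_sq[OF \<phi>]]
      by (simp add: fourier_eq_ft brep_distr_of[OF f(1)] brep_distr_of[OF g(1)])
  qed
qed

text \<open>The function from \<open>ft2_exists\<close> witnesses the \<open>SOME\<close>, so the
  chosen function meets its specification; a Borel representative of it turns the specification into
  \<open>ft2\<close>.\<close>

lemma fourier_L2_rep:
  assumes f: "brep f f0" "sq f0" shows "\<exists>g0. brep (fourier_L2 f) g0 \<and> ft2 f0 g0"
proof -
  obtain h where h: "ft2 f0 h" using ft2_exists f(2) by blast
  have bh: "brep h h" using ft2_sq(2)[OF h] by (auto simp: sq_def intro: brep_refl)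
  have "h \<in> Lp 2 \<and> distr_eq (fourier_distr (distr_of f)) (distr_of h)"
    using h ft2_sq(2)[OF h] by (simp add: Lp_2_iff[OF bh] distr_eq_fourier_iff_ft2[OF f bh])
  then have *: "fourier_L2 f \<in> Lp 2 \<and> distr_eq (fourier_distr (distr_of f)) (distr_of (fourier_L2 f))"
    unfolding fourier_L2_def by (rule someI[of "\<lambda>g. g \<in> Lp 2 \<and> distr_eq (fourier_distr (distr_of f)) (distr_of g)"])
  then obtain g0 where g0: "brep (fourier_L2 f) g0" using brep_exists by (auto simp: Lp_def)
  then show ?thesis using * Lp_2_iff[OF g0] distr_eq_fourier_iff_ft2[OF f g0] by blast
qed

lemma inv_fourier_L2_rep:
  assumes g: "brep g g0" "sq g0" shows "\<exists>u0. brep (inv_fourier_L2 g) u0 \<and> ft2 u0 g0"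
proof -
  obtain h where h: "ft2 h g0" using ft2_inverse_exists g(2) by blast
  have bh: "brep h h" using ft2_sq(1)[OF h] by (auto simp: sq_def intro: brep_refl)
  have "h \<in> Lp 2 \<and> distr_eq (fourier_distr (distr_of h)) (distr_of g)"
    using h ft2_sq(1)[OF h] by (simp add: Lp_2_iff[OF bh] distr_eq_fourier_iff_ft2[OF bh _ g])
  then have *: "inv_fourier_L2 g \<in> Lp 2 \<and> distr_eq (fourier_distr (distr_of (inv_fourier_L2 g))) (distr_of g)"
    unfolding inv_fourier_L2_def by (rule someI[of "\<lambda>u. u \<in> Lp 2 \<and> distr_eq (fourier_distr (distr_of u)) (distr_of g)"])
  then obtain u0 where u0: "brep (inv_fourier_L2 g) u0" using brep_exists by (auto simp: Lp_def)
  then show ?thesis using * Lp_2_iff[OF u0] distr_eq_fourier_iff_ft2[OF u0 _ g] by blast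
qed

text \<open>Volumes of centred balls increase strictly with the radius and take every finite value,
  so the \<open>THE\<close> is well defined and membership becomes the comparison of volumes used in
  \<open>star\<close>.\<close>

lemma set_rearrangement_eq:
  fixes A :: "'a::euclidean_space set"
  assumes fin: "vol B < \<infinity>" and eq: "emeasure lebesgue A = vol B"
  shows "x \<in> set_rearrangement A \<longleftrightarrow> vol (ball (0::'a) (norm x)) < vol B"
proof -
  have mb: "emeasure lebesgue (ball (0::'a) r) = vol (ball (0::'a) r)" for r by (simp add: emeasure_completion main_part_null_part_Un)
  obtain R where R: "0 \<le> R" "vol (ball (0::'a) R) = vol B"
  proof
    let ?U = "unit_ball_vol (real DIM('a))"
    let ?R = "root DIM('a) (enn2real (vol B) / ?U)"
    have U: "?U > 0" by simp
    then have U': "?U \<noteq> 0" by linarith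
    show R0: "0 \<le> ?R" using U by (intro real_root_ge_zero divide_nonneg_nonneg) auto
    have "vol (ball (0::'a) ?R) = ennreal (?U * ?R ^ DIM('a))" using R0 by (simp add: emeasure_ball)
    also have "?R ^ DIM('a) = enn2real (vol B) / ?U" using U by (intro real_root_pow_pos2) auto
    also have "?U * (enn2real (vol B) / ?U) = enn2real (vol B)" by (simp only: times_divide_eq_right nonzero_mult_div_cancel_left[OF U'])
    finally show "vol (ball (0::'a) ?R) = vol B" using fin by simp
  qed
  have sm: "vol (ball (0::'a) r) < vol (ball (0::'a) r')" if "0 \<le> r" "r < r'" for r r'
    using emeasure_ball_strict_mono that by blast
  have "(THE R. 0 \<le> R \<and> emeasure lebesgue (ball (0::'a) R) = emeasure lebesgue A) = R"
  proof (rule the_equality)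
    fix r assume "0 \<le> r \<and> emeasure lebesgue (ball (0::'a) r) = emeasure lebesgue A"
    then show "r = R" using sm[of r R] sm[of R r] R eq by (cases r R rule: linorder_cases) (auto simp: mb)
  qed (use R eq in \<open>auto simp: mb\<close>)
  then have "x \<in> set_rearrangement A \<longleftrightarrow> norm x < R" by (simp add: set_rearrangement_def)
  also have "\<dots> \<longleftrightarrow> vol (ball (0::'a) (norm x)) < vol B"
    using sm[of "norm x" R] sm[of R "norm x"] R by (cases "norm x" R rule: linorder_cases) auto
  finally show ?thesis .
qed

text \<open>The two functions agree at every point: where the layers add up to infinity, the Bochner
  integral and \<open>enn2real\<close> both give 0.\<close>

lemma symm_decr_rearrangement_eq_rs:
  assumes G: "brep G G0" "sq G0" shows "symm_decr_rearrangement G = rs G0"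
proof
  fix x
  let ?V = "\<lambda>\<xi>. ennreal (norm (G0 \<xi>))"
  have [measurable]: "G0 \<in> Borel" using brepD(2)[OF G(1)] .
  have mem: "x \<in> set_rearrangement {y. norm (G y) > t} \<longleftrightarrow> ennreal t < star ?V x" if t: "t > 0" for t
  proof -
    have "emeasure lebesgue {y. norm (G y) > t} = (\<integral>\<^sup>+y. indicator {y. norm (G y) > t} y \<partial>lebesgue)"
    proof (rule nn_integral_indicator[symmetric])
      have "G \<in> borel_measurable lebesgue" by (rule brepD(1)[OF G(1)])
      then have "{y \<in> space lebesgue. norm (G y) > t} \<in> sets lebesgue" by measurable
      then show "{y. norm (G y) > t} \<in> sets lebesgue" by simp
    qed
    also have "\<dots> = (\<integral>\<^sup>+y. indicator {z. norm z > t} (G y) \<partial>lebesgue)" by (simp add: indicator_def)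
    also have "\<dots> = (\<J> y. indicator {z. norm z > t} (G0 y))" by (rule brep_nn_integral[OF G(1)])
    also have "\<dots> = (\<J> y. indicator (lv ?V t) y)" using t by (simp add: indicator_def lv_def ennreal_less_iff)
    also have "\<dots> = vol (lv ?V t)" by simp
    finally have "emeasure lebesgue {y. norm (G y) > t} = vol (lv ?V t)" .
    from set_rearrangement_eq[OF sq_lv_finite[OF G(2) t] this, of x]
    show ?thesis using t by (subst star_greater_iff) auto
  qed
  have "symm_decr_rearrangement G x = (LINT t|lborel. indicator {t. 0 < t \<and> ennreal t < star ?V x} t)"
    unfolding symm_decr_rearrangement_def set_lebesgue_integral_def
    by (rule Bochner_Integration.integral_cong[OF refl]) (use mem in \<open>auto simp: indicator_def\<close>)
  also have "\<dots> = enn2real (\<J> t. ennreal (indicator {t. 0 < t \<and> ennreal t < star ?V x} t))"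
    by (rule integral_eq_nn_integral) auto
  also have "(\<J> t. ennreal (indicator {t. 0 < t \<and> ennreal t < star ?V x} t)) = (\<J> t. (if 0 < t \<and> ennreal t < star ?V x then 1 else 0))"
    by (rule nn_integral_cong) (simp add: indicator_def)
  also have "\<dots> = star ?V x" by (rule nn_integral_below)
  finally show "symm_decr_rearrangement G x = rs G0 x" by (simp add: rs_def)
qed

text \<open>If \<open>f\<close> is the transform of \<open>g\<close>, then its own transform is the
  reflection of \<open>g\<close>, as testing on \<open>gam w\<close> shows. The test is applicable
  because, with \<open>q \<ge> 1\<close>, a modulus above 1 is at most its power \<open>q\<close>,
  while smaller ones are controlled by the Gaussian.\<close>

lemma fourier_Lp_imp:
  fixes f :: "'a::euclidean_space \<Rightarrow> complex"
  assumes f: "brep f f0" "ft2 f0 F" and q: "q \<ge> 1" and mem: "distr_of f \<in> fourier_Lp (ennreal q)"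
  shows "(\<J> x. ennreal (norm (F x) powr q)) < \<infinity>"
proof -
  obtain g where g: "g \<in> Lp (ennreal q)" "distr_eq (distr_of f) (fourier_distr (distr_of g))" using mem by (auto simp: fourier_Lp_def)
  obtain g0 where g0: "brep g g0" using brep_exists g(1) by (auto simp: Lp_def)
  have [measurable]: "g0 \<in> Borel" "F \<in> Borel" using brepD(2)[OF g0] ft2_sq(2)[OF f(2)] by (auto simp: sq_def)
  have fin: "(\<J> x. ennreal (norm (g0 x) powr q)) < \<infinity>" using Lp_iff[OF g0] q g(1) by simp
  then have ig: "integrable lborel (\<lambda>x. norm (g0 x) powr q)" by (simp add: integrable_iff_bounded)
  have "integrable lborel (\<lambda>x. g0 x * complex_of_real (gauss 1 x))"
  proof (rule Bochner_Integration.integrable_bound)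
    show "integrable lborel (\<lambda>x::'a. gauss 1 x + norm (g0 x) powr q)" by (intro Bochner_Integration.integrable_add integrable_gauss ig) simp
    show "AE x in lborel. norm (g0 x * complex_of_real (gauss 1 x)) \<le> norm (gauss 1 x + norm (g0 x) powr q)"
    proof (rule AE_I2)
      fix x
      have "norm (g0 x) * gauss 1 x \<le> gauss 1 x + norm (g0 x) powr q"
      proof (cases "norm (g0 x) \<le> 1")
        case True then show ?thesis using mult_right_mono[OF True, of "gauss 1 x"] by (simp add: add_increasing2)
      next
        case False
        have "norm (g0 x) \<le> norm (g0 x) powr q" using powr_mono[of 1 q "norm (g0 x)"] q False by simp
        moreover have "norm (g0 x) * gauss 1 x \<le> norm (g0 x)" using mult_left_mono[OF gauss_le_1[of 1 x], of "norm (g0 x)"] by simp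
        ultimately show ?thesis using gauss_pos(2)[of 1 x] by linarith
      qed
      then show "norm (g0 x * complex_of_real (gauss 1 x)) \<le> norm (gauss 1 x + norm (g0 x) powr q)"
        by (simp add: norm_mult abs_of_nonneg add_nonneg_nonneg)
    qed
  qed measurable
  then have int: "integrable lborel (\<lambda>x. g0 (- x) * complex_of_real (gauss 1 x))"
    using lborel_integrable_shift(4)[of "\<lambda>x. g0 x * complex_of_real (gauss 1 x)"] by simp
  have "AE x in lborel. F x = g0 (- x)"
  proof (rule gam_test_unique[OF sq_gauss_integrable[OF ft2_sq(2)[OF f(2)]] int])
    fix w :: 'a
    have m: "gam w \<in> Borel" "tau w \<in> Borel" for w :: 'a
      by (rule schwartz_measurable[OF gam_schwartz], rule schwartz_measurable[OF tau_schwartz])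
    have "(LINT x|lborel. F x * gam w x) = (LINT x|lborel. f0 x * tau w x)"
      using ft2D[OF f(2) integrable_gam sq_gam, of w] by (simp add: ft_gam)
    also have "\<dots> = distr_of f (tau w)" by (simp add: brep_distr_of[OF f(1)] m)
    also have "\<dots> = distr_of g (fourier (tau w))" using g(2) tau_schwartz by (auto simp: distr_eq_def fourier_distr_def)
    also have "\<dots> = (LINT x|lborel. g0 x * gam (- w) x)" by (simp add: fourier_eq_ft m ft_tau brep_distr_of[OF g0])
    also have "\<dots> = (LINT x|lborel. g0 (- x) * gam w x)"
      using lborel_integral_shift(4)[of "\<lambda>x. g0 x * gam (- w) x"] m by (simp add: gam_def)
    finally show "(LINT x|lborel. F x * gam w x) = (LINT x|lborel. g0 (- x) * gam w x)" .
  qed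
  then have "(\<J> x. ennreal (norm (F x) powr q)) = (\<J> x. ennreal (norm (g0 (- x)) powr q))"
    by (intro nn_integral_cong_AE) auto
  also have "\<dots> = (\<J> x. ennreal (norm (g0 x) powr q))"
    using lborel_nn_integral_shift(4)[of "\<lambda>x. ennreal (norm (g0 x) powr q)"] by simp
  finally show ?thesis using fin by simp
qed

lemma tempered_distribution_distr_of:
  fixes f :: "'a::euclidean_space \<Rightarrow> complex"
  assumes f: "brep f f0" "sq f0" shows "tempered_distribution (distr_of f)"
  unfolding tempered_distribution_def
proof (intro conjI ballI allI)
  fix \<phi> \<psi> :: "'a \<Rightarrow> complex" and c assume \<phi>: "\<phi> \<in> schwartz"
  note [measurable] = schwartz_measurable[OF \<phi>]
  show "distr_of f (\<lambda>x. c * \<phi> x) = c * distr_of f \<phi>"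
    by (simp add: brep_distr_of[OF f(1)] mult.left_commute[of _ c])
  assume \<psi>: "\<psi> \<in> schwartz"
  note [measurable] = schwartz_measurable[OF \<psi>]
  show "distr_of f (\<lambda>x. \<phi> x + \<psi> x) = distr_of f \<phi> + distr_of f \<psi>"
    by (simp add: brep_distr_of[OF f(1)] distrib_left sq_mult_integrable[OF f(2) schwartz_sq] \<phi> \<psi>)
next
  obtain C where "\<And>\<phi>. \<phi> \<in> schwartz \<Longrightarrow> norm (LINT x|lborel. f0 x * \<phi> x) \<le> C * schwartz_seminorm (DIM('a)+2) \<phi>"
    using integral_schwartz_bound[OF f(2)] by blast
  then show "\<exists>N C. \<forall>\<phi>\<in>schwartz. norm (distr_of f \<phi>) \<le> C * schwartz_seminorm N \<phi>"
    using brep_distr_of[OF f(1) schwartz_measurable] by (intro exI[of _ "DIM('a)+2"] exI[of _ C]) auto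
qed

text \<open>\<open>R\<close> itself serves as the function with transform \<open>u\<close>:
  inversion produces its reflection, which is \<open>R\<close> again because \<open>R\<close> is
  even.\<close>

lemma fourier_LpI:
  fixes u :: "'a::euclidean_space \<Rightarrow> complex"
  assumes u: "brep u u0" "ft2 u0 R" and even: "\<And>\<xi>. R (- \<xi>) = R \<xi>" and q: "q > 0"
    and fin: "(\<J> x. ennreal (norm (R x) powr q)) < \<infinity>"
  shows "distr_of u \<in> fourier_Lp (ennreal q)"
proof -
  have [measurable]: "R \<in> Borel" using ft2_sq(2)[OF u(2)] by (simp add: sq_def)
  have bR: "brep R R" by (rule brep_refl) measurable
  have "R \<in> Lp (ennreal q)" using Lp_iff[OF bR q] fin by simp
  moreover have "distr_eq (distr_of u) (fourier_distr (distr_of R))" unfolding distr_eq_def fourier_distr_def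
  proof
    fix \<phi> :: "'a \<Rightarrow> complex" assume \<phi>: "\<phi> \<in> schwartz"
    note [measurable] = schwartz_measurable[OF \<phi>]
    have "ft2 (\<lambda>x. u0 (- x)) R" using ft2_reflect[OF u(2)] even by simp
    from ft2D[OF ft2_swap[OF this] schwartz_integrable[OF \<phi>] schwartz_sq[OF \<phi>]]
    have "(LINT x|lborel. R x * ft \<phi> x) = (LINT x|lborel. u0 x * \<phi> x)" by simp
    then show "distr_of u \<phi> = distr_of R (fourier \<phi>)" by (simp add: brep_distr_of[OF u(1)] brep_distr_of[OF bR] fourier_eq_ft)
  qed
  ultimately show ?thesis
    using tempered_distribution_distr_of[OF u(1) ft2_sq(1)[OF u(2)]] by (auto simp: fourier_Lp_def)
qed

text \<open>\<open>\<omega>\<close> is a monotone function of the norm, hence Borel. It may be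
  negative at the origin but is positive elsewhere, since below any positive norm there are points
  with a nonnegative value; so truncation by \<open>ennreal\<close> keeps strict
  monotonicity.\<close>

lemma strictly_radial_properties:
  fixes \<omega> :: "'a::euclidean_space \<Rightarrow> real"
  assumes eq: "\<And>x y. norm x = norm y \<Longrightarrow> \<omega> x = \<omega> y" and less: "\<And>x y. norm x < norm y \<Longrightarrow> \<omega> x < \<omega> y"
    and nn: "AE x in lborel. 0 \<le> \<omega> x"
  shows "\<omega> \<in> Borel" and "incw (\<lambda>x. ennreal (\<omega> x))"
    and "\<And>x y. norm x < norm y \<Longrightarrow> ennreal (\<omega> x) < ennreal (\<omega> y)"
proof -
  obtain b :: 'a where b: "b \<in> Basis" using nonempty_Basis by blast
  have le: "\<omega> x \<le> \<omega> y" if "norm x \<le> norm y" for x y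
    using that less[of x y] eq[of x y] by (cases "norm x = norm y") auto
  define m where "m r = \<omega> (max 0 r *\<^sub>R b)" for r :: real
  have "mono m" unfolding mono_def m_def using b by (intro allI impI le) simp
  then have [measurable]: "m \<in> Borel" by (rule borel_measurable_mono)
  have "\<omega> = (\<lambda>x. m (norm x))" unfolding m_def fun_eq_iff using b by (intro allI eq) simp
  then show [measurable]: "\<omega> \<in> Borel" by simp
  show "incw (\<lambda>x. ennreal (\<omega> x))" unfolding incw_def using le by (auto intro: ennreal_leI)
  fix x y :: 'a assume xy: "norm x < norm y"
  have "\<exists>z\<in>ball 0 (norm y). 0 \<le> \<omega> z"
  proof (rule ccontr)
    assume neg: "\<not> ?thesis"
    have "AE z in lborel. z \<notin> ball (0::'a) (norm y)" using nn by eventually_elim (use neg in blast)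
    then have "vol (ball (0::'a) (norm y)) = 0" by (subst (asm) AE_iff_measurable[of "ball 0 (norm y)"]) auto
    moreover have "0 < norm y" using xy norm_ge_zero[of x] by linarith
    ultimately show False using emeasure_ball_strict_mono[of 0 "norm y", where 'a='a] by simp
  qed
  then obtain z where "norm z < norm y" "0 \<le> \<omega> z" by auto
  then have "0 < \<omega> y" using less[of z y] by simp
  then show "ennreal (\<omega> x) < ennreal (\<omega> y)" using less[OF xy] by (simp add: ennreal_less_iff ennreal_lessI)
qed

lemma Lp_norm_infty: assumes f: "brep f f0" shows "Lp_norm \<infinity> f = esssup lebesgue (\<lambda>x. ennreal (norm (f0 x)))"
proof -
  note [measurable] = brepD(1)[OF f] borel_measurable_lebesgueI[OF brepD(2)[OF f]]
  have "esssup lebesgue (\<lambda>x. ennreal (norm (f x))) = esssup lebesgue (\<lambda>x. ennreal (norm (f0 x)))"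
  proof (rule esssup_AE_cong)
    show "AE x in lebesgue. ennreal (norm (f x)) = ennreal (norm (f0 x))" using brepD(4)[OF f] by eventually_elim (simp only:)
  qed measurable
  then show ?thesis by (simp add: Lp_norm_def)
qed

lemma Lp_norm_nat:
  assumes f: "brep f f0" and n: "n > 0"
  shows "Lp_norm (of_nat n) f = epowr (\<J> x. ennreal (norm (f0 x) ^ n)) (1 / real n)"
proof -
  have "norm z powr real n = norm z ^ n" for z :: complex using n by (cases "z = 0") (auto simp: powr_realpow)
  then show ?thesis unfolding Lp_norm_def Let_def
    using brep_nn_integral[OF f, of "\<lambda>x z. ennreal (norm z powr real n)"]
    by (simp add: epowr_def ennreal_of_nat_eq_real_of_nat)
qed

lemma epowr_le: "a \<le> b \<Longrightarrow> r > 0 \<Longrightarrow> epowr a r \<le> epowr b r"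
  unfolding epowr_def by (auto simp: top_unique intro!: ennreal_leI powr_mono2 enn2real_mono simp: less_top)

lemma epowr_eq_imp_le: assumes "epowr a r = epowr b r" "r > 0" shows "b \<le> a"
proof (cases "a = top")
  case False
  with assms have b: "b \<noteq> top" by (auto simp: epowr_def split: if_splits)
  have "enn2real a powr r = enn2real b powr r" using assms False b by (simp add: epowr_def)
  then have "enn2real a = enn2real b" using assms(2) by (metis enn2real_nonneg powr_powr powr_one divide_self_if less_irrefl mult.commute times_divide_eq_right mult_1_right)
  then have "ennreal (enn2real a) = ennreal (enn2real b)" by (rule arg_cong)
  moreover have "a < top" "b < top" using False b by (simp_all add: less_top)
  ultimately show ?thesis by (simp only: ennreal_enn2real order_refl)
qed simp

lemma AE_lborel_shiftD: "AE x in lborel. P x \<Longrightarrow> AE x in lborel. P (x - t)" for t :: "'a::euclidean_space"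
  by (rule AE_lborel_shifts(2))

lemma Lp_norm_translate:
  fixes f u :: "'a::euclidean_space \<Rightarrow> complex"
  assumes f: "brep f f0" and u: "brep u u0" and eq: "AE x in lborel. norm (f0 x) = norm (u0 (x - t))"
    and p: "p = \<infinity> \<or> (\<exists>n>0. p = of_nat n)"
  shows "Lp_norm p f = Lp_norm p u"
  using p
proof
  assume p: "p = \<infinity>"
  have le: "esssup lebesgue (\<lambda>x. ennreal (norm (a x))) \<le> esssup lebesgue (\<lambda>x. ennreal (norm (b x)))"
    if a: "a \<in> Borel" and e: "AE x in lborel. norm (a x) = norm (b (x - t))" for a b :: "'a \<Rightarrow> complex" and t
  proof (rule esssup_I)
    note [measurable] = borel_measurable_lebesgueI[OF a]
    show "(\<lambda>x. ennreal (norm (a x))) \<in> borel_measurable lebesgue" by measurable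
    have "AE x in lborel. ennreal (norm (b x)) \<le> esssup lebesgue (\<lambda>x. ennreal (norm (b x)))"
      using esssup_AE[of "\<lambda>x. ennreal (norm (b x))" lebesgue] unfolding AE_completion_iff .
    from AE_lborel_shiftD[OF this, of t] e
    have "AE x in lborel. ennreal (norm (a x)) \<le> esssup lebesgue (\<lambda>x. ennreal (norm (b x)))" by eventually_elim simp
    then show "AE x in lebesgue. ennreal (norm (a x)) \<le> esssup lebesgue (\<lambda>x. ennreal (norm (b x)))" by (rule AE_completion)
  qed
  have "AE x in lborel. norm (u0 x) = norm (f0 (x - (- t)))" using AE_lborel_shiftD[OF eq, of "- t"] by eventually_elim simp
  then show ?thesis unfolding p Lp_norm_infty[OF f] Lp_norm_infty[OF u]
    using le[OF brepD(2)[OF f] eq] le[OF brepD(2)[OF u]] by (intro antisym)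
next
  assume "\<exists>n>0. p = of_nat n"
  then obtain n where n: "n > 0" "p = of_nat n" by blast
  note [measurable] = brepD(2)[OF u]
  have "(\<J> x. ennreal (norm (f0 x) ^ n)) = (\<J> x. ennreal (norm (u0 (x - t)) ^ n))"
    by (rule nn_integral_cong_AE) (use eq in eventually_elim, simp)
  also have "\<dots> = (\<J> x. ennreal (norm (u0 x) ^ n))"
    using lborel_nn_integral_shift(2)[of "\<lambda>x. ennreal (norm (u0 x) ^ n)" t] by simp
  finally show ?thesis unfolding n(2) Lp_norm_nat[OF f n(1)] Lp_norm_nat[OF u n(1)] by simp
qed

text \<open>\<open>F\<close> may be any Borel representative of \<open>fourier_L2 f\<close>: an
  arbitrary one for the inequalities, the continuous one for the case of equality. \<open>u\<close>
  stands for the Fourier rearrangement of \<open>f\<close>.\<close>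

locale rearranged =
  fixes f f0 F u u0 :: "'a::euclidean_space \<Rightarrow> complex"
  assumes f: "brep f f0" and F: "brep (fourier_L2 f) F" "ft2 f0 F"
    and u: "brep u u0" "ft2 u0 (\<lambda>\<xi>. complex_of_real (rs F \<xi>))"
begin

lemma sqF: "sq F" using ft2_sq(2)[OF F(2)] .
lemma Fm [measurable]: "F \<in> Borel" using brepD(2)[OF F(1)] .

lemma phase_imp_translate:
  assumes "AE \<xi> in lborel. F \<xi> = c * ech (- (t \<bullet> \<xi>)) * of_real (rs F \<xi>)"
  shows "AE x in lborel. f0 x = c * u0 (x - t)"
proof -
  have m [measurable]: "u0 \<in> Borel" by (rule brepD(2)[OF u(1)])
  have "ft2 (\<lambda>x. c * u0 (x - t)) (\<lambda>\<xi>. c * (ech (- (t \<bullet> \<xi>)) * of_real (rs F \<xi>)))"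
    by (rule ft2_cmult[OF ft2_shift[OF u(2)]])
  then have "ft2 (\<lambda>x. c * u0 (x - t)) F"
  proof (rule ft2_cong_AE)
    show "AE \<xi> in lborel. c * (ech (- (t \<bullet> \<xi>)) * of_real (rs F \<xi>)) = F \<xi>" using assms by eventually_elim (simp add: mult.assoc)
  qed (auto intro: AE_I2)
  then show ?thesis by (rule ft2_unique_inverse[OF F(2)])
qed

lemma translate_imp_norm:
  assumes "AE x in lborel. f0 x = c * u0 (x - t)" and c: "norm c = 1"
  shows "AE \<xi> in lborel. norm (F \<xi>) = rs F \<xi>"
proof -
  have m [measurable]: "u0 \<in> Borel" "f0 \<in> Borel" using brepD(2)[OF u(1)] brepD(2)[OF f] by auto
  have "ft2 (\<lambda>x. c * u0 (x - t)) (\<lambda>\<xi>. c * (ech (- (t \<bullet> \<xi>)) * of_real (rs F \<xi>)))"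
    by (rule ft2_cmult[OF ft2_shift[OF u(2)]])
  then have "ft2 f0 (\<lambda>\<xi>. c * (ech (- (t \<bullet> \<xi>)) * of_real (rs F \<xi>)))"
  proof (rule ft2_cong_AE)
    show "AE x in lborel. c * u0 (x - t) = f0 x" using assms(1) by eventually_elim simp
  qed (auto intro: AE_I2)
  from ft2_unique[OF F(2) this] show ?thesis by eventually_elim (simp add: norm_mult c)
qed

lemma power_le:
  "(\<J> x. ennreal (norm (f0 x) ^ (2 * Suc k))) \<le> (\<J> x. ennreal (norm (u0 x) ^ (2 * Suc k)))"
  by (rule power_integral_rs(1)[OF F(2) u(2)])

lemma infty_bounds:
  assumes fin: "(\<J> x. ennreal (norm (F x))) < \<infinity>"
  shows "integrable lborel F" "Lp_norm \<infinity> f \<le> ennreal (LINT x|lborel. norm (F x))" "ennreal (LINT x|lborel. norm (F x)) \<le> Lp_norm \<infinity> u"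
proof -
  show iF: "integrable lborel F" using fin by (simp add: integrable_iff_bounded)
  have nn: "(\<J> x. ennreal (rs F x)) = (\<J> x. ennreal (norm (F x)))"
    using nn_integral_rs_powr[OF sqF, of 1] by simp
  then have ir: "integrable lborel (rs F)" using fin by (simp add: integrable_iff_bounded)
  then have ic: "integrable lborel (\<lambda>\<xi>. complex_of_real (rs F \<xi>))" by simp
  have "(LINT x|lborel. rs F x) = (LINT x|lborel. norm (F x))"
    using nn by (simp add: integral_eq_nn_integral)
  then show "ennreal (LINT x|lborel. norm (F x)) \<le> Lp_norm \<infinity> u"
    unfolding Lp_norm_infty[OF u(1)] using esssup_ft2_ge[OF u(2) ic] by simp
  show "Lp_norm \<infinity> f \<le> ennreal (LINT x|lborel. norm (F x))"
    unfolding Lp_norm_infty[OF f] by (rule esssup_ft2_le[OF F(2) iF])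
qed

lemma Lp_norm_le:
  assumes "p = \<infinity> \<and> q = 1 \<or> (\<exists>j. p = of_nat (2 * Suc (Suc j)))" "(\<J> x. ennreal (norm (F x) powr q)) < \<infinity>"
  shows "Lp_norm p f \<le> Lp_norm p u"
  using assms(1)
proof
  assume p: "p = \<infinity> \<and> q = 1"
  then have "(\<J> x. ennreal (norm (F x))) < \<infinity>" using assms(2) by simp
  from order_trans[OF infty_bounds(2,3)[OF this]] show ?thesis using p by simp
next
  assume "\<exists>j. p = of_nat (2 * Suc (Suc j))"
  then obtain j where p: "p = of_nat (2 * Suc (Suc j))" by blast
  have n: "0 < 2 * Suc (Suc j)" by simp
  show ?thesis unfolding p Lp_norm_nat[OF f n] Lp_norm_nat[OF u(1) n] by (rule epowr_le[OF power_le]) simp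
qed

lemma Lp_norm_eq_imp_phase:
  assumes c: "continuous_on UNIV F" and abs: "AE x in lborel. rs F x = norm (F x)"
    and p: "p = \<infinity> \<and> q = 1 \<or> (\<exists>j. p = of_nat (2 * Suc (Suc j)) \<and> q = real (2 * Suc (Suc j)) / (real (2 * Suc (Suc j)) - 1))"
    and fin: "(\<J> x. ennreal (norm (F x) powr q)) < \<infinity>" and eq: "Lp_norm p f = Lp_norm p u"
  shows "\<exists>\<alpha> t. AE x in lborel. f0 x = cis \<alpha> * u0 (x - t)"
proof -
  have "\<exists>\<alpha> v. \<forall>\<xi>. F \<xi> = cis \<alpha> * ech (v \<bullet> \<xi>) * of_real (norm (F \<xi>))"
    using p
  proof
    assume p: "p = \<infinity> \<and> q = 1"
    then have fin1: "(\<J> x. ennreal (norm (F x))) < \<infinity>" using fin by simp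
    show ?thesis
    proof (rule esssup_ft2_eq_imp_phase[OF F(2) infty_bounds(1)[OF fin1] c])
      show "ennreal (LINT \<xi>|lborel. norm (F \<xi>)) \<le> esssup lebesgue (\<lambda>x. ennreal (norm (f0 x)))"
        using infty_bounds(3)[OF fin1] unfolding eq[unfolded conjunct1[OF p], symmetric] Lp_norm_infty[OF f] .
    qed
  next
    assume "\<exists>j. p = of_nat (2 * Suc (Suc j)) \<and> q = real (2 * Suc (Suc j)) / (real (2 * Suc (Suc j)) - 1)"
    then obtain j where p: "p = of_nat (2 * Suc (Suc j))" and q: "q = real (2 * Suc (Suc j)) / (real (2 * Suc (Suc j)) - 1)" by blast
    have n: "0 < 2 * Suc (Suc j)" by simp
    have le: "(\<J> x. ennreal (norm (u0 x) ^ (2 * Suc (Suc j)))) \<le> (\<J> x. ennreal (norm (f0 x) ^ (2 * Suc (Suc j))))"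
      by (rule epowr_eq_imp_le[OF eq[unfolded p Lp_norm_nat[OF f n] Lp_norm_nat[OF u(1) n]]]) simp
    have "real (2 * Suc (Suc j)) = 2 * real (Suc (Suc j))" by (simp only: of_nat_mult of_nat_numeral)
    from power_integral_rs_eq_imp_phase[OF F(2) u(2) c this fin[unfolded q] abs le] show ?thesis .
  qed
  then obtain \<alpha> v where av: "\<And>\<xi>. F \<xi> = cis \<alpha> * ech (v \<bullet> \<xi>) * of_real (norm (F \<xi>))" by blast
  \<comment> \<open>Translation by \<open>t\<close> multiplies the transform by
    \<open>ech (- (t \<bullet> \<xi>))\<close>, so the translation vector is
    \<open>- v\<close>.\<close>
  have "AE \<xi> in lborel. F \<xi> = cis \<alpha> * ech (- ((- v) \<bullet> \<xi>)) * of_real (rs F \<xi>)"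
    using abs
  proof eventually_elim
    case (elim \<xi>) show ?case unfolding elim using av[of \<xi>] by simp
  qed
  from phase_imp_translate[OF this] show ?thesis by blast
qed

end

lemma sobolev_iff:
  assumes g: "brep (fourier_L2 g) H"
  shows "g \<in> sobolev s \<longleftrightarrow> g \<in> Lp 2 \<and> (\<J> \<xi>. ennreal ((norm (H \<xi>))\<^sup>2) * ennreal ((1 + (norm \<xi>)\<^sup>2) powr s)) < \<infinity>"
proof -
  have "(\<integral>\<^sup>+\<xi>. ennreal ((1 + (norm \<xi>)\<^sup>2) powr s * (norm (fourier_L2 g \<xi>))\<^sup>2) \<partial>lebesgue) =
    (\<J> \<xi>. ennreal ((1 + (norm \<xi>)\<^sup>2) powr s * (norm (H \<xi>))\<^sup>2))"
    by (rule brep_nn_integral[OF g, of "\<lambda>\<xi> z. ennreal ((1 + (norm \<xi>)\<^sup>2) powr s * (norm z)\<^sup>2)"])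
  also have "\<dots> = (\<J> \<xi>. ennreal ((norm (H \<xi>))\<^sup>2) * ennreal ((1 + (norm \<xi>)\<^sup>2) powr s))"
    by (intro nn_integral_cong) (simp add: ennreal_mult mult.commute)
  finally show ?thesis by (simp add: sobolev_def)
qed

lemma quad_form_eq:
  assumes g: "brep (fourier_L2 g) H" and \<omega> [measurable]: "\<omega> \<in> Borel" and nn: "AE \<xi> in lborel. 0 \<le> \<omega> \<xi>"
  shows "quad_form \<omega> g = enn2real (\<J> \<xi>. ennreal ((norm (H \<xi>))\<^sup>2) * ennreal (\<omega> \<xi>))"
proof -
  note H [measurable] = brepD(2)[OF g]
  have "quad_form \<omega> g = (LINT \<xi>|lebesgue. \<omega> \<xi> * (norm (H \<xi>))\<^sup>2)" unfolding quad_form_def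
  proof (rule integral_cong_AE)
    note [measurable] = brepD(1)[OF g] borel_measurable_lebesgueI[OF H] borel_measurable_lebesgueI[OF \<omega>]
    show "(\<lambda>\<xi>. \<omega> \<xi> * (norm (fourier_L2 g \<xi>))\<^sup>2) \<in> borel_measurable lebesgue" "(\<lambda>\<xi>. \<omega> \<xi> * (norm (H \<xi>))\<^sup>2) \<in> borel_measurable lebesgue" by measurable
    show "AE \<xi> in lebesgue. \<omega> \<xi> * (norm (fourier_L2 g \<xi>))\<^sup>2 = \<omega> \<xi> * (norm (H \<xi>))\<^sup>2" using brepD(4)[OF g] by eventually_elim (simp only:)
  qed
  also have "\<dots> = (LINT \<xi>|lborel. \<omega> \<xi> * (norm (H \<xi>))\<^sup>2)" by (rule integral_completion) measurable
  also have "\<dots> = enn2real (\<J> \<xi>. ennreal (\<omega> \<xi> * (norm (H \<xi>))\<^sup>2))"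
  proof (rule integral_eq_nn_integral)
    show "AE \<xi> in lborel. 0 \<le> \<omega> \<xi> * (norm (H \<xi>))\<^sup>2" using nn by eventually_elim simp
  qed measurable
  also have "(\<J> \<xi>. ennreal (\<omega> \<xi> * (norm (H \<xi>))\<^sup>2)) = (\<J> \<xi>. ennreal ((norm (H \<xi>))\<^sup>2) * ennreal (\<omega> \<xi>))"
  proof (rule nn_integral_cong_AE)
    show "AE \<xi> in lborel. ennreal (\<omega> \<xi> * (norm (H \<xi>))\<^sup>2) = ennreal ((norm (H \<xi>))\<^sup>2) * ennreal (\<omega> \<xi>)"
      using nn by eventually_elim (simp add: ennreal_mult mult.commute)
  qed
  finally show ?thesis .
qed

lemma incw_bessel: "s \<ge> 0 \<Longrightarrow> incw (\<lambda>\<xi>::'a::euclidean_space. ennreal ((1 + (norm \<xi>)\<^sup>2) powr s))"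
  unfolding incw_def by (auto intro!: ennreal_leI powr_mono2 power_mono)

context rearranged
begin

text \<open>\<open>fourier_L2 u\<close> is another choice by \<open>SOME\<close> and agrees with
  \<open>rs F\<close> only almost everywhere; the Sobolev condition and the quadratic form depend
  only on weighted integrals of the squared modulus.\<close>

lemma fourier_L2_u: "\<exists>H. brep (fourier_L2 u) H \<and> (\<forall>w. (\<J> \<xi>. ennreal ((norm (H \<xi>))\<^sup>2) * w \<xi>) = (\<J> \<xi>. ennreal ((rs F \<xi>)\<^sup>2) * w \<xi>))"
proof -
  obtain H where H: "brep (fourier_L2 u) H" "ft2 u0 H" using fourier_L2_rep[OF u(1) ft2_sq(1)[OF u(2)]] by blast
  have ae: "AE \<xi> in lborel. H \<xi> = complex_of_real (rs F \<xi>)" by (rule ft2_unique[OF H(2) u(2)])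
  have "(\<J> \<xi>. ennreal ((norm (H \<xi>))\<^sup>2) * w \<xi>) = (\<J> \<xi>. ennreal ((rs F \<xi>)\<^sup>2) * w \<xi>)" for w
  proof (rule nn_integral_cong_AE)
    show "AE \<xi> in lborel. ennreal ((norm (H \<xi>))\<^sup>2) * w \<xi> = ennreal ((rs F \<xi>)\<^sup>2) * w \<xi>" using ae by eventually_elim simp
  qed
  with H(1) show ?thesis by blast
qed

lemma sobolev_u:
  assumes s: "s \<ge> 0" and "f \<in> sobolev s" shows "u \<in> sobolev s"
proof -
  obtain H where H: "brep (fourier_L2 u) H" "\<And>w. (\<J> \<xi>. ennreal ((norm (H \<xi>))\<^sup>2) * w \<xi>) = (\<J> \<xi>. ennreal ((rs F \<xi>)\<^sup>2) * w \<xi>)"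
    using fourier_L2_u by blast
  have "(\<J> \<xi>. ennreal ((norm (F \<xi>))\<^sup>2) * ennreal ((1 + (norm \<xi>)\<^sup>2) powr s)) < \<infinity>"
    using assms(2) unfolding sobolev_iff[OF F(1)] by (rule conjunct2)
  from order_le_less_trans[OF rs_weight_le(1)[OF incw_bessel[OF s] sqF] this]
  have "(\<J> \<xi>. ennreal ((rs F \<xi>)\<^sup>2) * ennreal ((1 + (norm \<xi>)\<^sup>2) powr s)) < \<infinity>" .
  moreover have "u \<in> Lp 2" using Lp_2_iff[OF u(1)] ft2_sq(1)[OF u(2)] by blast
  ultimately show ?thesis unfolding sobolev_iff[OF H(1)] H(2) by blast
qed

lemma fourier_Lp_u:
  assumes q: "q \<ge> 1" and mem: "distr_of f \<in> fourier_Lp (ennreal q)"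
  shows "(\<J> x. ennreal (norm (F x) powr q)) < \<infinity>" and "distr_of u \<in> fourier_Lp (ennreal q)"
proof -
  show fin: "(\<J> x. ennreal (norm (F x) powr q)) < \<infinity>" by (rule fourier_Lp_imp[OF f F(2) q mem])
  have "(\<J> x. ennreal (rs F x powr q)) < \<infinity>" using fin nn_integral_rs_powr[OF sqF, of q] q by simp
  then show "distr_of u \<in> fourier_Lp (ennreal q)"
    using q by (intro fourier_LpI[OF u]) (auto intro: rs_radial)
qed

context
  fixes \<omega> :: "'a \<Rightarrow> real" and C s :: real
  assumes \<omega>_eq: "\<And>x y. norm x = norm y \<Longrightarrow> \<omega> x = \<omega> y" and \<omega>_less: "\<And>x y. norm x < norm y \<Longrightarrow> \<omega> x < \<omega> y"
    and \<omega>_bound: "AE \<xi> in lborel. 0 \<le> \<omega> \<xi> \<and> \<omega> \<xi> \<le> C * (1 + norm \<xi> powr (2 * s))"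
    and s: "s \<ge> 0" and C: "C \<ge> 0" and fs: "f \<in> sobolev s"
begin

lemma \<omega>_nonneg: "AE \<xi> in lborel. 0 \<le> \<omega> \<xi>" using \<omega>_bound by eventually_elim blast

lemma \<omega>_properties: "\<omega> \<in> Borel" "incw (\<lambda>x. ennreal (\<omega> x))"
  by (rule strictly_radial_properties[of \<omega>]; fact \<omega>_eq \<omega>_less \<omega>_nonneg)+

lemma \<omega>_strict: assumes "norm x < norm y" shows "ennreal (\<omega> x) < ennreal (\<omega> y)"
  by (rule strictly_radial_properties(3)[of \<omega>]; fact \<omega>_eq \<omega>_less \<omega>_nonneg assms)

text \<open>The growth bound on \<open>\<omega>\<close> is compared with the Sobolev weight through
  \<open>1 + norm \<xi> powr (2 * s) \<le> 2 * (1 + (norm \<xi>)\<^sup>2) powr s\<close>. Finiteness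
  lets equality of the real quadratic forms be read as equality of integrals in
  \<open>ennreal\<close>.\<close>

lemma weight_finite: "(\<J> \<xi>. ennreal ((norm (F \<xi>))\<^sup>2) * ennreal (\<omega> \<xi>)) < \<infinity>"
proof -
  let ?B = "\<lambda>\<xi>::'a. (1 + (norm \<xi>)\<^sup>2) powr s"
  have b: "1 + norm \<xi> powr (2 * s) \<le> 2 * ?B \<xi>" for \<xi>
  proof -
    have "norm \<xi> powr (2 * s) = ((norm \<xi>)\<^sup>2) powr s" by (simp add: powr_powr[symmetric])
    also have "\<dots> \<le> ?B \<xi>" using s by (intro powr_mono2) auto
    finally show ?thesis using ge_one_powr_ge_zero[of "1 + (norm \<xi>)\<^sup>2" s] s by simp
  qed
  have "(\<J> \<xi>. ennreal ((norm (F \<xi>))\<^sup>2) * ennreal (\<omega> \<xi>)) \<le> (\<J> \<xi>. ennreal (2 * C) * (ennreal ((norm (F \<xi>))\<^sup>2) * ennreal (?B \<xi>)))"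
  proof (rule nn_integral_mono_AE)
    show "AE \<xi> in lborel. ennreal ((norm (F \<xi>))\<^sup>2) * ennreal (\<omega> \<xi>) \<le> ennreal (2 * C) * (ennreal ((norm (F \<xi>))\<^sup>2) * ennreal (?B \<xi>))"
      using \<omega>_bound
    proof eventually_elim
      case (elim \<xi>)
      have "\<omega> \<xi> \<le> C * (2 * ?B \<xi>)" using elim mult_left_mono[OF b C, of \<xi>] by linarith
      then have "ennreal (\<omega> \<xi>) \<le> ennreal (2 * C * ?B \<xi>)" by (intro ennreal_leI) (simp add: mult_ac)
      also have "\<dots> = ennreal (2 * C) * ennreal (?B \<xi>)" using C by (intro ennreal_mult) auto
      finally have "ennreal ((norm (F \<xi>))\<^sup>2) * ennreal (\<omega> \<xi>) \<le> ennreal ((norm (F \<xi>))\<^sup>2) * (ennreal (2 * C) * ennreal (?B \<xi>))"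
        by (rule mult_left_mono) simp
      then show ?case by (simp only: mult.left_commute)
    qed
  qed
  also have "\<dots> = ennreal (2 * C) * (\<J> \<xi>. ennreal ((norm (F \<xi>))\<^sup>2) * ennreal (?B \<xi>))" by (rule nn_integral_cmult) measurable
  also have "\<dots> < \<infinity>" using fs unfolding sobolev_iff[OF F(1)] by (simp add: ennreal_mult_less_top)
  finally show ?thesis .
qed

lemma quad_form_u: "quad_form \<omega> u = enn2real (\<J> \<xi>. ennreal ((rs F \<xi>)\<^sup>2) * ennreal (\<omega> \<xi>))"
proof -
  obtain H where H: "brep (fourier_L2 u) H" "\<And>w. (\<J> \<xi>. ennreal ((norm (H \<xi>))\<^sup>2) * w \<xi>) = (\<J> \<xi>. ennreal ((rs F \<xi>)\<^sup>2) * w \<xi>)"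
    using fourier_L2_u by blast
  show ?thesis unfolding quad_form_eq[OF H(1) \<omega>_properties(1) \<omega>_nonneg] H(2) ..
qed

lemma quad_form_le: "quad_form \<omega> u \<le> quad_form \<omega> f"
  unfolding quad_form_u quad_form_eq[OF F(1) \<omega>_properties(1) \<omega>_nonneg]
  by (rule enn2real_mono[OF rs_weight_le(1)[OF \<omega>_properties(2) sqF]]) (use weight_finite in simp)

lemma quad_form_eq_iff: "quad_form \<omega> u = quad_form \<omega> f \<longleftrightarrow> (AE x in lborel. rs F x = norm (F x))"
proof
  assume eq: "quad_form \<omega> u = quad_form \<omega> f"
  let ?A = "\<J> \<xi>. ennreal ((norm (F \<xi>))\<^sup>2) * ennreal (\<omega> \<xi>)" and ?B = "\<J> \<xi>. ennreal ((rs F \<xi>)\<^sup>2) * ennreal (\<omega> \<xi>)"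
  have A: "?A < top" using weight_finite by simp
  have B: "?B < top" by (rule order_le_less_trans[OF rs_weight_le(1)[OF \<omega>_properties(2) sqF] A])
  have "ennreal (enn2real ?A) = ennreal (enn2real ?B)"
    using eq unfolding quad_form_u quad_form_eq[OF F(1) \<omega>_properties(1) \<omega>_nonneg] by simp
  then have le: "?A \<le> ?B" unfolding ennreal_enn2real[OF A] ennreal_enn2real[OF B] by simp
  show "AE x in lborel. rs F x = norm (F x)"
    by (rule rs_weight_le(2)[where w = "\<lambda>x. ennreal (\<omega> x)"]; fact \<omega>_properties \<omega>_strict sqF weight_finite le)
next
  assume ae: "AE x in lborel. rs F x = norm (F x)"
  have "(\<J> \<xi>. ennreal ((rs F \<xi>)\<^sup>2) * ennreal (\<omega> \<xi>)) = (\<J> \<xi>. ennreal ((norm (F \<xi>))\<^sup>2) * ennreal (\<omega> \<xi>))"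
  proof (rule nn_integral_cong_AE)
    show "AE \<xi> in lborel. ennreal ((rs F \<xi>)\<^sup>2) * ennreal (\<omega> \<xi>) = ennreal ((norm (F \<xi>))\<^sup>2) * ennreal (\<omega> \<xi>)" using ae by eventually_elim simp
  qed
  then show "quad_form \<omega> u = quad_form \<omega> f" unfolding quad_form_u quad_form_eq[OF F(1) \<omega>_properties(1) \<omega>_nonneg] by (rule arg_cong)
qed

end

lemma translate_iff:
  "(AE x in lebesgue. f x = exp (\<i> * complex_of_real \<alpha>) * u (x - t)) \<longleftrightarrow> (AE x in lborel. f0 x = cis \<alpha> * u0 (x - t))"
proof -
  have e: "AE x in lborel. (f x = exp (\<i> * complex_of_real \<alpha>) * u (x - t)) = (f0 x = cis \<alpha> * u0 (x - t))"
    using brepD(3)[OF f] AE_lborel_shiftD[OF brepD(3)[OF u(1)], of t]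
    by eventually_elim (simp add: cis_conv_exp)
  show ?thesis unfolding AE_completion_iff
  proof
    assume "AE x in lborel. f x = exp (\<i> * complex_of_real \<alpha>) * u (x - t)"
    with e show "AE x in lborel. f0 x = cis \<alpha> * u0 (x - t)" by eventually_elim blast
  next
    assume "AE x in lborel. f0 x = cis \<alpha> * u0 (x - t)"
    with e show "AE x in lborel. f x = exp (\<i> * complex_of_real \<alpha>) * u (x - t)" by eventually_elim blast
  qed
qed

end

section \<open>Exponents and the final assembly\<close>

text \<open>An even \<open>p > 2\<close> is at least 4, hence of the form
  \<open>2 * Suc (Suc j)\<close>: the convolution power has at least two factors and so contains the
  convolution of \<open>G\<close> with itself, on which the equality case rests.\<close>

lemma conjugate_exponent:
  fixes p p' :: ennreal
  assumes p2: "p > 2" and p: "(\<exists>n::nat. even n \<and> p = of_nat n) \<or> p = \<infinity>" and p': "1 \<le> p'" "p' \<le> 2" and conj: "1 / p + 1 / p' = 1"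
  shows "\<exists>q\<ge>1. p' = ennreal q \<and> (p = \<infinity> \<and> q = 1 \<or>
    (\<exists>j. p = of_nat (2 * Suc (Suc j)) \<and> q = real (2 * Suc (Suc j)) / (real (2 * Suc (Suc j)) - 1)))"
proof -
  have "p' \<noteq> top" using p'(2) by (auto simp: top_unique)
  then obtain q where q: "q \<ge> 0" "p' = ennreal q" by (cases p') auto
  have q1: "q \<ge> 1" using p'(1) unfolding q(2) ennreal_1[symmetric] by (simp add: ennreal_le_iff q(1) del: ennreal_1)
  have iq: "1 / p' = ennreal (1 / q)" using q1 divide_ennreal[of 1 q] by (simp add: q(2))
  show ?thesis using p
  proof
    assume p: "p = \<infinity>"
    then have "ennreal (1 / q) = ennreal 1" using conj unfolding iq by simp
    then have "1 / q = 1" using q1 by (subst (asm) ennreal_inj) auto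
    then have "q = 1" using q1 by simp
    with p q q1 show ?thesis by blast
  next
    assume "\<exists>n::nat. even n \<and> p = of_nat n"
    then obtain n :: nat where n: "even n" "p = of_nat n" by blast
    then obtain m where m: "n = 2 * m" by blast
    have "of_nat 2 < (of_nat n :: ennreal)" using p2 n(2) by simp
    then have "2 < n" by (simp only: of_nat_less_iff)
    then have "m = Suc (Suc (m - 2))" using m by simp
    then obtain j where j: "m = Suc (Suc j)" by blast
    have nr: "real n > 2" using \<open>2 < n\<close> by simp
    have "1 / p = ennreal (1 / real n)" using divide_ennreal[of 1 "real n"] nr by (simp add: n(2) ennreal_of_nat_eq_real_of_nat)
    then have "ennreal (1 / real n) + ennreal (1 / q) = ennreal 1" using conj unfolding iq by simp
    moreover have "ennreal (1 / real n) + ennreal (1 / q) = ennreal (1 / real n + 1 / q)" using q1 by (intro ennreal_plus[symmetric]) auto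
    ultimately have "ennreal (1 / real n + 1 / q) = ennreal 1" by (simp only:)
    then have "1 / real n + 1 / q = 1" using q1 by (subst (asm) ennreal_inj) auto
    then have "q = real n / (real n - 1)" using q1 nr by (simp add: field_simps)
    then have "p = of_nat (2 * Suc (Suc j)) \<and> q = real (2 * Suc (Suc j)) / (real (2 * Suc (Suc j)) - 1)" using n(2) unfolding m j by (simp only: simp_thms)
    with q1 q(2) show ?thesis by blast
  qed
qed

theorem theorem1:
  fixes L :: "('a::euclidean_space \<Rightarrow> complex) \<Rightarrow> 'a distribution"
    and \<omega> :: "'a \<Rightarrow> real"
    and s :: real
    and p p' :: ennreal
    and f :: "'a \<Rightarrow> complex"
  assumes "s \<ge> 0"
    and "multiplier_assumption s L \<omega>"
    and "p > 2"
    and "(\<exists>n::nat. even n \<and> p = of_nat n) \<or> p = \<infinity>"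
    and "1 \<le> p'" and "p' \<le> 2" and "1 / p + 1 / p' = 1"
    and "f \<in> sobolev s" and "distr_of f \<in> fourier_Lp p'"
  shows "fourier_rearrangement f \<in> sobolev s \<and>
    distr_of (fourier_rearrangement f) \<in> fourier_Lp p' \<and>
    quad_form \<omega> (fourier_rearrangement f) \<le> quad_form \<omega> f \<and>
    Lp_norm p f \<le> Lp_norm p (fourier_rearrangement f) \<and>
    ((\<exists>g. continuous_on UNIV g \<and> (AE \<xi> in lebesgue. fourier_L2 f \<xi> = g \<xi>)) \<longrightarrow>
      (quad_form \<omega> (fourier_rearrangement f) = quad_form \<omega> f \<and>
       Lp_norm p f = Lp_norm p (fourier_rearrangement f)
       \<longleftrightarrow>
       (\<exists>(\<alpha>::real) x\<^sub>0. AE x in lebesgue.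
          f x = exp (\<i> * complex_of_real \<alpha>) * fourier_rearrangement f (x - x\<^sub>0))) \<and>
      (quad_form \<omega> (fourier_rearrangement f) = quad_form \<omega> f \<and>
       Lp_norm p f = Lp_norm p (fourier_rearrangement f)
       \<longrightarrow>
       (\<exists>(\<alpha>::real) x\<^sub>0 (h::'a \<Rightarrow> real). radially_symmetric h \<and>
          (AE x in lebesgue. f x = exp (\<i> * complex_of_real \<alpha>) * complex_of_real (h (x - x\<^sub>0))))))"
proof -
  obtain q where q: "q \<ge> 1" "p' = ennreal q"
    and pq: "p = \<infinity> \<and> q = 1 \<or> (\<exists>j. p = of_nat (2 * Suc (Suc j)) \<and> q = real (2 * Suc (Suc j)) / (real (2 * Suc (Suc j)) - 1))"
    using conjugate_exponent[OF assms(3-7)] by blast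
  have pq': "p = \<infinity> \<and> q = 1 \<or> (\<exists>j. p = of_nat (2 * Suc (Suc j)))" using pq by blast
  have p0: "p = \<infinity> \<or> (\<exists>n>0. p = of_nat n)"
    using pq'
  proof
    assume "\<exists>j. p = of_nat (2 * Suc (Suc j))"
    then obtain j where "p = of_nat (2 * Suc (Suc j))" by blast
    moreover have "0 < 2 * Suc (Suc j)" by simp
    ultimately show ?thesis by blast
  qed blast
  note mem = assms(9)[unfolded q(2)]
  have w: "(\<forall>\<xi> \<eta>. (norm \<xi> = norm \<eta> \<longrightarrow> \<omega> \<xi> = \<omega> \<eta>) \<and> (norm \<xi> < norm \<eta> \<longrightarrow> \<omega> \<xi> < \<omega> \<eta>))"
    and "\<exists>C\<ge>0. AE \<xi> in lebesgue. 0 \<le> \<omega> \<xi> \<and> \<omega> \<xi> \<le> C * (1 + norm \<xi> powr (2 * s))"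
    using assms(2) unfolding multiplier_assumption_def by blast+
  then obtain C where C: "C \<ge> 0" "AE \<xi> in lborel. 0 \<le> \<omega> \<xi> \<and> \<omega> \<xi> \<le> C * (1 + norm \<xi> powr (2 * s))"
    unfolding AE_completion_iff by blast
  have w_eq: "\<omega> x = \<omega> y" if "norm x = norm y" for x y using w that by blast
  have w_less: "\<omega> x < \<omega> y" if "norm x < norm y" for x y using w that by blast
  have fL2: "f \<in> Lp 2" using assms(8) by (simp add: sobolev_def)
  then obtain f0 where f0: "brep f f0" using brep_exists by (auto simp: Lp_def)
  have sf0: "sq f0" using Lp_2_iff[OF f0] fL2 by blast
  obtain F0 where F0: "brep (fourier_L2 f) F0" "ft2 f0 F0" using fourier_L2_rep[OF f0 sf0] by blast
  \<comment> \<open>Stated for an arbitrary Borel representative \<open>F\<close> of the transform,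
    because the inequalities and the equality case use different ones;
    \<open>fourier_rearrangement f\<close> is the same function for all of them.\<close>
  have rearr: "\<exists>u0. rearranged f f0 F (fourier_rearrangement f) u0" if F: "brep (fourier_L2 f) F" for F
  proof -
    have "AE x in lborel. F0 x = F x" using brepD(3)[OF F0(1)] brepD(3)[OF F] by eventually_elim simp
    from ft2_cong_AE[OF F0(2) _ this brepD(2)[OF f0] brepD(2)[OF F]] have ft: "ft2 f0 F" by simp
    have sF: "sq F" using ft2_sq(2)[OF ft] .
    have "brep (\<lambda>\<xi>. complex_of_real (rs F \<xi>)) (\<lambda>\<xi>. complex_of_real (rs F \<xi>))"
      using sq_rs[OF sF] by (intro brep_refl) (simp add: sq_def)
    from inv_fourier_L2_rep[OF this sq_rs[OF sF]] obtain u0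
      where "brep (fourier_rearrangement f) u0" "ft2 u0 (\<lambda>\<xi>. complex_of_real (rs F \<xi>))"
      unfolding fourier_rearrangement_def symm_decr_rearrangement_eq_rs[OF F sF] by blast
    then show ?thesis using f0 F ft unfolding rearranged_def by blast
  qed
  have inequalities: "fourier_rearrangement f \<in> sobolev s \<and> distr_of (fourier_rearrangement f) \<in> fourier_Lp p' \<and>
    quad_form \<omega> (fourier_rearrangement f) \<le> quad_form \<omega> f \<and> Lp_norm p f \<le> Lp_norm p (fourier_rearrangement f)"
  proof -
    obtain u0 where "rearranged f f0 F0 (fourier_rearrangement f) u0" using rearr[OF F0(1)] by blast
    then interpret rearranged f f0 F0 "fourier_rearrangement f" u0 .
    show ?thesis unfolding q(2)
      using sobolev_u[OF assms(1,8)] fourier_Lp_u[OF q(1) mem] Lp_norm_le[OF pq' fourier_Lp_u(1)[OF q(1) mem]]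
        quad_form_le[OF w_eq w_less C(2) assms(1) C(1) assms(8)] by blast
  qed
  have equality: "(quad_form \<omega> (fourier_rearrangement f) = quad_form \<omega> f \<and> Lp_norm p f = Lp_norm p (fourier_rearrangement f) \<longleftrightarrow>
       (\<exists>(\<alpha>::real) x\<^sub>0. AE x in lebesgue. f x = exp (\<i> * complex_of_real \<alpha>) * fourier_rearrangement f (x - x\<^sub>0))) \<and>
      (quad_form \<omega> (fourier_rearrangement f) = quad_form \<omega> f \<and> Lp_norm p f = Lp_norm p (fourier_rearrangement f) \<longrightarrow>
       (\<exists>(\<alpha>::real) x\<^sub>0 (h::'a \<Rightarrow> real). radially_symmetric h \<and>
          (AE x in lebesgue. f x = exp (\<i> * complex_of_real \<alpha>) * complex_of_real (h (x - x\<^sub>0)))))"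
    if g: "continuous_on UNIV g" "AE \<xi> in lebesgue. fourier_L2 f \<xi> = g \<xi>" for g
  proof -
    have "brep (fourier_L2 f) g"
      using brepD(1)[OF F0(1)] borel_measurable_continuous_onI[OF g(1)] g(2) unfolding brep_def AE_completion_iff by blast
    from rearr[OF this] obtain u0 where "rearranged f f0 g (fourier_rearrangement f) u0" by blast
    then interpret rearranged f f0 g "fourier_rearrangement f" u0 .
    note quad_iff = quad_form_eq_iff[OF w_eq w_less C(2) assms(1) C(1) assms(8)]
    let ?E = "quad_form \<omega> (fourier_rearrangement f) = quad_form \<omega> f \<and> Lp_norm p f = Lp_norm p (fourier_rearrangement f)"
    have imp: "\<exists>\<alpha> t. AE x in lborel. f0 x = cis \<alpha> * u0 (x - t)" if E: ?E
      using E quad_iff by (intro Lp_norm_eq_imp_phase[OF g(1) _ pq fourier_Lp_u(1)[OF q(1) mem]]) auto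
    have conv: ?E if t: "AE x in lborel. f0 x = cis \<alpha> * u0 (x - t)" for \<alpha> t
    proof
      have "AE x in lborel. rs g x = norm (g x)" using translate_imp_norm[OF t] by (auto elim: eventually_mono)
      then show "quad_form \<omega> (fourier_rearrangement f) = quad_form \<omega> f" using quad_iff by blast
      have "AE x in lborel. norm (f0 x) = norm (u0 (x - t))" using t by eventually_elim (simp add: norm_mult)
      then show "Lp_norm p f = Lp_norm p (fourier_rearrangement f)" by (rule Lp_norm_translate[OF f u(1) _ p0])
    qed
    have radial: "\<exists>\<alpha> x0 (h::'a \<Rightarrow> real). radially_symmetric h \<and> (AE x in lebesgue. f x = exp (\<i> * complex_of_real \<alpha>) * complex_of_real (h (x - x0)))" if E: ?E
    proof -
      obtain \<alpha> t where t: "AE x in lborel. f0 x = cis \<alpha> * u0 (x - t)" using imp[OF E] by blast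
      obtain h :: "'a \<Rightarrow> real" where h: "radially_symmetric h" "AE x in lborel. u0 x = of_real (h x)"
        using ft2_radial_representative[OF u(2) rs_measurable[OF Fm] rs_radial] by blast
      have "AE x in lborel. f x = exp (\<i> * complex_of_real \<alpha>) * complex_of_real (h (x - t))"
        using brepD(3)[OF f] t AE_lborel_shiftD[OF h(2), of t] by eventually_elim (simp add: cis_conv_exp)
      then show ?thesis using h(1) AE_completion by blast
    qed
    show ?thesis unfolding translate_iff using imp conv radial by blast
  qed
  show ?thesis using inequalities equality by blast
qed

end
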